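(* Let $\chi\in\mathcal X$ and $p\in I$, and assume that $\chi$ is $p$-finite. The Lusztig maps $T_p,T_p^-:\mathcal U(\chi)\to\mathcal U(r_p(\chi))/(\mathcal I_p^+(r_p(\chi)),\mathcal I_p^-(r_p(\chi)))$ induce algebra isomorphisms $$T_p,T_p^-:U(\chi)\to U(r_p(\chi)).$$ Moreover these isomorphisms satisfy the following relations, with $c_{pi}=c_{pi}^\chi$ (in each composition, $T_p$ and $T_p^-$ are taken with respect to the bicharacter appropriate for its source, e.g. in $T_pT_p^-=\mathrm{id}$ the map $T_p^-$ is defined with respect to $\chi$ and $T_p$ with respect to $r_p(\chi)$): - $T_pT_p^-=T_p^-T_p=\mathrm{id}$; - $T_p\varphi_{\underline a}=\varphi_{\underline b}T_p$ and $T_p^-\varphi_{\underline a}=\varphi_{\underline b}T_p^-$ for all $\underline a\in(\Bbbk^\times)^I$, where $b_i=a_ia_p^{-c_{pi}}$ for all $i\in I$; - $T_p\phi_2=\phi_2T_p^-\varphi_{\underline a}$, where $a_i=(-1)^{\delta_{i,p}}$ for all $i\in I$; - $T_p\phi_3=\phi_3T_p\varphi_{\underline\lambda}$, where $\lambda_p=q_{pp}^{-1}$ and $\lambda_i=\lambda_i(r_p(\chi))^{-1}$ for all $i\in I\setminus\{p\}$; - $T_p^-\phi_3=\phi_3T_p^-\varphi_{\underline\lambda}$, where $\lambda_p=q_{pp}^{-1}$ and $\lambda_i=(-1)^{c_{pi}}\lambda_i(r_p(\chi^{-1}))$ for all $i\in I\setminus\{p\}$; - $T_p\phi_4=\phi_4T_p^-\varphi_{\underline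 a}$ for some $\underline a\in(\Bbbk^\times)^I$.
   Context: Let $\Bbbk$ be a field, $\Bbbk^\times=\Bbbk\setminus\{0\}$, $I$ a non-empty finite set, $\{\alpha_i\}_{i\in I}$ the standard basis of $\mathbb Z^I$, $\mathcal X$ the set of bicharacters $\chi:\mathbb Z^I\times\mathbb Z^I\to\Bbbk^\times$ (multiplicative in each argument). Put $q_{ij}=\chi(\alpha_i,\alpha_j)$, $\chi^{\mathrm{op}}(a,b)=\chi(b,a)$, $\chi^{-1}(a,b)=\chi(a,b)^{-1}$. For $q\in\Bbbk^\times$: $(0)_q=0$, $(m)_q=1+q+\dots+q^{m-1}$, $(m)^!_q=\prod_{n=1}^m(n)_q$. $\chi$ is $p$-finite if for all $j\ne p$ there is $m\in\mathbb N_0$ with $(m+1)_{q_{pp}}=0$ or $q_{pp}^mq_{pj}q_{jp}=1$. Then $c_{pp}^\chi=2$, $c_{pj}^\chi=-\min\{m\in\mathbb N_0\mid(m+1)_{q_{pp}}(q_{pp}^mq_{pj}q_{jp}-1)=0\}$ for $j\neq p$, $\sigma_p^\chi(\alpha_j)=\alpha_j-c_{pj}^\chi\alpha_p$, and $r_p(\chi)(a,b)=\chi((\sigma_p^\chi)^{-1}(a),(\sigma_p^\chi)^{-1}(b))$. Then $r_p(\chi)$ is $p$-finite, $c_{pj}^{r_p(\chi)}=c_{pj}^\chi$, $r_p(r_p(\chi))=\chi$. For $i\ne p$: $\lambda_i(\chi)=(-c_{pi}^\chi)^!_{q_{pp}}\prod_{s=0}^{-c_{pi}^\chi-1}(q_{pp}^sq_{pi}q_{ip}-1)$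 (depends on $p$). $h^\chi(\alpha_p)=\min\{m\in\mathbb N\mid(m)_{q_{pp}}=0\}$, or $\infty$ if no such $m$ exists. $\mathcal U(\chi)$ is the unital algebra generated by $K_i^{\pm1},L_i^{\pm1},E_i,F_i$ ($i\in I$) with relations: all $K_i^{\pm1},L_i^{\pm1}$ commute; $K_iK_i^{-1}=L_iL_i^{-1}=1$; $K_iE_jK_i^{-1}=q_{ij}E_j$; $L_iE_jL_i^{-1}=q_{ji}^{-1}E_j$; $K_iF_jK_i^{-1}=q_{ij}^{-1}F_j$; $L_iF_jL_i^{-1}=q_{ji}F_j$; $E_iF_j-F_jE_i=\delta_{i,j}(K_i-L_i)$. $\mathcal U^+(\chi),\mathcal U^-(\chi),\mathcal U^0(\chi)$ are the subalgebras generated by the $E_i$, the $F_i$, the $K_i^{\pm1},L_i^{\pm1}$; $\mathcal U^\pm(\chi)$ are free. Put $K_p\cdot X=K_pXK_p^{-1}$, $L_p\cdot X=L_pXL_p^{-1}$. $\mathcal U(\chi)$ is $\mathbb Z^I$-graded with $\deg E_i=\alpha_i$, $\deg F_i=-\alpha_i$, $\deg K_i^{\pm1}=\deg L_i^{\pm1}=0$. Nichols algebra and $U(\chi)$: the braided coproduct $\underline\Delta:\mathcal U^+(\chi)\to\mathcal U^+(\chi)\otimes\mathcal U^+(\chi)$ is the algebra map with $\underline\Delta(E_i)=E_i\otimes1+1\otimes E_i$, where $(x\otimes y)(x'\otimes y')=\chi(\deg y,\deg x')\,xx'\otimes yy'$ for homogeneous $y,x'$. $\mathcal S^+(\chi)$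 is the largest subspace $\mathcal S$ of $\bigoplus_{n\ge2}\mathcal U^+(\chi)_n$ ($n$ = number of factors $E_i$) with $\underline\Delta(\mathcal S)\subset\mathcal S\otimes\mathcal U^+(\chi)+\mathcal U^+(\chi)\otimes\mathcal S$; it is an ideal. $\mathcal S^-(\chi)=\phi_4(\mathcal S^+(\chi))$ ($\phi_4$ below), $\mathcal S(\chi)=\mathcal S^+(\chi)\mathcal U^0(\chi)\mathcal U^-(\chi)+\mathcal U^+(\chi)\mathcal U^0(\chi)\mathcal S^-(\chi)$ is an ideal of $\mathcal U(\chi)$ and $U(\chi)=\mathcal U(\chi)/\mathcal S(\chi)$. For $i\ne p$: $E^\pm_{i,0}=E_i$, $E^+_{i,m+1}=E_pE^+_{i,m}-(K_p\cdot E^+_{i,m})E_p$, $E^-_{i,m+1}=E_pE^-_{i,m}-(L_p\cdot E^-_{i,m})E_p$; $F^\pm_{i,0}=F_i$, $F^+_{i,m+1}=F_pF^+_{i,m}-(L_p\cdot F^+_{i,m})F_p$, $F^-_{i,m+1}=F_pF^-_{i,m}-(K_p\cdot F^-_{i,m})F_p$. For $p$-finite $\chi$ and $h=h^\chi(\alpha_p)$: if $h<\infty$, $\mathcal I_p^+(\chi)$ is the ideal of $\mathcal U^+(\chi)$ generated by $E_p^h$ and all $E^+_{i,1-c_{pi}}$ with $i\ne p$, $1-c_{pi}<h$, and $\mathcal I_p^-(\chi)$ is the ideal of $\mathcal U^-(\chi)$ generated by $F_p^h$ and all $F^+_{i,1-c_{pi}}$ with $i\neq p$, $1-c_{pi}<h$;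 if $h=\infty$, they are generated by all $E^+_{i,1-c_{pi}}$, resp. all $F^+_{i,1-c_{pi}}$, $i\ne p$. One has $\mathcal I_p^\pm(\chi)\subset\mathcal S^\pm(\chi)$. Lusztig maps: underlining generators of the target $\mathcal U(r_p(\chi))$ (and elements $\underline E^\pm_{i,m},\underline F^\pm_{i,m}$ formed there), $T_p,T_p^-$ are the unique algebra maps $\mathcal U(\chi)\to\mathcal U(r_p(\chi))/(\mathcal I_p^+(r_p(\chi)),\mathcal I_p^-(r_p(\chi)))$ (quotient by the ideal generated) with, for $i\neq p$, $T_p(K_p)=T_p^-(K_p)=\underline K_p^{-1}$, $T_p(K_i)=T_p^-(K_i)=\underline K_i\underline K_p^{-c_{pi}}$, $T_p(L_p)=T_p^-(L_p)=\underline L_p^{-1}$, $T_p(L_i)=T_p^-(L_i)=\underline L_i\underline L_p^{-c_{pi}}$, $T_p(E_p)=\underline F_p\underline L_p^{-1}$, $T_p(E_i)=\underline E^+_{i,-c_{pi}}$, $T_p(F_p)=\underline K_p^{-1}\underline E_p$, $T_p(F_i)=\lambda_i(r_p(\chi))^{-1}\underline F^+_{i,-c_{pi}}$, $T_p^-(E_p)=\underline K_p^{-1}\underline F_p$, $T_p^-(E_i)=\lambda_i(r_p(\chi^{-1}))^{-1}\underline E^-_{i,-c_{pi}}$, $T_p^-(F_p)=\underline E_p\underline L_p^{-1}$, $T_p^-(F_i)=(-1)^{c_{pi}}\underline F^-_{i,-c_{pi}}$. "Induce" means: after composing with the canonical map to $U(r_p(\chi))$ they factor through $U(\chi)$. Further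 maps (all inducing maps on the corresponding algebras $U$): for $\underline a=(a_i)\in(\Bbbk^\times)^I$, $\varphi_{\underline a}$ is the algebra automorphism of $\mathcal U(\chi)$ fixing $K_i,L_i$ with $E_i\mapsto a_iE_i$, $F_i\mapsto a_i^{-1}F_i$; $\phi_2:\mathcal U(\chi)\to\mathcal U(\chi^{-1})$ is the algebra isomorphism $K_i\mapsto K_i,L_i\mapsto L_i,E_i\mapsto F_i,F_i\mapsto-E_i$; $\phi_3:\mathcal U(\chi)\to\mathcal U(\chi^{\mathrm{op}})$ is the algebra isomorphism $K_i\mapsto L_i,L_i\mapsto K_i,E_i\mapsto F_i,F_i\mapsto E_i$; $\phi_4$ is the algebra antiautomorphism of $\mathcal U(\chi)$ with $K_i\mapsto K_i,L_i\mapsto L_i,E_i\mapsto F_i,F_i\mapsto E_i$. *)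

theory Defs
  imports
    "HOL-Algebra.QuotRing"
    "HOL-Algebra.Module"
    "HOL-Library.Poly_Mapping"
    "HOL-Library.Extended_Nat"
begin

section \<open>Algebras over a field\<close>

text \<open>
  A (unital, associative, not necessarily commutative) algebra over the field \<open>'k\<close> is represented
  by a record of type \<open>('k, 'a) module\<close>, i.e. a ring together with a scalar multiplication by
  elements of \<open>'k\<close>. (The library locale \<open>algebra\<close> is of no use here, since it is restricted to
  commutative algebras.)
\<close>

definition alg_hom :: "('k, 'a) module \<Rightarrow> ('k, 'b) module \<Rightarrow> ('a \<Rightarrow> 'b) set" where
  "alg_hom A B = {f \<in> ring_hom A B. \<forall>c. \<forall>x\<in>carrier A. f (c \<odot>\<^bsub>A\<^esub> x) = c \<odot>\<^bsub>B\<^esub> f x}"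

definition alg_iso :: "('k, 'a) module \<Rightarrow> ('k, 'b) module \<Rightarrow> ('a \<Rightarrow> 'b) set" where
  "alg_iso A B = {f \<in> alg_hom A B. bij_betw f (carrier A) (carrier B)}"

definition opp_alg :: "('k, 'a) module \<Rightarrow> ('k, 'a) module" where
  "opp_alg A = A\<lparr>mult := (\<lambda>x y. y \<otimes>\<^bsub>A\<^esub> x)\<rparr>"

definition quot_alg :: "('k, 'a) module \<Rightarrow> 'a set \<Rightarrow> ('k, 'a set) module" where
  "quot_alg A I =
    \<lparr>carrier = carrier (A Quot I), mult = mult (A Quot I), one = one (A Quot I),
     zero = zero (A Quot I), add = add (A Quot I),
     smult = (\<lambda>c X. \<Union>x\<in>X. I +>\<^bsub>A\<^esub> (c \<odot>\<^bsub>A\<^esub> x))\<rparr>"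

text \<open>
  The map induced by \<open>f\<close> on the quotient by \<open>I\<close>: a coset \<open>X\<close> is sent to the common value of \<open>f\<close>
  on \<open>X\<close>. Meaningful only if \<open>f\<close> is constant on the cosets of \<open>I\<close>.
\<close>
definition induced :: "('a \<Rightarrow> 'b) \<Rightarrow> 'a set \<Rightarrow> 'b" where
  "induced f X = the_elem (f ` X)"

definition alg_subspace :: "('k, 'a) module \<Rightarrow> 'a set \<Rightarrow> bool" where
  "alg_subspace A V \<longleftrightarrow> V \<subseteq> carrier A \<and> \<zero>\<^bsub>A\<^esub> \<in> V \<and>
    (\<forall>x\<in>V. \<forall>y\<in>V. x \<oplus>\<^bsub>A\<^esub> y \<in> V) \<and> (\<forall>c. \<forall>x\<in>V. c \<odot>\<^bsub>A\<^esub> x \<in> V)"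

definition lin_span :: "('k, 'a) module \<Rightarrow> 'a set \<Rightarrow> 'a set" where
  "lin_span A X = \<Inter>{V. alg_subspace A V \<and> X \<subseteq> V}"

definition alg_gen :: "('k, 'a) module \<Rightarrow> 'a set \<Rightarrow> 'a set" where
  "alg_gen A X = \<Inter>{B. alg_subspace A B \<and> \<one>\<^bsub>A\<^esub> \<in> B \<and> (\<forall>x\<in>B. \<forall>y\<in>B. x \<otimes>\<^bsub>A\<^esub> y \<in> B) \<and> X \<subseteq> B}"


section \<open>Free algebras\<close>

datatype 'g fmon = Word (letters: "'g list")

instantiation fmon :: (type) monoid_add
begin

definition zero_fmon :: "'g fmon" where
  "zero_fmon = Word []"

definition plus_fmon :: "'g fmon \<Rightarrow> 'g fmon \<Rightarrow> 'g fmon" where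
  "plus_fmon u v = Word (letters u @ letters v)"

instance
  by standard (simp_all add: zero_fmon_def plus_fmon_def)

end

text \<open>
  The free algebra on the set \<open>'g\<close> is the monoid algebra of the free monoid of words over \<open>'g\<close>.
  In \<open>'g fmon\<close> concatenation is written additively because \<open>poly_mapping\<close> forms its convolution
  product from an additive (not necessarily commutative) monoid.
\<close>
definition free_alg :: "('k::field, 'g fmon \<Rightarrow>\<^sub>0 'k) module" where
  "free_alg = \<lparr>carrier = UNIV, mult = (*), one = 1, zero = 0, add = (+),
     smult = (\<lambda>c. Poly_Mapping.map ((*) c))\<rparr>"

definition gen :: "'g \<Rightarrow> 'g fmon \<Rightarrow>\<^sub>0 'k::field" where
  "gen g = Poly_Mapping.single (Word [g]) 1"

definition const :: "'k::field \<Rightarrow> 'g fmon \<Rightarrow>\<^sub>0 'k" where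
  "const c = Poly_Mapping.single 0 c"


section \<open>Bicharacters and reflections\<close>

text \<open>
  \<open>\<int>\<^sup>I\<close> is the free abelian group \<open>'i \<Rightarrow>\<^sub>0 int\<close> on the finite type \<open>'i\<close>, with standard basis
  \<open>frag_of i\<close>.
\<close>
type_synonym ('i, 'k) bichar = "('i \<Rightarrow>\<^sub>0 int) \<Rightarrow> ('i \<Rightarrow>\<^sub>0 int) \<Rightarrow> 'k"

definition bicharacter :: "('i, 'k::field) bichar \<Rightarrow> bool" where
  "bicharacter \<chi> \<longleftrightarrow> (\<forall>a b. \<chi> a b \<noteq> 0) \<and>
    (\<forall>a b c. \<chi> (a + b) c = \<chi> a c * \<chi> b c) \<and> (\<forall>a b c. \<chi> a (b + c) = \<chi> a b * \<chi> a c)"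

definition bichar_op :: "('i, 'k::field) bichar \<Rightarrow> ('i, 'k) bichar" where
  "bichar_op \<chi> = (\<lambda>a b. \<chi> b a)"

definition bichar_inv :: "('i, 'k::field) bichar \<Rightarrow> ('i, 'k) bichar" where
  "bichar_inv \<chi> = (\<lambda>a b. inverse (\<chi> a b))"

definition qm :: "('i, 'k::field) bichar \<Rightarrow> 'i \<Rightarrow> 'i \<Rightarrow> 'k" where
  "qm \<chi> i j = \<chi> (frag_of i) (frag_of j)"

definition qnum :: "'k::field \<Rightarrow> nat \<Rightarrow> 'k" where
  "qnum x m = (\<Sum>k<m. x ^ k)"

definition qfact :: "'k::field \<Rightarrow> nat \<Rightarrow> 'k" where
  "qfact x m = (\<Prod>n=1..m. qnum x n)"

definition p_finite :: "'i \<Rightarrow> ('i, 'k::field) bichar \<Rightarrow> bool" where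
  "p_finite p \<chi> \<longleftrightarrow>
    (\<forall>j. j \<noteq> p \<longrightarrow> (\<exists>m. qnum (qm \<chi> p p) (m + 1) = 0 \<or> qm \<chi> p p ^ m * qm \<chi> p j * qm \<chi> j p = 1))"

definition cartan :: "('i, 'k::field) bichar \<Rightarrow> 'i \<Rightarrow> 'i \<Rightarrow> int" where
  "cartan \<chi> p j = (if j = p then 2 else
     - int (LEAST m. qnum (qm \<chi> p p) (m + 1) * (qm \<chi> p p ^ m * qm \<chi> p j * qm \<chi> j p - 1) = 0))"

definition reflection :: "'i \<Rightarrow> ('i, 'k::field) bichar \<Rightarrow> ('i \<Rightarrow>\<^sub>0 int) \<Rightarrow> ('i \<Rightarrow>\<^sub>0 int)" where
  "reflection p \<chi> = frag_extend (\<lambda>j. frag_of j - frag_cmul (cartan \<chi> p j) (frag_of p))"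

definition rp :: "'i \<Rightarrow> ('i, 'k::field) bichar \<Rightarrow> ('i, 'k) bichar" where
  "rp p \<chi> = (\<lambda>a b. \<chi> (inv_into UNIV (reflection p \<chi>) a) (inv_into UNIV (reflection p \<chi>) b))"

text \<open>\<open>lam p \<chi> i\<close> is \<open>\<lambda>\<^sub>i(\<chi>)\<close>, and \<open>height \<chi> p\<close> is \<open>h\<^sup>\<chi>(\<alpha>\<^sub>p)\<close>.\<close>
definition lam :: "'i \<Rightarrow> ('i, 'k::field) bichar \<Rightarrow> 'i \<Rightarrow> 'k" where
  "lam p \<chi> i = qfact (qm \<chi> p p) (nat (- cartan \<chi> p i)) *
    (\<Prod>s<nat (- cartan \<chi> p i). (qm \<chi> p p ^ s * qm \<chi> p i * qm \<chi> i p - 1))"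

definition height :: "('i, 'k::field) bichar \<Rightarrow> 'i \<Rightarrow> enat" where
  "height \<chi> p = (if \<exists>m>0. qnum (qm \<chi> p p) m = 0
     then enat (LEAST m. m > 0 \<and> qnum (qm \<chi> p p) m = 0) else \<infinity>)"


section \<open>The algebra \<open>\<U>(\<chi>)\<close>\<close>

datatype 'i ugen = GK 'i | GK' 'i | GL 'i | GL' 'i | GE 'i | GF 'i

definition cartan_gens :: "'i ugen set" where
  "cartan_gens = range GK \<union> range GK' \<union> range GL \<union> range GL'"

text \<open>The defining relations \<open>u = v\<close>, as elements \<open>u - v\<close> of the free algebra.\<close>
definition \<U>_rels :: "('i, 'k::field) bichar \<Rightarrow> ('i ugen fmon \<Rightarrow>\<^sub>0 'k) set" where
  "\<U>_rels \<chi> =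
     {gen x * gen y - gen y * gen x | x y. x \<in> cartan_gens \<and> y \<in> cartan_gens} \<union>
     {gen (GK i) * gen (GK' i) - 1 | i. True} \<union>
     {gen (GL i) * gen (GL' i) - 1 | i. True} \<union>
     {gen (GK i) * gen (GE j) * gen (GK' i) - const (qm \<chi> i j) * gen (GE j) | i j. True} \<union>
     {gen (GL i) * gen (GE j) * gen (GL' i) - const (inverse (qm \<chi> j i)) * gen (GE j) | i j. True} \<union>
     {gen (GK i) * gen (GF j) * gen (GK' i) - const (inverse (qm \<chi> i j)) * gen (GF j) | i j. True} \<union>
     {gen (GL i) * gen (GF j) * gen (GL' i) - const (qm \<chi> j i) * gen (GF j) | i j. True} \<union>
     {gen (GE i) * gen (GF j) - gen (GF j) * gen (GE i)
        - (if i = j then gen (GK i) - gen (GL i) else 0) | i j. True}"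

definition \<U>_ideal :: "('i, 'k::field) bichar \<Rightarrow> ('i ugen fmon \<Rightarrow>\<^sub>0 'k) set" where
  "\<U>_ideal \<chi> = Idl\<^bsub>free_alg\<^esub> (\<U>_rels \<chi>)"

type_synonym ('i, 'k) \<U>elem = "('i ugen fmon \<Rightarrow>\<^sub>0 'k) set"

definition \<U> :: "('i, 'k::field) bichar \<Rightarrow> ('k, ('i, 'k) \<U>elem) module" where
  "\<U> \<chi> = quot_alg free_alg (\<U>_ideal \<chi>)"

definition \<U>_gen :: "('i, 'k::field) bichar \<Rightarrow> 'i ugen \<Rightarrow> ('i, 'k) \<U>elem" where
  "\<U>_gen \<chi> g = \<U>_ideal \<chi> +>\<^bsub>free_alg\<^esub> gen g"

abbreviation "KK \<chi> i \<equiv> \<U>_gen \<chi> (GK i)"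
abbreviation "KK' \<chi> i \<equiv> \<U>_gen \<chi> (GK' i)"
abbreviation "LL \<chi> i \<equiv> \<U>_gen \<chi> (GL i)"
abbreviation "LL' \<chi> i \<equiv> \<U>_gen \<chi> (GL' i)"
abbreviation "EE \<chi> i \<equiv> \<U>_gen \<chi> (GE i)"
abbreviation "FF \<chi> i \<equiv> \<U>_gen \<chi> (GF i)"

definition \<U>_plus :: "('i, 'k::field) bichar \<Rightarrow> ('i, 'k) \<U>elem set" where
  "\<U>_plus \<chi> = alg_gen (\<U> \<chi>) (range (EE \<chi>))"

definition \<U>_minus :: "('i, 'k::field) bichar \<Rightarrow> ('i, 'k) \<U>elem set" where
  "\<U>_minus \<chi> = alg_gen (\<U> \<chi>) (range (FF \<chi>))"

definition \<U>_zero :: "('i, 'k::field) bichar \<Rightarrow> ('i, 'k) \<U>elem set" where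
  "\<U>_zero \<chi> = alg_gen (\<U> \<chi>) (\<U>_gen \<chi> ` cartan_gens)"

text \<open>
  The unique algebra map \<open>\<U>(\<chi>) \<rightarrow> B\<close> with \<open>K\<^sub>i \<mapsto> k i\<close>, \<open>L\<^sub>i \<mapsto> l i\<close>, \<open>E\<^sub>i \<mapsto> e i\<close>, \<open>F\<^sub>i \<mapsto> f i\<close>
  (its values on \<open>K\<^sub>i\<^sup>-\<^sup>1\<close>, \<open>L\<^sub>i\<^sup>-\<^sup>1\<close> are then determined).
\<close>
definition \<U>_map :: "('i, 'k::field) bichar \<Rightarrow> ('k, 'b) module \<Rightarrow>
    ('i \<Rightarrow> 'b) \<Rightarrow> ('i \<Rightarrow> 'b) \<Rightarrow> ('i \<Rightarrow> 'b) \<Rightarrow> ('i \<Rightarrow> 'b) \<Rightarrow> ('i, 'k) \<U>elem \<Rightarrow> 'b" where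
  "\<U>_map \<chi> B k l e f = (THE \<Phi>. \<Phi> \<in> alg_hom (\<U> \<chi>) B \<and> \<Phi> \<in> extensional (carrier (\<U> \<chi>)) \<and>
     (\<forall>i. \<Phi> (KK \<chi> i) = k i \<and> \<Phi> (LL \<chi> i) = l i \<and> \<Phi> (EE \<chi> i) = e i \<and> \<Phi> (FF \<chi> i) = f i))"

definition phi :: "('i, 'k::field) bichar \<Rightarrow> ('i \<Rightarrow> 'k) \<Rightarrow> ('i, 'k) \<U>elem \<Rightarrow> ('i, 'k) \<U>elem" where
  "phi \<chi> a = \<U>_map \<chi> (\<U> \<chi>) (KK \<chi>) (LL \<chi>)
     (\<lambda>i. a i \<odot>\<^bsub>\<U> \<chi>\<^esub> EE \<chi> i) (\<lambda>i. inverse (a i) \<odot>\<^bsub>\<U> \<chi>\<^esub> FF \<chi> i)"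

definition phi2 :: "('i, 'k::field) bichar \<Rightarrow> ('i, 'k) \<U>elem \<Rightarrow> ('i, 'k) \<U>elem" where
  "phi2 \<chi> = (let \<psi> = bichar_inv \<chi> in
     \<U>_map \<chi> (\<U> \<psi>) (KK \<psi>) (LL \<psi>) (FF \<psi>) (\<lambda>i. \<ominus>\<^bsub>\<U> \<psi>\<^esub> EE \<psi> i))"

definition phi3 :: "('i, 'k::field) bichar \<Rightarrow> ('i, 'k) \<U>elem \<Rightarrow> ('i, 'k) \<U>elem" where
  "phi3 \<chi> = (let \<psi> = bichar_op \<chi> in \<U>_map \<chi> (\<U> \<psi>) (LL \<psi>) (KK \<psi>) (FF \<psi>) (EE \<psi>))"

text \<open>An antihomomorphism is a homomorphism into the opposite algebra.\<close>
definition phi4 :: "('i, 'k::field) bichar \<Rightarrow> ('i, 'k) \<U>elem \<Rightarrow> ('i, 'k) \<U>elem" where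
  "phi4 \<chi> = \<U>_map \<chi> (opp_alg (\<U> \<chi>)) (KK \<chi>) (LL \<chi>) (FF \<chi>) (EE \<chi>)"


section \<open>The braided coproduct and \<open>U(\<chi>)\<close>\<close>

text \<open>
  Since \<open>\<U>\<^sup>+(\<chi>)\<close> is the free algebra on the \<open>E\<^sub>i\<close>, the braided coproduct is formed on the free
  algebra on \<open>'i\<close>, whose tensor square has the pairs of words as a basis. The resulting subspace
  is transported to \<open>\<U>\<^sup>+(\<chi>)\<close> along the canonical algebra map \<open>E_incl\<close>.
\<close>

definition tens :: "('i fmon \<Rightarrow>\<^sub>0 'k::field) \<Rightarrow> ('i fmon \<Rightarrow>\<^sub>0 'k) \<Rightarrow> ('i fmon \<times> 'i fmon \<Rightarrow>\<^sub>0 'k)" where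
  "tens x y = (\<Sum>u\<in>Poly_Mapping.keys x. \<Sum>v\<in>Poly_Mapping.keys y.
     Poly_Mapping.single (u, v) (Poly_Mapping.lookup x u * Poly_Mapping.lookup y v))"

definition wdeg :: "'i fmon \<Rightarrow> ('i \<Rightarrow>\<^sub>0 int)" where
  "wdeg w = sum_list (map frag_of (letters w))"

definition braided_tensor_alg :: "('i, 'k::field) bichar \<Rightarrow> ('k, 'i fmon \<times> 'i fmon \<Rightarrow>\<^sub>0 'k) module" where
  "braided_tensor_alg \<chi> = \<lparr>carrier = UNIV,
     mult = (\<lambda>s t. \<Sum>(x, y)\<in>Poly_Mapping.keys s. \<Sum>(x', y')\<in>Poly_Mapping.keys t.
       Poly_Mapping.single (x + x', y + y')
         (Poly_Mapping.lookup s (x, y) * Poly_Mapping.lookup t (x', y') * \<chi> (wdeg y) (wdeg x'))),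
     one = tens 1 1, zero = 0, add = (+), smult = (\<lambda>c. Poly_Mapping.map ((*) c))\<rparr>"

definition braided_coproduct ::
    "('i, 'k::field) bichar \<Rightarrow> ('i fmon \<Rightarrow>\<^sub>0 'k) \<Rightarrow> ('i fmon \<times> 'i fmon \<Rightarrow>\<^sub>0 'k)" where
  "braided_coproduct \<chi> = (THE \<Delta>. \<Delta> \<in> alg_hom free_alg (braided_tensor_alg \<chi>) \<and>
     (\<forall>i. \<Delta> (gen i) = tens (gen i) 1 + tens 1 (gen i)))"

text \<open>
  The largest subspace \<open>S\<close> in degrees at least 2 with
  \<open>\<Delta>(S) \<subseteq> S \<otimes> \<U>\<^sup>+(\<chi>) + \<U>\<^sup>+(\<chi>) \<otimes> S\<close>; the latter is spanned by the \<open>x \<otimes> y\<close> with \<open>x \<in> S\<close> or \<open>y \<in> S\<close>.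
\<close>
definition nichols_space :: "('i, 'k::field) bichar \<Rightarrow> ('i fmon \<Rightarrow>\<^sub>0 'k) set" where
  "nichols_space \<chi> = (GREATEST S. alg_subspace free_alg S \<and>
     (\<forall>x\<in>S. \<forall>w\<in>Poly_Mapping.keys x. 2 \<le> length (letters w)) \<and>
     braided_coproduct \<chi> ` S \<subseteq> lin_span (braided_tensor_alg \<chi>) {tens x y | x y. x \<in> S \<or> y \<in> S})"

definition E_incl :: "('i, 'k::field) bichar \<Rightarrow> ('i fmon \<Rightarrow>\<^sub>0 'k) \<Rightarrow> ('i, 'k) \<U>elem" where
  "E_incl \<chi> = (THE \<iota>. \<iota> \<in> alg_hom free_alg (\<U> \<chi>) \<and> (\<forall>i. \<iota> (gen i) = EE \<chi> i))"

definition \<S>_plus :: "('i, 'k::field) bichar \<Rightarrow> ('i, 'k) \<U>elem set" where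
  "\<S>_plus \<chi> = E_incl \<chi> ` nichols_space \<chi>"

definition \<S>_minus :: "('i, 'k::field) bichar \<Rightarrow> ('i, 'k) \<U>elem set" where
  "\<S>_minus \<chi> = phi4 \<chi> ` \<S>_plus \<chi>"

definition \<S> :: "('i, 'k::field) bichar \<Rightarrow> ('i, 'k) \<U>elem set" where
  "\<S> \<chi> = lin_span (\<U> \<chi>)
     ((\<S>_plus \<chi> <#>\<^bsub>\<U> \<chi>\<^esub> \<U>_zero \<chi> <#>\<^bsub>\<U> \<chi>\<^esub> \<U>_minus \<chi>) \<union>
      (\<U>_plus \<chi> <#>\<^bsub>\<U> \<chi>\<^esub> \<U>_zero \<chi> <#>\<^bsub>\<U> \<chi>\<^esub> \<S>_minus \<chi>))"

text \<open>The algebra \<open>U(\<chi>) = \<U>(\<chi>)/\<S>(\<chi>)\<close>.\<close>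
definition Uq :: "('i, 'k::field) bichar \<Rightarrow> ('k, ('i, 'k) \<U>elem set) module" where
  "Uq \<chi> = quot_alg (\<U> \<chi>) (\<S> \<chi>)"

definition Uq_class :: "('i, 'k::field) bichar \<Rightarrow> ('i, 'k) \<U>elem \<Rightarrow> ('i, 'k) \<U>elem set" where
  "Uq_class \<chi> x = \<S> \<chi> +>\<^bsub>\<U> \<chi>\<^esub> x"


section \<open>Lusztig maps\<close>

primrec root_vec :: "('k, 'a) module \<Rightarrow> 'a \<Rightarrow> 'a \<Rightarrow> 'a \<Rightarrow> 'a \<Rightarrow> nat \<Rightarrow> 'a" where
  "root_vec A k k' x y 0 = y"
| "root_vec A k k' x y (Suc m) = x \<otimes>\<^bsub>A\<^esub> root_vec A k k' x y m
     \<ominus>\<^bsub>A\<^esub> (k \<otimes>\<^bsub>A\<^esub> root_vec A k k' x y m \<otimes>\<^bsub>A\<^esub> k') \<otimes>\<^bsub>A\<^esub> x"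

definition Eplus :: "('i, 'k::field) bichar \<Rightarrow> 'i \<Rightarrow> 'i \<Rightarrow> nat \<Rightarrow> ('i, 'k) \<U>elem" where
  "Eplus \<chi> p i = root_vec (\<U> \<chi>) (KK \<chi> p) (KK' \<chi> p) (EE \<chi> p) (EE \<chi> i)"

definition Eminus :: "('i, 'k::field) bichar \<Rightarrow> 'i \<Rightarrow> 'i \<Rightarrow> nat \<Rightarrow> ('i, 'k) \<U>elem" where
  "Eminus \<chi> p i = root_vec (\<U> \<chi>) (LL \<chi> p) (LL' \<chi> p) (EE \<chi> p) (EE \<chi> i)"

definition Fplus :: "('i, 'k::field) bichar \<Rightarrow> 'i \<Rightarrow> 'i \<Rightarrow> nat \<Rightarrow> ('i, 'k) \<U>elem" where
  "Fplus \<chi> p i = root_vec (\<U> \<chi>) (LL \<chi> p) (LL' \<chi> p) (FF \<chi> p) (FF \<chi> i)"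

definition Fminus :: "('i, 'k::field) bichar \<Rightarrow> 'i \<Rightarrow> 'i \<Rightarrow> nat \<Rightarrow> ('i, 'k) \<U>elem" where
  "Fminus \<chi> p i = root_vec (\<U> \<chi>) (KK \<chi> p) (KK' \<chi> p) (FF \<chi> p) (FF \<chi> i)"

definition Ip_plus :: "'i \<Rightarrow> ('i, 'k::field) bichar \<Rightarrow> ('i, 'k) \<U>elem set" where
  "Ip_plus p \<chi> = Idl\<^bsub>(\<U> \<chi>)\<lparr>carrier := \<U>_plus \<chi>\<rparr>\<^esub> (case height \<chi> p of
       enat h \<Rightarrow> {EE \<chi> p [^]\<^bsub>\<U> \<chi>\<^esub> h} \<union>
         {Eplus \<chi> p i (nat (1 - cartan \<chi> p i)) | i. i \<noteq> p \<and> 1 - cartan \<chi> p i < int h}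
     | \<infinity> \<Rightarrow> {Eplus \<chi> p i (nat (1 - cartan \<chi> p i)) | i. i \<noteq> p})"

definition Ip_minus :: "'i \<Rightarrow> ('i, 'k::field) bichar \<Rightarrow> ('i, 'k) \<U>elem set" where
  "Ip_minus p \<chi> = Idl\<^bsub>(\<U> \<chi>)\<lparr>carrier := \<U>_minus \<chi>\<rparr>\<^esub> (case height \<chi> p of
       enat h \<Rightarrow> {FF \<chi> p [^]\<^bsub>\<U> \<chi>\<^esub> h} \<union>
         {Fplus \<chi> p i (nat (1 - cartan \<chi> p i)) | i. i \<noteq> p \<and> 1 - cartan \<chi> p i < int h}
     | \<infinity> \<Rightarrow> {Fplus \<chi> p i (nat (1 - cartan \<chi> p i)) | i. i \<noteq> p})"

definition Ip :: "'i \<Rightarrow> ('i, 'k::field) bichar \<Rightarrow> ('i, 'k) \<U>elem set" where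
  "Ip p \<chi> = Idl\<^bsub>\<U> \<chi>\<^esub> (Ip_plus p \<chi> \<union> Ip_minus p \<chi>)"

text \<open>
  \<open>LT p \<chi>\<close> and \<open>LTm p \<chi>\<close> are the Lusztig maps \<open>T\<^sub>p\<close> and \<open>T\<^sub>p\<^sup>-\<close> on \<open>\<U>(\<chi>)\<close>; the suffix \<open>_U\<close> below marks
  the maps induced on the quotients \<open>U\<close>.
\<close>
definition LT :: "'i \<Rightarrow> ('i, 'k::field) bichar \<Rightarrow> ('i, 'k) \<U>elem \<Rightarrow> ('i, 'k) \<U>elem set" where
  "LT p \<chi> = (let \<psi> = rp p \<chi>; V = \<U> \<psi>; \<pi> = (\<lambda>x. Ip p \<psi> +>\<^bsub>V\<^esub> x); n = (\<lambda>i. nat (- cartan \<chi> p i)) in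
     \<U>_map \<chi> (quot_alg V (Ip p \<psi>))
       (\<lambda>i. \<pi> (if i = p then KK' \<psi> p else KK \<psi> i \<otimes>\<^bsub>V\<^esub> KK \<psi> p [^]\<^bsub>V\<^esub> n i))
       (\<lambda>i. \<pi> (if i = p then LL' \<psi> p else LL \<psi> i \<otimes>\<^bsub>V\<^esub> LL \<psi> p [^]\<^bsub>V\<^esub> n i))
       (\<lambda>i. \<pi> (if i = p then FF \<psi> p \<otimes>\<^bsub>V\<^esub> LL' \<psi> p else Eplus \<psi> p i (n i)))
       (\<lambda>i. \<pi> (if i = p then KK' \<psi> p \<otimes>\<^bsub>V\<^esub> EE \<psi> p
                else inverse (lam p \<psi> i) \<odot>\<^bsub>V\<^esub> Fplus \<psi> p i (n i))))"

definition LTm :: "'i \<Rightarrow> ('i, 'k::field) bichar \<Rightarrow> ('i, 'k) \<U>elem \<Rightarrow> ('i, 'k) \<U>elem set" where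
  "LTm p \<chi> = (let \<psi> = rp p \<chi>; V = \<U> \<psi>; \<pi> = (\<lambda>x. Ip p \<psi> +>\<^bsub>V\<^esub> x); n = (\<lambda>i. nat (- cartan \<chi> p i)) in
     \<U>_map \<chi> (quot_alg V (Ip p \<psi>))
       (\<lambda>i. \<pi> (if i = p then KK' \<psi> p else KK \<psi> i \<otimes>\<^bsub>V\<^esub> KK \<psi> p [^]\<^bsub>V\<^esub> n i))
       (\<lambda>i. \<pi> (if i = p then LL' \<psi> p else LL \<psi> i \<otimes>\<^bsub>V\<^esub> LL \<psi> p [^]\<^bsub>V\<^esub> n i))
       (\<lambda>i. \<pi> (if i = p then KK' \<psi> p \<otimes>\<^bsub>V\<^esub> FF \<psi> p
                else inverse (lam p (rp p (bichar_inv \<chi>)) i) \<odot>\<^bsub>V\<^esub> Eminus \<psi> p i (n i)))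
       (\<lambda>i. \<pi> (if i = p then EE \<psi> p \<otimes>\<^bsub>V\<^esub> LL' \<psi> p
                else ((-1) powi cartan \<chi> p i) \<odot>\<^bsub>V\<^esub> Fminus \<psi> p i (n i))))"

text \<open>The canonical map \<open>\<U>(\<chi>)/(\<I>\<^sub>p\<^sup>+(\<chi>), \<I>\<^sub>p\<^sup>-(\<chi>)) \<rightarrow> U(\<chi>)\<close>.\<close>
definition Uq_canon :: "('i, 'k::field) bichar \<Rightarrow> ('i, 'k) \<U>elem set \<Rightarrow> ('i, 'k) \<U>elem set" where
  "Uq_canon \<chi> = induced (Uq_class \<chi>)"

definition LT_U :: "'i \<Rightarrow> ('i, 'k::field) bichar \<Rightarrow> ('i, 'k) \<U>elem set \<Rightarrow> ('i, 'k) \<U>elem set" where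
  "LT_U p \<chi> = induced (\<lambda>x. Uq_canon (rp p \<chi>) (LT p \<chi> x))"

definition LTm_U :: "'i \<Rightarrow> ('i, 'k::field) bichar \<Rightarrow> ('i, 'k) \<U>elem set \<Rightarrow> ('i, 'k) \<U>elem set" where
  "LTm_U p \<chi> = induced (\<lambda>x. Uq_canon (rp p \<chi>) (LTm p \<chi> x))"

definition phi_U :: "('i, 'k::field) bichar \<Rightarrow> ('i \<Rightarrow> 'k) \<Rightarrow> ('i, 'k) \<U>elem set \<Rightarrow> ('i, 'k) \<U>elem set" where
  "phi_U \<chi> a = induced (\<lambda>x. Uq_class \<chi> (phi \<chi> a x))"

definition phi2_U :: "('i, 'k::field) bichar \<Rightarrow> ('i, 'k) \<U>elem set \<Rightarrow> ('i, 'k) \<U>elem set" where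
  "phi2_U \<chi> = induced (\<lambda>x. Uq_class (bichar_inv \<chi>) (phi2 \<chi> x))"

definition phi3_U :: "('i, 'k::field) bichar \<Rightarrow> ('i, 'k) \<U>elem set \<Rightarrow> ('i, 'k) \<U>elem set" where
  "phi3_U \<chi> = induced (\<lambda>x. Uq_class (bichar_op \<chi>) (phi3 \<chi> x))"

definition phi4_U :: "('i, 'k::field) bichar \<Rightarrow> ('i, 'k) \<U>elem set \<Rightarrow> ('i, 'k) \<U>elem set" where
  "phi4_U \<chi> = induced (\<lambda>x. Uq_class \<chi> (phi4 \<chi> x))"

end

theory Submission
  imports Defs "HOL-Library.Product_Plus"
begin

section \<open>Linear algebra on finitely supported functions\<close>

definition scl :: "'k::field \<Rightarrow> ('b \<Rightarrow>\<^sub>0 'k) \<Rightarrow> ('b \<Rightarrow>\<^sub>0 'k)" where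
  "scl c x = Poly_Mapping.map ((*) c) x"

abbreviation "lookup \<equiv> Poly_Mapping.lookup"
abbreviation "keys \<equiv> Poly_Mapping.keys"

abbreviation mon :: "'b \<Rightarrow> ('b \<Rightarrow>\<^sub>0 'k::field)" where
  "mon b \<equiv> Poly_Mapping.single b 1"

lemma lookup_scl [simp]: "lookup (scl c x) b = c * lookup x b"
  by (simp add: scl_def Poly_Mapping.map.rep_eq when_def)

lemma scl_laws [simp]:
  "scl c (x + y) = scl c x + scl c y" "scl (c + d) x = scl c x + scl d x"
  "scl c (scl d x) = scl (c * d) x" "scl 1 x = x" "scl 0 x = 0" "scl c 0 = 0"
  "scl c (- x) = - scl c x" "scl c (x - y) = scl c x - scl c y"
  "scl (- c) x = - scl c x" "scl (c - d) x = scl c x - scl d x"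
  "scl c (Poly_Mapping.single b d) = Poly_Mapping.single b (c * d)"
  by (auto intro!: poly_mapping_eqI simp: lookup_add lookup_minus algebra_simps lookup_single when_def)

lemma pm_sum_singles: "x = (\<Sum>b\<in>keys x. Poly_Mapping.single b (lookup x b))"
  by (rule poly_mapping_eqI) (auto simp: lookup_sum lookup_single when_def in_keys_iff if_distrib cong: if_cong)

lemma pm_induct [case_names zero add single]:
  assumes "P 0" "\<And>x y. P x \<Longrightarrow> P y \<Longrightarrow> P (x + y)" "\<And>b c. P (Poly_Mapping.single b c)"
  shows "P (x :: 'b \<Rightarrow>\<^sub>0 'c::comm_monoid_add)"
proof -
  have "P (\<Sum>b\<in>B. Poly_Mapping.single b (lookup x b))" if "finite B" for B
    using that by induction (use assms in auto)
  moreover have "x = (\<Sum>b\<in>keys x. Poly_Mapping.single b (lookup x b))"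
    by (rule poly_mapping_eqI) (auto simp: lookup_sum lookup_single when_def in_keys_iff if_distrib cong: if_cong)
  ultimately show ?thesis by (metis finite_keys)
qed

locale linear_scale =
  fixes sc :: "'k::field \<Rightarrow> 'a::ab_group_add \<Rightarrow> 'a"
  assumes sc_add [simp]: "sc c (x + y) = sc c x + sc c y"
    and sc_add_left [simp]: "sc (c + d) x = sc c x + sc d x"
    and sc_sc [simp]: "sc c (sc d x) = sc (c * d) x"
    and sc_one [simp]: "sc 1 x = x"
begin

lemma sc_zero [simp]: "sc 0 x = 0" "sc c 0 = 0"
  using sc_add_left[of 0 0 x] sc_add[of c 0 0] by simp_all

lemma sc_minus [simp]: "sc c (- x) = - sc c x" "sc (- c) x = - sc c x"
  using sc_add[of c x "-x"] sc_add_left[of c "-c" x] by (simp_all add: eq_neg_iff_add_eq_0 add.commute)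

lemma sc_diff [simp]: "sc c (x - y) = sc c x - sc c y" "sc (c - d) x = sc c x - sc d x"
  using sc_add[of c x "-y"] sc_add_left[of c "-d" x] by simp_all

lemma sc_sum: "sc c (sum f B) = (\<Sum>b\<in>B. sc c (f b))"
  by (induction B rule: infinite_finite_induct) auto

lemma sc_cancel: "c \<noteq> 0 \<Longrightarrow> sc c x = sc c y \<longleftrightarrow> x = y"
  by (metis sc_sc sc_one left_inverse)

definition lext :: "('b \<Rightarrow> 'a) \<Rightarrow> ('b \<Rightarrow>\<^sub>0 'k) \<Rightarrow> 'a" where
  "lext f x = (\<Sum>b\<in>keys x. sc (lookup x b) (f b))"

lemma lext_superset: "finite B \<Longrightarrow> keys x \<subseteq> B \<Longrightarrow> lext f x = (\<Sum>b\<in>B. sc (lookup x b) (f b))"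
  unfolding lext_def by (rule sum.mono_neutral_left) (auto simp: in_keys_iff)

lemma lext_add [simp]: "lext f (x + y) = lext f x + lext f y"
proof -
  let ?B = "keys x \<union> keys y"
  have "lext f (x + y) = (\<Sum>b\<in>?B. sc (lookup (x + y) b) (f b))"
    by (rule lext_superset) (auto simp: Poly_Mapping.keys_add)
  also have "\<dots> = (\<Sum>b\<in>?B. sc (lookup x b) (f b)) + (\<Sum>b\<in>?B. sc (lookup y b) (f b))"
    by (simp add: lookup_add sum.distrib)
  also have "\<dots> = lext f x + lext f y"
    by (subst (1 2) lext_superset[of ?B]) auto
  finally show ?thesis .
qed

lemma lext_single [simp]: "lext f (Poly_Mapping.single b c) = sc c (f b)"
  by (auto simp: lext_def)

lemma lext_zero [simp]: "lext f 0 = 0"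
  by (simp add: lext_def)

lemma lext_minus [simp]: "lext f (- x) = - lext f x"
  using lext_add[of f x "-x"] by (simp add: eq_neg_iff_add_eq_0 add.commute)

lemma lext_diff [simp]: "lext f (x - y) = lext f x - lext f y"
  using lext_add[of f x "-y"] by simp

lemma lext_scl [simp]: "lext f (scl c x) = sc c (lext f x)"
  by (induction x rule: pm_induct) auto

lemma lext_sum: "lext f (sum g B) = (\<Sum>b\<in>B. lext f (g b))"
  by (induction B rule: infinite_finite_induct) auto

end

interpretation PM: linear_scale "scl :: 'k::field \<Rightarrow> ('b \<Rightarrow>\<^sub>0 'k) \<Rightarrow> ('b \<Rightarrow>\<^sub>0 'k)"
  by standard auto

locale algebra_scale = linear_scale sc for sc :: "'k::field \<Rightarrow> 'a::ring_1 \<Rightarrow> 'a" +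
  assumes sc_mult_left [simp]: "sc c x * y = sc c (x * y)"
    and sc_mult_right [simp]: "x * sc c y = sc c (x * y)"

lemma scl_mult_fa [simp]:
  fixes x y :: "'g fmon \<Rightarrow>\<^sub>0 'k::field"
  shows "scl c x * y = scl c (x * y)" "x * scl c y = scl c (x * y)"
proof -
  have s: "scl c (Poly_Mapping.single u d) * y = scl c (Poly_Mapping.single u d * y)"
    for c d :: 'k and u :: "'g fmon" and y
  proof (induction y rule: pm_induct)
    case (add x y)
    then show ?case by (simp only: distrib_left scl_laws(1))
  qed (simp_all only: mult_single scl_laws mult_zero_right mult.assoc)
  have s': "Poly_Mapping.single u d * scl c y = scl c (Poly_Mapping.single u d * y)"
    for c d :: 'k and u :: "'g fmon" and y
  proof (induction y rule: pm_induct)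
    case (add x y)
    then show ?case by (simp only: distrib_left scl_laws(1))
  qed (simp_all only: mult_single scl_laws mult_zero_right mult.left_commute)
  show "scl c x * y = scl c (x * y)"
  proof (induction x rule: pm_induct)
    case (add u v)
    then show ?case by (simp only: distrib_right scl_laws(1))
  next
    case (single u d)
    show ?case by (rule s)
  qed (simp_all only: scl_laws mult_zero_left)
  show "x * scl c y = scl c (x * y)"
  proof (induction x rule: pm_induct)
    case (add u v)
    then show ?case by (simp only: distrib_right scl_laws(1))
  next
    case (single u d)
    show ?case by (rule s')
  qed (simp_all only: scl_laws mult_zero_left)
qed

interpretation FA: algebra_scale "scl :: 'k::field \<Rightarrow> ('g fmon \<Rightarrow>\<^sub>0 'k) \<Rightarrow> ('g fmon \<Rightarrow>\<^sub>0 'k)"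
  by standard auto

lemma scl_one: "scl c 1 = const c"
  by (simp add: const_def flip: single_one)

lemma const_mult: "const c * x = scl c x"
  by (simp flip: scl_one)

lemma gen_mult_single: "gen i * Poly_Mapping.single w c = Poly_Mapping.single (Word [i] + w) c"
  by (simp add: gen_def mult_single)

lemma single_Word_Cons: "mon (Word (i # w)) = gen i * (mon (Word w) :: 'g fmon \<Rightarrow>\<^sub>0 'k::field)"
  by (simp add: gen_mult_single plus_fmon_def)

lemma single_Word_Nil: "mon (Word []) = (1 :: 'g fmon \<Rightarrow>\<^sub>0 'k::field)"
  by (simp add: zero_fmon_def flip: single_one)

lemma fa_induct [case_names word add scl]:
  fixes x :: "'g fmon \<Rightarrow>\<^sub>0 'k::field"
  assumes "\<And>w. P (mon (Word w))" "\<And>x y. P x \<Longrightarrow> P y \<Longrightarrow> P (x + y)" "\<And>c x. P x \<Longrightarrow> P (scl c x)"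
  shows "P x"
proof (induction x rule: pm_induct)
  case zero
  show ?case using assms(3)[OF assms(1), of 0] by simp
next
  case (single b c)
  show ?case using assms(3)[OF assms(1), of c "letters b"] by simp
qed (use assms in auto)

lemma fa_word_induct:
  fixes x :: "'g fmon \<Rightarrow>\<^sub>0 'k::field"
  assumes "P 1" "\<And>i x. P x \<Longrightarrow> P (gen i * x)" "\<And>x y. P x \<Longrightarrow> P y \<Longrightarrow> P (x + y)" "\<And>c x. P x \<Longrightarrow> P (scl c x)"
  shows "P x"
proof (induction x rule: fa_induct)
  case (word w)
  show ?case by (induction w) (auto simp: single_Word_Cons single_Word_Nil assms)
qed (use assms in auto)

context algebra_scale
begin

text \<open>Evaluation of a noncommutative polynomial at elements of an algebra.\<close>

definition ev :: "('g \<Rightarrow> 'a) \<Rightarrow> ('g fmon \<Rightarrow>\<^sub>0 'k) \<Rightarrow> 'a" where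
  "ev g = lext (\<lambda>w. prod_list (map g (letters w)))"

lemma ev_linear [simp]: "ev g (x + y) = ev g x + ev g y" "ev g (x - y) = ev g x - ev g y"
  "ev g (- x) = - ev g x" "ev g 0 = 0" "ev g (scl c x) = sc c (ev g x)"
  by (simp_all add: ev_def)

lemma ev_one [simp]: "ev g 1 = 1"
  by (simp add: ev_def zero_fmon_def flip: single_one)

lemma ev_gen [simp]: "ev g (gen i) = g i"
  by (simp add: ev_def gen_def)

lemma ev_mult [simp]: "ev g (x * y) = ev g x * ev g y"
proof (induction x rule: pm_induct)
  case (single u c)
  show ?case
    by (induction y rule: pm_induct) (auto simp: distrib_left mult_single ev_def plus_fmon_def mult.commute[of c])
qed (auto simp: distrib_right)

lemma ev_const [simp]: "ev g (const c) = sc c 1"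
  by (metis ev_linear(5) ev_one scl_one)

lemma ev_power [simp]: "ev g (x ^ n) = ev g x ^ n"
  by (induction n) auto

lemma ev_sum: "ev g (sum f B) = (\<Sum>b\<in>B. ev g (f b))"
  by (induction B rule: infinite_finite_induct) auto

end

context algebra_scale
begin

lemma ev_ev: "ev g (FA.ev h x) = ev (\<lambda>i. ev g (h i)) x"
  by (induction x rule: fa_word_induct) auto

lemma ev_unique:
  assumes "\<And>x y. \<Phi> (x * y) = \<Phi> x * \<Phi> y" "\<And>x y. \<Phi> (x + y) = \<Phi> x + \<Phi> y" "\<Phi> 1 = 1"
    "\<And>c x. \<Phi> (scl c x) = sc c (\<Phi> x)"
  shows "\<Phi> x = ev (\<lambda>i. \<Phi> (gen i)) x"
  by (induction x rule: fa_word_induct) (auto simp: assms)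

end

lemma FA_ev_gen: "FA.ev gen x = x"
  by (induction x rule: fa_word_induct) auto

text \<open>The anti-automorphism of the free algebra that reverses words.\<close>

definition frev :: "('g fmon \<Rightarrow>\<^sub>0 'k::field) \<Rightarrow> ('g fmon \<Rightarrow>\<^sub>0 'k)" where
  "frev = PM.lext (\<lambda>w. mon (Word (rev (letters w))))"

lemma frev_linear [simp]: "frev (x + y) = frev x + frev y" "frev (x - y) = frev x - frev y"
  "frev (- x) = - frev x" "frev 0 = 0" "frev (scl c x) = scl c (frev x)"
  by (simp_all add: frev_def)

lemma frev_single [simp]: "frev (Poly_Mapping.single w c) = Poly_Mapping.single (Word (rev (letters w))) c"
  by (simp add: frev_def)

lemma frev_one [simp]: "frev 1 = 1"
  by (simp add: zero_fmon_def flip: single_one)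

lemma frev_gen [simp]: "frev (gen i) = gen i"
  by (simp add: gen_def)

lemma frev_mult [simp]: "frev (x * y) = frev y * frev x"
proof (induction x rule: pm_induct)
  case (single u c)
  show ?case
    by (induction y rule: pm_induct) (auto simp: distrib_left distrib_right mult_single plus_fmon_def mult.commute[of c])
qed (auto simp: distrib_left distrib_right)

lemma frev_frev [simp]: "frev (frev x) = x"
  by (induction x rule: pm_induct) auto

section \<open>Endomorphism algebras\<close>

typedef (overloaded) ('b, 'k) lend = "{f :: ('b \<Rightarrow>\<^sub>0 'k::field) \<Rightarrow> ('b \<Rightarrow>\<^sub>0 'k).
    (\<forall>x y. f (x + y) = f x + f y) \<and> (\<forall>c x. f (scl c x) = scl c (f x))}"
  morphisms app Lend
  by (rule exI[of _ "\<lambda>x. x"]) auto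

setup_lifting type_definition_lend

instantiation lend :: (type, field) ring_1
begin
lift_definition zero_lend :: "('a, 'b) lend" is "\<lambda>x. 0" by auto
lift_definition one_lend :: "('a, 'b) lend" is "\<lambda>x. x" by auto
lift_definition plus_lend :: "('a, 'b) lend \<Rightarrow> ('a, 'b) lend \<Rightarrow> ('a, 'b) lend" is "\<lambda>f g x. f x + g x"
  by (simp add: ac_simps)
lift_definition uminus_lend :: "('a, 'b) lend \<Rightarrow> ('a, 'b) lend" is "\<lambda>f x. - f x"
  by simp
lift_definition minus_lend :: "('a, 'b) lend \<Rightarrow> ('a, 'b) lend \<Rightarrow> ('a, 'b) lend" is "\<lambda>f g x. f x - g x"
  by (simp add: add_diff_add)
lift_definition times_lend :: "('a, 'b) lend \<Rightarrow> ('a, 'b) lend \<Rightarrow> ('a, 'b) lend" is "\<lambda>f g x. f (g x)"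
  by simp
instance
proof
  have ext: "f = g" if "\<And>x. app f x = app g x" for f g :: "('a, 'b) lend"
    using that app_inject[of f g] by blast
  note reps = zero_lend.rep_eq one_lend.rep_eq plus_lend.rep_eq uminus_lend.rep_eq minus_lend.rep_eq
    times_lend.rep_eq
  have add: "app f (x + y) = app f x + app f y" for f :: "('a, 'b) lend" and x y
    using app[of f] by blast
  fix a b c :: "('a, 'b) lend"
  show "a + b + c = a + (b + c)" "a + b = b + a" "0 + a = a" "- a + a = 0" "a - b = a + - b"
    "a * b * c = a * (b * c)" "1 * a = a" "a * 1 = a" "(a + b) * c = a * c + b * c" "a * (b + c) = a * b + a * c"
    by (rule ext; simp add: reps add ac_simps)+
  show "(0::('a,'b) lend) \<noteq> 1"
  proof
    assume "(0::('a,'b) lend) = 1"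
    then have "app (0::('a,'b) lend) (mon undefined) = app 1 (mon undefined)" by simp
    then have "(mon undefined :: 'a \<Rightarrow>\<^sub>0 'b) = 0" by (simp add: reps)
    then have "lookup (mon undefined :: 'a \<Rightarrow>\<^sub>0 'b) undefined = 0" by simp
    then show False by simp
  qed
qed
end

lift_definition lsc :: "'k::field \<Rightarrow> ('b, 'k) lend \<Rightarrow> ('b, 'k) lend" is "\<lambda>c f x. scl c (f x)"
  by (auto simp: mult_ac)

interpretation LE: algebra_scale lsc
  by standard (transfer; auto simp: mult_ac)+

lemma app_simps [simp]:
  "app f (x + y) = app f x + app f y" "app f (scl c x) = scl c (app f x)" "app f 0 = 0"
  "app (f + g) x = app f x + app g x" "app (f - g) x = app f x - app g x" "app (- f) x = - app f x"
  "app (f * g) x = app f (app g x)" "app 1 x = x" "app 0 x = 0" "app (lsc c f) x = scl c (app f x)"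
proof -
  show 1: "app f (x + y) = app f x + app f y" "app f (scl c x) = scl c (app f x)" for f :: "('a,'b) lend" and x y c
    by (transfer; simp)+
  show "app f 0 = 0" using 1(2)[of f 0 0] by simp
qed (transfer; simp)+

lemma app_minus [simp]: "app f (x - y) = app f x - app f y" "app f (- x) = - app f x"
proof -
  show 1: "app f (x - y) = app f x - app f y" for x y
    using app_simps(1)[of f "x - y" y] by (simp add: eq_diff_eq)
  show "app f (- x) = - app f x" using 1[of 0 x] by simp
qed

lemma lend_eqI: "(\<And>b. app f (mon b) = app g (mon b)) \<Longrightarrow> f = g"
proof -
  assume a: "\<And>b. app f (mon b) = app g (mon b)"
  have "app f x = app g x" for x
  proof (induction x rule: pm_induct)
    case (single b c)
    have "app f (scl c (mon b)) = app g (scl c (mon b))" by (simp only: app_simps a)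
    then show ?case by simp
  qed auto
  then show ?thesis by (metis app_inject ext)
qed

lemma linear_scale_mult: "linear_scale ((*) :: 'k::field \<Rightarrow> 'k \<Rightarrow> 'k)"
  by standard (auto simp: algebra_simps)

definition kext :: "('b \<Rightarrow> 'k::field) \<Rightarrow> ('b \<Rightarrow>\<^sub>0 'k) \<Rightarrow> 'k" where
  "kext = linear_scale.lext (*)"

lemma kext_simps [simp]: "kext f (x + y) = kext f x + kext f y" "kext f (x - y) = kext f x - kext f y"
  "kext f (- x) = - kext f x" "kext f 0 = 0" "kext f (scl c x) = c * kext f x"
  "kext f (Poly_Mapping.single b c) = c * f b"
  unfolding kext_def
  by (rule linear_scale.lext_add[OF linear_scale_mult] linear_scale.lext_diff[OF linear_scale_mult]
    linear_scale.lext_minus[OF linear_scale_mult] linear_scale.lext_zero[OF linear_scale_mult]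
    linear_scale.lext_scl[OF linear_scale_mult] linear_scale.lext_single[OF linear_scale_mult])+

definition lin_op :: "('b \<Rightarrow> ('b \<Rightarrow>\<^sub>0 'k::field)) \<Rightarrow> ('b, 'k) lend" where
  "lin_op f = Lend (PM.lext f)"

lemma app_lin_op [simp]: "app (lin_op f) x = PM.lext f x"
  by (simp add: lin_op_def Lend_inverse)

section \<open>Skew derivations of the free algebra\<close>

type_synonym ('i, 'k) fa = "'i fmon \<Rightarrow>\<^sub>0 'k"

definition eps :: "('i, 'k::field) fa \<Rightarrow> 'k" where "eps x = lookup x 0"

lemma eps_simps [simp]: "eps (x + y) = eps x + eps y" "eps (x - y) = eps x - eps y" "eps (- x) = - eps x"
  "eps 0 = 0" "eps 1 = 1" "eps (scl c x) = c * eps x"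
  by (auto simp: eps_def lookup_add lookup_minus lookup_one)

lemma eps_gen_mult [simp]: "eps (gen i * x) = 0"
  by (induction x rule: pm_induct)
    (auto simp: distrib_left gen_mult_single, auto simp: eps_def lookup_single zero_fmon_def plus_fmon_def)

definition tor :: "('i \<Rightarrow> 'k) \<Rightarrow> ('i, 'k::field) fa \<Rightarrow> ('i, 'k) fa" where
  "tor a = FA.ev (\<lambda>i. scl (a i) (gen i))"

lemma tor_simps [simp]: "tor a (x + y) = tor a x + tor a y" "tor a (x - y) = tor a x - tor a y"
  "tor a (- x) = - tor a x" "tor a 0 = 0" "tor a (scl c x) = scl c (tor a x)" "tor a 1 = 1"
  "tor a (gen i) = scl (a i) (gen i)" "tor a (x * y) = tor a x * tor a y"
  by (simp_all add: tor_def)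

lemma eps_tor [simp]: "eps (tor a x) = eps x"
  by (induction x rule: fa_word_induct) auto

lemma tor_tor: "tor a (tor b x) = tor (\<lambda>i. a i * b i) x"
  by (induction x rule: fa_word_induct) (auto simp: mult_ac)

lemma tor_one: "tor (\<lambda>i. 1) x = x"
  by (induction x rule: fa_word_induct) auto

lemma frev_tor: "frev (tor a x) = tor a (frev x)"
  by (induction x rule: fa_word_induct) auto

definition transp :: "('i \<Rightarrow> 'i \<Rightarrow> 'k) \<Rightarrow> 'i \<Rightarrow> 'i \<Rightarrow> 'k" where "transp q = (\<lambda>i j. q j i)"

primrec ldw :: "('i \<Rightarrow> 'i \<Rightarrow> 'k::field) \<Rightarrow> 'i \<Rightarrow> 'i list \<Rightarrow> ('i, 'k) fa" where
  "ldw q j [] = 0"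
| "ldw q j (i # w) = (if i = j then mon (Word w) else 0) + scl (q i j) (gen i * ldw q j w)"

primrec rdw :: "('i \<Rightarrow> 'i \<Rightarrow> 'k::field) \<Rightarrow> 'i \<Rightarrow> 'i list \<Rightarrow> ('i, 'k) fa" where
  "rdw q j [] = 0"
| "rdw q j (i # w) = gen i * rdw q j w + (if i = j then tor (q j) (mon (Word w)) else 0)"

definition ld :: "('i \<Rightarrow> 'i \<Rightarrow> 'k::field) \<Rightarrow> 'i \<Rightarrow> ('i, 'k) fa \<Rightarrow> ('i, 'k) fa" where
  "ld q j = PM.lext (\<lambda>w. ldw q j (letters w))"

definition rd :: "('i \<Rightarrow> 'i \<Rightarrow> 'k::field) \<Rightarrow> 'i \<Rightarrow> ('i, 'k) fa \<Rightarrow> ('i, 'k) fa" where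
  "rd q j = PM.lext (\<lambda>w. rdw q j (letters w))"

lemma ld_linear [simp]: "ld q j (x + y) = ld q j x + ld q j y" "ld q j (x - y) = ld q j x - ld q j y"
  "ld q j (- x) = - ld q j x" "ld q j 0 = 0" "ld q j (scl c x) = scl c (ld q j x)"
  by (simp_all add: ld_def)

lemma rd_linear [simp]: "rd q j (x + y) = rd q j x + rd q j y" "rd q j (x - y) = rd q j x - rd q j y"
  "rd q j (- x) = - rd q j x" "rd q j 0 = 0" "rd q j (scl c x) = scl c (rd q j x)"
  by (simp_all add: rd_def)

lemma ld_one [simp]: "ld q j 1 = 0"
  by (simp add: ld_def flip: single_Word_Nil)

lemma rd_one [simp]: "rd q j 1 = 0"
  by (simp add: rd_def flip: single_Word_Nil)

lemma ld_gen_mult [simp]: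
  "ld q j (gen i * x) = (if i = j then x else 0) + scl (q i j) (gen i * ld q j x)"
proof (induction x rule: fa_induct)
  case (word w)
  show ?case by (simp add: ld_def flip: single_Word_Cons)
next
  case (scl c x)
  then show ?case by (simp add: mult_ac)
qed (auto simp: distrib_left)

lemma rd_gen_mult [simp]:
  "rd q j (gen i * x) = gen i * rd q j x + (if i = j then tor (q j) x else 0)"
proof (induction x rule: fa_induct)
  case (word w)
  show ?case by (simp add: rd_def flip: single_Word_Cons)
qed (auto simp: distrib_left)

lemma ld_mult: "ld q j (x * y) = ld q j x * y + tor (\<lambda>i. q i j) x * ld q j y"
  by (induction x rule: fa_word_induct) (auto simp: distrib_right distrib_left mult.assoc)

lemma rd_mult: "rd q j (x * y) = x * rd q j y + rd q j x * tor (q j) y"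
  by (induction x rule: fa_word_induct) (auto simp: distrib_right distrib_left mult.assoc)

lemma ld_gen [simp]: "ld q j (gen i) = (if i = j then 1 else 0)"
  using ld_gen_mult[of q j i 1] by simp

lemma rd_gen [simp]: "rd q j (gen i) = (if i = j then 1 else 0)"
  using rd_gen_mult[of q j i 1] by simp

lemma ld_tor: "ld q i (tor a x) = scl (a i) (tor a (ld q i x))"
  by (induction x rule: fa_word_induct) (auto simp: mult_ac)

lemma rd_tor: "rd q i (tor a x) = scl (a i) (tor a (rd q i x))"
  by (induction x rule: fa_word_induct) (auto simp: mult_ac tor_tor)

lemma ld_rd_commute: "ld q i (rd q j x) = rd q j (ld q i x)"
  by (induction x rule: fa_word_induct) (auto simp: ld_tor)

lemma eps_rd: "eps (rd q i x) = eps (ld q i x)"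
  by (induction x rule: fa_word_induct) auto

lemma ld_frev: "ld (transp q) i (frev x) = frev (rd q i x)"
  by (induction x rule: fa_word_induct) (auto simp: ld_mult frev_tor transp_def)

definition inv_op :: "('i \<Rightarrow> 'i \<Rightarrow> 'k::field) \<Rightarrow> 'i \<Rightarrow> 'i \<Rightarrow> 'k" where "inv_op q = (\<lambda>i j. inverse (q j i))"

lemma rd_inv_op: "(\<And>j. q i j \<noteq> 0) \<Longrightarrow> rd q i x = tor (q i) (ld (inv_op q) i x)"
  by (induction x rule: fa_word_induct) (auto simp: inv_op_def)

section \<open>The radical\<close>

primrec fw :: "('i \<Rightarrow> 'i \<Rightarrow> 'k::field) \<Rightarrow> 'i list \<Rightarrow> ('i, 'k) fa \<Rightarrow> 'k" where
  "fw q [] x = eps x"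
| "fw q (i # w) x = fw q w (ld q i x)"

lemma fw_linear [simp]: "fw q w (x + y) = fw q w x + fw q w y" "fw q w (x - y) = fw q w x - fw q w y"
  "fw q w (- x) = - fw q w x" "fw q w 0 = 0" "fw q w (scl c x) = c * fw q w x"
  by (induction w arbitrary: x y) auto

lemma fw_sum: "fw q w (sum f B) = (\<Sum>b\<in>B. fw q w (f b))"
  by (induction B rule: infinite_finite_induct) auto

lemma fw_rd: "fw q w (rd q i x) = fw q (w @ [i]) x"
  by (induction w arbitrary: x) (auto simp: eps_rd ld_rd_commute)

lemma fw_tor: "fw q w (tor a x) = prod_list (map a w) * fw q w x"
  by (induction w arbitrary: x) (auto simp: ld_tor)

lemma fw_frev: "fw (transp q) w (frev x) = fw q (rev w) x"
proof (induction w arbitrary: x)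
  case Nil
  have "eps (frev x) = eps x" for x :: "('i,'k::field) fa"
    by (induction x rule: pm_induct) (auto simp: eps_def lookup_add lookup_single zero_fmon_def when_def fmon.expand)
  then show ?case by simp
qed (auto simp: ld_frev fw_rd)

text \<open>Pairing of a functional with left multiplication by a generator: the terms of the shuffle
  (quantum) coproduct.\<close>

primrec dl :: "('i \<Rightarrow> 'i \<Rightarrow> 'k::field) \<Rightarrow> 'i \<Rightarrow> 'i list \<Rightarrow> ('k \<times> 'i list) list" where
  "dl q j [] = []"
| "dl q j (i # u) = (if i = j then [(1, u)] else []) @ map (\<lambda>(c, u'). (q j i * c, i # u')) (dl q j u)"

lemma fw_gen_mult: "fw q u (gen j * x) = (\<Sum>(c, u')\<leftarrow>dl q j u. c * fw q u' x)"
proof (induction u arbitrary: x)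
  case (Cons i u)
  have "(\<Sum>(c, u')\<leftarrow>map (\<lambda>(c, u'). (q j i * c, i # u')) l. c * fw q u' x)
      = q j i * (\<Sum>(c, u')\<leftarrow>l. c * fw q u' (ld q i x))" for l
    by (induction l) (auto simp: algebra_simps)
  then show ?case by (auto simp: Cons.IH)
qed auto

definition radical :: "('i \<Rightarrow> 'i \<Rightarrow> 'k::field) \<Rightarrow> ('i, 'k) fa set" where
  "radical q = {x. \<forall>w. fw q w x = 0}"

lemma radical_closed [simp]:
  "0 \<in> radical q" "x \<in> radical q \<Longrightarrow> y \<in> radical q \<Longrightarrow> x + y \<in> radical q"
  "x \<in> radical q \<Longrightarrow> y \<in> radical q \<Longrightarrow> x - y \<in> radical q"
  "x \<in> radical q \<Longrightarrow> scl c x \<in> radical q"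
  "x \<in> radical q \<Longrightarrow> tor a x \<in> radical q"
  by (auto simp: radical_def fw_tor)

lemma radical_ld: "x \<in> radical q \<Longrightarrow> ld q i x \<in> radical q"
  by (auto simp: radical_def simp flip: fw.simps(2))

lemma radical_rd: "x \<in> radical q \<Longrightarrow> rd q i x \<in> radical q"
  by (auto simp: radical_def fw_rd)

lemma radical_frev: "x \<in> radical q \<Longrightarrow> frev x \<in> radical (transp q)"
  by (auto simp: radical_def fw_frev)

lemma transp_transp [simp]: "transp (transp q) = q"
  by (simp add: transp_def)

lemma radical_gen_left: "x \<in> radical q \<Longrightarrow> gen j * x \<in> radical q"
proof -
  assume x: "x \<in> radical q"
  have "(\<Sum>(c, u')\<leftarrow>l. c * fw q u' x) = 0" for l :: "('b \<times> 'a list) list"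
    using x by (induction l) (auto simp: radical_def)
  then show ?thesis by (simp add: radical_def fw_gen_mult)
qed

lemma radical_left: "x \<in> radical q \<Longrightarrow> y * x \<in> radical q"
  by (induction y rule: fa_word_induct) (auto simp: distrib_right mult.assoc radical_gen_left)

lemma radical_right: "x \<in> radical q \<Longrightarrow> x * y \<in> radical q"
proof -
  assume "x \<in> radical q"
  then have "frev (frev y * frev x) \<in> radical (transp (transp q))"
    by (intro radical_frev radical_left)
  then show ?thesis by simp
qed

lemma subset_radicalI_rd:
  assumes "\<And>x. x \<in> S \<Longrightarrow> eps x = 0" "\<And>x i. x \<in> S \<Longrightarrow> rd q i x \<in> S"
  shows "S \<subseteq> radical q"
proof
  fix x assume x: "x \<in> S"
  have "fw q (rev w) x = 0" for w
    using x by (induction w arbitrary: x) (simp_all add: assms fw_rd[symmetric])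
  then have "fw q (rev (rev w)) x = 0" for w .
  then show "x \<in> radical q" by (simp add: radical_def)
qed

lemma subset_radicalI_ld:
  assumes "\<And>x. x \<in> S \<Longrightarrow> eps x = 0" "\<And>x i. x \<in> S \<Longrightarrow> ld q i x \<in> S"
  shows "S \<subseteq> radical q"
proof
  fix x assume x: "x \<in> S"
  have "fw q w x = 0" for w
    using x by (induction w arbitrary: x) (simp_all add: assms)
  then show "x \<in> radical q" by (simp add: radical_def)
qed

lemma radical_inv_op:
  assumes nz: "\<And>i j. q i j \<noteq> 0"
  shows "radical q \<subseteq> radical (inv_op q)"
proof (rule subset_radicalI_ld)
  fix x assume "x \<in> radical q"
  then have "fw q [] x = 0" unfolding radical_def by blast
  then show "eps x = 0" by simp
next
  fix x i assume x: "x \<in> radical q"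
  have "ld (inv_op q) i x = tor (\<lambda>j. inverse (q i j)) (rd q i x)"
    by (simp add: rd_inv_op nz tor_tor tor_one)
  then show "ld (inv_op q) i x \<in> radical q" using x by (simp add: radical_rd)
qed

lemma eps_ld: "eps (ld q i x) = lookup x (Word [i])"
proof (induction x rule: fa_induct)
  case (word w)
  show ?case
  proof (cases w)
    case (Cons j v)
    then show ?thesis
      by (simp add: single_Word_Cons)
        (auto simp: eps_def gen_mult_single plus_fmon_def lookup_single zero_fmon_def when_def)
  qed (simp add: lookup_single when_def single_Word_Nil lookup_one zero_fmon_def)
qed (auto simp: lookup_add)

lemma radical_degree: "x \<in> radical q \<Longrightarrow> w \<in> keys x \<Longrightarrow> 2 \<le> length (letters w)"
proof (rule ccontr)
  assume x: "x \<in> radical q" "w \<in> keys x" "\<not> 2 \<le> length (letters w)"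
  have f: "fw q w x = 0" for w using x(1) by (simp add: radical_def)
  have "lookup x 0 = 0" "lookup x (Word [i]) = 0" for i
    using f[of "[]"] f[of "[i]"] by (simp add: eps_def, simp add: eps_ld)
  moreover have "w = 0 \<or> (\<exists>i. w = Word [i])"
  proof (cases w)
    case (Word l)
    with x(3) show ?thesis by (cases l; cases "tl l") (auto simp: zero_fmon_def)
  qed
  ultimately show False using x(2) by (auto simp: in_keys_iff)
qed

section \<open>Tensors\<close>

lemma tens_single [simp]: "tens (Poly_Mapping.single u c) (Poly_Mapping.single v d) = Poly_Mapping.single (u, v) (c * d)"
  by (auto simp: tens_def)

lemma tens_superset: "finite B \<Longrightarrow> keys x \<subseteq> B \<Longrightarrow> finite C \<Longrightarrow> keys y \<subseteq> C \<Longrightarrow>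
  tens x y = (\<Sum>u\<in>B. \<Sum>v\<in>C. Poly_Mapping.single (u, v) (lookup x u * lookup y v))"
proof -
  assume a: "finite B" "keys x \<subseteq> B" "finite C" "keys y \<subseteq> C"
  have "tens x y = (\<Sum>u\<in>B. \<Sum>v\<in>keys y. Poly_Mapping.single (u, v) (lookup x u * lookup y v))"
    unfolding tens_def using a by (intro sum.mono_neutral_left) (auto simp: in_keys_iff)
  also have "\<dots> = (\<Sum>u\<in>B. \<Sum>v\<in>C. Poly_Mapping.single (u, v) (lookup x u * lookup y v))"
    using a by (intro sum.cong sum.mono_neutral_left) (auto simp: in_keys_iff)
  finally show ?thesis .
qed

lemma tens_add [simp]: "tens (x + x') y = tens x y + tens x' y" "tens x (y + y') = tens x y + tens x y'"
proof -
  let ?B = "keys x \<union> keys x'" and ?C = "keys y \<union> keys y'"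
  have k: "keys (x + x') \<subseteq> ?B" "keys (y + y') \<subseteq> ?C" by (auto simp: Poly_Mapping.keys_add)
  show "tens (x + x') y = tens x y + tens x' y"
    using k by (subst (1 2 3) tens_superset[of ?B _ "keys y"])
      (auto simp: lookup_add distrib_right single_add sum.distrib)
  show "tens x (y + y') = tens x y + tens x y'"
    using k by (subst (1 2 3) tens_superset[of "keys x" _ ?C])
      (auto simp: lookup_add distrib_left single_add sum.distrib)
qed

lemma tens_zero [simp]: "tens 0 y = 0" "tens x 0 = 0"
  by (auto simp: tens_def)

lemma bilinear_eqI:
  fixes f g :: "('a \<Rightarrow>\<^sub>0 'k::field) \<Rightarrow> ('b \<Rightarrow>\<^sub>0 'k) \<Rightarrow> 'c::ab_group_add"
  assumes f: "\<And>x x' y. f (x + x') y = f x y + f x' y" "\<And>x y y'. f x (y + y') = f x y + f x y'"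
    and g: "\<And>x x' y. g (x + x') y = g x y + g x' y" "\<And>x y y'. g x (y + y') = g x y + g x y'"
    and s: "\<And>a b c d. f (Poly_Mapping.single a c) (Poly_Mapping.single b d) = g (Poly_Mapping.single a c) (Poly_Mapping.single b d)"
  shows "f x y = g x y"
proof -
  have 0: "f 0 y = 0" "f x 0 = 0" "g 0 y = 0" "g x 0 = 0" for x y
    using f(1)[of 0 0 y] f(2)[of x 0 0] g(1)[of 0 0 y] g(2)[of x 0 0] by simp_all
  have "f (Poly_Mapping.single a c) y = g (Poly_Mapping.single a c) y" for a c y
    by (induction y rule: pm_induct) (auto simp: 0 f g s)
  then show ?thesis
    by (induction x rule: pm_induct) (auto simp: 0 f g)
qed

lemma tens_scl [simp]: "tens (scl c x) y = scl c (tens x y)" "tens x (scl c y) = scl c (tens x y)"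
  by (rule bilinear_eqI[of "\<lambda>x y. tens (scl c x) y" "\<lambda>x y. scl c (tens x y)"]; simp add: mult_ac)
    (rule bilinear_eqI[of "\<lambda>x y. tens x (scl c y)" "\<lambda>x y. scl c (tens x y)"]; simp add: mult_ac)

lemma tens_diff: "tens (x - x') y = tens x y - tens x' y" "tens x (y - y') = tens x y - tens x y'"
  using tens_add(1)[of "x - x'" x' y] tens_add(2)[of x "y - y'" y'] by (simp_all add: eq_diff_eq)

lemma tens_induct [case_names tens add]:
  assumes "\<And>x y. P (tens x y)" "\<And>s t. P s \<Longrightarrow> P t \<Longrightarrow> P (s + t)"
  shows "P t"
proof (induction t rule: pm_induct)
  case zero show ?case using assms(1)[of 0 0] by simp
next
  case (single b c) show ?case using assms(1)[of "Poly_Mapping.single (fst b) c" "mon (snd b)"] by simp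
qed (use assms in auto)

lemma scl_eq_const: "c = d \<Longrightarrow> scl c x = scl d x" by simp

interpretation VS: vector_space "scl :: 'k::field \<Rightarrow> ('b \<Rightarrow>\<^sub>0 'k) \<Rightarrow> ('b \<Rightarrow>\<^sub>0 'k)"
  by standard auto

interpretation VSP: vector_space_pair "scl :: 'k::field \<Rightarrow> ('b \<Rightarrow>\<^sub>0 'k) \<Rightarrow> ('b \<Rightarrow>\<^sub>0 'k)"
   "scl :: 'k::field \<Rightarrow> ('b \<Rightarrow>\<^sub>0 'k) \<Rightarrow> ('b \<Rightarrow>\<^sub>0 'k)"
  by unfold_locales

text \<open>Every subspace is the kernel of a linear projection.\<close>

lemma projection_exists:
  fixes N :: "('b \<Rightarrow>\<^sub>0 'k::field) set"
  assumes N: "0 \<in> N" "\<And>x y. x \<in> N \<Longrightarrow> y \<in> N \<Longrightarrow> x + y \<in> N" "\<And>c x. x \<in> N \<Longrightarrow> scl c x \<in> N"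
  obtains \<pi> :: "('b \<Rightarrow>\<^sub>0 'k) \<Rightarrow> ('b \<Rightarrow>\<^sub>0 'k)"
    where "\<And>x y. \<pi> (x + y) = \<pi> x + \<pi> y" "\<And>c x. \<pi> (scl c x) = scl c (\<pi> x)"
      "\<And>x. x \<in> N \<Longrightarrow> \<pi> x = 0" "\<And>x. x - \<pi> x \<in> N"
proof -
  have sN: "VS.subspace N" by (rule VS.subspaceI) (use N in auto)
  obtain B where B: "B \<subseteq> N" "VS.independent B" "N \<subseteq> VS.span B"
    by (rule VS.maximal_independent_subset)
  define C where "C = VS.extend_basis B"
  have C: "B \<subseteq> C" "VS.independent C" "VS.span C = UNIV"
    unfolding C_def using B(2) VS.extend_basis_superset VS.independent_extend_basis VS.span_extend_basis by auto
  obtain \<pi> where pi: "Vector_Spaces.linear scl scl \<pi>" "\<And>x. x \<in> C \<Longrightarrow> \<pi> x = (if x \<in> B then 0 else x)"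
    using VSP.linear_independent_extend[OF C(2), of "\<lambda>x. if x \<in> B then 0 else x"] by auto
  interpret L: Vector_Spaces.linear scl scl \<pi> by (rule pi(1))
  show thesis
  proof (rule that)
    show "\<pi> (x + y) = \<pi> x + \<pi> y" "\<pi> (scl c x) = scl c (\<pi> x)" for x y c
      by (auto simp: L.add L.scale)
    show "\<pi> x = 0" if "x \<in> N" for x
    proof -
      have "x \<in> VS.span B" using that B by auto
      then show ?thesis
        by (induction rule: VS.span_induct_alt) (use pi(2) C(1) in \<open>auto simp: L.add L.scale\<close>)
    qed
    show "x - \<pi> x \<in> N" for x
    proof -
      have "x \<in> VS.span C" using C by auto
      then show ?thesis
      proof (induction rule: VS.span_induct_alt)
        case base then show ?case using N by simp
      next
        case (step c x y)
        have "x - \<pi> x \<in> N" using step pi(2) B(1) N(1) by auto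
        then have "scl c (x - \<pi> x) + (y - \<pi> y) \<in> N" using step N by blast
        moreover have "scl c (x - \<pi> x) + (y - \<pi> y) = scl c x + y - \<pi> (scl c x + y)"
          by (simp add: L.add L.scale add_diff_add)
        ultimately show ?case by metis
      qed
    qed
  qed
qed

text \<open>The tensors annihilated by all products of functionals from two families.\<close>

definition ten2 :: "(('a \<Rightarrow>\<^sub>0 'k::field) \<Rightarrow> 'k) \<Rightarrow> (('b \<Rightarrow>\<^sub>0 'k) \<Rightarrow> 'k) \<Rightarrow> ('a \<times> 'b \<Rightarrow>\<^sub>0 'k) \<Rightarrow> 'k" where
  "ten2 f g = kext (\<lambda>(a, b). f (mon a) * g (mon b))"

lemma ten2_add [simp]: "ten2 f g (s + t) = ten2 f g s + ten2 f g t" by (simp add: ten2_def)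

lemma lin_fun_single:
  assumes "\<And>c x. f (scl c x) = c * f x" shows "f (Poly_Mapping.single b c) = c * f (mon b)"
  using assms[of c "mon b"] by simp

lemma ten2_tens:
  assumes f: "\<And>x y. f (x + y) = f x + f y" "\<And>c x. f (scl c x) = c * f x"
    and g: "\<And>x y. g (x + y) = g x + g y" "\<And>c x. g (scl c x) = c * g x"
  shows "ten2 f g (tens x y) = f x * g y"
proof -
  show ?thesis
  proof (rule bilinear_eqI[of "\<lambda>x y. ten2 f g (tens x y)" "\<lambda>x y. f x * g y"])
    fix a b c d
    show "ten2 f g (tens (Poly_Mapping.single a c) (Poly_Mapping.single b d))
        = f (Poly_Mapping.single a c) * g (Poly_Mapping.single b d)"
      using lin_fun_single[of f a c, OF f(2)] lin_fun_single[of g b d, OF g(2)]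
      by (simp add: ten2_def mult_ac)
  qed (simp_all add: f(1) g(1) algebra_simps)
qed

lemma tensor_annihilator:
  fixes t :: "'a fmon \<times> 'a fmon \<Rightarrow>\<^sub>0 'k::field"
  assumes F: "\<And>f x y. f \<in> F \<Longrightarrow> f (x + y) = f x + f y" "\<And>f c x. f \<in> F \<Longrightarrow> f (scl c x) = c * f x"
    and G: "\<And>g x y. g \<in> G \<Longrightarrow> g (x + y) = g x + g y" "\<And>g c x. g \<in> G \<Longrightarrow> g (scl c x) = c * g x"
    and N: "N = {x. \<forall>f\<in>F. f x = 0}" and M: "M = {x. \<forall>g\<in>G. g x = 0}"
    and t: "\<And>f g. f \<in> F \<Longrightarrow> g \<in> G \<Longrightarrow> ten2 f g t = 0"
    and P: "P 0" "\<And>s t. P s \<Longrightarrow> P t \<Longrightarrow> P (s + t)" "\<And>x y. x \<in> N \<or> y \<in> M \<Longrightarrow> P (tens x y)"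
  shows "P t"
proof -
  have F0: "f 0 = 0" if "f \<in> F" for f using F(2)[OF that, of 0 0] by simp
  have G0: "g 0 = 0" if "g \<in> G" for g using G(2)[OF that, of 0 0] by simp
  have Fm: "f (x - y) = f x - f y" if "f \<in> F" for f x y using F(1)[OF that, of "x - y" y] by simp
  have Gm: "g (x - y) = g x - g y" if "g \<in> G" for g x y using G(1)[OF that, of "x - y" y] by simp
  obtain \<pi> where pi: "\<And>x y. \<pi> (x + y) = \<pi> x + \<pi> y" "\<And>c x. \<pi> (scl c x) = scl c (\<pi> x)"
      "\<And>x. x \<in> N \<Longrightarrow> \<pi> x = 0" "\<And>x. x - \<pi> x \<in> N"
    by (rule projection_exists[of N]) (auto simp: N F F0)
  obtain \<rho> where rho: "\<And>x y. \<rho> (x + y) = \<rho> x + \<rho> y" "\<And>c x. \<rho> (scl c x) = scl c (\<rho> x)"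
      "\<And>x. x \<in> M \<Longrightarrow> \<rho> x = 0" "\<And>x. x - \<rho> x \<in> M"
    by (rule projection_exists[of M]) (auto simp: M G G0)
  have pipi: "\<pi> (\<pi> x) = \<pi> x" for x
  proof -
    have "\<pi> (x - \<pi> x) = 0" using pi by blast
    moreover have "\<pi> x = \<pi> (x - \<pi> x) + \<pi> (\<pi> x)" using pi(1)[of "x - \<pi> x" "\<pi> x"] by simp
    ultimately show ?thesis by simp
  qed
  have rhorho: "\<rho> (\<rho> x) = \<rho> x" for x
  proof -
    have "\<rho> (x - \<rho> x) = 0" using rho by blast
    moreover have "\<rho> x = \<rho> (x - \<rho> x) + \<rho> (\<rho> x)" using rho(1)[of "x - \<rho> x" "\<rho> x"] by simp
    ultimately show ?thesis by simp
  qed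
  have fpi: "f (\<pi> x) = f x" if "f \<in> F" for f x
    using pi(4)[of x] that by (auto simp: N Fm)
  have grho: "g (\<rho> x) = g x" if "g \<in> G" for g x
    using rho(4)[of x] that by (auto simp: M Gm)
  define Q where "Q = PM.lext (\<lambda>(a, b). tens (\<pi> (mon a)) (\<rho> (mon b)))"
  have pis: "\<pi> (Poly_Mapping.single b c) = scl c (\<pi> (mon b))" "\<rho> (Poly_Mapping.single b c) = scl c (\<rho> (mon b))" for b c
    using pi(2)[of c "mon b"] rho(2)[of c "mon b"] by auto
  have Qt: "Q (tens x y) = tens (\<pi> x) (\<rho> y)" for x y
  proof (rule bilinear_eqI[of "\<lambda>x y. Q (tens x y)" "\<lambda>x y. tens (\<pi> x) (\<rho> y)"])
    fix a b c d
    show "Q (tens (Poly_Mapping.single a c) (Poly_Mapping.single b d))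
        = tens (\<pi> (Poly_Mapping.single a c)) (\<rho> (Poly_Mapping.single b d))"
      using pis(1)[of a c] pis(2)[of b d] by (simp add: Q_def)
  qed (simp_all add: Q_def pi(1) rho(1))
  have Qadd: "Q (s + t) = Q s + Q t" for s t by (simp add: Q_def)
  have diff: "P (t - Q t)" for t
  proof (induction t rule: tens_induct)
    case (tens x y)
    have "tens x y - Q (tens x y) = tens (x - \<pi> x) y + tens (\<pi> x) (y - \<rho> y)"
      by (simp add: Qt tens_diff)
    then show ?case using P(2)[OF P(3) P(3)] pi(4) rho(4) by presburger
  next
    case (add s t)
    then show ?case using P(2)[OF add] by (simp add: Qadd add_diff_add)
  qed
  \<comment> \<open>It remains to see that the projected tensor vanishes; it is killed by all products of functionals,
    which separate the points of the complements.\<close>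
  define t' where "t' = Q t"
  define R where "R g = PM.lext (\<lambda>(a::'a fmon, b::'a fmon). scl (g (mon b)) (mon a))" for g :: "('a fmon \<Rightarrow>\<^sub>0 'k) \<Rightarrow> 'k"
  have Radd: "R g (s + t) = R g s + R g t" for g s t by (simp add: R_def)
  have gs: "g (Poly_Mapping.single b c) = c * g (mon b)" if "g \<in> G" for g b c
    using G(2)[OF that, of c "mon b"] by simp
  have Rt: "R g (tens x y) = scl (g y) x" if "g \<in> G" for g x y
  proof (rule bilinear_eqI[of "\<lambda>x y. R g (tens x y)" "\<lambda>x y. scl (g y) x"])
    fix a b c d
    show "R g (tens (Poly_Mapping.single a c) (Poly_Mapping.single b d))
        = scl (g (Poly_Mapping.single b d)) (Poly_Mapping.single a c)"
      using gs[OF that, of b d] by (simp add: R_def mult_ac)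
  qed (simp_all add: R_def G(1)[OF that])
  have R0: "R g t' = 0" if g: "g \<in> G" for g
  proof -
    have pR: "\<pi> (R g (Q s)) = R g (Q s)" for s
      by (induction s rule: tens_induct) (auto simp: Qt Rt[OF g] pi pipi Qadd Radd)
    have fR: "f (R g (Q s)) = ten2 f g s" if f: "f \<in> F" for f s
    proof (induction s rule: tens_induct)
      case (tens x y)
      have "ten2 f g (tens x y) = f x * g y" by (rule ten2_tens) (use F G f g in auto)
      then show ?case by (simp add: Qt Rt[OF g] F(2)[OF f] fpi[OF f] grho[OF g])
    qed (auto simp: Qadd Radd F(1)[OF f])
    have "f (R g t') = 0" if f: "f \<in> F" for f
      using fR[OF f, of t] t[OF f g] by (simp add: t'_def)
    then have "\<pi> (R g t') = 0" using pi(3) by (simp add: N)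
    then show ?thesis using pR[of t] by (simp add: t'_def)
  qed
  define C where "C a0 = PM.lext (\<lambda>(a::'a fmon, b::'a fmon). if a = a0 then (mon b :: 'a fmon \<Rightarrow>\<^sub>0 'k) else 0)" for a0
  have Cadd: "C a0 (s + t) = C a0 s + C a0 t" for a0 s t by (simp add: C_def)
  have Ct: "C a0 (tens x y) = scl (lookup x a0) y" for a0 x y
    by (rule bilinear_eqI[of "\<lambda>x y. C a0 (tens x y)" "\<lambda>x y. scl (lookup x a0) y"])
      (auto simp: C_def lookup_add lookup_single when_def)
  have C0: "C a0 t' = 0" for a0
  proof -
    have rC: "\<rho> (C a0 (Q s)) = C a0 (Q s)" for s
      by (induction s rule: tens_induct) (auto simp: Qt Ct rho rhorho Qadd Cadd)
    have gC: "g (C a0 s) = lookup (R g s) a0" if g: "g \<in> G" for g s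
      by (induction s rule: tens_induct) (auto simp: Ct Rt[OF g] Cadd Radd G(1)[OF g] G(2)[OF g] lookup_add)
    have "g (C a0 t') = 0" if g: "g \<in> G" for g
      using gC[OF g, of t'] R0[OF g] by simp
    then have "\<rho> (C a0 t') = 0" using rho(3) by (simp add: M)
    then show ?thesis using rC[of t] by (simp add: t'_def)
  qed
  have lC: "lookup s (a, b) = lookup (C a s) b" for s a b
    by (induction s rule: pm_induct) (auto simp: Cadd lookup_add C_def lookup_single when_def split: if_splits)
  have "t' = 0"
  proof (rule poly_mapping_eqI)
    fix w
    show "lookup t' w = lookup 0 w" using lC[of t' "fst w" "snd w"] by (simp add: C0)
  qed
  then show ?thesis using diff[of t] by (simp add: t'_def)
qed

section \<open>Bicharacters\<close>

abbreviation al :: "'i \<Rightarrow> ('i \<Rightarrow>\<^sub>0 int)" where "al \<equiv> frag_of"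

lemma bichar_add:
  assumes "bicharacter \<chi>"
  shows "\<chi> (a + b) c = \<chi> a c * \<chi> b c" "\<chi> a (b + c) = \<chi> a b * \<chi> a c" "\<chi> a b \<noteq> 0"
  using assms by (auto simp: bicharacter_def)

lemma bichar_zero:
  assumes "bicharacter \<chi>"
  shows "\<chi> 0 c = 1" "\<chi> c 0 = 1"
proof -
  have "\<chi> 0 c * \<chi> 0 c = \<chi> 0 c * 1" "\<chi> c 0 * \<chi> c 0 = \<chi> c 0 * 1"
    using bichar_add(1)[OF assms, of 0 0 c] bichar_add(2)[OF assms, of c 0 0] by simp_all
  then show "\<chi> 0 c = 1" "\<chi> c 0 = 1" using bichar_add(3)[OF assms] by (metis mult_left_cancel)+
qed

lemma bichar_uminus:
  assumes "bicharacter \<chi>"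
  shows "\<chi> (- a) b = inverse (\<chi> a b)" "\<chi> a (- b) = inverse (\<chi> a b)"
proof -
  have "\<chi> a b * \<chi> (-a) b = 1" "\<chi> a b * \<chi> a (-b) = 1"
    using bichar_add(1)[OF assms, of a "-a" b] bichar_add(2)[OF assms, of a b "-b"] by (simp_all add: bichar_zero assms)
  then show "\<chi> (- a) b = inverse (\<chi> a b)" "\<chi> a (- b) = inverse (\<chi> a b)" by (metis inverse_unique)+
qed

lemma bichar_diff:
  assumes "bicharacter \<chi>"
  shows "\<chi> (a - b) c = \<chi> a c / \<chi> b c" "\<chi> a (b - c) = \<chi> a b / \<chi> a c"
  using bichar_add(1)[OF assms, of a "-b" c] bichar_add(2)[OF assms, of a b "-c"]
  by (simp_all add: bichar_uminus assms field_simps)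

lemma bichar_cmul_nat:
  assumes "bicharacter \<chi>"
  shows "\<chi> (frag_cmul (int n) a) b = \<chi> a b ^ n" "\<chi> a (frag_cmul (int n) b) = \<chi> a b ^ n"
  by (induction n) (auto simp: bichar_zero assms frag_cmul_distrib bichar_add mult_ac)

lemmas bichar_simps = bichar_add bichar_zero bichar_uminus bichar_diff bichar_cmul_nat

lemma bichar_op [simp]: "bicharacter \<chi> \<Longrightarrow> bicharacter (bichar_op \<chi>)"
  by (auto simp: bicharacter_def bichar_op_def)

lemma bichar_inv [simp]: "bicharacter \<chi> \<Longrightarrow> bicharacter (bichar_inv \<chi>)"
  by (auto simp: bicharacter_def bichar_inv_def)

lemma qm_op [simp]: "qm (bichar_op \<chi>) = transp (qm \<chi>)"
  by (simp add: qm_def bichar_op_def transp_def fun_eq_iff)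

lemma qm_nonzero: "bicharacter \<chi> \<Longrightarrow> qm \<chi> i j \<noteq> 0"
  by (simp add: qm_def bichar_add)

lemma wdeg_simps [simp]: "wdeg (u + v) = wdeg u + wdeg v" "wdeg 0 = 0" "wdeg (Word [i]) = al i"
  by (auto simp: wdeg_def plus_fmon_def zero_fmon_def)

lemma wdeg_Cons: "wdeg (Word (i # w)) = al i + wdeg (Word w)"
  by (simp add: wdeg_def)

lemma tor_mon:
  assumes "\<And>a b. \<phi> (a + b) = \<phi> a * (\<phi> b :: 'k::field)" "\<phi> 0 = 1"
  shows "tor (\<lambda>i. \<phi> (al i)) (Poly_Mapping.single w c) = Poly_Mapping.single w (\<phi> (wdeg w) * c)"
proof -
  have "tor (\<lambda>i. \<phi> (al i)) (mon (Word l)) = Poly_Mapping.single (Word l) (\<phi> (wdeg (Word l)))" for l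
  proof (induction l)
    case Nil
    show ?case by (simp add: single_Word_Nil wdeg_def assms)
  next
    case (Cons i l)
    have "tor (\<lambda>i. \<phi> (al i)) (mon (Word (i # l))) = scl (\<phi> (al i)) (gen i * tor (\<lambda>i. \<phi> (al i)) (mon (Word l)))"
      by (simp only: single_Word_Cons tor_simps scl_mult_fa)
    also have "\<dots> = Poly_Mapping.single (Word (i # l)) (\<phi> (wdeg (Word (i # l))))"
      by (simp add: Cons gen_mult_single plus_fmon_def wdeg_Cons assms)
    finally show ?case .
  qed
  then have "tor (\<lambda>i. \<phi> (al i)) (mon w) = Poly_Mapping.single w (\<phi> (wdeg w))" by (cases w) auto
  then have "tor (\<lambda>i. \<phi> (al i)) (scl c (mon w)) = scl c (Poly_Mapping.single w (\<phi> (wdeg w)))"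
    by (simp only: tor_simps)
  then show ?thesis by (simp add: mult.commute)
qed

lemma tor_qm:
  assumes "bicharacter \<chi>"
  shows "tor (qm \<chi> k) (Poly_Mapping.single w c) = Poly_Mapping.single w (\<chi> (al k) (wdeg w) * c)"
  using tor_mon[of "\<chi> (al k)"] assms by (simp add: bichar_simps qm_def[abs_def])

lemma tens_one_one: "tens 1 1 = mon (0, 0)"
  by (simp flip: single_one)

section \<open>The braided coproduct\<close>

abbreviation bt :: "('i, 'k::field) bichar \<Rightarrow> _" where "bt \<chi> \<equiv> mult (braided_tensor_alg \<chi>)"

lemma bt_superset: "finite B \<Longrightarrow> keys s \<subseteq> B \<Longrightarrow> finite C \<Longrightarrow> keys t \<subseteq> C \<Longrightarrow>
  bt \<chi> s t = (\<Sum>u\<in>B. \<Sum>v\<in>C. Poly_Mapping.single (fst u + fst v, snd u + snd v)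
     (lookup s u * lookup t v * \<chi> (wdeg (snd u)) (wdeg (fst v))))"
proof -
  assume a: "finite B" "keys s \<subseteq> B" "finite C" "keys t \<subseteq> C"
  have "bt \<chi> s t = (\<Sum>u\<in>keys s. \<Sum>v\<in>keys t. Poly_Mapping.single (fst u + fst v, snd u + snd v)
     (lookup s u * lookup t v * \<chi> (wdeg (snd u)) (wdeg (fst v))))"
    by (simp add: braided_tensor_alg_def split_beta)
  also have "\<dots> = (\<Sum>u\<in>B. \<Sum>v\<in>keys t. Poly_Mapping.single (fst u + fst v, snd u + snd v)
     (lookup s u * lookup t v * \<chi> (wdeg (snd u)) (wdeg (fst v))))"
    using a by (intro sum.mono_neutral_left) (auto simp: in_keys_iff)
  also have "\<dots> = (\<Sum>u\<in>B. \<Sum>v\<in>C. Poly_Mapping.single (fst u + fst v, snd u + snd v)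
     (lookup s u * lookup t v * \<chi> (wdeg (snd u)) (wdeg (fst v))))"
    using a by (intro sum.cong sum.mono_neutral_left) (auto simp: in_keys_iff)
  finally show ?thesis .
qed

lemma bt_add [simp]: "bt \<chi> (s + s') t = bt \<chi> s t + bt \<chi> s' t" "bt \<chi> s (t + t') = bt \<chi> s t + bt \<chi> s t'"
proof -
  let ?B = "keys s \<union> keys s'" and ?C = "keys t \<union> keys t'"
  have k: "keys (s + s') \<subseteq> ?B" "keys (t + t') \<subseteq> ?C" by (auto simp: Poly_Mapping.keys_add)
  show "bt \<chi> (s + s') t = bt \<chi> s t + bt \<chi> s' t"
    using k by (subst (1 2 3) bt_superset[of ?B _ "keys t"])
      (auto simp: lookup_add distrib_right single_add sum.distrib)
  show "bt \<chi> s (t + t') = bt \<chi> s t + bt \<chi> s t'"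
    using k by (subst (1 2 3) bt_superset[of "keys s" _ ?C])
      (auto simp: lookup_add distrib_left distrib_right single_add sum.distrib)
qed

lemma bt_single [simp]: "bt \<chi> (Poly_Mapping.single (x, y) c) (Poly_Mapping.single (x', y') d) =
    Poly_Mapping.single (x + x', y + y') (c * d * \<chi> (wdeg y) (wdeg x'))"
  by (subst bt_superset[of "{(x, y)}" _ "{(x', y')}"]) auto

lemma bt_zero [simp]: "bt \<chi> 0 t = 0" "bt \<chi> s 0 = 0"
  using bt_add(1)[of \<chi> 0 0 t] bt_add(2)[of \<chi> s 0 0] by simp_all

definition lop :: "('i, 'k::field) bichar \<Rightarrow> 'i \<Rightarrow> ('i fmon \<times> 'i fmon \<Rightarrow>\<^sub>0 'k) \<Rightarrow> ('i fmon \<times> 'i fmon \<Rightarrow>\<^sub>0 'k)" where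
  "lop \<chi> i = PM.lext (\<lambda>(u, v). Poly_Mapping.single (Word [i] + u, v) 1
      + Poly_Mapping.single (u, Word [i] + v) (\<chi> (al i) (wdeg u)))"

lemma lop_linear [simp]: "lop \<chi> i (s + t) = lop \<chi> i s + lop \<chi> i t" "lop \<chi> i (scl c t) = scl c (lop \<chi> i t)"
  "lop \<chi> i 0 = 0"
  by (simp_all add: lop_def)

definition cop :: "('i, 'k::field) bichar \<Rightarrow> ('i, 'k) fa \<Rightarrow> ('i fmon \<times> 'i fmon \<Rightarrow>\<^sub>0 'k)" where
  "cop \<chi> = PM.lext (\<lambda>w. foldr (lop \<chi>) (letters w) (mon (0, 0)))"

lemma cop_linear [simp]: "cop \<chi> (x + y) = cop \<chi> x + cop \<chi> y" "cop \<chi> (scl c x) = scl c (cop \<chi> x)" "cop \<chi> 0 = 0"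
  by (simp_all add: cop_def)

lemma cop_one [simp]: "cop \<chi> 1 = mon (0, 0)"
  by (simp add: cop_def flip: single_Word_Nil)

lemma cop_gen_mult [simp]: "cop \<chi> (gen i * x) = lop \<chi> i (cop \<chi> x)"
proof (induction x rule: fa_induct)
  case (word w)
  show ?case by (simp add: cop_def flip: single_Word_Cons)
qed (auto simp: distrib_left)

context
  fixes \<chi> :: "('i, 'k::field) bichar"
  assumes bich: "bicharacter \<chi>"
begin

lemma lop_tens: "lop \<chi> i (tens x y) = tens (gen i * x) y + tens (tor (qm \<chi> i) x) (gen i * y)"
  by (rule bilinear_eqI[of "\<lambda>x y. lop \<chi> i (tens x y)" "\<lambda>x y. tens (gen i * x) y + tens (tor (qm \<chi> i) x) (gen i * y)"])
    (simp_all add: distrib_left lop_def gen_mult_single tor_qm[OF bich] mult_ac)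

lemma lop_bt: "lop \<chi> i (bt \<chi> s t) = bt \<chi> (lop \<chi> i s) t"
proof (rule bilinear_eqI[of "\<lambda>s t. lop \<chi> i (bt \<chi> s t)" "\<lambda>s t. bt \<chi> (lop \<chi> i s) t"])
  fix a b :: "'i fmon \<times> 'i fmon" and c d :: 'k
  show "lop \<chi> i (bt \<chi> (Poly_Mapping.single a c) (Poly_Mapping.single b d))
      = bt \<chi> (lop \<chi> i (Poly_Mapping.single a c)) (Poly_Mapping.single b d)"
    by (cases a; cases b) (simp add: lop_def bichar_simps[OF bich] add.assoc mult_ac)
qed simp_all

lemma bt_one: "bt \<chi> (mon (0, 0)) t = t"
  by (induction t rule: pm_induct) (auto simp: bichar_simps[OF bich])

lemma cop_mult: "cop \<chi> (x * y) = bt \<chi> (cop \<chi> x) (cop \<chi> y)"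
proof (induction x rule: fa_word_induct)
  case (4 c x)
  have "bt \<chi> (scl c s) t = scl c (bt \<chi> s t)" for s t
  proof (rule bilinear_eqI[of "\<lambda>s t. bt \<chi> (scl c s) t" "\<lambda>s t. scl c (bt \<chi> s t)"])
    fix a b :: "'i fmon \<times> 'i fmon" and d e :: 'k
    show "bt \<chi> (scl c (Poly_Mapping.single a d)) (Poly_Mapping.single b e)
      = scl c (bt \<chi> (Poly_Mapping.single a d) (Poly_Mapping.single b e))"
      by (cases a; cases b) (simp add: mult_ac)
  qed simp_all
  then show ?case using 4 by simp
qed (auto simp: distrib_right mult.assoc lop_bt bt_one)

lemma cop_eq: "braided_coproduct \<chi> = cop \<chi>"
  unfolding braided_coproduct_def
proof (rule the_equality)
  have one: "\<one>\<^bsub>braided_tensor_alg \<chi>\<^esub> = mon (0, 0)"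
    by (simp add: braided_tensor_alg_def flip: single_one)
  have gen: "cop \<chi> (gen i) = tens (gen i) 1 + tens 1 (gen i)" for i
  proof -
    have "cop \<chi> (gen i) = lop \<chi> i (mon (0, 0))" using cop_gen_mult[of \<chi> i 1] by simp
    also have "\<dots> = tens (gen i) 1 + tens 1 (gen i)"
      by (simp add: lop_tens flip: tens_one_one)
    finally show ?thesis .
  qed
  show "cop \<chi> \<in> alg_hom free_alg (braided_tensor_alg \<chi>) \<and> (\<forall>i. cop \<chi> (gen i) = tens (gen i) 1 + tens 1 (gen i))"
    unfolding alg_hom_def ring_hom_def
    using one gen by (auto simp: free_alg_def cop_mult, auto simp: braided_tensor_alg_def simp flip: scl_def)
  fix D assume D: "D \<in> alg_hom free_alg (braided_tensor_alg \<chi>) \<and> (\<forall>i. D (gen i) = tens (gen i) 1 + tens 1 (gen i))"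
  then have h: "D (x * y) = bt \<chi> (D x) (D y)" "D (x + y) = D x + D y" "D 1 = mon (0, 0)" "D (scl c x) = scl c (D x)" for x y c
    using one unfolding alg_hom_def ring_hom_def
    by (auto simp: free_alg_def, auto simp: braided_tensor_alg_def scl_def)
  have g: "D (gen i) = cop \<chi> (gen i)" for i using D gen by simp
  have "D x = cop \<chi> x" for x
    by (induction x rule: fa_word_induct) (simp_all add: h g flip: cop_mult)
  then show "D = cop \<chi>" by auto
qed

text \<open>Deriving in the first tensor factor; the coproduct intertwines it with the derivation.\<close>

definition ldt :: "'i \<Rightarrow> ('i fmon \<times> 'i fmon \<Rightarrow>\<^sub>0 'k) \<Rightarrow> ('i fmon \<times> 'i fmon \<Rightarrow>\<^sub>0 'k)" where
  "ldt i = PM.lext (\<lambda>(u, v). tens (ld (qm \<chi>) i (mon u)) (mon v))"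

definition epst :: "('i fmon \<times> 'i fmon \<Rightarrow>\<^sub>0 'k) \<Rightarrow> ('i, 'k) fa" where
  "epst = PM.lext (\<lambda>(u, v). scl (eps (mon u)) (mon v))"

lemma ldt_add [simp]: "ldt i (s + t) = ldt i s + ldt i t" "ldt i 0 = 0" "ldt i (scl c s) = scl c (ldt i s)"
  by (simp_all add: ldt_def)

lemma epst_add [simp]: "epst (s + t) = epst s + epst t" "epst 0 = 0" "epst (scl c s) = scl c (epst s)"
  by (simp_all add: epst_def)

lemma single_scl: "Poly_Mapping.single b c = scl c (mon b)" for c :: "'c::field" by simp

lemma ldt_tens [simp]: "ldt i (tens x y) = tens (ld (qm \<chi>) i x) y"
proof (rule bilinear_eqI[of "\<lambda>x y. ldt i (tens x y)" "\<lambda>x y. tens (ld (qm \<chi>) i x) y"])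
  fix a b :: "'i fmon" and c d :: 'k
  have "tens (ld (qm \<chi>) i (scl c (mon a))) (scl d (mon b)) = scl (c * d) (tens (ld (qm \<chi>) i (mon a)) (mon b))"
    by (simp only: ld_linear tens_scl) (simp only: scl_laws(3) mult.commute[of d c])
  then show "ldt i (tens (Poly_Mapping.single a c) (Poly_Mapping.single b d))
     = tens (ld (qm \<chi>) i (Poly_Mapping.single a c)) (Poly_Mapping.single b d)"
    by (simp add: ldt_def)
qed simp_all

lemma epst_tens [simp]: "epst (tens x y) = scl (eps x) y"
proof (rule bilinear_eqI[of "\<lambda>x y. epst (tens x y)" "\<lambda>x y. scl (eps x) y"])
  fix a b :: "'i fmon" and c d :: 'k
  have "scl (eps (scl c (mon a))) (scl d (mon b)) = scl (c * d) (scl (eps (mon a)) (mon b))"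
    by (simp only: eps_simps) (simp del: scl_laws(11) add: mult_ac)
  then show "epst (tens (Poly_Mapping.single a c) (Poly_Mapping.single b d))
     = scl (eps (Poly_Mapping.single a c)) (Poly_Mapping.single b d)"
    by (simp add: epst_def)
qed simp_all

lemma ldt_lop: "ldt i (lop \<chi> k t) = (if k = i then t else 0) + scl (qm \<chi> k i) (lop \<chi> k (ldt i t))"
proof (induction t rule: tens_induct)
  case (tens x y)
  show ?case by (simp add: lop_tens ld_tor)
qed auto

lemma ldt_cop: "ldt i (cop \<chi> x) = cop \<chi> (ld (qm \<chi>) i x)"
proof (induction x rule: fa_word_induct)
  case 1
  have "ldt i (tens 1 1) = 0" by (simp only: ldt_tens ld_one tens_zero)
  then show ?case by (simp add: tens_one_one)
qed (auto simp: ldt_lop)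

lemma epst_cop: "epst (cop \<chi> x) = x"
proof (induction x rule: fa_word_induct)
  case 1
  have "epst (tens 1 1) = 1" by (simp only: epst_tens eps_simps scl_laws)
  then show ?case by (simp add: tens_one_one)
next
  case (2 i x)
  have "epst (lop \<chi> i t) = gen i * epst t" for t
    by (induction t rule: tens_induct) (auto simp: lop_tens distrib_left)
  then show ?case using 2 by simp
qed auto

lemma ten2_fw_cop: "ten2 (fw (qm \<chi>) u) (fw (qm \<chi>) v) (cop \<chi> x) = fw (qm \<chi>) (u @ v) x"
proof (induction u arbitrary: x)
  case Nil
  have e: "ten2 (fw (qm \<chi>) []) (fw (qm \<chi>) v) t = fw (qm \<chi>) v (epst t)" for t
  proof (induction t rule: tens_induct)
    case (tens x y)
    show ?case by (subst ten2_tens; simp)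
  qed simp
  show ?case using e[of "cop \<chi> x"] by (simp add: epst_cop del: fw.simps)
next
  case (Cons i u)
  have e: "ten2 (fw (qm \<chi>) (i # u)) (fw (qm \<chi>) v) t = ten2 (fw (qm \<chi>) u) (fw (qm \<chi>) v) (ldt i t)" for t
  proof (induction t rule: tens_induct)
    case (tens x y)
    show ?case by (subst ldt_tens) (subst (1 2) ten2_tens; simp)
  qed simp
  show ?case unfolding e ldt_cop Cons.IH by simp
qed

lemma nichols_space_eq: "nichols_space \<chi> = radical (qm \<chi>)"
  unfolding nichols_space_def
proof (rule Greatest_equality)
  let ?N = "radical (qm \<chi>)" and ?B = "braided_tensor_alg \<chi>"
  have sub: "alg_subspace ?B V \<longleftrightarrow> 0 \<in> V \<and> (\<forall>x\<in>V. \<forall>y\<in>V. x + y \<in> V) \<and> (\<forall>c. \<forall>x\<in>V. scl c x \<in> V)" for V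
    by (simp add: alg_subspace_def braided_tensor_alg_def scl_def)
  have subf: "alg_subspace free_alg V \<longleftrightarrow> 0 \<in> V \<and> (\<forall>x\<in>V. \<forall>y\<in>V. x + y \<in> V) \<and> (\<forall>c. \<forall>x\<in>V. scl c x \<in> V)"
    for V :: "('i, 'k) fa set"
    by (simp add: alg_subspace_def free_alg_def scl_def)
  define L where "L S = lin_span ?B {tens x y | x y. x \<in> S \<or> y \<in> S}" for S
  have "cop \<chi> x \<in> L ?N" if "x \<in> ?N" for x
  proof (rule tensor_annihilator[of "range (fw (qm \<chi>))" "range (fw (qm \<chi>))" ?N ?N])
    show "?N = {x. \<forall>f\<in>range (fw (qm \<chi>)). f x = 0}" "?N = {x. \<forall>f\<in>range (fw (qm \<chi>)). f x = 0}"
      by (auto simp: radical_def)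
    show "ten2 f g (cop \<chi> x) = 0" if "f \<in> range (fw (qm \<chi>))" "g \<in> range (fw (qm \<chi>))" for f g
      using that \<open>x \<in> ?N\<close> by (auto simp: ten2_fw_cop radical_def)
    show "0 \<in> L ?N" by (auto simp: L_def lin_span_def sub)
    show "s + t \<in> L ?N" if "s \<in> L ?N" "t \<in> L ?N" for s t using that by (auto simp: L_def lin_span_def sub)
    show "tens x y \<in> L ?N" if "x \<in> ?N \<or> y \<in> ?N" for x y using that by (auto simp: L_def lin_span_def)
  qed auto
  then show "alg_subspace free_alg ?N \<and> (\<forall>x\<in>?N. \<forall>w\<in>keys x. 2 \<le> length (letters w)) \<and>
      braided_coproduct \<chi> ` ?N \<subseteq> lin_span ?B {tens x y | x y. x \<in> ?N \<or> y \<in> ?N}"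
    using radical_degree by (auto simp: subf cop_eq L_def)
  fix S assume S: "alg_subspace free_alg S \<and> (\<forall>x\<in>S. \<forall>w\<in>keys x. 2 \<le> length (letters w)) \<and>
      braided_coproduct \<chi> ` S \<subseteq> lin_span ?B {tens x y | x y. x \<in> S \<or> y \<in> S}"
  have deg: "lookup x w = 0" if "x \<in> S" "length (letters w) < 2" for x w
    using S that by (metis in_keys_iff leD)
  show "S \<le> ?N"
  proof (rule subset_radicalI_ld)
    show "eps x = 0" if "x \<in> S" for x using deg[OF that, of 0] by (simp add: eps_def zero_fmon_def)
    fix x i assume x: "x \<in> S"
    have s: "0 \<in> S" "\<And>x y. x \<in> S \<Longrightarrow> y \<in> S \<Longrightarrow> x + y \<in> S" "\<And>c x. x \<in> S \<Longrightarrow> scl c x \<in> S"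
      using S by (auto simp: subf)
    have "{tens x y | x y. x \<in> S \<or> y \<in> S} \<subseteq> {t. epst (ldt i t) \<in> S}"
    proof safe
      fix x y assume "x \<in> S"
      then have "eps (ld (qm \<chi>) i x) = 0" using deg[of x "Word [i]"] by (simp add: eps_ld)
      then show "epst (ldt i (tens x y)) \<in> S" using s by simp
    next
      fix x y assume "y \<in> S" then show "epst (ldt i (tens x y)) \<in> S" using s by simp
    qed
    moreover have "alg_subspace ?B {t. epst (ldt i t) \<in> S}"
      using s by (auto simp: sub)
    ultimately have "lin_span ?B {tens x y | x y. x \<in> S \<or> y \<in> S} \<subseteq> {t. epst (ldt i t) \<in> S}"
      by (auto simp: lin_span_def)
    then have "epst (ldt i (cop \<chi> x)) \<in> S" using S x by (auto simp: cop_eq)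
    then show "ld (qm \<chi>) i x \<in> S" by (simp add: ldt_cop epst_cop)
  qed
qed

end

section \<open>Ideals of the free algebra\<close>

definition tideal :: "'a::ring_1 set \<Rightarrow> bool" where
  "tideal I \<longleftrightarrow> 0 \<in> I \<and> (\<forall>x\<in>I. \<forall>y\<in>I. x + y \<in> I) \<and> (\<forall>x\<in>I. \<forall>y. y * x \<in> I \<and> x * y \<in> I)"

lemma tideal_closed:
  assumes "tideal I"
  shows "0 \<in> I" "x \<in> I \<Longrightarrow> y \<in> I \<Longrightarrow> x + y \<in> I" "x \<in> I \<Longrightarrow> z * x \<in> I" "x \<in> I \<Longrightarrow> x * z \<in> I"
    "x \<in> I \<Longrightarrow> - x \<in> I" "x \<in> I \<Longrightarrow> y \<in> I \<Longrightarrow> x - y \<in> I"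
proof -
  show m: "- x \<in> I" if "x \<in> I" for x
    using assms that unfolding tideal_def by (metis mult_minus1)
  show "x \<in> I \<Longrightarrow> y \<in> I \<Longrightarrow> x - y \<in> I"
    using assms m[of y] unfolding tideal_def by (metis diff_conv_add_uminus)
qed (use assms in \<open>auto simp: tideal_def\<close>)

lemma tideal_scl: "tideal I \<Longrightarrow> x \<in> I \<Longrightarrow> scl c x \<in> I" for x :: "'g fmon \<Rightarrow>\<^sub>0 'k::field"
  using tideal_closed(3)[of I x "const c"] by (simp add: const_mult)

lemma free_alg_simps [simp]: "carrier free_alg = UNIV" "mult free_alg = (*)" "one free_alg = 1"
  "zero free_alg = 0" "add free_alg = (+)" "smult free_alg = scl"
  by (simp_all add: free_alg_def scl_def fun_eq_iff)

lemma ring_free_alg: "ring (free_alg :: ('k::field, 'g fmon \<Rightarrow>\<^sub>0 'k) module)"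
proof (rule ringI)
  show "abelian_group (free_alg :: ('k::field, 'g fmon \<Rightarrow>\<^sub>0 'k) module)"
  proof (rule abelian_groupI)
    fix x :: "'g fmon \<Rightarrow>\<^sub>0 'k" show "\<exists>y\<in>carrier free_alg. y \<oplus>\<^bsub>free_alg\<^esub> x = \<zero>\<^bsub>free_alg\<^esub>"
      by (intro bexI[of _ "-x"]) auto
  qed (simp_all add: ac_simps)
  show "monoid (free_alg :: ('k::field, 'g fmon \<Rightarrow>\<^sub>0 'k) module)"
    by (rule monoidI) (simp_all add: mult.assoc)
qed (simp_all add: distrib_left distrib_right)

lemma a_inv_free_alg [simp]: "\<ominus>\<^bsub>free_alg\<^esub> x = - x" "x \<ominus>\<^bsub>free_alg\<^esub> y = x - y" for x :: "'g fmon \<Rightarrow>\<^sub>0 'k::field"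
proof -
  interpret ring "free_alg :: ('k::field, 'g fmon \<Rightarrow>\<^sub>0 'k) module" by (rule ring_free_alg)
  show *: "\<ominus>\<^bsub>free_alg\<^esub> x = - x" for x :: "'g fmon \<Rightarrow>\<^sub>0 'k::field"
    by (rule minus_equality) auto
  show "x \<ominus>\<^bsub>free_alg\<^esub> y = x - y" by (simp add: a_minus_def *)
qed

lemma ideal_free_alg_iff: "ideal I free_alg \<longleftrightarrow> tideal I" for I :: "('g fmon \<Rightarrow>\<^sub>0 'k::field) set"
proof
  assume "ideal I free_alg"
  then interpret ideal I "free_alg :: ('k::field, 'g fmon \<Rightarrow>\<^sub>0 'k) module" .
  show "tideal I"
    unfolding tideal_def
    using additive_subgroup.zero_closed[OF is_additive_subgroup]
      additive_subgroup.a_closed[OF is_additive_subgroup] I_l_closed I_r_closed by auto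
next
  assume I: "tideal I"
  show "ideal I free_alg"
  proof (rule idealI)
    show "subgroup I (add_monoid (free_alg :: ('k, 'g fmon \<Rightarrow>\<^sub>0 'k) module))"
    proof (rule group.subgroupI)
      show "group (add_monoid (free_alg :: ('k, 'g fmon \<Rightarrow>\<^sub>0 'k) module))"
        using ring_free_alg abelian_group.a_group ring.is_abelian_group by blast
      show "I \<noteq> {}" using tideal_closed(1)[OF I] by auto
      show "inv\<^bsub>add_monoid free_alg\<^esub> a \<in> I" if "a \<in> I" for a
        using tideal_closed(5)[OF I that] a_inv_free_alg(1)[of a] by (simp add: a_inv_def)
    qed (use tideal_closed[OF I] in auto)
  qed (use I ring_free_alg tideal_closed[OF I] in auto)
qed

lemma U_ideal: "tideal (\<U>_ideal \<chi>)" "\<U>_rels \<chi> \<subseteq> \<U>_ideal \<chi>"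
  "tideal I \<Longrightarrow> \<U>_rels \<chi> \<subseteq> I \<Longrightarrow> \<U>_ideal \<chi> \<subseteq> I"
proof -
  interpret ring "free_alg :: ('b, 'a ugen fmon \<Rightarrow>\<^sub>0 'b) module" by (rule ring_free_alg)
  show "tideal (\<U>_ideal \<chi>)" unfolding \<U>_ideal_def ideal_free_alg_iff[symmetric]
    by (rule genideal_ideal) auto
  show "\<U>_rels \<chi> \<subseteq> \<U>_ideal \<chi>" unfolding \<U>_ideal_def by (rule genideal_self) auto
  show "tideal I \<Longrightarrow> \<U>_rels \<chi> \<subseteq> I \<Longrightarrow> \<U>_ideal \<chi> \<subseteq> I"
    unfolding \<U>_ideal_def ideal_free_alg_iff[symmetric] by (rule genideal_minimal)
qed

section \<open>Algebras with the relations of the Drinfeld double\<close>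

locale double_rel = algebra_scale sc for sc :: "'k::field \<Rightarrow> 'a::ring_1 \<Rightarrow> 'a" +
  fixes \<chi> :: "('i, 'k) bichar" and X :: "'i ugen \<Rightarrow> 'a"
  assumes bich: "bicharacter \<chi>"
    and cart_comm: "x \<in> cartan_gens \<Longrightarrow> y \<in> cartan_gens \<Longrightarrow> X x * X y = X y * X x"
    and KK': "X (GK i) * X (GK' i) = 1"
    and LL': "X (GL i) * X (GL' i) = 1"
    and KE: "X (GK i) * X (GE j) = sc (qm \<chi> i j) (X (GE j) * X (GK i))"
    and LE: "X (GL i) * X (GE j) = sc (inverse (qm \<chi> j i)) (X (GE j) * X (GL i))"
    and KF: "X (GK i) * X (GF j) = sc (inverse (qm \<chi> i j)) (X (GF j) * X (GK i))"
    and LF: "X (GL i) * X (GF j) = sc (qm \<chi> j i) (X (GF j) * X (GL i))"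
    and EF: "X (GE i) * X (GF j) - X (GF j) * X (GE i) = (if i = j then X (GK i) - X (GL i) else 0)"
begin

abbreviation "K i \<equiv> X (GK i)"
abbreviation "K' i \<equiv> X (GK' i)"
abbreviation "L i \<equiv> X (GL i)"
abbreviation "L' i \<equiv> X (GL' i)"
abbreviation "E i \<equiv> X (GE i)"
abbreviation "F i \<equiv> X (GF i)"
abbreviation "q \<equiv> qm \<chi>"

lemma q_nz [simp]: "q i j \<noteq> 0"
  by (rule qm_nonzero[OF bich])

lemma cg [simp]: "GK i \<in> cartan_gens" "GK' i \<in> cartan_gens" "GL i \<in> cartan_gens" "GL' i \<in> cartan_gens"
  "GE i \<notin> cartan_gens" "GF i \<notin> cartan_gens"
  by (auto simp: cartan_gens_def)

lemma K'K: "K' i * K i = 1" and L'L: "L' i * L i = 1"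
  using KK' LL' cart_comm[of "GK' i" "GK i"] cart_comm[of "GL' i" "GL i"] by auto

lemma ev_rels: "r \<in> \<U>_rels \<chi> \<Longrightarrow> ev X r = 0"
proof -
  have "K i * E j * K' i = sc (q i j) (E j)" "L i * E j * L' i = sc (inverse (q j i)) (E j)"
    "K i * F j * K' i = sc (inverse (q i j)) (F j)" "L i * F j * L' i = sc (q j i) (F j)" for i j
    by (simp_all add: KE LE KF LF mult.assoc KK' LL')
  then show "r \<in> \<U>_rels \<chi> \<Longrightarrow> ev X r = 0"
    unfolding \<U>_rels_def const_mult by (auto simp: cart_comm KK' LL' EF)
qed

lemma ev_ideal: "x \<in> \<U>_ideal \<chi> \<Longrightarrow> ev X x = 0"
proof -
  have "tideal {x. ev X x = 0}" by (auto simp: tideal_def)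
  from U_ideal(3)[OF this, of \<chi>] show "x \<in> \<U>_ideal \<chi> \<Longrightarrow> ev X x = 0" using ev_rels by auto
qed

definition Ev :: "('i, 'k) fa \<Rightarrow> 'a" where "Ev = ev (\<lambda>i. E i)"

lemma Ev_simps [simp]: "Ev (x + y) = Ev x + Ev y" "Ev (x - y) = Ev x - Ev y" "Ev (- x) = - Ev x" "Ev 0 = 0"
  "Ev (scl c x) = sc c (Ev x)" "Ev 1 = 1" "Ev (gen i) = E i" "Ev (x * y) = Ev x * Ev y" "Ev (x ^ n) = Ev x ^ n"
  by (simp_all add: Ev_def)

lemma K_Ev: "K i * Ev x = Ev (tor (q i) x) * K i"
proof (induction x rule: fa_word_induct)
  case (2 j x)
  have "K i * (E j * Ev x) = sc (q i j) (E j * (K i * Ev x))"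
    by (simp add: KE mult.assoc[symmetric])
  then show ?case using 2 by (simp add: mult.assoc)
qed (auto simp: distrib_left distrib_right)

lemma L_Ev: "L i * Ev x = Ev (tor (\<lambda>j. inverse (q j i)) x) * L i"
proof (induction x rule: fa_word_induct)
  case (2 j x)
  have "L i * (E j * Ev x) = sc (inverse (q j i)) (E j * (L i * Ev x))"
    by (simp add: LE mult.assoc[symmetric])
  then show ?case using 2 by (simp add: mult.assoc)
qed (auto simp: distrib_left distrib_right)

text \<open>The two skew derivations are the components of the commutator with a generator \<open>F\<close>.\<close>

lemma Ev_F: "Ev x * F j - F j * Ev x = Ev (rd q j x) * K j - L j * Ev (ld q j x)"
proof (induction x rule: fa_word_induct)
  case (2 i x)
  have "E i * Ev x * F j - F j * (E i * Ev x) =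
     E i * (Ev x * F j - F j * Ev x) + (E i * F j - F j * E i) * Ev x"
    by (simp add: algebra_simps mult.assoc)
  also have "\<dots> = E i * (Ev (rd q j x) * K j - L j * Ev (ld q j x)) + (if i = j then K j - L j else 0) * Ev x"
    by (simp add: 2 EF)
  also have "E i * L j = sc (q i j) (L j * E i)" by (simp add: LE)
  then have "E i * (L j * Ev (ld q j x)) = sc (q i j) (L j * (E i * Ev (ld q j x)))"
    by (simp add: mult.assoc[symmetric])
  then have "E i * (Ev (rd q j x) * K j - L j * Ev (ld q j x)) + (if i = j then K j - L j else 0) * Ev x
      = Ev (rd q j (gen i * x)) * K j - L j * Ev (ld q j (gen i * x))"
    by (auto simp: algebra_simps mult.assoc K_Ev)
  finally show ?case by simp
next
  case (3 x y)
  have "Ev (x + y) * F j - F j * Ev (x + y) = (Ev x * F j - F j * Ev x) + (Ev y * F j - F j * Ev y)"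
    by (simp add: algebra_simps)
  then show ?case by (simp only: 3) (simp add: algebra_simps)
next
  case (4 c x)
  have "Ev (scl c x) * F j - F j * Ev (scl c x) = sc c (Ev x * F j - F j * Ev x)" by simp
  then show ?case by (simp only: 4) simp
qed simp

end

section \<open>The Poincare--Birkhoff--Witt model\<close>

type_synonym 'i wts = "('i \<Rightarrow>\<^sub>0 int) \<times> ('i \<Rightarrow>\<^sub>0 int)"
type_synonym 'i pbw = "'i fmon \<times> 'i wts \<times> 'i fmon"

definition opE :: "'i \<Rightarrow> ('i pbw, 'k::field) lend" where
  "opE i = lin_op (\<lambda>(w, m, v). mon (Word [i] + w, m, v))"

definition opK :: "('i, 'k::field) bichar \<Rightarrow> ('i \<Rightarrow>\<^sub>0 int) \<Rightarrow> ('i pbw, 'k) lend" where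
  "opK \<chi> c = lin_op (\<lambda>(w, (a, b), v). Poly_Mapping.single (w, (a + c, b), v) (\<chi> c (wdeg w)))"

definition opL :: "('i, 'k::field) bichar \<Rightarrow> ('i \<Rightarrow>\<^sub>0 int) \<Rightarrow> ('i pbw, 'k) lend" where
  "opL \<chi> c = lin_op (\<lambda>(w, (a, b), v). Poly_Mapping.single (w, (a, b + c), v) (inverse (\<chi> (wdeg w) c)))"

primrec fow :: "('i, 'k::field) bichar \<Rightarrow> 'i \<Rightarrow> 'i wts \<Rightarrow> 'i fmon \<Rightarrow> 'i list \<Rightarrow> ('i pbw \<Rightarrow>\<^sub>0 'k)" where
  "fow \<chi> j m v [] = Poly_Mapping.single (0, m, Word [j] + v) (\<chi> (fst m) (al j) * inverse (\<chi> (al j) (snd m)))"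
| "fow \<chi> j m v (i # w) = app (opE i) (fow \<chi> j m v w)
     - (if i = j then app (opK \<chi> (al j) - opL \<chi> (al j)) (mon (Word w, m, v)) else 0)"

definition opF :: "('i, 'k::field) bichar \<Rightarrow> 'i \<Rightarrow> ('i pbw, 'k) lend" where
  "opF \<chi> j = lin_op (\<lambda>(w, m, v). fow \<chi> j m v (letters w))"

primrec opX :: "('i, 'k::field) bichar \<Rightarrow> 'i ugen \<Rightarrow> ('i pbw, 'k) lend" where
  "opX \<chi> (GK i) = opK \<chi> (al i)"
| "opX \<chi> (GK' i) = opK \<chi> (- al i)"
| "opX \<chi> (GL i) = opL \<chi> (al i)"
| "opX \<chi> (GL' i) = opL \<chi> (- al i)"
| "opX \<chi> (GE i) = opE i"
| "opX \<chi> (GF i) = opF \<chi> i"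

lemma op_single [simp]:
  "app (opE i) (Poly_Mapping.single (w, m, v) c) = Poly_Mapping.single (Word [i] + w, m, v) c"
  "app (opK \<chi> d) (Poly_Mapping.single (w, (a, b), v) c) = Poly_Mapping.single (w, (a + d, b), v) (c * \<chi> d (wdeg w))"
  "app (opL \<chi> d) (Poly_Mapping.single (w, (a, b), v) c) = Poly_Mapping.single (w, (a, b + d), v) (c * inverse (\<chi> (wdeg w) d))"
  "app (opF \<chi> j) (Poly_Mapping.single (w, m, v) c) = scl c (fow \<chi> j m v (letters w))"
  by (simp_all add: opE_def opK_def opL_def opF_def)

lemma lend_pbw_eqI:
  fixes f g :: "('i pbw, 'k::field) lend"
  shows "(\<And>w a b v. app f (mon (w, (a, b), v)) = app g (mon (w, (a, b), v))) \<Longrightarrow> f = g"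
  by (rule lend_eqI) auto

lemma opF_opE: "opE i * opF \<chi> j - opF \<chi> j * opE i = (if i = j then opK \<chi> (al j) - opL \<chi> (al j) else 0)"
proof (rule lend_pbw_eqI)
  fix w a b v
  show "app (opE i * opF \<chi> j - opF \<chi> j * opE i) (mon (w, (a, b), v)) =
    app (if i = j then opK \<chi> (al j) - opL \<chi> (al j) else 0) (mon (w, (a, b), v))"
    by (cases w) (auto simp: plus_fmon_def)
qed

lemma pbw_comm_F_I:
  fixes G :: "('i pbw, 'k::field) lend"
  assumes E: "\<And>k. G * opE k = lsc (e k) (opE k * G)" and ej: "e j * f = 1"
    and comm: "G * opK \<chi> (al j) = opK \<chi> (al j) * G" "G * opL \<chi> (al j) = opL \<chi> (al j) * G"
    and base: "\<And>m v. app (G * opF \<chi> j) (mon (0, m, v)) = scl f (app (opF \<chi> j * G) (mon (0, m, v)))"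
  shows "G * opF \<chi> j = lsc f (opF \<chi> j * G)"
proof (rule lend_eqI)
  fix x :: "'i pbw"
  obtain u m v where x: "x = (Word u, m, v)" by (cases x; cases "fst x") auto
  have FE: "opF \<chi> j * opE k = opE k * opF \<chi> j - (if k = j then opK \<chi> (al j) - opL \<chi> (al j) else 0)" for k
  proof -
    have "opF \<chi> j * opE k = opE k * opF \<chi> j - (opE k * opF \<chi> j - opF \<chi> j * opE k)" by simp
    then show ?thesis by (simp only: opF_opE)
  qed
  have "app (G * opF \<chi> j) (mon (Word u, m, v)) = scl f (app (opF \<chi> j * G) (mon (Word u, m, v)))"
  proof (induction u)
    case Nil
    show ?case using base by (simp add: zero_fmon_def)
  next
    case (Cons k u)
    let ?y = "mon (Word u, m, v) :: 'i pbw \<Rightarrow>\<^sub>0 'k"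
    let ?D = "if k = j then opK \<chi> (al j) - opL \<chi> (al j) else 0"
    have eq: "mon (Word (k # u), m, v) = app (opE k) ?y" by (simp add: plus_fmon_def)
    have GD: "G * ?D = ?D * G" using comm by (auto simp: algebra_simps)
    have 1: "G * opF \<chi> j * opE k = lsc (e k) (opE k * (G * opF \<chi> j)) - ?D * G"
    proof -
      have "G * opF \<chi> j * opE k = G * (opE k * opF \<chi> j) - G * ?D"
        by (simp only: mult.assoc FE right_diff_distrib)
      also have "G * (opE k * opF \<chi> j) = lsc (e k) (opE k * (G * opF \<chi> j))"
        by (simp only: mult.assoc[symmetric] E LE.sc_mult_left)
      finally show ?thesis by (simp only: GD)
    qed
    have 2: "opF \<chi> j * G * opE k = lsc (e k) (opE k * (opF \<chi> j * G) - ?D * G)"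
    proof -
      have "opF \<chi> j * G * opE k = lsc (e k) (opF \<chi> j * opE k * G)"
        by (simp only: mult.assoc E LE.sc_mult_right)
      then show ?thesis by (simp only: FE left_diff_distrib mult.assoc)
    qed
    define Z W where "Z = app (opF \<chi> j * G) ?y" and "W = app (?D * G) ?y"
    have fe: "scl f (scl (e k) W) = W"
      using ej unfolding W_def by (auto simp: mult.commute)
    have "app (G * opF \<chi> j) (mon (Word (k # u), m, v)) = app (G * opF \<chi> j * opE k) ?y"
      by (simp only: eq app_simps)
    also have "\<dots> = scl (e k) (app (opE k) (app (G * opF \<chi> j) ?y)) - app (?D * G) ?y"
      by (simp only: 1 app_simps)
    also have "\<dots> = scl (e k) (app (opE k) (scl f Z)) - W"
      by (simp only: Cons Z_def W_def)
    also have "\<dots> = scl f (scl (e k) (app (opE k) Z - W))"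
      using fe by (simp add: mult.commute)
    also have "scl (e k) (app (opE k) Z - W) = app (opF \<chi> j * G * opE k) ?y"
      by (simp only: 2 app_simps Z_def W_def)
    also have "app (opF \<chi> j * G * opE k) ?y = app (opF \<chi> j * G) (mon (Word (k # u), m, v))"
      by (simp only: eq app_simps)
    finally show ?case .
  qed
  then show "app (G * opF \<chi> j) (mon x) = app (lsc f (opF \<chi> j * G)) (mon x)" by (simp add: x)
qed

lemma pbw_model:
  assumes b: "bicharacter \<chi>" shows "double_rel lsc \<chi> (opX \<chi>)"
proof (unfold_locales)
  note s = bichar_simps[OF b]
  show "bicharacter \<chi>" by (rule b)
  have KKc: "opK \<chi> c * opK \<chi> d = opK \<chi> d * opK \<chi> c" "opL \<chi> c * opL \<chi> d = opL \<chi> d * opL \<chi> c"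
    "opK \<chi> c * opL \<chi> d = opL \<chi> d * opK \<chi> c" for c d
    by (rule lend_pbw_eqI; simp add: ac_simps)+
  show "opX \<chi> x * opX \<chi> y = opX \<chi> y * opX \<chi> x" if "x \<in> cartan_gens" "y \<in> cartan_gens" for x y
    using that by (auto simp: cartan_gens_def KKc)
  show "opX \<chi> (GK i) * opX \<chi> (GK' i) = 1" "opX \<chi> (GL i) * opX \<chi> (GL' i) = 1" for i
    by (rule lend_pbw_eqI; simp add: s)+
  have KE: "opK \<chi> c * opE j = lsc (\<chi> c (al j)) (opE j * opK \<chi> c)" for c j
    by (rule lend_pbw_eqI) (simp add: s)
  have LE: "opL \<chi> c * opE j = lsc (inverse (\<chi> (al j) c)) (opE j * opL \<chi> c)" for c j
    by (rule lend_pbw_eqI) (simp add: s mult_ac)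
  have KF: "opK \<chi> c * opF \<chi> j = lsc (inverse (\<chi> c (al j))) (opF \<chi> j * opK \<chi> c)" for c j
  proof (rule pbw_comm_F_I[OF KE])
    show "\<chi> c (al j) * inverse (\<chi> c (al j)) = 1" using s(3) by simp
    show "app (opK \<chi> c * opF \<chi> j) (mon (0, m, v)) = scl (inverse (\<chi> c (al j))) (app (opF \<chi> j * opK \<chi> c) (mon (0, m, v)))" for m v
      by (cases m) (simp add: zero_fmon_def s wdeg_def field_simps)
  qed (simp_all add: KKc)
  have LF: "opL \<chi> c * opF \<chi> j = lsc (\<chi> (al j) c) (opF \<chi> j * opL \<chi> c)" for c j
  proof (rule pbw_comm_F_I[OF LE])
    show "inverse (\<chi> (al j) c) * \<chi> (al j) c = 1" using s(3) by simp
    show "app (opL \<chi> c * opF \<chi> j) (mon (0, m, v)) = scl (\<chi> (al j) c) (app (opF \<chi> j * opL \<chi> c) (mon (0, m, v)))" for m v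
      by (cases m) (simp add: zero_fmon_def s wdeg_def field_simps)
  qed (simp_all add: KKc)
  show "opX \<chi> (GK i) * opX \<chi> (GE j) = lsc (qm \<chi> i j) (opX \<chi> (GE j) * opX \<chi> (GK i))"
    "opX \<chi> (GL i) * opX \<chi> (GE j) = lsc (inverse (qm \<chi> j i)) (opX \<chi> (GE j) * opX \<chi> (GL i))"
    "opX \<chi> (GK i) * opX \<chi> (GF j) = lsc (inverse (qm \<chi> i j)) (opX \<chi> (GF j) * opX \<chi> (GK i))"
    "opX \<chi> (GL i) * opX \<chi> (GF j) = lsc (qm \<chi> j i) (opX \<chi> (GF j) * opX \<chi> (GL i))" for i j
    by (simp_all add: KE LE KF LF qm_def)
  show "opX \<chi> (GE i) * opX \<chi> (GF j) - opX \<chi> (GF j) * opX \<chi> (GE i) = (if i = j then opX \<chi> (GK i) - opX \<chi> (GL i) else 0)" for i j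
    by (simp add: opF_opE)
qed

lemma rels_intros:
  "x \<in> cartan_gens \<Longrightarrow> y \<in> cartan_gens \<Longrightarrow> gen x * gen y - gen y * gen x \<in> \<U>_rels \<chi>"
  "gen (GK i) * gen (GK' i) - 1 \<in> \<U>_rels \<chi>"
  "gen (GL i) * gen (GL' i) - 1 \<in> \<U>_rels \<chi>"
  "gen (GK i) * gen (GE j) * gen (GK' i) - const (qm \<chi> i j) * gen (GE j) \<in> \<U>_rels \<chi>"
  "gen (GL i) * gen (GE j) * gen (GL' i) - const (inverse (qm \<chi> j i)) * gen (GE j) \<in> \<U>_rels \<chi>"
  "gen (GK i) * gen (GF j) * gen (GK' i) - const (inverse (qm \<chi> i j)) * gen (GF j) \<in> \<U>_rels \<chi>"
  "gen (GL i) * gen (GF j) * gen (GL' i) - const (qm \<chi> j i) * gen (GF j) \<in> \<U>_rels \<chi>"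
  "gen (GE i) * gen (GF j) - gen (GF j) * gen (GE i) - (if i = j then gen (GK i) - gen (GL i) else 0) \<in> \<U>_rels \<chi>"
  unfolding \<U>_rels_def by blast+

definition eqm :: "'a::ring_1 set \<Rightarrow> 'a \<Rightarrow> 'a \<Rightarrow> bool" where "eqm I x y \<longleftrightarrow> x - y \<in> I"

lemma eqm_refl: "tideal I \<Longrightarrow> eqm I x x"
  by (simp add: eqm_def tideal_closed)

lemma eqm_sym: "tideal I \<Longrightarrow> eqm I x y \<Longrightarrow> eqm I y x"
  unfolding eqm_def using tideal_closed(5)[of I "x - y"] by simp

lemma eqm_trans: "tideal I \<Longrightarrow> eqm I x y \<Longrightarrow> eqm I y z \<Longrightarrow> eqm I x z"
  unfolding eqm_def using tideal_closed(2)[of I "x - y" "y - z"] by simp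

lemma eqm_add: "tideal I \<Longrightarrow> eqm I x y \<Longrightarrow> eqm I z w \<Longrightarrow> eqm I (x + z) (y + w)"
  unfolding eqm_def using tideal_closed(2)[of I "x - y" "z - w"] by (simp add: algebra_simps)

lemma eqm_diff: "tideal I \<Longrightarrow> eqm I x y \<Longrightarrow> eqm I z w \<Longrightarrow> eqm I (x - z) (y - w)"
  unfolding eqm_def using tideal_closed(6)[of I "x - y" "z - w"] by (simp add: algebra_simps)

lemma eqm_left: "tideal I \<Longrightarrow> eqm I x y \<Longrightarrow> eqm I (z * x) (z * y)"
  unfolding eqm_def using tideal_closed(3)[of I "x - y" z] by (simp add: right_diff_distrib)

lemma eqm_right: "tideal I \<Longrightarrow> eqm I x y \<Longrightarrow> eqm I (x * z) (y * z)"
  unfolding eqm_def using tideal_closed(4)[of I "x - y" z] by (simp add: left_diff_distrib)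

lemma eqm_scl: "tideal I \<Longrightarrow> eqm I x y \<Longrightarrow> eqm I (scl c x) (scl c y)" for x y :: "'g fmon \<Rightarrow>\<^sub>0 'k::field"
  unfolding eqm_def using tideal_scl[of I "x - y" c] by simp

lemma eqm_mem: "tideal I \<Longrightarrow> eqm I x y \<Longrightarrow> y \<in> I \<Longrightarrow> x \<in> I"
  unfolding eqm_def using tideal_closed(2)[of I "x - y" y] by simp

lemma eqm_mono: "I \<subseteq> J \<Longrightarrow> eqm I x y \<Longrightarrow> eqm J x y"
  by (auto simp: eqm_def)

text \<open>Commutation up to a non-zero scalar, modulo an ideal.\<close>

definition skew :: "('g fmon \<Rightarrow>\<^sub>0 'k::field) set \<Rightarrow> ('g fmon \<Rightarrow>\<^sub>0 'k) \<Rightarrow> ('g fmon \<Rightarrow>\<^sub>0 'k) \<Rightarrow> bool" where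
  "skew I a x \<longleftrightarrow> (\<exists>c. c \<noteq> 0 \<and> eqm I (a * x) (scl c (x * a)))"

lemma skew_sym:
  assumes I: "tideal I" and s: "skew I a x" shows "skew I x a"
proof -
  obtain c where c: "c \<noteq> 0" "eqm I (a * x) (scl c (x * a))" using s by (auto simp: skew_def)
  have "eqm I (scl (inverse c) (a * x)) (scl (inverse c) (scl c (x * a)))" by (rule eqm_scl[OF I c(2)])
  then have "eqm I (x * a) (scl (inverse c) (a * x))" using c eqm_sym[OF I] by simp
  then show ?thesis using c unfolding skew_def by (intro exI[of _ "inverse c"]) simp
qed

lemma skew_mult:
  assumes I: "tideal I" and s: "skew I a x" "skew I a y" shows "skew I a (x * y)"
proof -
  obtain c where c: "c \<noteq> 0" "eqm I (a * x) (scl c (x * a))" using s by (auto simp: skew_def)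
  obtain d where d: "d \<noteq> 0" "eqm I (a * y) (scl d (y * a))" using s by (auto simp: skew_def)
  have "eqm I (a * (x * y)) (scl c (x * (a * y)))"
    using eqm_right[OF I c(2), of y] by (simp add: mult.assoc)
  moreover have "eqm I (scl c (x * (a * y))) (scl (c * d) (x * y * a))"
    using eqm_scl[OF I eqm_left[OF I d(2), of x], of c] by (simp add: mult.assoc)
  ultimately show ?thesis using c d eqm_trans[OF I] unfolding skew_def by (metis mult_eq_0_iff)
qed

lemma skew_one: "tideal I \<Longrightarrow> skew I a 1"
  unfolding skew_def by (intro exI[of _ 1]) (simp add: eqm_refl)

lemma skew_inverse:
  assumes I: "tideal I" and s: "skew I a x" and i: "eqm I (a * a') 1" "eqm I (a' * a) 1"
  shows "skew I a' x"
proof -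
  obtain c where c: "c \<noteq> 0" "eqm I (x * a) (scl c (a * x))"
    using skew_sym[OF I s] by (auto simp: skew_def)
  have "eqm I (a' * x) (a' * x * (a * a'))" using eqm_left[OF I eqm_sym[OF I i(1)], of "a' * x"] by simp
  also have "a' * x * (a * a') = a' * (x * a) * a'" by (simp add: mult.assoc)
  finally have 1: "eqm I (a' * x) (a' * (x * a) * a')" .
  have 2: "eqm I (a' * (x * a) * a') (a' * scl c (a * x) * a')"
    by (rule eqm_right[OF I eqm_left[OF I c(2)]])
  have "a' * scl c (a * x) * a' = scl c ((a' * a) * (x * a'))" by (simp add: mult.assoc)
  moreover have "eqm I (scl c ((a' * a) * (x * a'))) (scl c (1 * (x * a')))"
    by (rule eqm_scl[OF I eqm_right[OF I i(2)]])
  ultimately show ?thesis using c eqm_trans[OF I 1] eqm_trans[OF I 2] unfolding skew_def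
    by (metis mult_1)
qed

definition embE :: "('i, 'k::field) fa \<Rightarrow> ('i ugen fmon \<Rightarrow>\<^sub>0 'k)" where "embE = FA.ev (\<lambda>i. gen (GE i))"
definition embF :: "('i, 'k::field) fa \<Rightarrow> ('i ugen fmon \<Rightarrow>\<^sub>0 'k)" where "embF = FA.ev (\<lambda>i. gen (GF i))"

lemma emb_simps [simp]:
  "embE (x + y) = embE x + embE y" "embE (x - y) = embE x - embE y" "embE (- x) = - embE x" "embE 0 = 0" "embE 1 = 1"
  "embE (scl c x) = scl c (embE x)" "embE (x * y) = embE x * embE y" "embE (gen i) = gen (GE i)" "embE (x ^ n) = embE x ^ n"
  "embF (x + y) = embF x + embF y" "embF (x - y) = embF x - embF y" "embF (- x) = - embF x" "embF 0 = 0" "embF 1 = 1"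
  "embF (scl c x) = scl c (embF x)" "embF (x * y) = embF x * embF y" "embF (gen i) = gen (GF i)" "embF (x ^ n) = embF x ^ n"
  by (simp_all add: embE_def embF_def)

primrec cwt :: "'i ugen \<Rightarrow> 'i wts" where
  "cwt (GK i) = (al i, 0)" | "cwt (GK' i) = (- al i, 0)" | "cwt (GL i) = (0, al i)" | "cwt (GL' i) = (0, - al i)"
| "cwt (GE i) = 0" | "cwt (GF i) = 0"

primrec ginv :: "'i ugen \<Rightarrow> 'i ugen" where
  "ginv (GK i) = GK' i" | "ginv (GK' i) = GK i" | "ginv (GL i) = GL' i" | "ginv (GL' i) = GL i"
| "ginv (GE i) = GE i" | "ginv (GF i) = GF i"

definition cwl :: "'i ugen list \<Rightarrow> 'i wts" where "cwl c = sum_list (map cwt c)"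

definition gw :: "'g list \<Rightarrow> ('g fmon \<Rightarrow>\<^sub>0 'k::field)" where "gw c = mon (Word c)"

lemma gw_simps [simp]: "gw [] = 1" "gw (g # c) = gen g * gw c"
  by (simp_all add: gw_def single_Word_Nil single_Word_Cons)

lemma gw_append: "gw (c @ d) = gw c * gw d"
  by (induction c) (auto simp: mult.assoc)

lemma cwl_simps [simp]: "cwl [] = 0" "cwl (g # c) = cwt g + cwl c" "cwl (c @ d) = cwl c + cwl d" "cwl (rev c) = cwl c"
  by (simp_all add: cwl_def sum_list_rev flip: rev_map)

lemma cg [simp]: "GK i \<in> cartan_gens" "GK' i \<in> cartan_gens" "GL i \<in> cartan_gens" "GL' i \<in> cartan_gens"
  "GE i \<notin> cartan_gens" "GF i \<notin> cartan_gens"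
  by (auto simp: cartan_gens_def)

lemma cartan_cases:
  assumes "g \<in> cartan_gens" obtains i where "g = GK i" | i where "g = GK' i" | i where "g = GL i" | i where "g = GL' i"
  using assms by (auto simp: cartan_gens_def)

lemma ginv_cg [simp]: "g \<in> cartan_gens \<Longrightarrow> ginv g \<in> cartan_gens" "cwt (ginv g) = - cwt g" "ginv (ginv g) = g"
  by (auto elim!: cartan_cases, (cases g; auto simp: prod_eq_iff)+)

lemma weight_zero_cancels:
  assumes "set (g # c) \<subseteq> cartan_gens" "cwl (g # c) = 0"
  shows "ginv g \<in> set c"
proof (rule ccontr)
  assume n: "ginv g \<notin> set c"
  have "GK' i \<notin> set c \<Longrightarrow> lookup (fst (cwl c)) i \<ge> 0" "GK i \<notin> set c \<Longrightarrow> lookup (fst (cwl c)) i \<le> 0"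
    "GL' i \<notin> set c \<Longrightarrow> lookup (snd (cwl c)) i \<ge> 0" "GL i \<notin> set c \<Longrightarrow> lookup (snd (cwl c)) i \<le> 0" for i
  proof (induction c)
    case (Cons g c)
    { case 1 then show ?case using Cons by (cases g) (auto simp: lookup_add lookup_minus)
    next case 2 then show ?case using Cons by (cases g) (auto simp: lookup_add lookup_minus)
    next case 3 then show ?case using Cons by (cases g) (auto simp: lookup_add lookup_minus)
    next case 4 then show ?case using Cons by (cases g) (auto simp: lookup_add lookup_minus) }
  qed auto
  note * = this
  have "g \<in> cartan_gens" using assms by simp
  then obtain i where i: "g = GK i \<or> g = GK' i \<or> g = GL i \<or> g = GL' i" by (auto elim: cartan_cases)
  have "lookup (fst (cwl (g # c))) i = 0" "lookup (snd (cwl (g # c))) i = 0" using assms(2) by simp_all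
  then show False using n *[of i] i by (auto simp: lookup_add lookup_minus)
qed

lemma cartan_word_exists:
  fixes m :: "'a wts"
  shows "\<exists>c. set c \<subseteq> cartan_gens \<and> cwl c = m"
proof -
  define W where "W = {m :: 'a wts. \<exists>c. set c \<subseteq> cartan_gens \<and> cwl c = m}"
  have add: "m + m' \<in> W" if "m \<in> W" "m' \<in> W" for m m' :: "'a wts"
  proof -
    from that obtain c c' where "set c \<subseteq> cartan_gens" "cwl c = m" "set c' \<subseteq> cartan_gens" "cwl c' = m'"
      by (auto simp: W_def)
    then show ?thesis by (auto simp: W_def intro!: exI[of _ "c @ c'"])
  qed
  have neg: "- m \<in> W" if m: "m \<in> W" for m :: "'a wts"
  proof -
    from m obtain c where c: "set c \<subseteq> cartan_gens" "cwl c = m" by (auto simp: W_def)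
    have "cwl (map ginv c) = - cwl c" by (induction c) auto
    moreover have "set (map ginv c) \<subseteq> cartan_gens" using c(1) ginv_cg(1) by fastforce
    ultimately show ?thesis using c(2) unfolding W_def by (intro CollectI exI[of _ "map ginv c"]) simp
  qed
  have 0: "0 \<in> W" by (auto simp: W_def intro!: exI[of _ "[]"])
  have g: "cwt g \<in> W" if "g \<in> cartan_gens" for g :: "'a ugen"
    using that by (auto simp: W_def intro!: exI[of _ "[g]"])
  have "(a, 0) \<in> W" for a :: "'a \<Rightarrow>\<^sub>0 int"
  proof (rule frag_induction[of a UNIV])
    show "(0, 0) \<in> W" using 0 by (simp add: zero_prod_def)
    show "(al i, 0) \<in> W" for i using g[of "GK i"] by simp
    show "(a - b, 0) \<in> W" if "(a, 0) \<in> W" "(b, 0) \<in> W" for a b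
      using add[OF that(1) neg[OF that(2)]] by simp
  qed simp
  moreover have "(0, a) \<in> W" for a :: "'a \<Rightarrow>\<^sub>0 int"
  proof (rule frag_induction[of a UNIV])
    show "(0, 0) \<in> W" using 0 by (simp add: zero_prod_def)
    show "(0, al i) \<in> W" for i using g[of "GL i"] by simp
    show "(0, a - b) \<in> W" if "(0, a) \<in> W" "(0, b) \<in> W" for a b
      using add[OF that(1) neg[OF that(2)]] by simp
  qed simp
  ultimately have "(fst m, 0) + (0, snd m) \<in> W" by (intro add)
  then show ?thesis by (simp add: W_def)
qed

definition kw :: "'i wts \<Rightarrow> 'i ugen list" where "kw m = (SOME c. set c \<subseteq> cartan_gens \<and> cwl c = m)"

lemma kw: "set (kw m) \<subseteq> cartan_gens" "cwl (kw m) = m"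
  using someI_ex[OF cartan_word_exists[of m]] by (auto simp: kw_def)

definition el :: "('i, 'k::field) fa \<Rightarrow> 'i ugen list \<Rightarrow> ('i, 'k) fa \<Rightarrow> ('i ugen fmon \<Rightarrow>\<^sub>0 'k)" where
  "el x c y = embE x * gw c * embF y"

definition emb :: "('i pbw \<Rightarrow>\<^sub>0 'k::field) \<Rightarrow> ('i ugen fmon \<Rightarrow>\<^sub>0 'k)" where
  "emb = PM.lext (\<lambda>(w, m, v). el (mon w) (kw m) (mon v))"

lemma emb_linear [simp]: "emb (s + t) = emb s + emb t" "emb (scl c t) = scl c (emb t)" "emb 0 = 0"
  "emb (mon (w, m, v)) = el (mon w) (kw m) (mon v)"
  by (simp_all add: emb_def)

definition rho :: "('i, 'k::field) bichar \<Rightarrow> ('i ugen fmon \<Rightarrow>\<^sub>0 'k) \<Rightarrow> ('i pbw, 'k) lend" where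
  "rho \<chi> = LE.ev (opX \<chi>)"

definition nf :: "('i, 'k::field) bichar \<Rightarrow> ('i ugen fmon \<Rightarrow>\<^sub>0 'k) \<Rightarrow> ('i pbw \<Rightarrow>\<^sub>0 'k)" where
  "nf \<chi> x = app (rho \<chi> x) (mon (0, 0, 0))"

lemma rho_simps [simp]: "rho \<chi> (x + y) = rho \<chi> x + rho \<chi> y" "rho \<chi> (x - y) = rho \<chi> x - rho \<chi> y"
  "rho \<chi> (- x) = - rho \<chi> x" "rho \<chi> 0 = 0" "rho \<chi> 1 = 1" "rho \<chi> (x * y) = rho \<chi> x * rho \<chi> y"
  "rho \<chi> (scl c x) = lsc c (rho \<chi> x)" "rho \<chi> (gen g) = opX \<chi> g"
  by (simp_all add: rho_def)

lemma nf_simps [simp]: "nf \<chi> (x + y) = nf \<chi> x + nf \<chi> y" "nf \<chi> (x - y) = nf \<chi> x - nf \<chi> y"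
  "nf \<chi> (- x) = - nf \<chi> x" "nf \<chi> 0 = 0" "nf \<chi> (scl c x) = scl c (nf \<chi> x)"
  "nf \<chi> (gen g * x) = app (opX \<chi> g) (nf \<chi> x)"
  by (simp_all add: nf_def)

locale bichar_loc =
  fixes \<chi> :: "('i, 'k::field) bichar"
  assumes bichar: "bicharacter \<chi>"

sublocale bichar_loc \<subseteq> M: double_rel lsc \<chi> "opX \<chi>"
  by (rule pbw_model[OF bichar])

context bichar_loc
begin

abbreviation "R \<equiv> \<U>_ideal \<chi>"
abbreviation "q \<equiv> qm \<chi>"

lemma R: "tideal R" by (rule U_ideal)

lemmas eqm_R_trans [trans] = eqm_trans[OF R]

lemma rel: "r \<in> \<U>_rels \<chi> \<Longrightarrow> r \<in> R"
  using U_ideal(2) by blast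

lemma inverse_rels: "g \<in> cartan_gens \<Longrightarrow> eqm R (gen g * gen (ginv g)) 1"
proof -
  have c: "eqm R (gen x * gen y) (gen y * gen x)" if "x \<in> cartan_gens" "y \<in> cartan_gens" for x y
    unfolding eqm_def by (rule rel, rule rels_intros) (use that in auto)
  have 1: "eqm R (gen (GK i) * gen (GK' i)) 1" "eqm R (gen (GL i) * gen (GL' i)) 1" for i
    unfolding eqm_def by (rule rel, rule rels_intros)+
  have 2: "eqm R (gen (GK' i) * gen (GK i)) 1" "eqm R (gen (GL' i) * gen (GL i)) 1" for i
    by (rule eqm_trans[OF R c 1(1)] eqm_trans[OF R c 1(2)]; simp)+
  show "g \<in> cartan_gens \<Longrightarrow> eqm R (gen g * gen (ginv g)) 1"
    using 1 2 by (elim cartan_cases) auto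
qed

lemma cart_skew: "x \<in> cartan_gens \<Longrightarrow> y \<in> cartan_gens \<Longrightarrow> eqm R (gen x * gen y) (gen y * gen x)"
  unfolding eqm_def by (rule rel, rule rels_intros)

lemma skew_EF:
  assumes g: "g \<in> cartan_gens" and y: "y = GE j \<or> y = GF j"
  shows "skew R (gen g) (gen y)"
proof -
  have conj: "skew R (gen a) (gen y)"
    if r: "gen a * gen y * gen (ginv a) - const c * gen y \<in> \<U>_rels \<chi>" and c: "c \<noteq> 0" and a: "a \<in> cartan_gens" for a c
  proof -
    have "gen a * gen y = gen a * gen y * 1" by simp
    also have "eqm R \<dots> (gen a * gen y * (gen (ginv a) * gen (ginv (ginv a))))"
      by (rule eqm_left[OF R], rule eqm_sym[OF R], rule inverse_rels) (use a in simp)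
    also have "gen a * gen y * (gen (ginv a) * gen (ginv (ginv a))) = gen a * gen y * gen (ginv a) * gen a"
      using a by (simp add: mult.assoc)
    also have "eqm R \<dots> (const c * gen y * gen a)"
      by (rule eqm_right[OF R]) (use rel[OF r] in \<open>simp add: eqm_def\<close>)
    also have "const c * gen y * gen a = scl c (gen y * gen a)"
      by (simp add: const_mult)
    finally have "eqm R (gen a * gen y) (scl c (gen y * gen a))" .
    then show ?thesis using c by (auto simp: skew_def)
  qed
  have KL: "skew R (gen (GK i)) (gen y)" "skew R (gen (GL i)) (gen y)" for i
  proof -
    show "skew R (gen (GK i)) (gen y)"
      using y
    proof
      assume y: "y = GE j" show ?thesis by (rule conj, unfold y ginv.simps, rule rels_intros, simp_all)
    next
      assume y: "y = GF j" show ?thesis by (rule conj, unfold y ginv.simps, rule rels_intros, simp_all)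
    qed
    show "skew R (gen (GL i)) (gen y)"
      using y
    proof
      assume y: "y = GE j" show ?thesis by (rule conj, unfold y ginv.simps, rule rels_intros, simp_all)
    next
      assume y: "y = GF j" show ?thesis by (rule conj, unfold y ginv.simps, rule rels_intros, simp_all)
    qed
  qed
  have inv: "skew R (gen (ginv a)) (gen y)" if "skew R (gen a) (gen y)" "a \<in> cartan_gens" for a
    using skew_inverse[OF R that(1) inverse_rels[OF that(2)]] inverse_rels[of "ginv a"] that(2) by simp
  show ?thesis
    using g KL inv[OF KL(1)] inv[OF KL(2)] by (elim cartan_cases) auto
qed

text \<open>Words in the Cartan generators are determined by their weights.\<close>

lemma cartan_word_swap: "set c \<subseteq> cartan_gens \<Longrightarrow> g \<in> cartan_gens \<Longrightarrow> eqm R (gen g * gw c) (gw c * gen g)"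
proof (induction c)
  case (Cons h c)
  have "gen g * gw (h # c) = gen g * gen h * gw c" by (simp add: mult.assoc)
  also have "eqm R \<dots> (gen h * gen g * gw c)"
    by (intro eqm_right R cart_skew) (use Cons in auto)
  also have "gen h * gen g * gw c = gen h * (gen g * gw c)" by (simp add: mult.assoc)
  also have "eqm R \<dots> (gen h * (gw c * gen g))"
    by (intro eqm_left R) (use Cons in auto)
  also have "gen h * (gw c * gen g) = gw (h # c) * gen g" by (simp add: mult.assoc)
  finally show ?case .
qed (simp add: eqm_refl R)

lemma weight_zero_word: "set c \<subseteq> cartan_gens \<Longrightarrow> cwl c = 0 \<Longrightarrow> eqm R (gw c) 1"
proof (induction "length c" arbitrary: c rule: less_induct)
  case less
  show ?case
  proof (cases c)
    case (Cons g d)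
    obtain u v where uv: "d = u @ ginv g # v"
      using weight_zero_cancels[of g d] less.prems Cons by (auto simp: in_set_conv_decomp)
    have sub: "set u \<subseteq> cartan_gens" "set v \<subseteq> cartan_gens" "g \<in> cartan_gens"
      using less.prems Cons uv by auto
    have "gw c = gen g * gw u * (gen (ginv g) * gw v)" by (simp add: Cons uv gw_append mult.assoc)
    also have "eqm R \<dots> (gw u * gen g * (gen (ginv g) * gw v))"
      by (intro eqm_right R cartan_word_swap sub)
    also have "gw u * gen g * (gen (ginv g) * gw v) = gw u * (gen g * gen (ginv g) * gw v)"
      by (simp add: mult.assoc)
    also have "eqm R \<dots> (gw u * (1 * gw v))"
      by (intro eqm_right eqm_left R inverse_rels sub)
    also have "gw u * (1 * gw v) = gw (u @ v)" by (simp add: gw_append)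
    also have "eqm R \<dots> 1"
    proof (rule less.hyps)
      show "cwl (u @ v) = 0" using less.prems(2) sub(3) by (simp add: Cons uv algebra_simps)
    qed (use Cons uv sub in auto)
    finally show ?thesis .
  qed (simp add: eqm_refl R)
qed

lemma word_weight_eq:
  assumes "set c \<subseteq> cartan_gens" "set d \<subseteq> cartan_gens" "cwl c = cwl d"
  shows "eqm R (gw c) (gw d)"
proof -
  have i: "set (map ginv e) \<subseteq> cartan_gens" if "set e \<subseteq> cartan_gens" for e :: "'i ugen list"
    using that ginv_cg(1) by fastforce
  have w: "cwl (map ginv e) = - cwl e" for e :: "'i ugen list" by (induction e) auto
  have "gw c = gw c * 1" by simp
  also have "eqm R \<dots> (gw c * gw (map ginv d @ d))"
    by (rule eqm_left[OF R], rule eqm_sym[OF R], rule weight_zero_word) (use assms i w in auto)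
  also have "gw c * gw (map ginv d @ d) = gw (c @ map ginv d) * gw d" by (simp add: gw_append mult.assoc)
  also have "eqm R \<dots> (1 * gw d)"
    by (intro eqm_right R weight_zero_word) (use assms i w in auto)
  finally show ?thesis by simp
qed

text \<open>The ordered monomials span.\<close>

definition spanned :: "('i ugen fmon \<Rightarrow>\<^sub>0 'k) \<Rightarrow> bool" where "spanned x \<longleftrightarrow> (\<exists>t. eqm R x (emb t))"

lemma spanned_cong: "eqm R x y \<Longrightarrow> spanned y \<Longrightarrow> spanned x"
  unfolding spanned_def using eqm_trans[OF R] by blast

lemma spanned_add: "spanned x \<Longrightarrow> spanned y \<Longrightarrow> spanned (x + y)"
  unfolding spanned_def by (metis emb_linear(1) eqm_add[OF R])

lemma spanned_scl: "spanned x \<Longrightarrow> spanned (scl c x)"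
  unfolding spanned_def by (metis emb_linear(2) eqm_scl[OF R])

lemma spanned_diff: "spanned x \<Longrightarrow> spanned y \<Longrightarrow> spanned (x - y)"
  using spanned_add[OF _ spanned_scl[of y "-1"], of x] by simp

lemma spanned_el: "set c \<subseteq> cartan_gens \<Longrightarrow> spanned (el (mon w) c (mon v))"
proof -
  assume c: "set c \<subseteq> cartan_gens"
  have "eqm R (el (mon w) c (mon v)) (el (mon w) (kw (cwl c)) (mon v))"
    unfolding el_def by (intro eqm_left eqm_right R word_weight_eq c kw) (simp add: kw)
  then show ?thesis unfolding spanned_def by (metis emb_linear(4))
qed

lemma spanned_E: "spanned x \<Longrightarrow> spanned (gen (GE i) * x)"
proof -
  have "spanned (gen (GE i) * emb t)" for t
  proof (induction t rule: pm_induct)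
    case zero show ?case by (auto simp: spanned_def intro!: exI[of _ 0] eqm_refl R)
  next
    case (add x y) then show ?case by (simp add: distrib_left spanned_add)
  next
    case (single b c)
    obtain w m v where b: "b = (w, m, v)" by (cases b)
    have "spanned (el (mon (Word [i] + w)) (kw m) (mon v))" by (rule spanned_el[OF kw(1)])
    moreover have "el (mon (Word [i] + w)) (kw m) (mon v) = gen (GE i) * emb (mon b)"
      by (simp add: el_def b mult.assoc flip: gen_mult_single)
    ultimately have "spanned (scl c (gen (GE i) * emb (mon b)))" using spanned_scl by metis
    then have "spanned (gen (GE i) * emb (scl c (mon b)))" by (simp only: emb_linear scl_mult_fa)
    then show ?case by simp
  qed
  then show "spanned x \<Longrightarrow> spanned (gen (GE i) * x)"
    using spanned_cong[OF eqm_left[OF R]] unfolding spanned_def by blast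
qed

lemma spanned_cartan_el:
  assumes g: "g \<in> cartan_gens" and c: "set c \<subseteq> cartan_gens"
  shows "spanned (gen g * el (mon w) c (mon v))"
proof -
  have "skew R (gen g) (embE (mon (Word u)))" for u
    by (induction u) (auto simp: single_Word_Nil single_Word_Cons intro!: skew_one skew_mult R skew_EF g)
  then obtain d where "eqm R (gen g * embE (mon w)) (scl d (embE (mon w) * gen g))"
    unfolding skew_def by (metis fmon.exhaust)
  then have "eqm R (gen g * embE (mon w) * (gw c * embF (mon v))) (scl d (embE (mon w) * gen g) * (gw c * embF (mon v)))"
    by (rule eqm_right[OF R])
  moreover have "scl d (embE (mon w) * gen g) * (gw c * embF (mon v)) = scl d (el (mon w) (g # c) (mon v))"
    by (simp add: el_def mult.assoc)
  moreover have "spanned (scl d (el (mon w) (g # c) (mon v)))"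
    by (intro spanned_scl spanned_el) (use g c in auto)
  ultimately show ?thesis using spanned_cong by (simp add: el_def mult.assoc)
qed

lemma spanned_F_el:
  assumes c: "set c \<subseteq> cartan_gens"
  shows "spanned (gen (GF j) * el (mon (Word u)) c (mon v))"
proof (induction u)
  case Nil
  have "skew R (gen (GF j)) (gw c)" using c
    by (induction c) (auto intro!: skew_one skew_mult R skew_sym[OF R skew_EF])
  then obtain d where "eqm R (gen (GF j) * gw c) (scl d (gw c * gen (GF j)))" by (auto simp: skew_def)
  then have 1: "eqm R (gen (GF j) * gw c * embF (mon v)) (scl d (gw c * gen (GF j)) * embF (mon v))"
    by (rule eqm_right[OF R])
  have 2: "scl d (gw c * gen (GF j)) * embF (mon v) = scl d (el (mon (Word [])) c (mon (Word [j] + v)))"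
  proof -
    have "(embF (mon (Word [j] + v)) :: 'i ugen fmon \<Rightarrow>\<^sub>0 'k) = gen (GF j) * embF (mon v)" by (simp flip: gen_mult_single)
    then show ?thesis by (simp add: el_def single_Word_Nil mult.assoc)
  qed
  have 3: "spanned (scl d (el (mon (Word [])) c (mon (Word [j] + v))))"
    by (intro spanned_scl spanned_el c)
  have "gen (GF j) * el (mon (Word [])) c (mon v) = gen (GF j) * gw c * embF (mon v)"
    by (simp add: el_def single_Word_Nil mult.assoc)
  then show ?case using spanned_cong[OF 1[unfolded 2] 3] by metis
next
  case (Cons i u)
  let ?Y = "el (mon (Word u)) c (mon v)"
  let ?D = "if i = j then gen (GK i) - gen (GL i) else 0"
  have "gen (GE i) * gen (GF j) - gen (GF j) * gen (GE i) - ?D \<in> R"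
    by (rule rel, rule rels_intros)
  then have "eqm R ((gen (GE i) * gen (GF j) - ?D) * ?Y) (gen (GF j) * gen (GE i) * ?Y)"
    by (intro eqm_right R) (simp add: eqm_def algebra_simps)
  then have 1: "eqm R (gen (GF j) * gen (GE i) * ?Y) ((gen (GE i) * gen (GF j) - ?D) * ?Y)"
    by (rule eqm_sym[OF R])
  have "spanned (?D * ?Y)"
  proof (cases "i = j")
    case True
    then show ?thesis
      using spanned_diff[OF spanned_cartan_el[of "GK i" c] spanned_cartan_el[of "GL i" c]] c
      by (simp add: left_diff_distrib)
  next
    case False
    have "emb 0 = (0 :: 'i ugen fmon \<Rightarrow>\<^sub>0 'k)" by simp
    then show ?thesis using False by (auto simp: spanned_def intro!: exI[of _ 0] eqm_refl R)
  qed
  then have "spanned (gen (GE i) * (gen (GF j) * ?Y) - ?D * ?Y)"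
    by (intro spanned_diff spanned_E Cons)
  moreover have "(gen (GE i) * gen (GF j) - ?D) * ?Y = gen (GE i) * (gen (GF j) * ?Y) - ?D * ?Y"
    by (simp only: left_diff_distrib mult.assoc)
  moreover have "gen (GF j) * el (mon (Word (i # u))) c (mon v) = gen (GF j) * gen (GE i) * ?Y"
    by (simp add: el_def single_Word_Cons mult.assoc)
  ultimately show ?case using spanned_cong[OF 1] by metis
qed

lemma spanned_gen: "spanned x \<Longrightarrow> spanned (gen g * x)"
proof -
  have b: "spanned (gen g * el (mon w) (kw m) (mon v))" for w m v
  proof (cases g)
    case (GE i)
    show ?thesis unfolding GE by (intro spanned_E spanned_el kw)
  next
    case (GF i)
    show ?thesis unfolding GF using spanned_F_el[OF kw(1), of i "letters w"] by simp
  qed (use spanned_cartan_el[OF _ kw(1)] in auto)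
  have "spanned (gen g * emb t)" for t
  proof (induction t rule: pm_induct)
    case zero show ?case by (auto simp: spanned_def intro!: exI[of _ 0] eqm_refl R)
  next
    case (add x y) then show ?case by (simp add: distrib_left spanned_add)
  next
    case (single b' c)
    obtain w m v where b': "b' = (w, m, v)" by (cases b')
    have "spanned (scl c (gen g * emb (mon b')))" unfolding b' emb_linear by (intro spanned_scl b)
    then have "spanned (gen g * emb (scl c (mon b')))" by (simp only: emb_linear scl_mult_fa)
    then show ?case by simp
  qed
  then show "spanned x \<Longrightarrow> spanned (gen g * x)"
    using spanned_cong[OF eqm_left[OF R]] unfolding spanned_def by blast
qed

lemma all_spanned: "spanned x"
proof (induction x rule: fa_word_induct)
  case 1
  have "spanned (el (mon (Word [])) [] (mon (Word [])))" by (rule spanned_el) simp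
  then show ?case by (simp add: el_def single_Word_Nil)
qed (auto intro: spanned_add spanned_scl spanned_gen)

text \<open>The model separates the ordered monomials.\<close>

lemma rho_embE: "rho \<chi> (embE x) = M.Ev x"
  by (induction x rule: fa_word_induct) auto

lemma Ev_mon: "app (M.Ev (mon u)) (mon (w, m, v)) = mon (u + w, m, v)"
proof -
  have "app (M.Ev (mon (Word u))) (mon (w, m, v)) = mon (Word u + w, m, v)" for u
    by (induction u) (auto simp: single_Word_Nil single_Word_Cons plus_fmon_def)
  then show ?thesis by (cases u) auto
qed

lemma rho_gw: "set c \<subseteq> cartan_gens \<Longrightarrow> app (rho \<chi> (gw c)) (mon (0, m, v)) = mon (0, m + cwl c, v)"
proof (induction c)
  case (Cons g c)
  then show ?case
    by (cases m; cases "cwl c") (auto elim!: cartan_cases simp: bichar_simps[OF bichar] ac_simps)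
qed simp

lemma rho_embF: "app (rho \<chi> (embF (mon v))) (mon (0, 0, 0)) = mon (0, 0, v)"
proof -
  have "app (rho \<chi> (embF (mon (Word v)))) (mon (0, 0, 0)) = mon (0, 0, Word v)" for v
  proof (induction v)
    case (Cons j v)
    then show ?case
      by (simp add: single_Word_Cons) (simp add: zero_fmon_def plus_fmon_def bichar_simps[OF bichar])
  qed (simp add: single_Word_Nil zero_fmon_def)
  then show ?thesis by (cases v) auto
qed

lemma nf_el: "set c \<subseteq> cartan_gens \<Longrightarrow> nf \<chi> (el (mon w) c (mon v)) = mon (w, cwl c, v)"
  by (simp add: nf_def el_def rho_embE rho_embF rho_gw Ev_mon)

lemma nf_emb: "nf \<chi> (emb t) = t"
proof (induction t rule: pm_induct)
  case (single b c)
  obtain w m v where b: "b = (w, m, v)" by (cases b)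
  have "nf \<chi> (emb (scl c (mon b))) = scl c (mon b)"
    by (simp only: b emb_linear nf_simps nf_el[OF kw(1)] kw)
  then show ?case by simp
qed auto

lemma rho_R: "x \<in> R \<Longrightarrow> rho \<chi> x = 0"
  unfolding rho_def by (rule M.ev_ideal)

lemma nf_zero_iff: "nf \<chi> x = 0 \<longleftrightarrow> x \<in> R"
proof
  assume 0: "nf \<chi> x = 0"
  obtain t where t: "eqm R x (emb t)" using all_spanned[of x] by (auto simp: spanned_def)
  then have "nf \<chi> (x - emb t) = 0" by (auto simp: eqm_def nf_def dest!: rho_R)
  then have "t = 0" using 0 by (simp add: nf_emb)
  then show "x \<in> R" using t by (simp add: eqm_def)
qed (simp add: nf_def rho_R)

lemma rho_eq_iff: "rho \<chi> x = rho \<chi> y \<longleftrightarrow> eqm R x y"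
proof
  assume "rho \<chi> x = rho \<chi> y"
  then have "nf \<chi> (x - y) = 0" by (simp add: nf_def)
  then show "eqm R x y" by (simp only: nf_zero_iff eqm_def)
next
  assume "eqm R x y"
  then have "rho \<chi> (x - y) = 0" unfolding eqm_def by (rule rho_R)
  then show "rho \<chi> x = rho \<chi> y" by simp
qed

lemma nf_eq: "eqm R x y \<Longrightarrow> nf \<chi> x = nf \<chi> y"
  using rho_eq_iff[of x y] by (simp add: nf_def)

lemma emb_nf: "eqm R x (emb (nf \<chi> x))"
proof -
  obtain t where t: "eqm R x (emb t)" using all_spanned[of x] by (auto simp: spanned_def)
  then show ?thesis using nf_eq[OF t] by (simp add: nf_emb)
qed

end

section \<open>The radical of the double\<close>

definition Phi :: "('i, 'k::field) bichar \<Rightarrow> 'i list \<Rightarrow> 'i wts \<Rightarrow> 'i list \<Rightarrow> ('i pbw \<Rightarrow>\<^sub>0 'k) \<Rightarrow> 'k" where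
  "Phi \<chi> u m v = kext (\<lambda>(w, m', w'). if m' = m then fw (qm \<chi>) u (mon w) * fw (qm \<chi>) v (frev (mon w')) else 0)"

lemma Phi_simps [simp]: "Phi \<chi> u m v (s + t) = Phi \<chi> u m v s + Phi \<chi> u m v t"
  "Phi \<chi> u m v (s - t) = Phi \<chi> u m v s - Phi \<chi> u m v t" "Phi \<chi> u m v (- s) = - Phi \<chi> u m v s"
  "Phi \<chi> u m v 0 = 0" "Phi \<chi> u m v (scl c t) = c * Phi \<chi> u m v t"
  by (simp_all add: Phi_def)

definition SF :: "('i, 'k::field) bichar \<Rightarrow> ('i ugen fmon \<Rightarrow>\<^sub>0 'k) set" where
  "SF \<chi> = {x. \<forall>u m v. Phi \<chi> u m v (nf \<chi> x) = 0}"

primrec swEF :: "'i ugen \<Rightarrow> 'i ugen" where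
  "swEF (GK i) = GK i" | "swEF (GK' i) = GK' i" | "swEF (GL i) = GL i" | "swEF (GL' i) = GL' i"
| "swEF (GE i) = GF i" | "swEF (GF i) = GE i"

definition ph4 :: "('i ugen fmon \<Rightarrow>\<^sub>0 'k::field) \<Rightarrow> ('i ugen fmon \<Rightarrow>\<^sub>0 'k)" where
  "ph4 x = FA.ev (\<lambda>g. gen (swEF g)) (frev x)"

lemma ph4_simps [simp]: "ph4 (x + y) = ph4 x + ph4 y" "ph4 (x - y) = ph4 x - ph4 y" "ph4 (- x) = - ph4 x"
  "ph4 0 = 0" "ph4 1 = 1" "ph4 (scl c x) = scl c (ph4 x)" "ph4 (x * y) = ph4 y * ph4 x" "ph4 (gen g) = gen (swEF g)"
  by (simp_all add: ph4_def)

lemma swEF_swEF [simp]: "swEF (swEF g) = g"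
  by (cases g) auto

lemma ph4_ph4 [simp]: "ph4 (ph4 x) = x"
  by (induction x rule: fa_word_induct) auto

lemma ph4_embE: "ph4 (embE x) = embF (frev x)"
  by (induction x rule: fa_word_induct) auto

lemma ph4_embF: "ph4 (embF x) = embE (frev x)"
  by (induction x rule: fa_word_induct) auto

lemma fw_mult_gen: "fw q (rev u) (x * gen j) = (\<Sum>(c, u')\<leftarrow>dl (transp q) j u. c * fw q (rev u') x)"
proof -
  have "fw q (rev u) (x * gen j) = fw (transp q) u (gen j * frev x)"
    using fw_frev[of q u "x * gen j"] by simp
  then show ?thesis by (simp add: fw_gen_mult fw_frev)
qed

context algebra_scale
begin

lemma inverse_skew_comm:
  assumes "k * k' = 1" "k' * k = 1" "k * x = sc c (x * k)" "c \<noteq> 0"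
  shows "k' * x = sc (inverse c) (x * k')"
proof -
  have xk: "x * k = sc (inverse c) (k * x)" using assms by simp
  have "k' * x = k' * (x * k) * k'" using assms(1) by (simp only: mult.assoc mult_1_right)
  also have "\<dots> = sc (inverse c) ((k' * k) * (x * k'))"
    unfolding xk by (simp only: mult.assoc sc_mult_left sc_mult_right)
  finally show ?thesis by (simp only: assms(2) mult_1)
qed

end

context double_rel
begin

lemma K'E: "K' i * E j = sc (inverse (q i j)) (E j * K' i)"
  and K'F: "K' i * F j = sc (q i j) (F j * K' i)"
  and L'E: "L' i * E j = sc (q j i) (E j * L' i)"
  and L'F: "L' i * F j = sc (inverse (q j i)) (F j * L' i)"
  using inverse_skew_comm[OF KK' K'K KE] inverse_skew_comm[OF KK' K'K KF]
    inverse_skew_comm[OF LL' L'L LE] inverse_skew_comm[OF LL' L'L LF] by simp_all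

end

context bichar_loc
begin

lemma fw_weight:
  assumes "\<And>a b. \<phi> (a + b) = \<phi> a * (\<phi> b :: 'k)" "\<phi> 0 = 1"
  shows "\<phi> (wdeg w) * fw q' u (mon w) = \<phi> (wdeg (Word u)) * fw q' u (mon w)"
proof -
  have "\<phi> (wdeg w) * fw q' u (mon w) = fw q' u (scl (\<phi> (wdeg w)) (mon w))"
    by (rule fw_linear(5)[symmetric])
  also have "scl (\<phi> (wdeg w)) (mon w) = tor (\<lambda>i. \<phi> (al i)) (mon w)"
    unfolding tor_mon[OF assms] by simp
  also have "fw q' u \<dots> = prod_list (map (\<lambda>i. \<phi> (al i)) u) * fw q' u (mon w)"
    by (rule fw_tor)
  also have "prod_list (map (\<lambda>i. \<phi> (al i)) u) = \<phi> (wdeg (Word u))"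
    by (induction u) (auto simp: wdeg_def assms)
  finally show ?thesis .
qed

lemma Phi_opK: "Phi \<chi> u (a, b) v (app (opK \<chi> c) t) = \<chi> c (wdeg (Word u)) * Phi \<chi> u (a - c, b) v t"
proof (induction t rule: pm_induct)
  case (single x d)
  obtain w a' b' w' where x: "x = (w, (a', b'), w')" by (cases x) auto
  have "\<chi> c (wdeg w) * fw q u (mon w) = \<chi> c (wdeg (Word u)) * fw q u (mon w)"
    by (rule fw_weight) (simp_all add: bichar_simps[OF bichar])
  then show ?case by (auto simp: x Phi_def algebra_simps)
qed (auto simp: algebra_simps)

lemma Phi_opL: "Phi \<chi> u (a, b) v (app (opL \<chi> c) t) = inverse (\<chi> (wdeg (Word u)) c) * Phi \<chi> u (a, b - c) v t"
proof (induction t rule: pm_induct)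
  case (single x d)
  obtain w a' b' w' where x: "x = (w, (a', b'), w')" by (cases x) auto
  have "inverse (\<chi> (wdeg w) c) * fw q u (mon w) = inverse (\<chi> (wdeg (Word u)) c) * fw q u (mon w)"
    by (rule fw_weight) (simp_all add: bichar_simps[OF bichar])
  then show ?case by (auto simp: x Phi_def algebra_simps)
qed (auto simp: algebra_simps)

lemma sum_list_const_mult: "(\<Sum>(c, u')\<leftarrow>l. c * (d * f u')) = d * (\<Sum>(c, u')\<leftarrow>l. c * f u')" for d :: 'k
  by (induction l) (auto simp: algebra_simps)

lemma Phi_opE: "Phi \<chi> u m v (app (opE j) t) = (\<Sum>(c, u')\<leftarrow>dl q j u. c * Phi \<chi> u' m v t)"
proof (induction t rule: pm_induct)
  case zero
  have "(\<Sum>(c, u')\<leftarrow>l. c * 0) = (0 :: 'k)" for l :: "('k \<times> 'i list) list" by (induction l) auto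
  then show ?case by simp
next
  case (add s t)
  have "(\<Sum>(c, u')\<leftarrow>l. c * (f u' + g u')) = (\<Sum>(c, u')\<leftarrow>l. c * f u') + (\<Sum>(c, u')\<leftarrow>l. c * g u')"
    for l :: "('k \<times> 'i list) list" and f g by (induction l) (auto simp: algebra_simps)
  then show ?case using add by simp
next
  case (single x d)
  obtain w m' w' where x: "x = (w, m', w')" by (cases x) auto
  have "Phi \<chi> u m v (app (opE j) (Poly_Mapping.single x d))
      = (if m' = m then d * fw q v (frev (mon w')) * fw q u (gen j * mon w) else 0)"
    by (simp add: x Phi_def gen_mult_single)
  also have "\<dots> = (\<Sum>(c, u')\<leftarrow>dl q j u. c * ((if m' = m then d * fw q v (frev (mon w')) else 0) * fw q u' (mon w)))"
    by (simp only: sum_list_const_mult fw_gen_mult) simp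
  also have "\<dots> = (\<Sum>(c, u')\<leftarrow>dl q j u. c * Phi \<chi> u' m v (Poly_Mapping.single x d))"
    by (rule arg_cong[of _ _ sum_list], rule map_cong) (auto simp: x Phi_def)
  finally show ?case .
qed

text \<open>The elements \<open>E\<^sub>x K\<^sup>m F\<^sub>y\<close> in the model.\<close>

definition J :: "'i wts \<Rightarrow> 'i fmon \<Rightarrow> ('i, 'k) fa \<Rightarrow> ('i pbw \<Rightarrow>\<^sub>0 'k)" where
  "J m v x = app (M.Ev x) (mon (0, m, v))"

lemma J_simps [simp]: "J m v (x + y) = J m v x + J m v y" "J m v 0 = 0" "J m v (scl c x) = scl c (J m v x)"
  by (simp_all add: J_def)

lemma J_mon [simp]: "J m v (mon w) = mon (w, m, v)"
  by (simp add: J_def Ev_mon)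

lemma Phi_J: "Phi \<chi> u m v (J m' w x) = (if m' = m then fw q u x * fw q v (frev (mon w)) else 0)"
proof (induction x rule: fa_induct)
  case (word w')
  show ?case unfolding J_mon by (simp add: Phi_def)
qed (auto simp: algebra_simps)

lemma opF_mon: "app (opF \<chi> j) (mon (w, (a, b), v)) =
    scl (\<chi> a (al j) * inverse (\<chi> (al j) b)) (mon (w, (a, b), Word [j] + v))
    - J (a + al j, b) v (rd q j (mon w)) + app (opL \<chi> (al j)) (J (a, b) v (ld q j (mon w)))"
proof -
  let ?o = "mon (0, (a, b), v) :: 'i pbw \<Rightarrow>\<^sub>0 'k"
  have F0: "app (opF \<chi> j) ?o = scl (\<chi> a (al j) * inverse (\<chi> (al j) b)) (mon (0, (a, b), Word [j] + v))"
    by (simp add: zero_fmon_def)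
  have K0: "app (opK \<chi> (al j)) ?o = mon (0, (a + al j, b), v)" by (simp add: bichar_simps[OF bichar])
  have "opF \<chi> j * M.Ev (mon w) = M.Ev (mon w) * opF \<chi> j - M.Ev (rd q j (mon w)) * opK \<chi> (al j) + opL \<chi> (al j) * M.Ev (ld q j (mon w))"
    using M.Ev_F[of "mon w" j] by (simp add: algebra_simps)
  then have "app (opF \<chi> j) (app (M.Ev (mon w)) ?o) = app (M.Ev (mon w)) (app (opF \<chi> j) ?o)
     - app (M.Ev (rd q j (mon w))) (app (opK \<chi> (al j)) ?o) + app (opL \<chi> (al j)) (app (M.Ev (ld q j (mon w))) ?o)"
    by (drule_tac arg_cong[of _ _ "\<lambda>f. app f ?o"]) (simp only: app_simps)
  then show ?thesis unfolding F0 K0 J_def by (simp only: app_simps Ev_mon) simp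
qed

lemma Phi_opF:
  "Phi \<chi> u (a, b) (rev v) (app (opF \<chi> j) t) =
     \<chi> a (al j) * inverse (\<chi> (al j) b) * (\<Sum>(c, v')\<leftarrow>dl (transp q) j v. c * Phi \<chi> u (a, b) (rev v') t)
     - Phi \<chi> (u @ [j]) (a - al j, b) (rev v) t
     + inverse (\<chi> (wdeg (Word u)) (al j)) * Phi \<chi> (j # u) (a, b - al j) (rev v) t"
proof (induction t rule: pm_induct)
  case zero
  have "(\<Sum>(c, u')\<leftarrow>l. c * 0) = (0 :: 'k)" for l :: "('k \<times> 'i list) list" by (induction l) auto
  then show ?case by simp
next
  case (add s t)
  have "(\<Sum>(c, u')\<leftarrow>l. c * (f u' + g u')) = (\<Sum>(c, u')\<leftarrow>l. c * f u') + (\<Sum>(c, u')\<leftarrow>l. c * g u')"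
    for l :: "('k \<times> 'i list) list" and f g by (induction l) (auto simp: algebra_simps)
  then show ?case using add by (simp add: algebra_simps)
next
  case (single x d)
  obtain w a' b' w' where x: "x = (w, (a', b'), w')" by (cases x) auto
  have 1: "Phi \<chi> u (a, b) (rev v) (mon (w, (a', b'), Word [j] + w')) =
     (\<Sum>(c, v')\<leftarrow>dl (transp q) j v. c * Phi \<chi> u (a, b) (rev v') (mon (w, (a', b'), w')))"
  proof -
    have "frev (mon (Word [j] + w') :: ('i, 'k) fa) = frev (mon w') * gen j"
      by (metis frev_gen frev_mult gen_mult_single)
    then have "Phi \<chi> u (a, b) (rev v) (mon (w, (a', b'), Word [j] + w')) =
       (if (a', b') = (a, b) then fw q u (mon w) else 0) * fw q (rev v) (frev (mon w') * gen j)"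
      by (simp add: Phi_def)
    also have "\<dots> = (\<Sum>(c, v')\<leftarrow>dl (transp q) j v. c * ((if (a', b') = (a, b) then fw q u (mon w) else 0) * fw q (rev v') (frev (mon w'))))"
      by (simp only: sum_list_const_mult fw_mult_gen)
    also have "\<dots> = (\<Sum>(c, v')\<leftarrow>dl (transp q) j v. c * Phi \<chi> u (a, b) (rev v') (mon (w, (a', b'), w')))"
      by (rule arg_cong[of _ _ sum_list], rule map_cong) (auto simp: Phi_def)
    finally show ?thesis .
  qed
  have e: "(a' = a - al j) = (a' + al j = a)" "(b' = b - al j) = (b' + al j = b)" by auto
  have 2: "Phi \<chi> u (a, b) (rev v) (J (a' + al j, b') w' (rd q j (mon w))) = Phi \<chi> (u @ [j]) (a - al j, b) (rev v) (mon (w, (a', b'), w'))"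
    by (simp add: Phi_J fw_rd) (simp add: Phi_def e)
  have 3: "Phi \<chi> u (a, b) (rev v) (app (opL \<chi> (al j)) (J (a', b') w' (ld q j (mon w)))) =
     inverse (\<chi> (wdeg (Word u)) (al j)) * Phi \<chi> (j # u) (a, b - al j) (rev v) (mon (w, (a', b'), w'))"
    unfolding Phi_opL Phi_J by (simp add: Phi_def)
  have 4: "(\<chi> a' (al j) * inverse (\<chi> (al j) b')) * Phi \<chi> u (a, b) z (mon (w, (a', b'), z'))
      = (\<chi> a (al j) * inverse (\<chi> (al j) b)) * Phi \<chi> u (a, b) z (mon (w, (a', b'), z'))" for z z'
    by (simp add: Phi_def)
  have main: "Phi \<chi> u (a, b) (rev v) (app (opF \<chi> j) (mon x)) =
     \<chi> a (al j) * inverse (\<chi> (al j) b) * (\<Sum>(c, v')\<leftarrow>dl (transp q) j v. c * Phi \<chi> u (a, b) (rev v') (mon x))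
     - Phi \<chi> (u @ [j]) (a - al j, b) (rev v) (mon x)
     + inverse (\<chi> (wdeg (Word u)) (al j)) * Phi \<chi> (j # u) (a, b - al j) (rev v) (mon x)"
    unfolding x opF_mon by (simp only: Phi_simps 2 3 4 1[symmetric])
  have alg: "d * (r * S - P + r' * Q) = r * (d * S) - d * P + r' * (d * Q)" for r r' S P Q :: 'k
    by (simp add: algebra_simps)
  have "Phi \<chi> u (a, b) (rev v) (app (opF \<chi> j) (scl d (mon x))) =
     \<chi> a (al j) * inverse (\<chi> (al j) b) * (\<Sum>(c, v')\<leftarrow>dl (transp q) j v. c * Phi \<chi> u (a, b) (rev v') (scl d (mon x)))
     - Phi \<chi> (u @ [j]) (a - al j, b) (rev v) (scl d (mon x))
     + inverse (\<chi> (wdeg (Word u)) (al j)) * Phi \<chi> (j # u) (a, b - al j) (rev v) (scl d (mon x))"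
    unfolding app_simps Phi_simps main sum_list_const_mult by (rule alg)
  then show ?case by simp
qed

lemma SF_linear: "0 \<in> SF \<chi>" "x \<in> SF \<chi> \<Longrightarrow> y \<in> SF \<chi> \<Longrightarrow> x + y \<in> SF \<chi>" "x \<in> SF \<chi> \<Longrightarrow> scl c x \<in> SF \<chi>"
  by (auto simp: SF_def)

lemma SF_left_gen:
  assumes x: "x \<in> SF \<chi>" shows "gen g * x \<in> SF \<chi>"
proof -
  have 0: "Phi \<chi> u m v (nf \<chi> x) = 0" for u m v using x unfolding SF_def by blast
  have s: "(\<Sum>(c, u')\<leftarrow>l. 0) = (0 :: 'k)" for l :: "('k \<times> 'i list) list" by (induction l) auto
  have 1: "Phi \<chi> u (a, b) (rev v) (app (opX \<chi> g) (nf \<chi> x)) = 0" for u a b v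
    by (cases g) (simp_all add: Phi_opK Phi_opL Phi_opE Phi_opF 0 s)
  have "Phi \<chi> u m v (app (opX \<chi> g) (nf \<chi> x)) = 0" for u m v
    using 1[of u "fst m" "snd m" "rev v"] by simp
  then show ?thesis by (simp add: SF_def)
qed

lemma SF_left: "x \<in> SF \<chi> \<Longrightarrow> y * x \<in> SF \<chi>"
  by (induction y rule: fa_word_induct) (auto simp: distrib_right mult.assoc intro: SF_linear SF_left_gen)

lemma R_SF: "R \<subseteq> SF \<chi>"
  by (auto simp: SF_def nf_zero_iff[symmetric])

lemma eqm_SF: "eqm R x y \<Longrightarrow> y \<in> SF \<chi> \<Longrightarrow> x \<in> SF \<chi>"
  using nf_eq[of x y] by (simp add: SF_def)

lemma ph4_R: "x \<in> R \<Longrightarrow> ph4 x \<in> R"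
proof -
  have I: "tideal {x. ph4 x \<in> R}" using tideal_closed[OF R] by (auto simp: tideal_def)
  have sw: "g \<in> cartan_gens \<Longrightarrow> swEF g = g" for g :: "'i ugen" by (auto elim: cartan_cases)
  have "rho \<chi> (ph4 r) = 0" if "r \<in> \<U>_rels \<chi>" for r
    using that unfolding \<U>_rels_def const_mult
  proof (elim UnE CollectE exE conjE)
    fix x y assume "r = gen x * gen y - gen y * gen x" "x \<in> cartan_gens" "y \<in> cartan_gens"
    then show ?thesis using M.cart_comm[of x y] by (simp add: sw)
  next
    fix i j assume "r = gen (GE i) * gen (GF j) - gen (GF j) * gen (GE i) - (if i = j then gen (GK i) - gen (GL i) else 0)"
    then show ?thesis using M.EF[of j i] by auto
  qed (simp_all add: M.K'K M.L'L M.K'E M.K'F M.L'E M.L'F mult.assoc[symmetric] del: opX.simps,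
      simp_all add: mult.assoc M.K'K M.L'L del: opX.simps)
  then have "\<U>_rels \<chi> \<subseteq> {x. ph4 x \<in> R}"
    using rho_eq_iff[of _ 0] by (auto simp: eqm_def)
  then show "x \<in> R \<Longrightarrow> ph4 x \<in> R" using U_ideal(3)[OF I] by blast
qed

lemma ph4_gw: "set c \<subseteq> cartan_gens \<Longrightarrow> ph4 (gw c) = gw (rev c)"
  by (induction c) (auto simp: gw_append elim!: cartan_cases)

lemma Phi_nf_ph4: "Phi \<chi> u m v (nf \<chi> (ph4 x)) = Phi \<chi> v m u (nf \<chi> x)"
proof -
  have "Phi \<chi> u m v (nf \<chi> (ph4 (emb t))) = Phi \<chi> v m u t" for t
  proof (induction t rule: pm_induct)
    case (single b c)
    obtain w m' w' where b: "b = (w, m', w')" by (cases b)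
    have "ph4 (emb (mon b :: 'i pbw \<Rightarrow>\<^sub>0 'k)) = el (frev (mon w')) (rev (kw m')) (frev (mon w))"
      by (simp add: b el_def ph4_embE ph4_embF ph4_gw kw mult.assoc)
    then have "nf \<chi> (ph4 (emb (mon b :: 'i pbw \<Rightarrow>\<^sub>0 'k))) = mon (Word (rev (letters w')), m', Word (rev (letters w)))"
      using nf_el[of "rev (kw m')"] kw[of m'] by simp
    then have "Phi \<chi> u m v (nf \<chi> (ph4 (emb (mon b)))) = Phi \<chi> v m u (mon b)"
      by (simp add: Phi_def b)
    then have "Phi \<chi> u m v (nf \<chi> (ph4 (emb (scl c (mon b))))) = Phi \<chi> v m u (scl c (mon b))"
      by (simp only: emb_linear ph4_simps nf_simps Phi_simps)
    then show ?case by simp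
  qed auto
  moreover have "eqm R (ph4 x) (ph4 (emb (nf \<chi> x)))"
    using ph4_R[of "x - emb (nf \<chi> x)"] emb_nf[of x] by (simp add: eqm_def)
  ultimately show ?thesis using nf_eq by metis
qed

lemma ph4_SF: "x \<in> SF \<chi> \<Longrightarrow> ph4 x \<in> SF \<chi>"
  by (simp add: SF_def Phi_nf_ph4)

lemma SF: "tideal (SF \<chi>)"
proof -
  have "x * y \<in> SF \<chi>" if "x \<in> SF \<chi>" for x y
    using ph4_SF[OF SF_left[OF ph4_SF[OF that], of "ph4 y"]] by simp
  then show ?thesis unfolding tideal_def using SF_linear SF_left by auto
qed

lemma nf_el_general: "set c \<subseteq> cartan_gens \<Longrightarrow> nf \<chi> (el x c (mon v)) = J (cwl c) v x"
proof (induction x rule: fa_induct)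
  case (word w)
  show ?case using nf_el[OF word] unfolding J_mon .
next
  case (add x y)
  have "el (x + y) c (mon v) = el x c (mon v) + el y c (mon v)" by (simp add: el_def distrib_right)
  then show ?case using add by simp
next
  case (scl d x)
  have "el (scl d x) c (mon v) = scl d (el x c (mon v))" by (simp add: el_def)
  then show ?case using scl by simp
qed

lemma el_scl: "el (scl d x) c y = scl d (el x c y)" "el x c (scl d y) = scl d (el x c y)"
  by (simp_all add: el_def)

lemma embE_SF_iff: "embE x \<in> SF \<chi> \<longleftrightarrow> x \<in> radical q"
proof -
  have "nf \<chi> (embE x) = J 0 0 x"
    using nf_el_general[of "[]" x 0] by (simp add: el_def)
  then have nf: "Phi \<chi> u m v (nf \<chi> (embE x)) = (if 0 = m then fw q u x * fw q v (frev (mon 0)) else 0)" for u m v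
    by (simp only: Phi_J)
  have e: "fw q [] (frev (mon 0)) = 1" by (simp add: zero_fmon_def eps_def)
  show ?thesis
  proof
    assume "embE x \<in> SF \<chi>"
    then have "Phi \<chi> u 0 [] (nf \<chi> (embE x)) = 0" for u unfolding SF_def by blast
    then show "x \<in> radical q" unfolding nf e by (simp add: radical_def)
  next
    assume "x \<in> radical q"
    then have "Phi \<chi> u m v (nf \<chi> (embE x)) = 0" for u m v unfolding nf by (simp add: radical_def)
    then show "embE x \<in> SF \<chi>" unfolding SF_def by blast
  qed
qed

text \<open>\<open>SF\<close> is spanned, modulo the defining relations, by the ordered products with a factor in the radical.\<close>

lemma SF_induct [consumes 1, case_names R add prod]:
  assumes x: "x \<in> SF \<chi>"
    and PR: "\<And>x. x \<in> R \<Longrightarrow> P x" and Padd: "\<And>x y. P x \<Longrightarrow> P y \<Longrightarrow> P (x + y)"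
    and Pprod: "\<And>x c y. set c \<subseteq> cartan_gens \<Longrightarrow> x \<in> radical q \<or> frev y \<in> radical q \<Longrightarrow> P (el x c y)"
  shows "P x"
proof -
  let ?t = "nf \<chi> x"
  define slice where "slice m = PM.lext (\<lambda>(w, m', v). if m' = m then mon (w, v) else (0 :: 'i fmon \<times> 'i fmon \<Rightarrow>\<^sub>0 'k))" for m :: "'i wts"
  define inj where "inj m = PM.lext (\<lambda>(w, v). (mon (w, m, v) :: 'i pbw \<Rightarrow>\<^sub>0 'k))" for m :: "'i wts"
  have inj_add: "inj m (s + t) = inj m s + inj m t" "inj m 0 = 0" for m s t by (simp_all add: inj_def)
  have slice_add: "slice m (s + t) = slice m s + slice m t" "slice m 0 = 0" for m s t by (simp_all add: slice_def)
  have P0: "P 0" using PR tideal_closed(1)[OF R] by blast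
  have emb_inj: "emb (inj m (tens y z)) = el y (kw m) z" for m y z
  proof (rule bilinear_eqI[of "\<lambda>y z. emb (inj m (tens y z))" "\<lambda>y z. el y (kw m) z"])
    fix a b :: "'i fmon" and c d :: 'k
    have "emb (inj m (tens (Poly_Mapping.single a c) (Poly_Mapping.single b d))) = scl (c * d) (el (mon a) (kw m) (mon b))"
    proof -
      have "inj m (tens (Poly_Mapping.single a c) (Poly_Mapping.single b d)) = scl (c * d) (mon (a, m, b))"
        by (simp add: inj_def)
      then show ?thesis by (simp only: emb_linear)
    qed
    also have "\<dots> = el (scl c (mon a)) (kw m) (scl d (mon b))"
      by (simp only: el_scl(1)) (simp only: el_scl(2) scl_laws(3))
    finally show "emb (inj m (tens (Poly_Mapping.single a c) (Poly_Mapping.single b d))) = el (Poly_Mapping.single a c) (kw m) (Poly_Mapping.single b d)"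
      by simp
  qed (simp_all add: inj_add el_def distrib_left distrib_right)
  have slice_P: "P (emb (inj m (slice m ?t)))" for m
  proof (rule tensor_annihilator[of "range (fw q)" "range (\<lambda>v y. fw q v (frev y))" "radical q" "{y. frev y \<in> radical q}"
      _ "\<lambda>s. P (emb (inj m s))"])
    show "ten2 f g (slice m ?t) = 0" if fg: "f \<in> range (fw q)" "g \<in> range (\<lambda>v y. fw q v (frev y))" for f g
    proof -
      obtain u v where uv: "f = fw q u" "g = (\<lambda>y. fw q v (frev y))" using fg by auto
      have "ten2 (fw q u) (\<lambda>y. fw q v (frev y)) (slice m t) = Phi \<chi> u m v t" for t
        by (induction t rule: pm_induct) (auto simp: slice_add, auto simp: ten2_def slice_def Phi_def)
      moreover have "Phi \<chi> u m v ?t = 0" using x unfolding SF_def by blast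
      ultimately show ?thesis by (simp add: uv)
    qed
    show "P (emb (inj m (tens y z)))" if "y \<in> radical q \<or> z \<in> {y. frev y \<in> radical q}" for y z
      unfolding emb_inj by (rule Pprod[OF kw(1)]) (use that in simp)
  qed (auto simp: radical_def inj_add P0 intro: Padd)
  have emb_P: "P (emb (\<Sum>m\<in>B. inj m (slice m ?t)))" if "finite B" for B
    using that by induction (auto simp: P0 intro: Padd slice_P)
  have "t = (\<Sum>m\<in>B. inj m (slice m t))" if "finite B" "(\<lambda>(w, m, v). m) ` keys t \<subseteq> B" for B t
    using that
  proof -
    have "(\<Sum>m\<in>B. inj m (slice m (\<Sum>b\<in>C. Poly_Mapping.single b (lookup t b)))) = (\<Sum>b\<in>C. Poly_Mapping.single b (lookup t b))"
      if "finite C" "(\<lambda>(w, m, v). m) ` C \<subseteq> B" for C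
      using that
    proof (induction C)
      case (insert b C)
      obtain w m v where b: "b = (w, m, v)" by (cases b)
      have "inj m' (slice m' (Poly_Mapping.single b d)) = (if m' = m then Poly_Mapping.single b d else 0)" for m' d
        by (simp add: slice_def inj_def b)
      then have "(\<Sum>m'\<in>B. inj m' (slice m' (Poly_Mapping.single b d))) = Poly_Mapping.single b d" for d
        using insert.prems \<open>finite B\<close> by (simp add: b)
      then show ?case using insert by (simp add: slice_add inj_add sum.distrib)
    qed (simp add: slice_add inj_add)
    from this[of "keys t"] show ?thesis using that(2) pm_sum_singles[of t] by simp
  qed
  from this[of "(\<lambda>(w, m, v). m) ` keys ?t" ?t] have "P (emb ?t)" using emb_P[of "(\<lambda>(w, m, v). m) ` keys ?t"] by simp
  moreover have "P (x - emb ?t)" using emb_nf[of x] by (intro PR) (simp add: eqm_def)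
  ultimately show ?thesis using Padd[of "x - emb ?t" "emb ?t"] by simp
qed

end

section \<open>Reflections of bicharacters\<close>

definition cmin :: "'k::field \<Rightarrow> 'k \<Rightarrow> nat \<Rightarrow> bool" where
  "cmin q r m \<longleftrightarrow> qnum q (m + 1) = 0 \<or> q ^ m * r = 1"

definition nn :: "'i \<Rightarrow> ('i, 'k::field) bichar \<Rightarrow> 'i \<Rightarrow> nat" where
  "nn p \<chi> i = nat (- cartan \<chi> p i)"

lemma cartan_p [simp]: "cartan \<chi> p p = 2"
  by (simp add: cartan_def)

lemma nn_Least: "i \<noteq> p \<Longrightarrow> nn p \<chi> i = (LEAST m. cmin (qm \<chi> p p) (qm \<chi> p i * qm \<chi> i p) m)"
  unfolding nn_def cartan_def cmin_def by (simp add: mult.assoc)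

lemma cartan_nn: "i \<noteq> p \<Longrightarrow> cartan \<chi> p i = - int (nn p \<chi> i)"
  by (simp add: nn_def cartan_def)

lemma cmin_nn:
  assumes "p_finite p \<chi>" "i \<noteq> p"
  shows "cmin (qm \<chi> p p) (qm \<chi> p i * qm \<chi> i p) (nn p \<chi> i)"
    "m < nn p \<chi> i \<Longrightarrow> \<not> cmin (qm \<chi> p p) (qm \<chi> p i * qm \<chi> i p) m"
proof -
  have "\<exists>m. cmin (qm \<chi> p p) (qm \<chi> p i * qm \<chi> i p) m"
    using assms unfolding p_finite_def cmin_def by (auto simp: mult.assoc)
  then show "cmin (qm \<chi> p p) (qm \<chi> p i * qm \<chi> i p) (nn p \<chi> i)"
    unfolding nn_Least[OF assms(2)] by (rule LeastI_ex)
  show "m < nn p \<chi> i \<Longrightarrow> \<not> cmin (qm \<chi> p p) (qm \<chi> p i * qm \<chi> i p) m"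
    unfolding nn_Least[OF assms(2)] by (rule not_less_Least)
qed

lemma p_finite_iff: "p_finite p \<chi> \<longleftrightarrow> (\<forall>i. i \<noteq> p \<longrightarrow> (\<exists>m. cmin (qm \<chi> p p) (qm \<chi> p i * qm \<chi> i p) m))"
  unfolding p_finite_def cmin_def by (simp add: mult.assoc)

lemma qnum_simps [simp]: "qnum q 0 = 0" "qnum q (Suc n) = qnum q n + q ^ n"
  by (simp_all add: qnum_def)

lemma qnum_Suc2: "qnum q (Suc n) = 1 + q * qnum q n"
proof (induction n)
  case (Suc n)
  have "qnum q (Suc (Suc n)) = qnum q (Suc n) + q ^ Suc n" by (rule qnum_simps(2))
  also have "\<dots> = 1 + q * qnum q n + q ^ Suc n" by (simp only: Suc)
  also have "\<dots> = 1 + q * qnum q (Suc n)" by (simp add: algebra_simps)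
  finally show ?case .
qed simp

lemma qnum_add: "qnum q (m + n) = qnum q m + q ^ m * qnum q n"
  by (induction n) (auto simp: algebra_simps power_add)

lemma qnum_zero_power: "qnum q n = 0 \<Longrightarrow> q ^ n = 1"
  for q :: "'k::field"
proof -
  have "(q - 1) * qnum q n = q ^ n - 1" by (induction n) (auto simp: algebra_simps)
  then show "qnum q n = 0 \<Longrightarrow> q ^ n = 1" by simp
qed

lemma qnum_inverse: "q \<noteq> 0 \<Longrightarrow> q ^ n * qnum (inverse q) (Suc n) = qnum q (Suc n)" for q :: "'k::field"
proof (induction n)
  case (Suc n)
  have "q ^ Suc n * qnum (inverse q) (Suc (Suc n)) = q * (q ^ n * qnum (inverse q) (Suc n)) + q ^ Suc n * inverse q ^ Suc n"
    by (simp add: algebra_simps)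
  also have "q ^ Suc n * inverse q ^ Suc n = 1" using Suc.prems by (simp add: power_inverse field_simps)
  also have "q * (q ^ n * qnum (inverse q) (Suc n)) + 1 = qnum q (Suc (Suc n))"
    using Suc by (simp only: qnum_Suc2[of q "Suc n"]) (simp add: add.commute)
  finally show ?case .
qed simp

lemma qnum_inverse_zero: "q \<noteq> 0 \<Longrightarrow> qnum (inverse q) (Suc n) = 0 \<longleftrightarrow> qnum q (Suc n) = 0" for q :: "'k::field"
  using qnum_inverse[of q n] by (metis mult_eq_0_iff power_not_zero)

lemma cmin_inverse: "q \<noteq> 0 \<Longrightarrow> cmin (inverse q) (inverse r) m \<longleftrightarrow> cmin q r m" for q :: "'k::field"
  unfolding cmin_def using qnum_inverse_zero[of q m]
  by (metis Suc_eq_plus1 inverse_eq_1_iff inverse_mult_distrib power_inverse)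

lemma qm_inv [simp]: "qm (bichar_inv \<chi>) i j = inverse (qm \<chi> i j)"
  by (simp add: qm_def bichar_inv_def)

lemma qm_op_app: "qm (bichar_op \<chi>) i j = qm \<chi> j i"
  by (simp add: qm_def bichar_op_def)

lemma cartan_op: "cartan (bichar_op \<chi>) p i = cartan \<chi> p i"
  by (simp add: cartan_def transp_def mult_ac)

lemma cartan_inv:
  assumes "bicharacter \<chi>" shows "cartan (bichar_inv \<chi>) p i = cartan \<chi> p i"
proof (cases "i = p")
  case False
  have "cmin (inverse (qm \<chi> p p)) (inverse (qm \<chi> p i * qm \<chi> i p)) m \<longleftrightarrow> cmin (qm \<chi> p p) (qm \<chi> p i * qm \<chi> i p) m" for m
    by (rule cmin_inverse) (rule qm_nonzero[OF assms])
  then show ?thesis using False by (simp add: cartan_nn nn_Least)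
qed simp

lemma p_finite_op: "p_finite p \<chi> \<Longrightarrow> p_finite p (bichar_op \<chi>)"
  by (simp add: p_finite_iff transp_def mult_ac)

lemma p_finite_inv: "bicharacter \<chi> \<Longrightarrow> p_finite p \<chi> \<Longrightarrow> p_finite p (bichar_inv \<chi>)"
  using cmin_inverse[OF qm_nonzero[of \<chi> p p]] by (simp add: p_finite_iff flip: inverse_mult_distrib)

lemma refl_simps [simp]: "reflection p \<chi> (a + b) = reflection p \<chi> a + reflection p \<chi> b"
  "reflection p \<chi> (a - b) = reflection p \<chi> a - reflection p \<chi> b" "reflection p \<chi> (- a) = - reflection p \<chi> a"
  "reflection p \<chi> 0 = 0" "reflection p \<chi> (frag_cmul c a) = frag_cmul c (reflection p \<chi> a)"
  by (simp_all add: reflection_def frag_extend_add frag_extend_diff frag_extend_minus frag_extend_cmul)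

lemma refl_al: "reflection p \<chi> (al i) = (if i = p then - al p else al i + frag_cmul (int (nn p \<chi> i)) (al p))"
proof (cases "i = p")
  case True
  have "frag_cmul 2 (al p) = al p + al p" using frag_cmul_distrib[of 1 1 "al p"] by simp
  then show ?thesis using True by (simp add: reflection_def)
qed (simp add: reflection_def cartan_nn)

lemma refl_refl [simp]: "reflection p \<chi> (reflection p \<chi> a) = a"
proof (rule frag_induction[of a UNIV])
  have "frag_cmul c (- a) = frag_cmul (- c) a" for c and a :: "'a \<Rightarrow>\<^sub>0 int"
    by (rule poly_mapping_eqI) (simp add: lookup_minus)
  then have "frag_cmul c (al p) + frag_cmul c (- al p) = 0" for c
    by (simp flip: frag_cmul_distrib)
  then show "reflection p \<chi> (reflection p \<chi> (al i)) = al i" for i by (simp add: refl_al)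
qed auto

lemma inv_refl: "inv_into UNIV (reflection p \<chi>) = reflection p \<chi>"
  by (rule inv_equality) auto

lemma rp_app: "rp p \<chi> a b = \<chi> (reflection p \<chi> a) (reflection p \<chi> b)"
  by (simp add: rp_def inv_refl)

lemma rp_bichar [simp]: "bicharacter \<chi> \<Longrightarrow> bicharacter (rp p \<chi>)"
  unfolding bicharacter_def by (simp add: rp_app)

lemma refl_cong: "(\<And>i. cartan \<chi> p i = cartan \<psi> p i) \<Longrightarrow> reflection p \<chi> = reflection p \<psi>"
  by (simp add: reflection_def)

lemma rp_op: "rp p (bichar_op \<chi>) = bichar_op (rp p \<chi>)"
proof -
  have "reflection p (bichar_op \<chi>) = reflection p \<chi>" by (rule refl_cong) (rule cartan_op)
  then show ?thesis by (simp add: fun_eq_iff rp_app) (simp add: bichar_op_def rp_app)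
qed

lemma rp_inv: "bicharacter \<chi> \<Longrightarrow> rp p (bichar_inv \<chi>) = bichar_inv (rp p \<chi>)"
proof -
  assume b: "bicharacter \<chi>"
  have "reflection p (bichar_inv \<chi>) = reflection p \<chi>" by (rule refl_cong) (rule cartan_inv[OF b])
  then show ?thesis by (simp add: fun_eq_iff rp_app) (simp add: bichar_inv_def rp_app)
qed

lemma qm_rp:
  assumes b: "bicharacter \<chi>"
  shows "qm (rp p \<chi>) p p = qm \<chi> p p"
    "i \<noteq> p \<Longrightarrow> qm (rp p \<chi>) p i = inverse (qm \<chi> p i * qm \<chi> p p ^ nn p \<chi> i)"
    "i \<noteq> p \<Longrightarrow> qm (rp p \<chi>) i p = inverse (qm \<chi> i p * qm \<chi> p p ^ nn p \<chi> i)"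
  by (simp_all add: qm_def rp_app refl_al bichar_simps[OF b] mult_ac power_inverse)

lemma cmin_reflect:
  fixes q r :: "'k::field"
  assumes q: "q \<noteq> 0" and r: "r \<noteq> 0" and N: "cmin q r N" and min: "\<And>m. m < N \<Longrightarrow> \<not> cmin q r m"
    and r': "r' = inverse (r * q ^ (2 * N))"
  shows "cmin q r' N" "m < N \<Longrightarrow> \<not> cmin q r' m"
proof -
  have c: "(q ^ N * r = 1 \<and> r' = r) \<or> (qnum q (N + 1) = 0 \<and> r' = inverse r * q ^ 2)"
  proof (cases "q ^ N * r = 1")
    case True
    have "r * (r * q ^ (2 * N)) = (q ^ N * r) * (q ^ N * r)" by (simp only: mult_2 power_add) (simp only: mult_ac)
    then have "r' = r" using True r' by (metis inverse_unique mult.commute mult_1)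
    then show ?thesis using True by simp
  next
    case False
    then have 0: "qnum q (N + 1) = 0" using N by (auto simp: cmin_def)
    have "q ^ (2 * N) * q ^ 2 = q ^ (N + 1) * q ^ (N + 1)" by (simp flip: power_add) (simp add: mult_2)
    then have "q ^ (2 * N) * q ^ 2 = 1" using qnum_zero_power[OF 0] by simp
    then have "inverse (q ^ (2 * N)) = q ^ 2" by (rule inverse_unique)
    then show ?thesis using 0 r' by (simp add: inverse_mult_distrib)
  qed
  then show "cmin q r' N" by (auto simp: cmin_def)
  assume m: "m < N"
  show "\<not> cmin q r' m"
  proof
    assume a: "cmin q r' m"
    have nq: "qnum q (m + 1) \<noteq> 0" using min[OF m] by (simp add: cmin_def)
    then have e: "q ^ m * r' = 1" using a by (simp add: cmin_def)
    from c show False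
    proof
      assume "q ^ N * r = 1 \<and> r' = r" then show False using min[OF m] a by simp
    next
      assume z: "qnum q (N + 1) = 0 \<and> r' = inverse r * q ^ 2"
      have "r * 1 = r * (q ^ m * (inverse r * q ^ 2))" using e z by simp
      also have "\<dots> = (r * inverse r) * (q ^ m * q ^ 2)" by (simp only: mult_ac)
      finally have "r = q ^ m * q ^ 2" using r by simp
      then have "q ^ (N - 1 - m) * r = q ^ (N - 1 - m) * q ^ m * q ^ 2" by (simp add: mult.assoc)
      also have "\<dots> = q ^ (N + 1)" using m by (simp flip: power_add)
      also have "\<dots> = 1" using z by (intro qnum_zero_power) simp
      finally have "cmin q r (N - 1 - m)" by (simp add: cmin_def)
      then show False using min[of "N - 1 - m"] m by simp
    qed
  qed
qed

lemma qm_rp_mult: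
  assumes "bicharacter \<chi>" "i \<noteq> p"
  shows "qm (rp p \<chi>) p i * qm (rp p \<chi>) i p = inverse (qm \<chi> p i * qm \<chi> i p * qm \<chi> p p ^ (2 * nn p \<chi> i))"
  using assms by (simp add: qm_rp mult_2 power_add mult_ac)

lemma nn_rp:
  assumes "bicharacter \<chi>" "p_finite p \<chi>"
  shows "nn p (rp p \<chi>) i = nn p \<chi> i"
proof (cases "i = p")
  case False
  let ?q = "qm \<chi> p p" and ?r = "qm \<chi> p i * qm \<chi> i p"
  note nz = qm_nonzero[OF assms(1)]
  show ?thesis
    unfolding nn_Least[OF False, of "rp p \<chi>"]
  proof (rule Least_equality)
    note c = cmin_reflect[OF _ _ cmin_nn[OF assms(2) False] qm_rp_mult[OF assms(1) False]]
    show "cmin (qm (rp p \<chi>) p p) (qm (rp p \<chi>) p i * qm (rp p \<chi>) i p) (nn p \<chi> i)"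
      unfolding qm_rp(1)[OF assms(1)] by (rule c(1)) (simp_all add: nz)
    show "nn p \<chi> i \<le> m" if "cmin (qm (rp p \<chi>) p p) (qm (rp p \<chi>) p i * qm (rp p \<chi>) i p) m" for m
      using that c(2)[of m] unfolding qm_rp(1)[OF assms(1)] by (simp add: nz) (meson not_le)
  qed
qed (simp add: nn_def)

lemma cartan_rp:
  assumes "bicharacter \<chi>" "p_finite p \<chi>" shows "cartan (rp p \<chi>) p i = cartan \<chi> p i"
  using nn_rp[OF assms] by (cases "i = p") (simp_all add: cartan_nn)

lemma p_finite_rp: "bicharacter \<chi> \<Longrightarrow> p_finite p \<chi> \<Longrightarrow> p_finite p (rp p \<chi>)"
proof -
  assume a: "bicharacter \<chi>" "p_finite p \<chi>"
  have "cmin (qm (rp p \<chi>) p p) (qm (rp p \<chi>) p i * qm (rp p \<chi>) i p) (nn p \<chi> i)" if "i \<noteq> p" for i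
    unfolding qm_rp(1)[OF a(1)]
    by (rule cmin_reflect(1)[OF _ _ cmin_nn[OF a(2) that] qm_rp_mult[OF a(1) that]]) (simp_all add: qm_nonzero[OF a(1)])
  then show ?thesis by (auto simp: p_finite_iff)
qed

lemma refl_rp: "bicharacter \<chi> \<Longrightarrow> p_finite p \<chi> \<Longrightarrow> reflection p (rp p \<chi>) = reflection p \<chi>"
  by (rule refl_cong) (rule cartan_rp)

lemma rp_rp: "bicharacter \<chi> \<Longrightarrow> p_finite p \<chi> \<Longrightarrow> rp p (rp p \<chi>) = \<chi>"
  by (simp add: fun_eq_iff rp_app refl_rp)

lemma lam_nonzero:
  assumes "p_finite p \<chi>" "i \<noteq> p" shows "lam p \<chi> i \<noteq> 0"
proof -
  have "qnum (qm \<chi> p p) (Suc m) \<noteq> 0" "qm \<chi> p p ^ m * (qm \<chi> p i * qm \<chi> i p) \<noteq> 1" if "m < nn p \<chi> i" for m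
    using cmin_nn(2)[OF assms that] by (auto simp: cmin_def)
  then have "qnum (qm \<chi> p p) n \<noteq> 0" if "n \<in> {1..nn p \<chi> i}" for n using that by (cases n) auto
  then show ?thesis
    using \<open>\<And>m. m < nn p \<chi> i \<Longrightarrow> qm \<chi> p p ^ m * (qm \<chi> p i * qm \<chi> i p) \<noteq> 1\<close>
    by (auto simp: lam_def qfact_def mult.assoc simp flip: nn_def)
qed

lemma lam_op: "lam p (bichar_op \<chi>) i = lam p \<chi> i"
  by (simp add: lam_def cartan_op transp_def mult_ac)

lemma qfact_Suc_prod: "qfact q N = (\<Prod>s<N. qnum q (Suc s))"
  unfolding qfact_def by (rule prod.reindex_bij_witness[of _ Suc "\<lambda>n. n - 1"]) auto

lemma qfact_inverse: "q \<noteq> 0 \<Longrightarrow> (\<Prod>s<N. q ^ s) * qfact (inverse q) N = qfact q N" for q :: "'k::field"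
  unfolding qfact_Suc_prod prod.distrib[symmetric] by (rule prod.cong) (simp_all add: qnum_inverse del: qnum_simps)

lemma lam_reflect_aux:
  fixes q r :: "'k::field"
  assumes q: "q \<noteq> 0" and r: "r \<noteq> 0" and N: "cmin q r N" and min: "\<And>m. m < N \<Longrightarrow> \<not> cmin q r m"
    and r': "r' = inverse (r * q ^ (2 * N))"
  shows "(\<Prod>s<N. q ^ s) * (\<Prod>s<N. q ^ s * r' - 1) = (- inverse q) ^ N * (\<Prod>s<N. inverse q ^ s * inverse r - 1)"
proof (cases "q ^ N * r = 1")
  case True
  have ir: "inverse r = q ^ N" using True by (intro inverse_unique) (simp add: mult.commute)
  have r'r: "r' = inverse (q ^ N)"
  proof -
    have "r * q ^ (2 * N) = (q ^ N * r) * q ^ N" by (simp only: mult_2 power_add) (simp only: mult_ac)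
    then have "r * q ^ (2 * N) = q ^ N" using True by simp
    then show ?thesis using r' by simp
  qed
  have "(\<Prod>s<N. q ^ s * r' - 1) = (\<Prod>s<N. q ^ (N - Suc s) * inverse (q ^ N) - 1)"
    unfolding r'r by (rule prod.nat_diff_reindex[symmetric])
  also have "\<dots> = (\<Prod>s<N. inverse (q ^ Suc s) - 1)"
  proof (rule prod.cong)
    fix s assume "s \<in> {..<N}"
    then have "q ^ N = q ^ (N - Suc s) * q ^ Suc s" unfolding power_add[symmetric] by simp
    then show "q ^ (N - Suc s) * inverse (q ^ N) - 1 = inverse (q ^ Suc s) - 1" using q by (simp add: field_simps)
  qed simp
  finally have B: "(\<Prod>s<N. q ^ s * r' - 1) = (\<Prod>s<N. inverse (q ^ Suc s) - 1)" .
  have "(\<Prod>s<N. inverse q ^ s * inverse r - 1) = (\<Prod>s<N. inverse q ^ (N - Suc s) * inverse r - 1)"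
    by (rule prod.nat_diff_reindex[symmetric])
  also have "\<dots> = (\<Prod>s<N. q ^ Suc s - 1)"
  proof (rule prod.cong)
    fix s assume "s \<in> {..<N}"
    then have "q ^ N = q ^ (N - Suc s) * q ^ Suc s" unfolding power_add[symmetric] by simp
    then show "inverse q ^ (N - Suc s) * inverse r - 1 = q ^ Suc s - 1" using q by (simp add: ir power_inverse)
  qed simp
  finally have C: "(\<Prod>s<N. inverse q ^ s * inverse r - 1) = (\<Prod>s<N. q ^ Suc s - 1)" .
  have "(- inverse q) ^ N = (\<Prod>s<N. - inverse q)" by simp
  then show ?thesis
    unfolding B C by (simp only: prod.distrib[symmetric]) (rule prod.cong, auto simp: field_simps q)
next
  case False
  then have 0: "qnum q (N + 1) = 0" using N by (auto simp: cmin_def)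
  have q1: "q ^ (N + 1) = 1" by (rule qnum_zero_power[OF 0])
  have q2: "inverse (q ^ (2 * N)) = q ^ 2"
  proof -
    have "q ^ (2 * N) * q ^ 2 = q ^ (N + 1) * q ^ (N + 1)" by (simp flip: power_add) (simp add: mult_2)
    then show ?thesis using q1 by (intro inverse_unique) simp
  qed
  have BC: "(\<Prod>s<N. q ^ s * r' - 1) = (\<Prod>s<N. inverse q ^ s * inverse r - 1)"
  proof (cases N)
    case (Suc n)
    have r2: "r' = inverse r * q ^ 2" using r' q2 by (simp add: inverse_mult_distrib)
    have "(\<Prod>s<N. inverse q ^ s * inverse r - 1) = (\<Prod>s<n. inverse q ^ Suc s * inverse r - 1) * (inverse r - 1)"
      unfolding Suc by (subst prod.lessThan_Suc_shift) (simp add: mult.commute)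
    also have "(\<Prod>s<n. inverse q ^ Suc s * inverse r - 1) = (\<Prod>s<n. inverse q ^ Suc (n - Suc s) * inverse r - 1)"
      by (rule prod.nat_diff_reindex[symmetric])
    also have "\<dots> = (\<Prod>s<n. q ^ s * r' - 1)"
    proof (rule prod.cong)
      fix s assume s: "s \<in> {..<n}"
      then have eq: "q ^ Suc (n - Suc s) * (q ^ s * q ^ 2) = q ^ (N + 1)" unfolding power_add[symmetric] by (simp add: Suc)
      have "inverse (q ^ Suc (n - Suc s)) = q ^ s * q ^ 2" by (rule inverse_unique, unfold eq, rule q1)
      then show "inverse q ^ Suc (n - Suc s) * inverse r - 1 = q ^ s * r' - 1"
        unfolding power_inverse r2 by (simp add: mult_ac)
    qed simp
    also have "inverse r - 1 = q ^ n * r' - 1"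
    proof -
      have "q ^ n * q ^ 2 = 1" using q1 unfolding Suc by (simp flip: power_add)
      then have "q ^ n * (inverse r * q ^ 2) = inverse r" by (metis mult.commute mult.left_commute mult_1)
      then show ?thesis by (simp add: r2)
    qed
    finally show ?thesis by (simp add: Suc)
  qed simp
  have A: "(\<Prod>s<N. q ^ s) = (- inverse q) ^ N"
  proof -
    have nz: "(\<Prod>s<N. qnum q (Suc s)) \<noteq> 0"
      using min by (auto simp: cmin_def)
    have "(\<Prod>s<N. qnum q (Suc s)) = (\<Prod>s<N. qnum q (Suc (N - Suc s)))"
      by (rule prod.nat_diff_reindex[symmetric])
    also have "\<dots> = (\<Prod>s<N. (- q) * q ^ (N - Suc s) * qnum q (Suc s))"
    proof (rule prod.cong)
      fix s assume s: "s \<in> {..<N}"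
      have "qnum q (Suc (N - Suc s) + Suc s) = 0" using 0 s by (simp add: Suc_diff_Suc)
      then show "qnum q (Suc (N - Suc s)) = (- q) * q ^ (N - Suc s) * qnum q (Suc s)"
        unfolding qnum_add by (simp add: eq_neg_iff_add_eq_0)
    qed simp
    also have "\<dots> = (- q) ^ N * (\<Prod>s<N. q ^ (N - Suc s)) * (\<Prod>s<N. qnum q (Suc s))"
      by (simp only: prod.distrib) simp
    also have "(\<Prod>s<N. q ^ (N - Suc s)) = (\<Prod>s<N. q ^ s)"
      by (rule prod.nat_diff_reindex)
    finally have "(- q) ^ N * (\<Prod>s<N. q ^ s) = 1" using nz by simp
    then have "inverse ((- q) ^ N) = (\<Prod>s<N. q ^ s)" by (rule inverse_unique)
    then show ?thesis by (metis inverse_minus_eq power_inverse)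
  qed
  show ?thesis unfolding A BC ..
qed

lemma lam_reflect:
  assumes b: "bicharacter \<chi>" and f: "p_finite p \<chi>" and i: "i \<noteq> p"
  shows "lam p (rp p \<chi>) i = (- inverse (qm \<chi> p p)) ^ nn p \<chi> i * lam p (bichar_inv \<chi>) i"
proof -
  let ?q = "qm \<chi> p p" and ?r = "qm \<chi> p i * qm \<chi> i p" and ?N = "nn p \<chi> i"
  let ?r' = "qm (rp p \<chi>) p i * qm (rp p \<chi>) i p"
  note nz = qm_nonzero[OF b]
  have 1: "lam p (rp p \<chi>) i = qfact ?q ?N * (\<Prod>s<?N. ?q ^ s * ?r' - 1)"
    by (simp add: lam_def cartan_rp[OF b f] qm_rp(1)[OF b] mult.assoc flip: nn_def)
  have 2: "lam p (bichar_inv \<chi>) i = qfact (inverse ?q) ?N * (\<Prod>s<?N. inverse ?q ^ s * inverse ?r - 1)"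
    by (simp add: lam_def cartan_inv[OF b] mult.assoc inverse_mult_distrib flip: nn_def)
  have 3: "(\<Prod>s<?N. ?q ^ s) * (\<Prod>s<?N. ?q ^ s * ?r' - 1) = (- inverse ?q) ^ ?N * (\<Prod>s<?N. inverse ?q ^ s * inverse ?r - 1)"
    by (rule lam_reflect_aux[OF _ _ cmin_nn[OF f i] qm_rp_mult[OF b i]]) (simp_all add: nz)
  have "lam p (rp p \<chi>) i = qfact (inverse ?q) ?N * ((\<Prod>s<?N. ?q ^ s) * (\<Prod>s<?N. ?q ^ s * ?r' - 1))"
    unfolding 1 qfact_inverse[of ?q ?N, OF nz, symmetric] by (simp only: mult_ac)
  also have "\<dots> = (- inverse ?q) ^ ?N * lam p (bichar_inv \<chi>) i"
    unfolding 3 2 by (simp only: mult_ac)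
  finally show ?thesis .
qed

section \<open>Root vectors\<close>

primrec rv :: "'a::ring_1 \<Rightarrow> 'a \<Rightarrow> 'a \<Rightarrow> 'a \<Rightarrow> nat \<Rightarrow> 'a" where
  "rv k k' x y 0 = y"
| "rv k k' x y (Suc m) = x * rv k k' x y m - (k * rv k k' x y m * k') * x"

primrec gv :: "'k::field \<Rightarrow> 'k \<Rightarrow> 'i \<Rightarrow> 'i \<Rightarrow> nat \<Rightarrow> ('i, 'k) fa" where
  "gv s t p i 0 = gen i"
| "gv s t p i (Suc m) = gen p * gv s t p i m - scl (s ^ m * t) (gv s t p i m * gen p)"

lemma tor_gv: "tor a (gv s t p i m) = scl (a p ^ m * a i) (gv s t p i m)"
  by (induction m) (auto simp: mult_ac)

abbreviation epl :: "('i \<Rightarrow> 'i \<Rightarrow> 'k::field) \<Rightarrow> 'i \<Rightarrow> 'i \<Rightarrow> nat \<Rightarrow> ('i, 'k) fa" where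
  "epl q p i \<equiv> gv (q p p) (q p i) p i"

definition cc :: "'k::field \<Rightarrow> 'k \<Rightarrow> nat \<Rightarrow> 'k" where
  "cc q r m = qnum q m * (q ^ (m - 1) * r - 1)"

definition aa :: "'k::field \<Rightarrow> 'k \<Rightarrow> nat \<Rightarrow> 'k" where
  "aa q r m = (\<Prod>s<m. 1 - q ^ s * r)"

lemma rd_p_epl: "i \<noteq> p \<Longrightarrow> rd q p (epl q p i m) = 0"
  by (induction m) (auto simp: rd_mult tor_gv)

lemma rd_other_epl: "j \<noteq> p \<Longrightarrow> j \<noteq> i \<Longrightarrow> rd q j (epl q p i m) = 0"
  by (induction m) (auto simp: rd_mult)

lemma ld_other_epl: "j \<noteq> p \<Longrightarrow> j \<noteq> i \<Longrightarrow> ld q j (epl q p i m) = 0"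
  by (induction m) (auto simp: ld_mult)

lemma ld_i_epl: "i \<noteq> p \<Longrightarrow> q i p \<noteq> 0 \<Longrightarrow> ld q i (epl q p i m) = (if m = 0 then 1 else 0)"
  by (induction m) (auto simp: ld_mult tor_gv)

lemma rd_i_epl: "i \<noteq> p \<Longrightarrow> rd q i (epl q p i m) = scl (aa (q p p) (q p i * q i p) m) (gen p ^ m)"
proof (induction m)
  case (Suc m)
  then show ?case
    by (simp add: rd_mult aa_def power_commutes) (simp add: algebra_simps flip: power_Suc2)
qed (simp add: aa_def)

lemma cc_Suc: "cc q r (Suc m) = q * cc q r m + (q ^ (2 * m) * r - 1)" for q :: "'k::field"
proof -
  have a: "qnum q m + q ^ m = 1 + q * qnum q m" using qnum_Suc2[of q m] by simp
  have b: "q * (qnum q m * (q ^ (m - 1) * r - 1)) = qnum q m * (q ^ m * r - q)"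
    by (cases m) (auto simp: algebra_simps)
  have "(Q + X) * (X * r - 1) = Q * (X * r - q) + (X * X * r - 1)" if "Q + X = 1 + q * Q" for Q X :: 'k
  proof -
    have "(Q + X) * (X * r - 1) = Q * X * r + X * X * r - (Q + X)" by (simp add: algebra_simps)
    also have "\<dots> = Q * X * r + X * X * r - (1 + q * Q)" by (simp only: that)
    also have "\<dots> = Q * (X * r - q) + (X * X * r - 1)" by (simp add: algebra_simps)
    finally show ?thesis .
  qed
  from this[OF a] show ?thesis by (simp only: cc_def b qnum_simps diff_Suc_1 mult_2 power_add)
qed

lemma ld_p_epl: "i \<noteq> p \<Longrightarrow> ld q p (epl q p i (Suc m)) = scl (- cc (q p p) (q p i * q i p) (Suc m)) (epl q p i m)"
proof (induction m)
  case 0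
  then show ?case by (simp add: cc_def ld_mult)
next
  case (Suc m)
  let ?q = "q p p" and ?r = "q p i * q i p"
  let ?x = "epl q p i"
  have "ld q p (?x (Suc (Suc m))) = ?x (Suc m) + scl ?q (gen p * ld q p (?x (Suc m)))
     - scl (?q ^ Suc m * q p i) (ld q p (?x (Suc m)) * gen p) - scl (?q ^ Suc m * q p i * (?q ^ Suc m * q i p)) (?x (Suc m))"
    by (simp only: gv.simps(2)[of _ _ _ _ "Suc m"] ld_linear ld_gen_mult ld_mult ld_gen tor_gv)
      (simp add: mult_ac diff_diff_eq)
  also have "\<dots> = scl (- (?q * cc ?q ?r (Suc m))) (gen p * ?x m - scl (?q ^ m * q p i) (?x m * gen p))
      + scl (1 - ?q ^ (2 * Suc m) * ?r) (?x (Suc m))"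
  proof -
    have "?q ^ (2 * Suc m) = ?q ^ Suc m * ?q ^ Suc m" by (simp only: mult_2 power_add)
    then show ?thesis
      by (simp only: Suc.IH[OF Suc.prems] scl_mult_fa) (simp add: algebra_simps del: gv.simps)
  qed
  also have "gen p * ?x m - scl (?q ^ m * q p i) (?x m * gen p) = ?x (Suc m)" by simp
  also have "scl (- (?q * cc ?q ?r (Suc m))) (?x (Suc m)) + scl (1 - ?q ^ (2 * Suc m) * ?r) (?x (Suc m))
      = scl (- (?q * cc ?q ?r (Suc m)) + (1 - ?q ^ (2 * Suc m) * ?r)) (?x (Suc m))" by (simp only: scl_laws(2))
  also have "- (?q * cc ?q ?r (Suc m)) + (1 - ?q ^ (2 * Suc m) * ?r) = - cc ?q ?r (Suc (Suc m))"
    by (simp only: cc_Suc[of ?q ?r "Suc m"]) (simp add: algebra_simps)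
  finally show ?case .
qed

lemma eps_mult [simp]: "eps (x * y) = eps x * eps y"
  by (induction x rule: fa_word_induct) (auto simp: distrib_right mult.assoc algebra_simps)

lemma eps_gen [simp]: "eps (gen i) = 0"
  using eps_gen_mult[of i 1] by simp

lemma eps_gv: "eps (gv s t p i m) = 0"
  by (induction m) auto

text \<open>Expansion of root vectors; the coefficients are those of \<open>\<Prod>s<m. (1 - q\<^sup>s t z)\<close>.\<close>

fun bc :: "'k::field \<Rightarrow> 'k \<Rightarrow> nat \<Rightarrow> nat \<Rightarrow> 'k" where
  "bc q t 0 k = (if k = 0 then 1 else 0)"
| "bc q t (Suc m) 0 = bc q t m 0"
| "bc q t (Suc m) (Suc k) = bc q t m (Suc k) - q ^ m * t * bc q t m k"

lemma bc_zero: "m < k \<Longrightarrow> bc q t m k = 0"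
  by (induction q t m k rule: bc.induct) auto

lemma bc_0 [simp]: "bc q t m 0 = 1"
  by (induction m) auto

lemma gv_expand: "gv q t p i m = (\<Sum>k\<le>m. scl (bc q t m k) (gen p ^ (m - k) * gen i * gen p ^ k))"
proof (induction m)
  case (Suc m)
  let ?f = "\<lambda>k. gen p ^ (Suc m - k) * gen i * gen p ^ k"
  have 1: "gen p * gv q t p i m = (\<Sum>k\<le>m. scl (bc q t m k) (?f k))"
    unfolding Suc sum_distrib_left
    by (rule sum.cong) (auto simp: Suc_diff_le mult.assoc)
  have 2: "gv q t p i m * gen p = (\<Sum>k\<le>m. scl (bc q t m k) (?f (Suc k)))"
    unfolding Suc sum_distrib_right by (rule sum.cong) (auto simp: mult.assoc power_commutes)
  have "(\<Sum>k\<le>Suc m. scl (bc q t (Suc m) k) (?f k))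
      = scl (bc q t (Suc m) 0) (?f 0) + (\<Sum>k\<le>m. scl (bc q t (Suc m) (Suc k)) (?f (Suc k)))"
    by (rule sum.atMost_Suc_shift)
  also have "\<dots> = (scl (bc q t m 0) (?f 0) + (\<Sum>k\<le>m. scl (bc q t m (Suc k)) (?f (Suc k))))
      - scl (q ^ m * t) (\<Sum>k\<le>m. scl (bc q t m k) (?f (Suc k)))"
    by (simp only: bc.simps scl_laws sum_subtractf PM.sc_sum) (simp add: algebra_simps)
  also have "scl (bc q t m 0) (?f 0) + (\<Sum>k\<le>m. scl (bc q t m (Suc k)) (?f (Suc k)))
      = (\<Sum>k\<le>Suc m. scl (bc q t m k) (?f k))"
    by (rule sum.atMost_Suc_shift[symmetric])
  also have "\<dots> = (\<Sum>k\<le>m. scl (bc q t m k) (?f k))" by (simp add: bc_zero)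
  finally show ?case unfolding gv.simps(2) 1 2 by simp
qed simp

lemma bc_absorb: "qnum q (Suc k) * bc q t m (Suc k) = - (t * q ^ k * qnum q (m - k) * bc q t m k)"
  for q :: "'k::field"
proof (induction m arbitrary: k)
  case (Suc m)
  show ?case
  proof (cases "k \<le> m")
    case False
    then show ?thesis by (simp add: bc_zero)
  next
    case True
    show ?thesis
    proof (cases k)
      case 0
      have "q ^ m * t + t * qnum q m = t * qnum q (Suc m)" by (simp add: algebra_simps)
      then show ?thesis using Suc[of 0] 0 by (simp add: algebra_simps)
    next
      case (Suc j)
      let ?b = "bc q t m k" and ?c = "bc q t m j"
      have ih1: "qnum q (Suc k) * bc q t m (Suc k) = - (t * q ^ k * qnum q (m - k) * ?b)" by (rule Suc.IH)
      have ih2: "qnum q k * ?b = - (t * q ^ j * qnum q (m - j) * ?c)" using Suc.IH[of j] Suc by simp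
      have mj: "m - j = Suc (m - k)" using True Suc by simp
      have p: "q ^ m = q ^ k * q ^ (m - k)" using True by (simp flip: power_add)
      have "qnum q (Suc k) * bc q t (Suc m) (Suc k)
          = - (t * q ^ k * qnum q (m - k) * ?b) - qnum q (Suc k) * (q ^ m * t * ?b)"
        by (simp only: bc.simps right_diff_distrib ih1)
      also have "\<dots> = - (t * q ^ k * qnum q (Suc (m - k)) * ?b) - q ^ m * t * q * (qnum q k * ?b)"
        unfolding p qnum_Suc2[of q k] by (simp add: algebra_simps)
      also have "\<dots> = - (t * q ^ k * qnum q (Suc (m - k)) * (?b - q ^ m * t * ?c))"
        unfolding ih2 mj by (simp add: Suc algebra_simps)
      also have "?b - q ^ m * t * ?c = bc q t (Suc m) k" by (simp add: Suc)
      also have "Suc (m - k) = Suc m - k" using True by simp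
      finally show ?thesis .
    qed
  qed
qed simp

lemma bc_height:
  fixes q :: "'k::field"
  assumes h: "qnum q h = 0" "\<And>k. 0 < k \<Longrightarrow> k < h \<Longrightarrow> qnum q k \<noteq> 0" and k: "0 < k" "k < h"
  shows "bc q t h k = 0"
  using k
proof (induction k)
  case (Suc k)
  have "qnum q (Suc k) * bc q t h (Suc k) = 0"
    unfolding bc_absorb using Suc h(1) by (cases k) auto
  then show ?case using h(2)[of "Suc k"] Suc.prems by simp
qed simp

lemma gv_height:
  assumes h: "qnum q h = 0" "\<And>k. 0 < k \<Longrightarrow> k < h \<Longrightarrow> qnum q k \<noteq> 0" "0 < h"
  shows "gv q t p i h = gen p ^ h * gen i + scl (bc q t h h) (gen i * gen p ^ h)"
proof -
  have "gv q t p i h = (\<Sum>k\<in>{0, h}. scl (bc q t h k) (gen p ^ (h - k) * gen i * gen p ^ k))"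
    unfolding gv_expand by (rule sum.mono_neutral_right) (use bc_height[OF h(1,2)] in auto)
  then show ?thesis using h(3) by simp
qed

text \<open>Reversing the order of the commuting factors \<open>ad\<close>.\<close>

lemma bc_reverse:
  fixes q :: "'k::field" assumes q: "q \<noteq> 0"
  shows "bc (inverse q) (q ^ m * t) (Suc m) k = bc q t (Suc m) k"
proof -
  have shift: "bc q t (Suc m) (Suc k) = bc q (q * t) m (Suc k) - t * bc q (q * t) m k" for m k t
  proof (induction m arbitrary: k)
    case (Suc m)
    show ?case
      by (cases k; simp only: bc.simps(3)[of q t "Suc m"] bc.simps(3)[of q "q * t" m] Suc.IH bc_0; simp add: algebra_simps)
  qed (cases k; simp)
  show ?thesis
  proof (induction m arbitrary: t k)
    case (Suc m)
    show ?case
    proof (cases k)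
      case (Suc j)
      have e: "bc (inverse q) (q ^ Suc m * t) (Suc m) l = bc q (q * t) (Suc m) l" for l
        using Suc.IH[of "q * t" l] by (simp add: mult.assoc mult.left_commute)
      have "inverse q ^ Suc m * (q ^ Suc m * t) = t" using q by (simp add: power_inverse field_simps)
      then have "bc (inverse q) (q ^ Suc m * t) (Suc (Suc m)) (Suc j) = bc q (q * t) (Suc m) (Suc j) - t * bc q (q * t) (Suc m) j"
        by (simp only: bc.simps(3)[of _ _ "Suc m"] e)
      then show ?thesis by (simp only: shift[of t "Suc m"] Suc)
    qed simp
  next
    case 0
    show ?case by (cases k) auto
  qed
qed

lemma gv_reverse: "q \<noteq> 0 \<Longrightarrow> gv (inverse q) (q ^ m * t) p i (Suc m) = gv q t p i (Suc m)"
  unfolding gv_expand bc_reverse ..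

section \<open>Root vectors in the double\<close>

context double_rel
begin

definition wt :: "('i \<Rightarrow>\<^sub>0 int) \<Rightarrow> 'a \<Rightarrow> bool" where
  "wt \<beta> x \<longleftrightarrow> (\<forall>i. K i * x = sc (\<chi> (al i) \<beta>) (x * K i) \<and> L i * x = sc (inverse (\<chi> \<beta> (al i))) (x * L i))"

lemma wt_K: "wt \<beta> x \<Longrightarrow> K i * x = sc (\<chi> (al i) \<beta>) (x * K i)"
  and wt_L: "wt \<beta> x \<Longrightarrow> L i * x = sc (inverse (\<chi> \<beta> (al i))) (x * L i)"
  by (simp_all add: wt_def)

lemma wt_K': "wt \<beta> x \<Longrightarrow> K' i * x = sc (inverse (\<chi> (al i) \<beta>)) (x * K' i)"
  using inverse_skew_comm[OF KK' K'K wt_K] bichar_add(3)[OF bich] by simp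

lemma wt_L': "wt \<beta> x \<Longrightarrow> L' i * x = sc (\<chi> \<beta> (al i)) (x * L' i)"
  using inverse_skew_comm[OF LL' L'L wt_L] bichar_add(3)[OF bich] by simp

lemma wt_mult: "wt \<beta> x \<Longrightarrow> wt \<gamma> y \<Longrightarrow> wt (\<beta> + \<gamma>) (x * y)"
proof -
  have *: "k * (x * y) = sc (c * d) (x * y * k)" if "k * x = sc c (x * k)" "k * y = sc d (y * k)" for k x y c d
  proof -
    have "k * (x * y) = sc c (x * (k * y))" using that(1) by (simp add: mult.assoc[symmetric])
    then show ?thesis by (simp add: that(2) mult.assoc)
  qed
  assume "wt \<beta> x" "wt \<gamma> y"
  then show ?thesis unfolding wt_def
    using *[of _ x _ y] by (auto simp: bichar_simps[OF bich])
qed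

lemma wt_gens: "wt (al i) (E i)" "wt (- al i) (F i)"
  "g \<in> cartan_gens \<Longrightarrow> wt 0 (X g)"
  by (auto simp: wt_def KE LE KF LF bichar_simps[OF bich] cart_comm simp flip: qm_def)

lemma wt_diff: "wt \<beta> x \<Longrightarrow> wt \<beta> y \<Longrightarrow> wt \<beta> (x - y)"
  by (auto simp: wt_def algebra_simps)

lemma wt_sc: "wt \<beta> x \<Longrightarrow> wt \<beta> (sc c x)"
  by (auto simp: wt_def mult.commute)

lemma wt_power: "wt \<beta> x \<Longrightarrow> wt (frag_cmul (int n) \<beta>) (x ^ n)"
proof (induction n)
  case (Suc n)
  have "wt (\<beta> + frag_cmul (int n) \<beta>) (x * x ^ n)" using Suc by (intro wt_mult) auto
  moreover have "\<beta> + frag_cmul (int n) \<beta> = frag_cmul (int (Suc n)) \<beta>" by (simp add: frag_cmul_distrib)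
  ultimately show ?case by (metis power_Suc)
qed (auto simp: wt_def bichar_simps[OF bich])

abbreviation "Ep p i m \<equiv> rv (K p) (K' p) (E p) (E i) m"
abbreviation "Em p i m \<equiv> rv (L p) (L' p) (E p) (E i) m"
abbreviation "Fp p i m \<equiv> rv (L p) (L' p) (F p) (F i) m"
abbreviation "Fm p i m \<equiv> rv (K p) (K' p) (F p) (F i) m"

lemma conj_Ev: "K p * Ev x * K' p = Ev (tor (q p) x)" "L p * Ev x * L' p = Ev (tor (\<lambda>j. inverse (q j p)) x)"
  by (simp_all add: K_Ev L_Ev mult.assoc KK' LL')

lemma Ep_Ev: "Ep p i m = Ev (epl q p i m)"
  by (induction m) (simp_all add: conj_Ev tor_gv)

lemma Em_Ev: "Em p i m = Ev (epl (inv_op q) p i m)"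
  by (induction m) (simp_all add: conj_Ev tor_gv inv_op_def power_inverse)

abbreviation "rr p i \<equiv> q p i * q i p"

lemma Ep_Fp:
  assumes "i \<noteq> p"
  shows "Ep p i (Suc m) * F p - F p * Ep p i (Suc m) = sc (cc (q p p) (rr p i) (Suc m)) (L p * Ep p i m)"
  unfolding Ep_Ev Ev_F using assms by (simp add: rd_p_epl ld_p_epl del: gv.simps)

lemma Ep_F0: "i \<noteq> p \<Longrightarrow> E i * F p = F p * E i"
  using EF[of i p] by (simp add: )

lemma Ep_Fi:
  assumes "i \<noteq> p"
  shows "Ep p i m * F i - F i * Ep p i m = sc (aa (q p p) (rr p i) m) (E p ^ m * K i) - (if m = 0 then L i else 0)"
  unfolding Ep_Ev Ev_F using assms by (simp add: rd_i_epl ld_i_epl del: gv.simps)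

lemma Ep_Fj: "j \<noteq> p \<Longrightarrow> j \<noteq> i \<Longrightarrow> Ep p i m * F j = F j * Ep p i m"
  using Ev_F[of "epl q p i m" j] unfolding Ep_Ev by (simp add: rd_other_epl ld_other_epl del: gv.simps)

lemma wt_root:
  assumes x: "wt \<beta> x" and y: "wt \<gamma> y" and k: "wt 0 k" "wt 0 k'"
  shows "wt (\<gamma> + frag_cmul (int m) \<beta>) (rv k k' x y m)"
proof (induction m)
  case (Suc m)
  have e: "\<beta> + (\<gamma> + frag_cmul (int m) \<beta>) = \<gamma> + frag_cmul (int (Suc m)) \<beta>"
    "0 + (\<gamma> + frag_cmul (int m) \<beta>) + 0 + \<beta> = \<gamma> + frag_cmul (int (Suc m)) \<beta>"
    by (simp_all add: frag_cmul_distrib algebra_simps)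
  show ?case unfolding rv.simps
    by (rule wt_diff) (use wt_mult[OF x Suc] wt_mult[OF wt_mult[OF wt_mult[OF k(1) Suc] k(2)] x] e in metis)+
qed (simp add: y)

lemma wt_Ep: "wt (al i + frag_cmul (int m) (al p)) (Ep p i m)" "wt (al i + frag_cmul (int m) (al p)) (Em p i m)"
  by (rule wt_root; simp add: wt_gens)+

lemma frag_cmul_uminus: "frag_cmul c (- a) = - frag_cmul c a"
  by (rule poly_mapping_eqI) (simp add: lookup_minus)

lemma wt_Fp: "wt (- (al i + frag_cmul (int m) (al p))) (Fp p i m)" "wt (- (al i + frag_cmul (int m) (al p))) (Fm p i m)"
  using wt_root[of "- al p" "F p" "- al i" "F i" _ _ m] by (simp_all add: wt_gens frag_cmul_uminus)

text \<open>Commutators of root vectors for \<open>E\<close> and \<open>F\<close>.\<close>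

lemma L_Fp: "L p * Fp p i n = sc (\<chi> (al i + frag_cmul (int n) (al p)) (al p)) (Fp p i n * L p)"
  using wt_L[OF wt_Fp(1)[of i n p], of p] by (simp only: bichar_uminus[OF bich] inverse_inverse_eq)

lemma Fp_step: "Fp p i (Suc n) = F p * Fp p i n - sc (\<chi> (al i + frag_cmul (int n) (al p)) (al p)) (Fp p i n * F p)"
proof -
  have "L p * Fp p i n * L' p = sc (\<chi> (al i + frag_cmul (int n) (al p)) (al p)) (Fp p i n)"
    unfolding L_Fp by (simp add: mult.assoc LL')
  then show ?thesis by simp
qed

lemma KiKp_F:
  "sc (\<chi> (al i + frag_cmul (int n) (al p)) (al p)) (K i * K p ^ n * F p) = F p * (K i * K p ^ n)"
proof -
  have n: "K p ^ n * F p = sc (inverse (q p p ^ n)) (F p * K p ^ n)"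
  proof (induction n)
    case (Suc n)
    have "K p * (K p ^ n * F p) = sc (inverse (q p p ^ n)) (K p * F p * K p ^ n)" by (simp add: Suc mult.assoc)
    then show ?case by (simp add: KF mult.assoc mult.commute[of "inverse (q p p)"])
  qed simp
  have "K i * K p ^ n * F p = sc (inverse (q p p ^ n)) (K i * F p * K p ^ n)" by (simp add: mult.assoc n)
  also have "\<dots> = sc (inverse (q p p ^ n) * inverse (q i p)) (F p * (K i * K p ^ n))" by (simp add: KF mult.assoc)
  finally show ?thesis by (simp add: bichar_simps[OF bich] qm_def mult_ac)
qed

lemma comm_step:
  assumes "i \<noteq> p" "j \<noteq> p"
  shows "Ep p i (Suc m) * Fp p j (Suc n) - Fp p j (Suc n) * Ep p i (Suc m) =
     F p * (Ep p i (Suc m) * Fp p j n - Fp p j n * Ep p i (Suc m))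
     - sc (\<chi> (al j + frag_cmul (int n) (al p)) (al p)) ((Ep p i (Suc m) * Fp p j n - Fp p j n * Ep p i (Suc m)) * F p)
     + sc (cc (q p p) (rr p i) (Suc m)) (L p * (Ep p i m * Fp p j n - Fp p j n * Ep p i m))"
proof -
  let ?e = "Ep p i (Suc m)" and ?Y = "Fp p j n" and ?s = "\<chi> (al j + frag_cmul (int n) (al p)) (al p)"
  let ?W = "sc (cc (q p p) (rr p i) (Suc m)) (L p * Ep p i m)"
  have YL: "sc ?s (?Y * L p) = L p * ?Y"
    by (rule L_Fp[symmetric])
  have "?e * Fp p j (Suc n) - Fp p j (Suc n) * ?e = F p * (?e * ?Y - ?Y * ?e) - sc ?s ((?e * ?Y - ?Y * ?e) * F p)
     + ((?e * F p - F p * ?e) * ?Y - sc ?s (?Y * (?e * F p - F p * ?e)))"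
    unfolding Fp_step by (simp add: algebra_simps del: rv.simps)
  also have "?e * F p - F p * ?e = ?W" by (rule Ep_Fp[OF assms(1)])
  also have "sc ?s (?Y * ?W) = sc (cc (q p p) (rr p i) (Suc m)) (L p * ?Y * Ep p i m)"
  proof -
    have "sc ?s (?Y * ?W) = sc (cc (q p p) (rr p i) (Suc m)) (sc ?s (?Y * L p) * Ep p i m)"
      by (simp add: mult.assoc mult.commute del: rv.simps)
    then show ?thesis by (simp only: YL)
  qed
  finally show ?thesis by (simp add: algebra_simps del: rv.simps)
qed

lemma comm_different:
  assumes "i \<noteq> p" "j \<noteq> p" "i \<noteq> j"
  shows "Ep p i m * Fp p j n = Fp p j n * Ep p i m"
proof (induction n arbitrary: m)
  case 0
  show ?case using Ep_Fj[of j p i m] assms by simp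
next
  case (Suc n)
  show ?case
  proof (cases m)
    case 0
    have a: "E i * F p = F p * E i" by (rule Ep_F0[OF assms(1)])
    have b: "E i * Fp p j n = Fp p j n * E i" using Suc[of 0] by simp
    have c: "E i * (F p * Fp p j n) = F p * Fp p j n * E i"
      by (simp only: mult.assoc[symmetric] a) (simp only: mult.assoc b)
    have d: "E i * (Fp p j n * F p) = Fp p j n * F p * E i"
      by (simp only: mult.assoc[symmetric] b) (simp only: mult.assoc a)
    show ?thesis unfolding 0 Fp_step rv.simps(1)
      by (simp only: right_diff_distrib left_diff_distrib sc_mult_left sc_mult_right c d)
  next
    case (Suc m')
    have z: "Ep p i l * Fp p j n - Fp p j n * Ep p i l = 0" for l using Suc.IH by simp
    show ?thesis unfolding Suc using comm_step[OF assms(1,2), of m' n] unfolding z by (simp del: rv.simps)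
  qed
qed

lemma Ep_power_F: "E p ^ m * F p - F p * E p ^ m = sc (qnum (q p p) m) (E p ^ (m - 1) * K p - L p * E p ^ (m - 1))"
proof -
  have r: "rd q p (gen p ^ m) = scl (qnum (q p p) m) (gen p ^ (m - 1))"
  proof (induction m)
    case (Suc m)
    have "tor (q p) (gen p ^ m) = scl (q p p ^ m) (gen p ^ m)" by (induction m) (auto simp: mult_ac)
    then show ?case using Suc by (cases m) (auto simp: algebra_simps)
  qed simp
  have l: "ld q p (gen p ^ m) = scl (qnum (q p p) m) (gen p ^ (m - 1))"
  proof (induction m)
    case (Suc m)
    then show ?case by (cases m) (auto simp del: qnum_simps simp: qnum_Suc2[of _ m], simp_all add: qnum_Suc2 algebra_simps del: qnum_simps)
  qed simp
  show ?thesis using Ev_F[of "gen p ^ m" p] by (simp add: r l)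
qed

lemma comm_same_low:
  assumes i: "i \<noteq> p" and "n < m"
  shows "Ep p i m * Fp p i n - Fp p i n * Ep p i m =
    sc ((-1) ^ n * (\<Prod>k<n. qnum (q p p) (m - k)) * aa (q p p) (rr p i) m) (E p ^ (m - n) * K i * K p ^ n)"
  using \<open>n < m\<close>
proof (induction n arbitrary: m)
  case 0
  then show ?case using Ep_Fi[OF i, of m] by simp
next
  case (Suc n)
  then obtain m' where m: "m = Suc m'" "n < m'" by (cases m) auto
  let ?z = "\<lambda>m. (-1) ^ n * (\<Prod>k<n. qnum (q p p) (m - k)) * aa (q p p) (rr p i) m"
  let ?s = "\<chi> (al i + frag_cmul (int n) (al p)) (al p)"
  let ?k = "m - n"
  let ?H = "K i * K p ^ n"
  have HF: "sc ?s (?H * F p) = F p * ?H" by (rule KiKp_F)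
  have I1: "Ep p i m * Fp p i n - Fp p i n * Ep p i m = sc (?z m) (E p ^ ?k * ?H)"
    using Suc.IH[of m] Suc.prems by (simp add: mult.assoc del: rv.simps)
  have I2: "Ep p i m' * Fp p i n - Fp p i n * Ep p i m' = sc (?z m') (E p ^ (m' - n) * ?H)"
    using Suc.IH[of m'] m by (simp add: mult.assoc del: rv.simps)
  have k1: "?k - 1 = m' - n" using m by simp
  have s2: "sc ?s (sc (?z m) (E p ^ ?k * ?H) * F p) = sc (?z m) (E p ^ ?k * F p * ?H)"
  proof -
    have "sc ?s (sc (?z m) (E p ^ ?k * ?H) * F p) = sc (?z m) (E p ^ ?k * sc ?s (?H * F p))"
      by (simp add: mult.assoc mult.commute)
    also have "\<dots> = sc (?z m) (E p ^ ?k * (F p * ?H))" by (simp only: HF)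
    finally show ?thesis by (simp only: mult.assoc)
  qed
  have "Ep p i m * Fp p i (Suc n) - Fp p i (Suc n) * Ep p i m =
     F p * sc (?z m) (E p ^ ?k * ?H) - sc ?s (sc (?z m) (E p ^ ?k * ?H) * F p)
     + sc (cc (q p p) (rr p i) m) (L p * sc (?z m') (E p ^ (m' - n) * ?H))"
    using comm_step[OF i i, of m' n] by (simp only: I1 I2 m(1)[symmetric])
  also have "\<dots> = - sc (?z m) ((E p ^ ?k * F p - F p * E p ^ ?k) * ?H)
     + sc (cc (q p p) (rr p i) m * ?z m') (L p * E p ^ (m' - n) * ?H)"
    unfolding s2 by (simp add: algebra_simps)
  also have "\<dots> = - sc (?z m * qnum (q p p) ?k) (E p ^ (m' - n) * K p * ?H)
     + sc (?z m * qnum (q p p) ?k + cc (q p p) (rr p i) m * ?z m') (L p * E p ^ (m' - n) * ?H)"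
    unfolding Ep_power_F k1 by (simp add: algebra_simps)
  also have "?z m * qnum (q p p) ?k + cc (q p p) (rr p i) m * ?z m' = 0"
  proof -
    have pr: "(\<Prod>k<n. qnum (q p p) (m - k)) * qnum (q p p) ?k = qnum (q p p) m * (\<Prod>k<n. qnum (q p p) (m' - k))"
    proof -
      have "(\<Prod>k<n. qnum (q p p) (m - k)) * qnum (q p p) (m - n) = (\<Prod>k<Suc n. qnum (q p p) (m - k))" by simp
      also have "\<dots> = qnum (q p p) m * (\<Prod>k<n. qnum (q p p) (m - Suc k))"
        by (subst prod.lessThan_Suc_shift) simp
      finally show ?thesis using m by (simp del: qnum_simps)
    qed
    have a: "aa (q p p) (rr p i) m = aa (q p p) (rr p i) m' * (1 - q p p ^ m' * rr p i)" by (simp add: aa_def m)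
    have c: "cc (q p p) (rr p i) m = - (qnum (q p p) m * (1 - q p p ^ m' * rr p i))" by (simp add: cc_def m algebra_simps del: qnum_simps)
    have "?z m * qnum (q p p) ?k = (-1) ^ n * ((\<Prod>k<n. qnum (q p p) (m - k)) * qnum (q p p) ?k) * aa (q p p) (rr p i) m"
      by (simp only: mult_ac)
    then show ?thesis unfolding pr a c by (simp add: mult_ac)
  qed
  also have "E p ^ (m' - n) * K p * ?H = E p ^ (m - Suc n) * K i * K p ^ Suc n"
    using m by (simp add: mult.assoc) (simp add: mult.assoc[symmetric] cart_comm[of "GK p" "GK i"])
  finally show ?case by (simp add: mult_ac del: rv.simps)
qed

lemma comm_same_diag:
  assumes i: "i \<noteq> p"
  shows "Ep p i m * Fp p i m - Fp p i m * Ep p i m =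
    sc (\<Prod>k<m. cc (q p p) (rr p i) (Suc k)) (K i * K p ^ m - L i * L p ^ m)"
proof (induction m)
  case 0
  show ?case using EF[of i i] by simp
next
  case (Suc m)
  let ?H = "K i * K p ^ m"
  let ?s = "\<chi> (al i + frag_cmul (int m) (al p)) (al p)"
  let ?w = "\<lambda>m. \<Prod>k<m. cc (q p p) (rr p i) (Suc k)"
  let ?z = "(-1) ^ m * (\<Prod>k<m. qnum (q p p) (Suc m - k)) * aa (q p p) (rr p i) (Suc m)"
  have z: "?z = - ?w (Suc m)"
  proof -
    have "(\<Prod>k<m. qnum (q p p) (Suc m - k)) = (\<Prod>k<Suc m. qnum (q p p) (Suc m - k))" by simp
    also have "\<dots> = (\<Prod>k<Suc m. qnum (q p p) (Suc k))"
    proof -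
      have "(\<Prod>k<Suc m. qnum (q p p) (Suc m - k)) = (\<Prod>k<Suc m. qnum (q p p) (Suc (Suc m - Suc k)))"
        by (rule prod.cong) (auto simp: Suc_diff_le)
      then show ?thesis by (simp only: prod.nat_diff_reindex[of "\<lambda>k. qnum (q p p) (Suc k)"])
    qed
    finally have e: "(\<Prod>k<m. qnum (q p p) (Suc m - k)) = (\<Prod>k<Suc m. qnum (q p p) (Suc k))" .
    have "?w n = (-1) ^ n * (\<Prod>k<n. qnum (q p p) (Suc k)) * aa (q p p) (rr p i) n" for n
      by (induction n) (simp_all add: aa_def cc_def algebra_simps del: qnum_simps)
    from this[of "Suc m"] show ?thesis unfolding e by simp
  qed
  have HF: "sc ?s (E p * ?H * F p) = E p * F p * ?H"
  proof -
    have "sc ?s (?H * F p) = F p * ?H" by (rule KiKp_F)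
    then have "E p * sc ?s (?H * F p) = E p * (F p * ?H)" by simp
    then show ?thesis by (simp add: mult.assoc)
  qed
  have I1: "Ep p i (Suc m) * Fp p i m - Fp p i m * Ep p i (Suc m) = sc ?z (E p * ?H)"
    using comm_same_low[OF i, of m "Suc m"] by (simp add: mult.assoc del: rv.simps)
  have "Ep p i (Suc m) * Fp p i (Suc m) - Fp p i (Suc m) * Ep p i (Suc m) =
     F p * sc ?z (E p * ?H) - sc ?s (sc ?z (E p * ?H) * F p)
     + sc (cc (q p p) (rr p i) (Suc m)) (L p * sc (?w m) (?H - L i * L p ^ m))"
    using comm_step[OF i i, of m m] by (simp only: I1 Suc)
  also have "sc ?s (sc ?z (E p * ?H) * F p) = sc ?z (E p * F p * ?H)"
  proof -
    have "sc ?s (sc ?z (E p * ?H) * F p) = sc ?z (sc ?s (E p * ?H * F p))"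
      by (simp only: sc_mult_left sc_sc mult.commute[of ?s])
    then show ?thesis by (simp only: HF)
  qed
  also have "F p * sc ?z (E p * ?H) - sc ?z (E p * F p * ?H) = - sc ?z ((E p * F p - F p * E p) * ?H)"
    by (simp add: algebra_simps)
  also have "E p * F p - F p * E p = K p - L p" using EF[of p p] by simp
  also have "- sc ?z ((K p - L p) * ?H) + sc (cc (q p p) (rr p i) (Suc m)) (L p * sc (?w m) (?H - L i * L p ^ m))
      = sc (?w (Suc m)) (K p * ?H - L p * (L i * L p ^ m))"
    unfolding z by (simp add: algebra_simps del: prod.lessThan_Suc) (simp add: algebra_simps)
  also have "K p * ?H - L p * (L i * L p ^ m) = K i * K p ^ Suc m - L i * L p ^ Suc m"
    by (simp add: mult.assoc[symmetric] cart_comm[of "GK p" "GK i"] cart_comm[of "GL p" "GL i"])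
  finally show ?case .
qed

end

section \<open>The images of the generators under the Lusztig maps\<close>

primrec Tim :: "('k \<Rightarrow> 'a \<Rightarrow> 'a) \<Rightarrow> ('i ugen \<Rightarrow> 'a::ring_1) \<Rightarrow> 'i \<Rightarrow> ('i \<Rightarrow> nat) \<Rightarrow> ('i \<Rightarrow> 'k) \<Rightarrow> 'i ugen \<Rightarrow> 'a" where
  "Tim sc X p N l (GK i) = (if i = p then X (GK' p) else X (GK i) * X (GK p) ^ N i)"
| "Tim sc X p N l (GK' i) = (if i = p then X (GK p) else X (GK' i) * X (GK' p) ^ N i)"
| "Tim sc X p N l (GL i) = (if i = p then X (GL' p) else X (GL i) * X (GL p) ^ N i)"
| "Tim sc X p N l (GL' i) = (if i = p then X (GL p) else X (GL' i) * X (GL' p) ^ N i)"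
| "Tim sc X p N l (GE i) = (if i = p then X (GF p) * X (GL' p) else rv (X (GK p)) (X (GK' p)) (X (GE p)) (X (GE i)) (N i))"
| "Tim sc X p N l (GF i) = (if i = p then X (GK' p) * X (GE p) else sc (l i) (rv (X (GL p)) (X (GL' p)) (X (GF p)) (X (GF i)) (N i)))"

primrec Tmim :: "('k::field \<Rightarrow> 'a \<Rightarrow> 'a) \<Rightarrow> ('i ugen \<Rightarrow> 'a::ring_1) \<Rightarrow> 'i \<Rightarrow> ('i \<Rightarrow> nat) \<Rightarrow> ('i \<Rightarrow> 'k) \<Rightarrow> 'i ugen \<Rightarrow> 'a" where
  "Tmim sc X p N l (GK i) = (if i = p then X (GK' p) else X (GK i) * X (GK p) ^ N i)"
| "Tmim sc X p N l (GK' i) = (if i = p then X (GK p) else X (GK' i) * X (GK' p) ^ N i)"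
| "Tmim sc X p N l (GL i) = (if i = p then X (GL' p) else X (GL i) * X (GL p) ^ N i)"
| "Tmim sc X p N l (GL' i) = (if i = p then X (GL p) else X (GL' i) * X (GL' p) ^ N i)"
| "Tmim sc X p N l (GE i) = (if i = p then X (GK' p) * X (GF p) else sc (l i) (rv (X (GL p)) (X (GL' p)) (X (GE p)) (X (GE i)) (N i)))"
| "Tmim sc X p N l (GF i) = (if i = p then X (GE p) * X (GL' p) else sc ((-1) ^ N i) (rv (X (GK p)) (X (GK' p)) (X (GF p)) (X (GF i)) (N i)))"

text \<open>The substitutions of generators behind \<open>\<phi>\<^sub>3\<close> and behind \<open>\<phi>\<^sub>3\<phi>\<^sub>2\<close>.\<close>

primrec sw3 :: "'i ugen \<Rightarrow> 'i ugen" where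
  "sw3 (GK i) = GL i" | "sw3 (GK' i) = GL' i" | "sw3 (GL i) = GK i" | "sw3 (GL' i) = GK' i"
| "sw3 (GE i) = GF i" | "sw3 (GF i) = GE i"

primrec thX :: "('i ugen \<Rightarrow> 'a::ring_1) \<Rightarrow> 'i ugen \<Rightarrow> 'a" where
  "thX X (GK i) = X (GL i)" | "thX X (GK' i) = X (GL' i)" | "thX X (GL i) = X (GK i)" | "thX X (GL' i) = X (GK' i)"
| "thX X (GE i) = X (GE i)" | "thX X (GF i) = - X (GF i)"

lemma rv_minus: "rv k k' (- x) (- y) m = (-1) ^ (m + 1) * rv k k' x y m"
  by (induction m) (simp_all add: algebra_simps uminus_power_if)

lemma sw3_cg: "g \<in> cartan_gens \<Longrightarrow> sw3 g \<in> cartan_gens"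
  by (auto elim: cartan_cases)

lemma thX_cg: "g \<in> cartan_gens \<Longrightarrow> thX X g = X (sw3 g)"
  by (auto elim: cartan_cases)

context double_rel
begin

lemma dual_op: "double_rel sc (bichar_op \<chi>) (\<lambda>g. X (sw3 g))"
proof (unfold_locales)
  show "X (sw3 (GE i)) * X (sw3 (GF j)) - X (sw3 (GF j)) * X (sw3 (GE i)) =
    (if i = j then X (sw3 (GK i)) - X (sw3 (GL i)) else 0)" for i j
    using EF[of j i] by (auto simp: algebra_simps)
qed (simp_all add: bich cart_comm sw3_cg KK' LL' KE LE KF LF qm_op_app del: qm_op)

lemma dual_inv_op: "double_rel sc (bichar_op (bichar_inv \<chi>)) (thX X)"
proof (unfold_locales)
  show "thX X (GE i) * thX X (GF j) - thX X (GF j) * thX X (GE i) = (if i = j then thX X (GK i) - thX X (GL i) else 0)" for i j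
    using EF[of i j] by (auto simp: algebra_simps)
qed (simp_all add: bich cart_comm sw3_cg thX_cg KK' LL' KE LE KF LF qm_op_app del: qm_op)

lemma Em_Fp:
  assumes "i \<noteq> p"
  shows "Em p i (Suc m) * F p - F p * Em p i (Suc m) = - sc (cc (inverse (q p p)) (inverse (rr p i)) (Suc m)) (K p * Em p i m)"
proof -
  interpret D: double_rel sc "bichar_op (bichar_inv \<chi>)" "thX X" by (rule dual_inv_op)
  have "cc (D.q p p) (D.rr p i) (Suc m) = cc (inverse (q p p)) (inverse (rr p i)) (Suc m)"
    by (simp add: transp_def mult.commute)
  then show ?thesis using D.Ep_Fp[OF assms, of m] by (simp del: rv.simps qm_op) (simp add: algebra_simps del: rv.simps)
qed

lemma Fm_Ep:
  assumes "i \<noteq> p"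
  shows "Fm p i (Suc m) * E p - E p * Fm p i (Suc m) = - sc (cc (inverse (q p p)) (inverse (rr p i)) (Suc m)) (L p * Fm p i m)"
proof -
  interpret D: double_rel sc "bichar_op \<chi>" "\<lambda>g. X (sw3 g)" by (rule dual_op)
  have "cc (inverse (D.q p p)) (inverse (D.rr p i)) (Suc m) = cc (inverse (q p p)) (inverse (rr p i)) (Suc m)"
    by (simp add: transp_def mult.commute)
  then show ?thesis using D.Em_Fp[OF assms, of m] by (simp del: rv.simps qm_op)
qed

lemma cartan_power_inverse: "K p ^ n * K' p ^ n = 1" "K' p ^ n * K p ^ n = 1" "L p ^ n * L' p ^ n = 1" "L' p ^ n * L p ^ n = 1"
  by (rule left_right_inverse_power; simp add: KK' K'K LL' L'L)+

text \<open>Elements commuting with all Cartan generators, in the subalgebra that they generate.\<close>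

definition cc0 :: "'a \<Rightarrow> bool" where "cc0 x \<longleftrightarrow> (\<forall>y\<in>cartan_gens. x * X y = X y * x)"

lemma cc0_intros: "g \<in> cartan_gens \<Longrightarrow> cc0 (X g)" "cc0 x \<Longrightarrow> cc0 y \<Longrightarrow> cc0 (x * y)" "cc0 x \<Longrightarrow> cc0 (x ^ n)"
proof -
  show "g \<in> cartan_gens \<Longrightarrow> cc0 (X g)" by (auto simp: cc0_def cart_comm)
  show m: "cc0 (x * y)" if "cc0 x" "cc0 y" for x y
    using that unfolding cc0_def by (metis mult.assoc)
  have "cc0 1" by (simp add: cc0_def)
  then show "cc0 x \<Longrightarrow> cc0 (x ^ n)" by (induction n) (auto intro: m)
qed

lemma Tim_cc0: "g \<in> cartan_gens \<Longrightarrow> cc0 (Tim sc X p N l g)"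
  by (auto elim!: cartan_cases intro!: cc0_intros)

lemma Tim_cartan_comm:
  assumes g: "g \<in> cartan_gens" and x: "cc0 x"
  shows "x * Tim sc X p N l g = Tim sc X p N l g * x"
proof -
  have c: "x * X h = X h * x" if "h \<in> cartan_gens" for h using x that by (simp add: cc0_def)
  have pw: "x * X h ^ n = X h ^ n * x" if "h \<in> cartan_gens" for h n
    using power_commuting_commutes[OF c[OF that, symmetric]] by simp
  have "x * (X h * X h' ^ n) = X h * X h' ^ n * x" if "h \<in> cartan_gens" "h' \<in> cartan_gens" for h h' n
    by (simp only: mult.assoc[symmetric] c[OF that(1)]) (simp only: mult.assoc pw[OF that(2)])
  then show ?thesis using g c by (elim cartan_cases) auto
qed

lemma mult4: "b * c = c * b \<Longrightarrow> a * b * (c * d) = a * c * (b * d)" for a b c d :: 'a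
  by (metis mult.assoc)

lemma Tim_KK': "Tim sc X p N l (GK i) * Tim sc X p N l (GK' i) = 1" "Tim sc X p N l (GL i) * Tim sc X p N l (GL' i) = 1"
proof -
  have c: "X h ^ n * X h' = X h' * X h ^ n" if "h \<in> cartan_gens" "h' \<in> cartan_gens" for h h' n
    using power_commuting_commutes[OF cart_comm[OF that]] by simp
  show "Tim sc X p N l (GK i) * Tim sc X p N l (GK' i) = 1"
    by (simp add: K'K) (simp add: mult4[OF c] KK' cartan_power_inverse)
  show "Tim sc X p N l (GL i) * Tim sc X p N l (GL' i) = 1"
    by (simp add: L'L) (simp add: mult4[OF c] LL' cartan_power_inverse)
qed

lemma wt_K_power: "wt \<beta> x \<Longrightarrow> K p ^ n * x = sc (\<chi> (al p) \<beta> ^ n) (x * K p ^ n)"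
proof (induction n)
  case (Suc n)
  have "K p * (K p ^ n * x) = sc (\<chi> (al p) \<beta> ^ n) (K p * x * K p ^ n)" using Suc by (simp add: mult.assoc)
  also have "K p * x = sc (\<chi> (al p) \<beta>) (x * K p)" using Suc.prems by (rule wt_K)
  finally show ?case by (simp add: mult_ac)
qed simp

lemma wt_L_power: "wt \<beta> x \<Longrightarrow> L p ^ n * x = sc (inverse (\<chi> \<beta> (al p)) ^ n) (x * L p ^ n)"
proof (induction n)
  case (Suc n)
  have "L p * (L p ^ n * x) = sc (inverse (\<chi> \<beta> (al p)) ^ n) (L p * x * L p ^ n)" using Suc by (simp add: mult.assoc)
  also have "L p * x = sc (inverse (\<chi> \<beta> (al p))) (x * L p)" using Suc.prems by (rule wt_L)
  finally show ?case by (simp add: mult_ac)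
qed simp

abbreviation "TX p \<equiv> Tim sc X p (nn p \<chi>) (\<lambda>i. inverse (lam p \<chi> i))"

lemma Tim_K:
  assumes x: "wt \<beta> x"
  shows "TX p (GK i) * x = sc (\<chi> (reflection p \<chi> (al i)) \<beta>) (x * TX p (GK i))"
    "TX p (GL i) * x = sc (inverse (\<chi> \<beta> (reflection p \<chi> (al i)))) (x * TX p (GL i))"
proof -
  show "TX p (GK i) * x = sc (\<chi> (reflection p \<chi> (al i)) \<beta>) (x * TX p (GK i))"
  proof (cases "i = p")
    case True then show ?thesis using wt_K'[OF x] by (simp add: refl_al bichar_simps[OF bich])
  next
    case False
    have "K i * K p ^ n * x = sc (\<chi> (al p) \<beta> ^ n) (K i * x * K p ^ n)" for n
      by (simp add: mult.assoc wt_K_power[OF x])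
    then show ?thesis using False by (simp add: refl_al bichar_simps[OF bich] wt_K[OF x] mult.assoc mult.commute)
  qed
  show "TX p (GL i) * x = sc (inverse (\<chi> \<beta> (reflection p \<chi> (al i)))) (x * TX p (GL i))"
  proof (cases "i = p")
    case True then show ?thesis using wt_L'[OF x] by (simp add: refl_al bichar_simps[OF bich])
  next
    case False
    have "L i * L p ^ n * x = sc (inverse (\<chi> \<beta> (al p)) ^ n) (L i * x * L p ^ n)" for n
      by (simp add: mult.assoc wt_L_power[OF x])
    then show ?thesis using False
      by (simp add: refl_al bichar_simps[OF bich] wt_L[OF x] mult.assoc mult.commute power_inverse)
  qed
qed

lemma Tim_wt: "wt (reflection p \<chi> (al j)) (TX p (GE j))" "wt (- reflection p \<chi> (al j)) (TX p (GF j))"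
proof -
  show "wt (reflection p \<chi> (al j)) (TX p (GE j))"
    using wt_Ep(1)[of j "nn p \<chi> j" p] wt_mult[OF wt_gens(2)[of p] wt_gens(3)[of "GL' p"]]
    by (simp add: refl_al)
  show "wt (- reflection p \<chi> (al j)) (TX p (GF j))"
    using wt_sc[OF wt_Fp(1)[of j "nn p \<chi> j" p]] wt_mult[OF wt_gens(3)[of "GK' p"] wt_gens(1)[of p]]
    by (simp add: refl_al)
qed

lemma lam_cc: "i \<noteq> p \<Longrightarrow> lam p \<chi> i = (\<Prod>k<nn p \<chi> i. cc (q p p) (rr p i) (Suc k))"
  by (simp add: lam_def qfact_Suc_prod cc_def prod.distrib mult.assoc del: qnum_simps flip: nn_def)

lemma TEp_TFj:
  assumes "j \<noteq> p"
  shows "F p * L' p * Fp p j n - Fp p j n * (F p * L' p) = sc (q p p) (L' p * Fp p j (Suc n))"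
proof -
  let ?Y = "Fp p j n" and ?s = "\<chi> (al j + frag_cmul (int n) (al p)) (al p)"
  have L'Y: "sc ?s (L' p * ?Y) = ?Y * L' p"
    using inverse_skew_comm[OF LL' L'L L_Fp] bichar_add(3)[OF bich] by simp
  have "sc ?s (L' p * (?Y * F p)) = sc ?s (L' p * ?Y) * F p" by (simp add: mult.assoc)
  also have "\<dots> = ?Y * (L' p * F p)" unfolding L'Y by (simp add: mult.assoc)
  also have "\<dots> = sc (inverse (q p p)) (?Y * (F p * L' p))" by (simp add: L'F)
  finally have 1: "sc ?s (L' p * (?Y * F p)) = sc (inverse (q p p)) (?Y * (F p * L' p))" .
  have 2: "L' p * (F p * ?Y) = sc (inverse (q p p)) (F p * L' p * ?Y)" by (simp add: mult.assoc[symmetric] L'F)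
  show ?thesis unfolding Fp_step right_diff_distrib sc_mult_right 1 2 by simp
qed

lemma TEi_TFp: "Ep p i n * (K' p * E p) - K' p * E p * Ep p i n = - (K' p * Ep p i (Suc n))"
proof -
  have "K' p * (K p * Ep p i n * K' p * E p) = Ep p i n * (K' p * E p)"
    by (simp only: mult.assoc[symmetric] K'K) simp
  then show ?thesis by (simp add: algebra_simps)
qed

lemma TEp_TFp: "F p * L' p * (K' p * E p) - K' p * E p * (F p * L' p) = K' p - L' p"
proof -
  have 1: "L' p * (K' p * E p) = E p * (L' p * K' p)"
  proof -
    have "L' p * (K' p * E p) = sc (inverse (q p p)) (L' p * E p * K' p)" by (simp add: K'E mult.assoc)
    then show ?thesis by (simp add: L'E mult.assoc)
  qed
  have 2: "K' p * E p * (F p * L' p) = E p * F p * (L' p * K' p)"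
  proof -
    have "K' p * E p * (F p * L' p) = sc (inverse (q p p)) (E p * (K' p * F p) * L' p)" by (simp add: K'E mult.assoc)
    also have "\<dots> = E p * F p * (K' p * L' p)" by (simp add: K'F mult.assoc)
    finally show ?thesis by (simp add: cart_comm[of "GK' p" "GL' p"])
  qed
  have "F p * L' p * (K' p * E p) = F p * E p * (L' p * K' p)" using 1 by (simp add: mult.assoc)
  then have "F p * L' p * (K' p * E p) - K' p * E p * (F p * L' p) = - ((E p * F p - F p * E p) * (L' p * K' p))"
    unfolding 2 by (simp add: algebra_simps)
  also have "E p * F p - F p * E p = K p - L p" using EF[of p p] by simp
  also have "- ((K p - L p) * (L' p * K' p)) = L p * (L' p * K' p) - K p * (K' p * L' p)"
    using cart_comm[of "GK' p" "GL' p"] by (simp add: algebra_simps)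
  also have "\<dots> = K' p - L' p" by (simp only: mult.assoc[symmetric] LL' KK' mult_1)
  finally show ?thesis .
qed

text \<open>The relations of the source hold for the images, up to the root vectors of degree one above the top.\<close>

lemma Tim_rels:
  assumes f: "p_finite p \<chi>" and r: "r \<in> \<U>_rels (rp p \<chi>)"
  shows "ev (TX p) r = 0 \<or> (\<exists>j c. j \<noteq> p \<and> ev (TX p) r = sc c (L' p * Fp p j (Suc (nn p \<chi> j))))
     \<or> (\<exists>j c. j \<noteq> p \<and> ev (TX p) r = sc c (K' p * Ep p j (Suc (nn p \<chi> j))))"
proof -
  let ?\<sigma> = "reflection p \<chi>"
  have Q: "qm (rp p \<chi>) i j = \<chi> (?\<sigma> (al i)) (?\<sigma> (al j))" for i j by (simp add: qm_def rp_app)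
  have KC: "TX p (GK i) * x * TX p (GK' i) = sc (\<chi> (?\<sigma> (al i)) \<beta>) x" if "wt \<beta> x" for i \<beta> x
    using Tim_KK'(1)[of p "nn p \<chi>" _ i] by (simp add: Tim_K(1)[OF that] mult.assoc del: Tim.simps)
  have LC: "TX p (GL i) * x * TX p (GL' i) = sc (inverse (\<chi> \<beta> (?\<sigma> (al i)))) x" if "wt \<beta> x" for i \<beta> x
    using Tim_KK'(2)[of p "nn p \<chi>" _ i] by (simp add: Tim_K(2)[OF that] mult.assoc del: Tim.simps)
  let ?D = "\<lambda>i j. TX p (GE i) * TX p (GF j) - TX p (GF j) * TX p (GE i) - (if i = j then TX p (GK i) - TX p (GL i) else 0)"
  have EFc: "?D i j = 0 \<or> (\<exists>k c. k \<noteq> p \<and> ?D i j = sc c (L' p * Fp p k (Suc (nn p \<chi> k))))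
     \<or> (\<exists>k c. k \<noteq> p \<and> ?D i j = sc c (K' p * Ep p k (Suc (nn p \<chi> k))))" for i j
  proof -
    consider "i = p" "j = p" | "i = p" "j \<noteq> p" | "i \<noteq> p" "j = p" | "i \<noteq> p" "j \<noteq> p" "i = j" | "i \<noteq> p" "j \<noteq> p" "i \<noteq> j" by blast
    then show ?thesis
    proof cases
      case 1 then show ?thesis using TEp_TFp[of p] by simp
    next
      case 2
      let ?l = "inverse (lam p \<chi> j)" and ?Y = "Fp p j (nn p \<chi> j)"
      have "F p * L' p * sc ?l ?Y - sc ?l ?Y * (F p * L' p) = sc ?l (F p * L' p * ?Y - ?Y * (F p * L' p))" by simp
      also have "\<dots> = sc (?l * q p p) (L' p * Fp p j (Suc (nn p \<chi> j)))" unfolding TEp_TFj[OF 2(2)] by simp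
      finally show ?thesis using 2 by (intro disjI2 disjI1 exI[of _ j] exI[of _ "?l * q p p"]) simp
    next
      case 3
      have "Ep p i (nn p \<chi> i) * (K' p * E p) - K' p * E p * Ep p i (nn p \<chi> i) = sc (-1) (K' p * Ep p i (Suc (nn p \<chi> i)))"
        unfolding TEi_TFp by simp
      then show ?thesis using 3 by (intro disjI2 exI[of _ i] exI[of _ "-1"]) simp
    next
      case 4
      have "sc (inverse (lam p \<chi> i)) (Ep p i (nn p \<chi> i) * Fp p i (nn p \<chi> i) - Fp p i (nn p \<chi> i) * Ep p i (nn p \<chi> i))
          = K i * K p ^ nn p \<chi> i - L i * L p ^ nn p \<chi> i"
        unfolding comm_same_diag[OF 4(1)] lam_cc[OF 4(1), symmetric] using lam_nonzero[OF f 4(1)] by simp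
      then show ?thesis using 4 by simp
    next
      case 5
      then show ?thesis using comm_different[of i p j "nn p \<chi> i" "nn p \<chi> j"] by simp
    qed
  qed
  from r show ?thesis unfolding \<U>_rels_def const_mult
  proof (elim UnE CollectE exE conjE)
    fix x y assume a: "r = gen x * gen y - gen y * gen x" "x \<in> cartan_gens" "y \<in> cartan_gens"
    then show ?thesis using Tim_cartan_comm[OF a(3) Tim_cc0[OF a(2)]] by (simp del: Tim.simps)
  next
    fix i assume "r = gen (GK i) * gen (GK' i) - 1"
    then show ?thesis by (simp add: Tim_KK' del: Tim.simps)
  next
    fix i assume "r = gen (GL i) * gen (GL' i) - 1"
    then show ?thesis by (simp add: Tim_KK' del: Tim.simps)
  next
    fix i j assume "r = gen (GK i) * gen (GE j) * gen (GK' i) - scl (qm (rp p \<chi>) i j) (gen (GE j))"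
    then show ?thesis by (simp add: KC[OF Tim_wt(1)] Q del: Tim.simps)
  next
    fix i j assume "r = gen (GL i) * gen (GE j) * gen (GL' i) - scl (inverse (qm (rp p \<chi>) j i)) (gen (GE j))"
    then show ?thesis by (simp add: LC[OF Tim_wt(1)] Q del: Tim.simps)
  next
    fix i j assume "r = gen (GK i) * gen (GF j) * gen (GK' i) - scl (inverse (qm (rp p \<chi>) i j)) (gen (GF j))"
    then show ?thesis by (simp add: KC[OF Tim_wt(2)] Q bichar_simps[OF bich] del: Tim.simps)
  next
    fix i j assume "r = gen (GL i) * gen (GF j) * gen (GL' i) - scl (qm (rp p \<chi>) j i) (gen (GF j))"
    then show ?thesis by (simp add: LC[OF Tim_wt(2)] Q bichar_simps[OF bich] del: Tim.simps)
  next
    fix i j assume "r = gen (GE i) * gen (GF j) - gen (GF j) * gen (GE i) - (if i = j then gen (GK i) - gen (GL i) else 0)"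
    then have e: "ev (TX p) r = ?D i j" by (simp del: Tim.simps)
    show ?thesis unfolding e by (rule EFc)
  qed
qed

text \<open>The composition of the two Lusztig maps fixes the generators.\<close>

abbreviation "TmX p \<equiv> Tmim sc X p (nn p \<chi>) (\<lambda>i. inverse (lam p (bichar_inv \<chi>) i))"

lemma lam_inv_cc: "i \<noteq> p \<Longrightarrow> lam p (bichar_inv \<chi>) i = (\<Prod>k<nn p \<chi> i. cc (inverse (q p p)) (inverse (rr p i)) (Suc k))"
  by (simp add: lam_def qfact_Suc_prod cc_def prod.distrib mult.assoc cartan_inv[OF bich] inverse_mult_distrib del: qnum_simps flip: nn_def)

lemma Tim_Tmim:
  assumes f: "p_finite p \<chi>"
  shows "Tim sc (TmX p) p (nn p \<chi>) (\<lambda>i. inverse (lam p (rp p \<chi>) i)) g = X g"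
proof (cases g)
  case (GE i)
  show ?thesis
  proof (cases "i = p")
    case False
    let ?N = "nn p \<chi> i" and ?l = "inverse (lam p (bichar_inv \<chi>) i)"
    let ?c = "\<lambda>n. cc (inverse (q p p)) (inverse (rr p i)) n"
    have "m \<le> ?N \<Longrightarrow> rv (K' p) (K p) (K' p * F p) (sc ?l (Em p i ?N)) m = sc (?l * (\<Prod>k<m. ?c (?N - k))) (Em p i (?N - m))" for m
    proof (induction m)
      case (Suc m)
      let ?d = "?l * (\<Prod>k<m. ?c (?N - k))" and ?y = "Em p i (?N - m)"
      have n: "?N - m = Suc (?N - Suc m)" using Suc.prems by simp
      have "rv (K' p) (K p) (K' p * F p) (sc ?l (Em p i ?N)) (Suc m) = K' p * F p * sc ?d ?y - K' p * sc ?d ?y * K p * (K' p * F p)"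
        using Suc by (simp only: rv.simps)
      also have "K' p * sc ?d ?y * K p * (K' p * F p) = sc ?d (K' p * (?y * F p))"
      proof -
        have "K' p * sc ?d ?y * K p * (K' p * F p) = sc ?d (K' p * ?y * (K p * K' p) * F p)" by (simp add: mult.assoc)
        then show ?thesis by (simp add: KK' mult.assoc)
      qed
      also have "K' p * F p * sc ?d ?y - sc ?d (K' p * (?y * F p)) = - sc ?d (K' p * (?y * F p - F p * ?y))"
        by (simp add: algebra_simps)
      also have "?y * F p - F p * ?y = - sc (?c (?N - m)) (K p * Em p i (?N - Suc m))"
        unfolding n by (rule Em_Fp[OF False])
      also have "- sc ?d (K' p * - sc (?c (?N - m)) (K p * Em p i (?N - Suc m))) = sc (?d * ?c (?N - m)) (Em p i (?N - Suc m))"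
        by (simp add: mult.assoc[symmetric] K'K del: rv.simps)
      finally show ?case by (simp add: mult_ac del: rv.simps)
    qed simp
    from this[of ?N] have "rv (K' p) (K p) (K' p * F p) (sc ?l (Em p i ?N)) ?N = sc (?l * (\<Prod>k<?N. ?c (?N - k))) (E i)" by simp
    also have "(\<Prod>k<?N. ?c (?N - k)) = (\<Prod>k<?N. ?c (Suc (?N - Suc k)))" by (rule prod.cong) (auto simp: Suc_diff_Suc)
    also have "\<dots> = lam p (bichar_inv \<chi>) i"
      unfolding lam_inv_cc[OF False] by (rule prod.nat_diff_reindex[of "\<lambda>k. ?c (Suc k)"])
    also have "?l * lam p (bichar_inv \<chi>) i = 1" using lam_nonzero[OF p_finite_inv[OF bich f] False] by simp
    finally show ?thesis using False GE by simp
  qed (simp add: GE L'L mult.assoc)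
next
  case (GF i)
  show ?thesis
  proof (cases "i = p")
    case False
    let ?N = "nn p \<chi> i"
    let ?l = "(-1) ^ ?N :: 'k"
    let ?c = "\<lambda>n. cc (inverse (q p p)) (inverse (rr p i)) n"
    let ?qi = "inverse (q p p)"
    have EL: "E p * L' p = sc ?qi (L' p * E p)" by (simp add: L'E)
    have LEL: "L p * (E p * L' p) = sc ?qi (E p)" unfolding EL by (simp add: mult.assoc[symmetric] LL')
    have "m \<le> ?N \<Longrightarrow> rv (L' p) (L p) (E p * L' p) (sc ?l (Fm p i ?N)) m = sc (?l * (\<Prod>k<m. ?qi * ?c (?N - k))) (Fm p i (?N - m))" for m
    proof (induction m)
      case (Suc m)
      let ?d = "?l * (\<Prod>k<m. ?qi * ?c (?N - k))" and ?y = "Fm p i (?N - m)"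
      have n: "?N - m = Suc (?N - Suc m)" using Suc.prems by simp
      have "rv (L' p) (L p) (E p * L' p) (sc ?l (Fm p i ?N)) (Suc m) = E p * L' p * sc ?d ?y - L' p * sc ?d ?y * L p * (E p * L' p)"
        using Suc by (simp only: rv.simps)
      also have "L' p * sc ?d ?y * L p * (E p * L' p) = sc (?d * ?qi) (L' p * (?y * E p))"
      proof -
        have "L' p * sc ?d ?y * L p * (E p * L' p) = sc ?d (L' p * (?y * (L p * (E p * L' p))))" by (simp add: mult.assoc)
        then show ?thesis unfolding LEL by simp
      qed
      also have "E p * L' p * sc ?d ?y - sc (?d * ?qi) (L' p * (?y * E p)) = - sc (?d * ?qi) (L' p * (?y * E p - E p * ?y))"
        unfolding EL by (simp add: algebra_simps)
      also have "?y * E p - E p * ?y = - sc (?c (?N - m)) (L p * Fm p i (?N - Suc m))"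
        unfolding n by (rule Fm_Ep[OF False])
      also have "- sc (?d * ?qi) (L' p * - sc (?c (?N - m)) (L p * Fm p i (?N - Suc m))) = sc (?d * (?qi * ?c (?N - m))) (Fm p i (?N - Suc m))"
        by (simp add: mult.assoc[symmetric] L'L del: rv.simps)
      finally show ?case by (simp add: mult_ac del: rv.simps)
    qed simp
    from this[of ?N] have "rv (L' p) (L p) (E p * L' p) (sc ?l (Fm p i ?N)) ?N = sc (?l * (\<Prod>k<?N. ?qi * ?c (?N - k))) (F i)" by simp
    also have "(\<Prod>k<?N. ?qi * ?c (?N - k)) = ?qi ^ ?N * (\<Prod>k<?N. ?c (?N - k))" by (simp add: prod.distrib)
    also have "(\<Prod>k<?N. ?c (?N - k)) = (\<Prod>k<?N. ?c (Suc (?N - Suc k)))" by (rule prod.cong) (auto simp: Suc_diff_Suc)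
    also have "\<dots> = lam p (bichar_inv \<chi>) i"
      unfolding lam_inv_cc[OF False] by (rule prod.nat_diff_reindex[of "\<lambda>k. ?c (Suc k)"])
    also have "?l * (?qi ^ ?N * lam p (bichar_inv \<chi>) i) = lam p (rp p \<chi>) i"
      unfolding lam_reflect[OF bich f False] by (simp add: power_minus[of ?qi] mult.assoc)
    finally have e: "rv (L' p) (L p) (E p * L' p) (sc ?l (Fm p i ?N)) ?N = sc (lam p (rp p \<chi>) i) (F i)" .
    have "lam p (rp p \<chi>) i \<noteq> 0" by (rule lam_nonzero[OF p_finite_rp[OF bich f] False])
    then show ?thesis using False GF e by simp
  qed (simp add: GF KK' mult.assoc[symmetric])
qed (auto simp: mult.assoc cartan_power_inverse)

text \<open>The map with the exponent minus is conjugate to the other one.\<close>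

lemma Tmim_via:
  fixes p :: 'i and N :: "'i \<Rightarrow> nat" and lm :: "'i \<Rightarrow> 'k"
  assumes f: "p_finite p \<chi>" and lm: "\<And>i. i \<noteq> p \<Longrightarrow> lm i \<noteq> 0"
  defines "a \<equiv> \<lambda>i. if i = p then - q p p else lm i"
  defines "T \<equiv> Tim sc (thX X) p N lm"
  shows "Tmim sc X p N lm (GK i) = T (GL i)" "Tmim sc X p N lm (GK' i) = T (GL' i)"
    "Tmim sc X p N lm (GL i) = T (GK i)" "Tmim sc X p N lm (GL' i) = T (GK' i)"
    "Tmim sc X p N lm (GE i) = sc (a i) (T (GE i))" "Tmim sc X p N lm (GF i) = - sc (inverse (a i)) (T (GF i))"
proof -
  show "Tmim sc X p N lm (GF i) = - sc (inverse (a i)) (T (GF i))"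
  proof (cases "i = p")
    case True
    then show ?thesis by (simp add: T_def a_def L'E)
  next
    case False
    have "(-1) ^ n * x = sc ((-1) ^ n) x" for n x by (induction n) auto
    note m1 = this
    have e: "inverse (lm i) * (lm i * (-1) ^ N i) = (-1) ^ N i"
    proof -
      have "inverse (lm i) * lm i = 1" using lm[OF False] by simp
      then show ?thesis by (simp only: mult.assoc[symmetric] mult_1)
    qed
    show ?thesis using False by (simp add: T_def a_def rv_minus m1 e)
  qed
qed (simp_all add: T_def a_def K'F)

end

section \<open>The maps on the free algebra\<close>

lemma (in algebra_scale) ev_cong: "(\<And>g. X g = Y g) \<Longrightarrow> ev X x = ev Y x"
  by (metis ext)

lemma (in algebra_scale) ev_rv: "ev X (rv k k' x y m) = rv (ev X k) (ev X k') (ev X x) (ev X y) m"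
  by (induction m) auto

lemma (in algebra_scale) ev_Tim: "ev X (Tim scl gen p N l g) = Tim sc X p N l g"
  by (cases g) (simp_all add: ev_rv)

lemma (in algebra_scale) ev_Tmim: "ev X (Tmim scl gen p N l g) = Tmim sc X p N l g"
  by (cases g) (simp_all add: ev_rv)

lemma (in algebra_scale) ev_thX: "ev X (thX gen g) = thX X g"
  by (cases g) simp_all

definition That :: "'i \<Rightarrow> ('i, 'k::field) bichar \<Rightarrow> ('i ugen fmon \<Rightarrow>\<^sub>0 'k) \<Rightarrow> ('i ugen fmon \<Rightarrow>\<^sub>0 'k)" where
  "That p \<chi> = FA.ev (Tim scl gen p (nn p \<chi>) (\<lambda>i. inverse (lam p (rp p \<chi>) i)))"

definition Tmhat :: "'i \<Rightarrow> ('i, 'k::field) bichar \<Rightarrow> ('i ugen fmon \<Rightarrow>\<^sub>0 'k) \<Rightarrow> ('i ugen fmon \<Rightarrow>\<^sub>0 'k)" where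
  "Tmhat p \<chi> = FA.ev (Tmim scl gen p (nn p \<chi>) (\<lambda>i. inverse (lam p (rp p (bichar_inv \<chi>)) i)))"

definition ph3 :: "('i ugen fmon \<Rightarrow>\<^sub>0 'k::field) \<Rightarrow> ('i ugen fmon \<Rightarrow>\<^sub>0 'k)" where
  "ph3 = FA.ev (\<lambda>g. gen (sw3 g))"

definition phth :: "('i ugen fmon \<Rightarrow>\<^sub>0 'k::field) \<Rightarrow> ('i ugen fmon \<Rightarrow>\<^sub>0 'k)" where
  "phth = FA.ev (thX gen)"

primrec torX :: "('k::field \<Rightarrow> 'a \<Rightarrow> 'a) \<Rightarrow> ('i \<Rightarrow> 'k) \<Rightarrow> ('i ugen \<Rightarrow> 'a::ring_1) \<Rightarrow> 'i ugen \<Rightarrow> 'a" where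
  "torX sc a X (GK i) = X (GK i)" | "torX sc a X (GK' i) = X (GK' i)" | "torX sc a X (GL i) = X (GL i)"
| "torX sc a X (GL' i) = X (GL' i)" | "torX sc a X (GE i) = sc (a i) (X (GE i))"
| "torX sc a X (GF i) = sc (inverse (a i)) (X (GF i))"

lemma (in algebra_scale) ev_torX: "ev X (torX scl a gen g) = torX sc a X g"
  by (cases g) simp_all

definition pha :: "('i \<Rightarrow> 'k::field) \<Rightarrow> ('i ugen fmon \<Rightarrow>\<^sub>0 'k) \<Rightarrow> ('i ugen fmon \<Rightarrow>\<^sub>0 'k)" where
  "pha a = FA.ev (torX scl a gen)"

lemma hat_simps [simp]:
  "That p \<chi> (x + y) = That p \<chi> x + That p \<chi> y" "That p \<chi> (x - y) = That p \<chi> x - That p \<chi> y" "That p \<chi> (x * y) = That p \<chi> x * That p \<chi> y"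
  "That p \<chi> 0 = 0" "That p \<chi> 1 = 1" "That p \<chi> (scl c x) = scl c (That p \<chi> x)" "That p \<chi> (- x) = - That p \<chi> x"
  "Tmhat p \<chi> (x + y) = Tmhat p \<chi> x + Tmhat p \<chi> y" "Tmhat p \<chi> (x - y) = Tmhat p \<chi> x - Tmhat p \<chi> y" "Tmhat p \<chi> (x * y) = Tmhat p \<chi> x * Tmhat p \<chi> y"
  "Tmhat p \<chi> 0 = 0" "Tmhat p \<chi> 1 = 1" "Tmhat p \<chi> (scl c x) = scl c (Tmhat p \<chi> x)" "Tmhat p \<chi> (- x) = - Tmhat p \<chi> x"
  "ph3 (x + y) = ph3 x + ph3 y" "ph3 (x - y) = ph3 x - ph3 y" "ph3 (x * y) = ph3 x * ph3 y"
  "ph3 0 = 0" "ph3 1 = 1" "ph3 (scl c x) = scl c (ph3 x)" "ph3 (- x) = - ph3 x" "ph3 (gen g) = gen (sw3 g)"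
  "phth (x + y) = phth x + phth y" "phth (x - y) = phth x - phth y" "phth (x * y) = phth x * phth y"
  "phth 0 = 0" "phth 1 = 1" "phth (scl c x) = scl c (phth x)" "phth (- x) = - phth x" "phth (gen g) = thX gen g"
  "pha a (x + y) = pha a x + pha a y" "pha a (x - y) = pha a x - pha a y" "pha a (x * y) = pha a x * pha a y"
  "pha a 0 = 0" "pha a 1 = 1" "pha a (scl c x) = scl c (pha a x)" "pha a (- x) = - pha a x" "pha a (gen g) = torX scl a gen g"
  by (simp_all add: That_def Tmhat_def ph3_def phth_def pha_def)

lemma ph3_ph3 [simp]: "ph3 (ph3 x) = x"
proof -
  have "sw3 (sw3 g) = g" for g :: "'a ugen" by (cases g) auto
  then show ?thesis by (induction x rule: fa_word_induct) auto
qed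

lemma phth_phth [simp]: "phth (phth x) = x"
proof -
  have "phth (thX gen g) = (gen g :: 'a ugen fmon \<Rightarrow>\<^sub>0 'b)" for g :: "'a ugen" by (cases g) auto
  then show ?thesis by (induction x rule: fa_word_induct) auto
qed

lemma rho_hat:
  "rho \<psi> (That p \<chi> x) = LE.ev (Tim lsc (opX \<psi>) p (nn p \<chi>) (\<lambda>i. inverse (lam p (rp p \<chi>) i))) x"
  "rho \<psi> (Tmhat p \<chi> x) = LE.ev (Tmim lsc (opX \<psi>) p (nn p \<chi>) (\<lambda>i. inverse (lam p (rp p (bichar_inv \<chi>)) i))) x"
  "rho \<psi> (ph3 x) = LE.ev (\<lambda>g. opX \<psi> (sw3 g)) x"
  "rho \<psi> (phth x) = LE.ev (thX (opX \<psi>)) x"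
  "rho \<psi> (pha a x) = LE.ev (torX lsc a (opX \<psi>)) x"
  by (simp_all add: rho_def That_def Tmhat_def ph3_def phth_def pha_def LE.ev_ev LE.ev_Tim LE.ev_Tmim LE.ev_thX LE.ev_torX)

lemma rho_zeroD: "bicharacter \<psi> \<Longrightarrow> rho \<psi> x = 0 \<Longrightarrow> x \<in> \<U>_ideal \<psi>"
  using bichar_loc.rho_eq_iff[OF bichar_loc.intro, of \<psi> x 0] by (simp add: eqm_def)

lemma rho_eqmI: "bicharacter \<psi> \<Longrightarrow> rho \<psi> x = rho \<psi> y \<Longrightarrow> eqm (\<U>_ideal \<psi>) x y"
  using bichar_loc.rho_eq_iff[OF bichar_loc.intro, of \<psi> x y] by simp

lemma eqm_rho: "bicharacter \<psi> \<Longrightarrow> eqm (\<U>_ideal \<psi>) x y \<Longrightarrow> rho \<psi> x = rho \<psi> y"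
  using bichar_loc.rho_eq_iff[OF bichar_loc.intro, of \<psi> x y] by simp

lemma bichar_op_op [simp]: "bichar_op (bichar_op \<chi>) = \<chi>"
  by (simp add: bichar_op_def)

lemma bichar_inv_inv [simp]: "bichar_inv (bichar_inv \<chi>) = \<chi>"
  by (simp add: bichar_inv_def)

lemma bichar_inv_op: "bichar_inv (bichar_op \<chi>) = bichar_op (bichar_inv \<chi>)"
  by (simp add: bichar_inv_def bichar_op_def)

lemma model: "bicharacter \<psi> \<Longrightarrow> double_rel lsc \<psi> (opX \<psi>)" by (rule pbw_model)

lemma ph3_R:
  assumes b: "bicharacter \<chi>" shows "x \<in> \<U>_ideal \<chi> \<Longrightarrow> ph3 x \<in> \<U>_ideal (bichar_op \<chi>)"
proof -
  have "double_rel lsc \<chi> (\<lambda>g. opX (bichar_op \<chi>) (sw3 g))"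
    using double_rel.dual_op[OF model[OF bichar_op[OF b]]] by simp
  from double_rel.ev_ideal[OF this] show "x \<in> \<U>_ideal \<chi> \<Longrightarrow> ph3 x \<in> \<U>_ideal (bichar_op \<chi>)"
    by (intro rho_zeroD) (simp_all add: b rho_hat)
qed

lemma phth_R:
  assumes b: "bicharacter \<chi>" shows "x \<in> \<U>_ideal \<chi> \<Longrightarrow> phth x \<in> \<U>_ideal (bichar_op (bichar_inv \<chi>))"
proof -
  have "double_rel lsc \<chi> (thX (opX (bichar_op (bichar_inv \<chi>))))"
    using double_rel.dual_inv_op[OF model[OF bichar_op[OF bichar_inv[OF b]]]] by (simp add: bichar_inv_op)
  from double_rel.ev_ideal[OF this] show "x \<in> \<U>_ideal \<chi> \<Longrightarrow> phth x \<in> \<U>_ideal (bichar_op (bichar_inv \<chi>))"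
    by (intro rho_zeroD) (simp_all add: b rho_hat)
qed

lemma (in double_rel) torus: "(\<And>i. a i \<noteq> 0) \<Longrightarrow> double_rel sc \<chi> (torX sc a X)"
proof (unfold_locales)
  have t: "g \<in> cartan_gens \<Longrightarrow> torX sc a X g = X g" for g by (auto elim: cartan_cases)
  show "torX sc a X x * torX sc a X y = torX sc a X y * torX sc a X x" if "x \<in> cartan_gens" "y \<in> cartan_gens" for x y
    using that by (simp add: t cart_comm)
  assume a: "\<And>i. a i \<noteq> 0"
  show "torX sc a X (GE i) * torX sc a X (GF j) - torX sc a X (GF j) * torX sc a X (GE i) =
      (if i = j then torX sc a X (GK i) - torX sc a X (GL i) else 0)" for i j
  proof -
    have "torX sc a X (GE i) * torX sc a X (GF j) - torX sc a X (GF j) * torX sc a X (GE i) = sc (a i * inverse (a j)) (E i * F j - F j * E i)"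
      by (simp add: mult.commute)
    then show ?thesis using a[of j] unfolding EF by (auto simp del: sc_diff)
  qed
qed (simp_all add: bich KK' LL' KE LE KF LF mult.commute)

lemma pha_R:
  assumes b: "bicharacter \<chi>" and a: "\<And>i. a i \<noteq> 0"
  shows "x \<in> \<U>_ideal \<chi> \<Longrightarrow> pha a x \<in> \<U>_ideal \<chi>"
  using double_rel.ev_ideal[OF double_rel.torus[OF model[OF b]], of a x] a
  by (intro rho_zeroD) (simp_all add: b rho_hat)

lemma SF_tideal: "bicharacter \<chi> \<Longrightarrow> tideal (SF \<chi>)"
  by (rule bichar_loc.SF) (rule bichar_loc.intro)

lemma R_SF: "bicharacter \<chi> \<Longrightarrow> \<U>_ideal \<chi> \<subseteq> SF \<chi>"
  by (rule bichar_loc.R_SF) (rule bichar_loc.intro)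

lemma R_tideal: "tideal (\<U>_ideal \<chi>)" by (rule U_ideal)

lemma embE_SF: "bicharacter \<chi> \<Longrightarrow> embE x \<in> SF \<chi> \<longleftrightarrow> x \<in> radical (qm \<chi>)"
  by (rule bichar_loc.embE_SF_iff) (rule bichar_loc.intro)

lemma embF_SF: "bicharacter \<chi> \<Longrightarrow> frev x \<in> radical (qm \<chi>) \<Longrightarrow> embF x \<in> SF \<chi>"
  using bichar_loc.ph4_SF[OF bichar_loc.intro, of \<chi> "embE (frev x)"] by (simp add: embE_SF ph4_embE)

lemma SF_hom:
  assumes b: "bicharacter \<chi>" and b': "bicharacter \<chi>'"
    and G: "\<And>x y. G (x + y) = G x + G y" "\<And>x y. G (x * y) = G x * G y"
    and GR: "\<And>x. x \<in> \<U>_ideal \<chi> \<Longrightarrow> G x \<in> SF \<chi>'"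
    and E: "\<And>x. x \<in> radical (qm \<chi>) \<Longrightarrow> G (embE x) \<in> SF \<chi>'"
    and F: "\<And>x. frev x \<in> radical (qm \<chi>) \<Longrightarrow> G (embF x) \<in> SF \<chi>'"
    and x: "x \<in> SF \<chi>"
  shows "G x \<in> SF \<chi>'"
proof -
  interpret bichar_loc \<chi> by (rule bichar_loc.intro[OF b])
  note I = tideal_closed[OF SF_tideal[OF b']]
  show ?thesis using x
  proof (induction rule: SF_induct)
    case (prod x c y)
    then show ?case unfolding el_def G using E[of x] F[of y] I(3,4) by blast
  next
    case (R x) then show ?case by (rule GR)
  next
    case (add x y) then show ?case by (simp add: G I(2))
  qed
qed

lemma ph3_emb: "ph3 (embE x) = embF x" "ph3 (embF x) = embE x"
  by (induction x rule: fa_word_induct; simp)+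

lemma phth_emb: "phth (embE x) = embE x" "phth (embF x) = embF (tor (\<lambda>i. -1) x)"
  by (induction x rule: fa_word_induct; simp)+

lemma pha_emb: "pha a (embE x) = embE (tor a x)" "pha a (embF x) = embF (tor (\<lambda>i. inverse (a i)) x)"
  by (induction x rule: fa_word_induct; simp)+

lemma ph3_SF:
  assumes b: "bicharacter \<chi>" and x: "x \<in> SF \<chi>" shows "ph3 x \<in> SF (bichar_op \<chi>)"
proof (rule SF_hom[OF b bichar_op[OF b] _ _ _ _ _ x])
  show "ph3 (embE x) \<in> SF (bichar_op \<chi>)" if "x \<in> radical (qm \<chi>)" for x
    unfolding ph3_emb by (rule embF_SF) (use b radical_frev[OF that] in simp_all)
  show "ph3 (embF x) \<in> SF (bichar_op \<chi>)" if "frev x \<in> radical (qm \<chi>)" for x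
    unfolding ph3_emb using b radical_frev[OF that] by (simp add: embE_SF)
  show "ph3 x \<in> SF (bichar_op \<chi>)" if "x \<in> \<U>_ideal \<chi>" for x
    using ph3_R[OF b that] R_SF[OF bichar_op[OF b]] by blast
qed simp_all

lemma qm_inv_op: "qm (bichar_op (bichar_inv \<chi>)) = inv_op (qm \<chi>)"
  by (simp add: fun_eq_iff inv_op_def transp_def)

lemma phth_SF:
  assumes b: "bicharacter \<chi>" and x: "x \<in> SF \<chi>" shows "phth x \<in> SF (bichar_op (bichar_inv \<chi>))"
proof (rule SF_hom[OF b _ _ _ _ _ _ x])
  note b' = bichar_op[OF bichar_inv[OF b]]
  show "bicharacter (bichar_op (bichar_inv \<chi>))" by (rule b')
  have rad: "x \<in> radical (qm \<chi>) \<Longrightarrow> x \<in> radical (qm (bichar_op (bichar_inv \<chi>)))" for x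
    unfolding qm_inv_op using radical_inv_op[of "qm \<chi>"] qm_nonzero[OF b] by blast
  show "phth (embE x) \<in> SF (bichar_op (bichar_inv \<chi>))" if "x \<in> radical (qm \<chi>)" for x
    unfolding phth_emb embE_SF[OF b'] by (rule rad[OF that])
  show "phth (embF x) \<in> SF (bichar_op (bichar_inv \<chi>))" if "frev x \<in> radical (qm \<chi>)" for x
    unfolding phth_emb by (rule embF_SF[OF b']) (unfold frev_tor, rule radical_closed(5)[OF rad[OF that]])
  show "phth x \<in> SF (bichar_op (bichar_inv \<chi>))" if "x \<in> \<U>_ideal \<chi>" for x
    using phth_R[OF b that] R_SF[OF b'] by blast
qed simp_all

lemma pha_SF:
  assumes b: "bicharacter \<chi>" and a: "\<And>i. a i \<noteq> 0" and x: "x \<in> SF \<chi>" shows "pha a x \<in> SF \<chi>"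
proof (rule SF_hom[OF b b _ _ _ _ _ x])
  show "pha a (embE x) \<in> SF \<chi>" if "x \<in> radical (qm \<chi>)" for x
    unfolding pha_emb embE_SF[OF b] by (rule radical_closed(5)[OF that])
  show "pha a (embF x) \<in> SF \<chi>" if "frev x \<in> radical (qm \<chi>)" for x
    unfolding pha_emb by (rule embF_SF[OF b]) (unfold frev_tor, rule radical_closed(5)[OF that])
  show "pha a x \<in> SF \<chi>" if "x \<in> \<U>_ideal \<chi>" for x
    using pha_R[of \<chi> a x, OF b _ that] a R_SF[OF b] by fast
qed simp_all

text \<open>The top root vectors lie in the radical.\<close>

abbreviation "EpF p i \<equiv> rv (gen (GK p)) (gen (GK' p)) (gen (GE p)) (gen (GE i))"
abbreviation "EmF p i \<equiv> rv (gen (GL p)) (gen (GL' p)) (gen (GE p)) (gen (GE i))"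
abbreviation "FpF p i \<equiv> rv (gen (GL p)) (gen (GL' p)) (gen (GF p)) (gen (GF i))"
abbreviation "FmF p i \<equiv> rv (gen (GK p)) (gen (GK' p)) (gen (GF p)) (gen (GF i))"

lemma cc_top: "p_finite p \<chi> \<Longrightarrow> i \<noteq> p \<Longrightarrow> cc (qm \<chi> p p) (qm \<chi> p i * qm \<chi> i p) (Suc (nn p \<chi> i)) = 0"
  using cmin_nn(1)[of p \<chi> i] by (auto simp: cmin_def cc_def)

lemma radical_epl_top:
  assumes b: "bicharacter \<chi>" and f: "p_finite p \<chi>" and i: "i \<noteq> p"
  shows "epl (qm \<chi>) p i (Suc (nn p \<chi> i)) \<in> radical (qm \<chi>)"
proof -
  let ?x = "epl (qm \<chi>) p i (Suc (nn p \<chi> i))"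
  have "{0, ?x} \<subseteq> radical (qm \<chi>)"
  proof (rule subset_radicalI_ld)
    show "ld (qm \<chi>) j x \<in> {0, ?x}" if "x \<in> {0, ?x}" for x j
    proof -
      have "ld (qm \<chi>) j ?x = 0"
        using ld_p_epl[OF i, of "qm \<chi>" "nn p \<chi> i"] cc_top[OF f i] ld_i_epl[OF i, of "qm \<chi>" "Suc (nn p \<chi> i)"]
          ld_other_epl[of j p i "qm \<chi>" "Suc (nn p \<chi> i)"] qm_nonzero[OF b]
        by (cases "j = p"; cases "j = i") (simp_all del: gv.simps)
      then show ?thesis using that by (auto simp del: gv.simps)
    qed
  qed (use eps_gv in auto)
  then show ?thesis by blast
qed

lemma eqm_EpF: "bicharacter \<chi> \<Longrightarrow> eqm (\<U>_ideal \<chi>) (EpF p i m) (embE (epl (qm \<chi>) p i m))"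
proof (rule rho_eqmI)
  assume b: "bicharacter \<chi>"
  interpret bichar_loc \<chi> by (rule bichar_loc.intro[OF b])
  have "rho \<chi> (EpF p i m) = M.Ep p i m" unfolding rho_def by (simp add: LE.ev_rv)
  then show "rho \<chi> (EpF p i m) = rho \<chi> (embE (epl (qm \<chi>) p i m))" by (simp only: rho_embE M.Ep_Ev)
qed

lemma eqm_EmF: "bicharacter \<chi> \<Longrightarrow> eqm (\<U>_ideal \<chi>) (EmF p i m) (embE (epl (inv_op (qm \<chi>)) p i m))"
proof (rule rho_eqmI)
  assume b: "bicharacter \<chi>"
  interpret bichar_loc \<chi> by (rule bichar_loc.intro[OF b])
  have "rho \<chi> (EmF p i m) = M.Em p i m" unfolding rho_def by (simp add: LE.ev_rv)
  then show "rho \<chi> (EmF p i m) = rho \<chi> (embE (epl (inv_op (qm \<chi>)) p i m))" by (simp only: rho_embE M.Em_Ev)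
qed

lemma ph3_rv: "ph3 (rv k k' x y m) = rv (ph3 k) (ph3 k') (ph3 x) (ph3 y) m"
  by (induction m) (simp_all only: rv.simps hat_simps)

lemma phth_rv: "phth (rv k k' x y m) = rv (phth k) (phth k') (phth x) (phth y) m"
  by (induction m) (simp_all only: rv.simps hat_simps)

lemma EpF_SF: "bicharacter \<chi> \<Longrightarrow> p_finite p \<chi> \<Longrightarrow> i \<noteq> p \<Longrightarrow> EpF p i (Suc (nn p \<chi> i)) \<in> SF \<chi>"
  by (rule bichar_loc.eqm_SF[OF bichar_loc.intro eqm_EpF]) (simp_all only: embE_SF radical_epl_top not_False_eq_True)

lemma nn_op: "nn p (bichar_op \<chi>) i = nn p \<chi> i"
  by (simp add: nn_def cartan_op)

lemma nn_inv: "bicharacter \<chi> \<Longrightarrow> nn p (bichar_inv \<chi>) i = nn p \<chi> i"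
  by (simp add: nn_def cartan_inv)

lemma FpF_SF:
  assumes "bicharacter \<chi>" "p_finite p \<chi>" "i \<noteq> p" shows "FpF p i (Suc (nn p \<chi> i)) \<in> SF \<chi>"
  using ph3_SF[OF bichar_op[OF assms(1)] EpF_SF[OF bichar_op[OF assms(1)] p_finite_op[OF assms(2)] assms(3)]]
  by (simp add: ph3_rv nn_op del: rv.simps)

section \<open>The Lusztig maps respect the defining relations\<close>

lemma That_R_general:
  assumes b: "bicharacter \<chi>" and f: "p_finite p \<chi>" and I: "tideal I" and RI: "\<U>_ideal (rp p \<chi>) \<subseteq> I"
    and E: "\<And>i. i \<noteq> p \<Longrightarrow> EpF p i (Suc (nn p \<chi> i)) \<in> I" and F: "\<And>i. i \<noteq> p \<Longrightarrow> FpF p i (Suc (nn p \<chi> i)) \<in> I"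
    and x: "x \<in> \<U>_ideal \<chi>"
  shows "That p \<chi> x \<in> I"
proof -
  let ?\<psi> = "rp p \<chi>"
  note b' = rp_bichar[OF b, of p] and f' = p_finite_rp[OF b f]
  interpret bichar_loc ?\<psi> by (rule bichar_loc.intro[OF b'])
  have nn: "nn p \<chi> = nn p ?\<psi>" using nn_rp[OF b f] by auto
  have *: "y \<in> I" if "rho ?\<psi> y = rho ?\<psi> z" "z \<in> I" for y z
    using rho_eqmI[OF b' that(1)] RI tideal_closed(2)[OF I, of "y - z" z] that(2) by (auto simp: eqm_def)
  have rel: "That p \<chi> r \<in> I" if "r \<in> \<U>_rels \<chi>" for r
  proof -
    have e: "rho ?\<psi> (That p \<chi> r) = LE.ev (M.TX p) r" unfolding rho_hat(1) nn ..
    have rE: "rho ?\<psi> (EpF p j m) = M.Ep p j m" and rF: "rho ?\<psi> (FpF p j m) = M.Fp p j m" for j m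
      unfolding rho_def by (simp_all add: LE.ev_rv)
    from M.Tim_rels[OF f', of r] that have "LE.ev (M.TX p) r = 0 \<or>
       (\<exists>j c. j \<noteq> p \<and> LE.ev (M.TX p) r = lsc c (M.L' p * M.Fp p j (Suc (nn p ?\<psi> j)))) \<or>
       (\<exists>j c. j \<noteq> p \<and> LE.ev (M.TX p) r = lsc c (M.K' p * M.Ep p j (Suc (nn p ?\<psi> j))))"
      unfolding rp_rp[OF b f] by blast
    then show ?thesis
    proof (elim disjE exE conjE)
      assume "LE.ev (M.TX p) r = 0"
      then show ?thesis using *[of _ 0] e tideal_closed(1)[OF I] by simp
    next
      fix j c assume j: "j \<noteq> p" and r: "LE.ev (M.TX p) r = lsc c (M.L' p * M.Fp p j (Suc (nn p ?\<psi> j)))"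
      show ?thesis
      proof (rule *)
        show "rho ?\<psi> (That p \<chi> r) = rho ?\<psi> (scl c (gen (GL' p) * FpF p j (Suc (nn p ?\<psi> j))))"
          unfolding e r by (simp add: rF del: rv.simps opX.simps)
        show "scl c (gen (GL' p) * FpF p j (Suc (nn p ?\<psi> j))) \<in> I"
          by (intro tideal_scl[OF I] tideal_closed(3)[OF I]) (use F[OF j] in \<open>simp only: nn\<close>)
      qed
    next
      fix j c assume j: "j \<noteq> p" and r: "LE.ev (M.TX p) r = lsc c (M.K' p * M.Ep p j (Suc (nn p ?\<psi> j)))"
      show ?thesis
      proof (rule *)
        show "rho ?\<psi> (That p \<chi> r) = rho ?\<psi> (scl c (gen (GK' p) * EpF p j (Suc (nn p ?\<psi> j))))"
          unfolding e r by (simp add: rE del: rv.simps opX.simps)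
        show "scl c (gen (GK' p) * EpF p j (Suc (nn p ?\<psi> j))) \<in> I"
          by (intro tideal_scl[OF I] tideal_closed(3)[OF I]) (use E[OF j] in \<open>simp only: nn\<close>)
      qed
    qed
  qed
  have "tideal {x. That p \<chi> x \<in> I}" using tideal_closed[OF I] by (auto simp: tideal_def)
  from U_ideal(3)[OF this, of \<chi>] show ?thesis using rel x by blast
qed

lemma That_R:
  assumes b: "bicharacter \<chi>" and f: "p_finite p \<chi>" and x: "x \<in> \<U>_ideal \<chi>"
  shows "That p \<chi> x \<in> SF (rp p \<chi>)"
proof (rule That_R_general[OF b f _ _ _ _ x])
  note b' = rp_bichar[OF b, of p] and f' = p_finite_rp[OF b f]
  show "tideal (SF (rp p \<chi>))" "\<U>_ideal (rp p \<chi>) \<subseteq> SF (rp p \<chi>)" by (rule SF_tideal[OF b'], rule R_SF[OF b'])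
  show "EpF p i (Suc (nn p \<chi> i)) \<in> SF (rp p \<chi>)" "FpF p i (Suc (nn p \<chi> i)) \<in> SF (rp p \<chi>)" if "i \<noteq> p" for i
    using EpF_SF[OF b' f' that] FpF_SF[OF b' f' that] unfolding nn_rp[OF b f] .
qed

text \<open>The composition of the lifted maps, and the conjugation between the two of them.\<close>

lemma Tmhat_That:
  assumes b: "bicharacter \<chi>" and f: "p_finite p \<chi>"
  shows "eqm (\<U>_ideal \<chi>) (Tmhat p (rp p \<chi>) (That p \<chi> x)) x"
proof (rule rho_eqmI[OF b])
  interpret bichar_loc \<chi> by (rule bichar_loc.intro[OF b])
  have nn: "nn p (rp p \<chi>) = nn p \<chi>" using nn_rp[OF b f] by auto
  have rr: "rp p (bichar_inv (rp p \<chi>)) = bichar_inv \<chi>"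
    using rp_inv[OF rp_bichar[OF b]] rp_rp[OF b f] by simp
  have "rho \<chi> (Tmhat p (rp p \<chi>) (That p \<chi> x)) = LE.ev (M.TmX p) (That p \<chi> x)"
    unfolding rho_hat(2) nn rr ..
  also have "\<dots> = LE.ev (\<lambda>g. Tim lsc (M.TmX p) p (nn p \<chi>) (\<lambda>i. inverse (lam p (rp p \<chi>) i)) g) x"
    unfolding That_def LE.ev_ev LE.ev_Tim ..
  also have "\<dots> = LE.ev (opX \<chi>) x" unfolding M.Tim_Tmim[OF f] ..
  finally show "rho \<chi> (Tmhat p (rp p \<chi>) (That p \<chi> x)) = rho \<chi> x" by (simp add: rho_def)
qed

definition conj_tor :: "'i \<Rightarrow> ('i, 'k::field) bichar \<Rightarrow> 'i \<Rightarrow> 'k" where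
  "conj_tor p \<chi> i = (if i = p then - qm \<chi> p p else inverse (lam p (rp p (bichar_inv \<chi>)) i))"

lemma lam_inv_nonzero:
  "bicharacter \<chi> \<Longrightarrow> p_finite p \<chi> \<Longrightarrow> i \<noteq> p \<Longrightarrow> lam p (rp p (bichar_inv \<chi>)) i \<noteq> 0"
  by (intro lam_nonzero p_finite_rp p_finite_inv bichar_inv)

lemma conj_tor_nonzero: "bicharacter \<chi> \<Longrightarrow> p_finite p \<chi> \<Longrightarrow> conj_tor p \<chi> i \<noteq> 0"
  using lam_inv_nonzero[of \<chi> p i] qm_nonzero[of \<chi> p p] by (simp add: conj_tor_def)

lemma Tmhat_via_That:
  assumes b: "bicharacter \<chi>" and f: "p_finite p \<chi>"
  shows "eqm (\<U>_ideal (rp p \<chi>)) (Tmhat p \<chi> x)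
    (phth (That p (bichar_op (bichar_inv \<chi>)) (phth (pha (conj_tor p \<chi>) x))))"
proof (rule rho_eqmI[OF rp_bichar[OF b]])
  let ?\<psi> = "rp p \<chi>" and ?c = "bichar_op (bichar_inv \<chi>)"
  note b' = rp_bichar[OF b, of p] and f' = p_finite_rp[OF b f]
  interpret bichar_loc ?\<psi> by (rule bichar_loc.intro[OF b'])
  let ?N = "nn p \<chi>" and ?l = "\<lambda>i. inverse (lam p (rp p (bichar_inv \<chi>)) i)"
  have nn: "nn p ?c = ?N" by (rule ext) (simp add: nn_op nn_inv[OF b])
  have ll: "(\<lambda>i. inverse (lam p (rp p ?c) i)) = ?l" by (rule ext) (simp add: rp_op lam_op)
  let ?T = "Tim lsc (thX (opX ?\<psi>)) p ?N ?l"
  have lnz: "i \<noteq> p \<Longrightarrow> ?l i \<noteq> 0" for i using lam_inv_nonzero[OF b f] by simp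
  have tor: "(if i = p then - M.q p p else ?l i) = conj_tor p \<chi> i" for i
    by (simp add: conj_tor_def qm_rp(1)[OF b])
  note via = M.Tmim_via[of p ?l ?N, OF f' lnz, unfolded tor]
  have "rho ?\<psi> (phth (That p ?c (phth (pha (conj_tor p \<chi>) x)))) = LE.ev ?T (phth (pha (conj_tor p \<chi>) x))"
    unfolding rho_hat(4) That_def nn ll LE.ev_ev LE.ev_Tim ..
  also have "\<dots> = LE.ev (\<lambda>g. LE.ev (thX ?T) (torX scl (conj_tor p \<chi>) gen g)) x"
    unfolding phth_def pha_def LE.ev_ev LE.ev_thX by (simp add: LE.ev_torX)
  also have "\<dots> = LE.ev (Tmim lsc (opX ?\<psi>) p ?N ?l) x"
  proof (rule LE.ev_cong)
    fix g show "LE.ev (thX ?T) (torX scl (conj_tor p \<chi>) gen g) = Tmim lsc (opX ?\<psi>) p ?N ?l g"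
    proof (cases g)
      case (GK i) show ?thesis unfolding LE.ev_torX unfolding GK torX.simps thX.simps by (rule via(1)[symmetric])
    next
      case (GK' i) show ?thesis unfolding LE.ev_torX unfolding GK' torX.simps thX.simps by (rule via(2)[symmetric])
    next
      case (GL i) show ?thesis unfolding LE.ev_torX unfolding GL torX.simps thX.simps by (rule via(3)[symmetric])
    next
      case (GL' i) show ?thesis unfolding LE.ev_torX unfolding GL' torX.simps thX.simps by (rule via(4)[symmetric])
    next
      case (GE i) show ?thesis unfolding LE.ev_torX unfolding GE torX.simps thX.simps by (rule via(5)[symmetric])
    next
      case (GF i) show ?thesis unfolding LE.ev_torX unfolding GF torX.simps thX.simps LE.sc_minus by (rule via(6)[symmetric])
    qed
  qed
  finally show "rho ?\<psi> (Tmhat p \<chi> x) = rho ?\<psi> (phth (That p ?c (phth (pha (conj_tor p \<chi>) x))))"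
    unfolding rho_hat(2) ..
qed

lemma minus_one_power_scl: "(-1) ^ n * (x :: 'g fmon \<Rightarrow>\<^sub>0 'k::field) = scl ((-1) ^ n) x"
  by (induction n) auto

lemma Tmhat_R_general:
  assumes b: "bicharacter \<chi>" and f: "p_finite p \<chi>" and I: "tideal I" and RI: "\<U>_ideal (rp p \<chi>) \<subseteq> I"
    and E: "\<And>i. i \<noteq> p \<Longrightarrow> EmF p i (Suc (nn p \<chi> i)) \<in> I" and F: "\<And>i. i \<noteq> p \<Longrightarrow> FmF p i (Suc (nn p \<chi> i)) \<in> I"
    and x: "x \<in> \<U>_ideal \<chi>"
  shows "Tmhat p \<chi> x \<in> I"
proof -
  let ?c = "bichar_op (bichar_inv \<chi>)"
  have bc: "bicharacter ?c" using b by simp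
  have fc: "p_finite p ?c" by (intro p_finite_op p_finite_inv b f)
  have rc: "rp p ?c = bichar_op (bichar_inv (rp p \<chi>))" by (simp add: rp_op rp_inv[OF b])
  have nn: "nn p ?c i = nn p \<chi> i" for i by (simp add: nn_op nn_inv[OF b])
  let ?I = "{y. phth y \<in> I}"
  have "That p ?c (phth (pha (conj_tor p \<chi>) x)) \<in> ?I"
  proof (rule That_R_general[OF bc fc])
    show "tideal ?I" using tideal_closed[OF I] by (auto simp: tideal_def)
    show "\<U>_ideal (rp p ?c) \<subseteq> ?I"
      using phth_R[of "rp p ?c"] bc RI unfolding rc by (auto simp: bichar_inv_op b)
    show "EpF p i (Suc (nn p ?c i)) \<in> ?I" if "i \<noteq> p" for i
      using E[OF that] by (simp add: phth_rv nn del: rv.simps)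
    show "FpF p i (Suc (nn p ?c i)) \<in> ?I" if "i \<noteq> p" for i
    proof -
      have "phth (FpF p i m :: 'a ugen fmon \<Rightarrow>\<^sub>0 'b) = scl ((-1) ^ (m + 1)) (FmF p i m)" for m
      proof -
        show ?thesis by (simp only: phth_rv) (simp add: rv_minus minus_one_power_scl)
      qed
      then show ?thesis using tideal_scl[OF I F[OF that], of "(-1) ^ (nn p \<chi> i + 2)"] tideal_closed(5)[OF I] by (simp add: nn del: rv.simps)
    qed
    show "phth (pha (conj_tor p \<chi>) x) \<in> \<U>_ideal ?c"
      by (intro phth_R pha_R b x conj_tor_nonzero f)
  qed
  then show ?thesis using eqm_mem[OF I eqm_mono[OF RI Tmhat_via_That[OF b f]]] by simp
qed

section \<open>Splitting off the powers of one generator\<close>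

context double_rel
begin

text \<open>The image of the algebra generated by the \<open>E\<^sub>i\<close> of the source.\<close>

definition Te :: "'i \<Rightarrow> ('i, 'k) fa \<Rightarrow> 'a" where "Te p = ev (\<lambda>i. TX p (GE i))"

lemma Te_simps [simp]: "Te p (x + y) = Te p x + Te p y" "Te p (x - y) = Te p x - Te p y" "Te p 0 = 0"
  "Te p (scl c x) = sc c (Te p x)" "Te p 1 = 1" "Te p (gen i) = TX p (GE i)" "Te p (x * y) = Te p x * Te p y"
  "Te p (x ^ n) = Te p x ^ n"
  by (simp_all add: Te_def del: Tim.simps)

lemma Te_sum: "Te p (sum f B) = (\<Sum>b\<in>B. Te p (f b))"
  by (simp add: Te_def ev_sum)

abbreviation "sq p \<equiv> qm (rp p \<chi>)"
abbreviation "Ds p \<equiv> tor (\<lambda>j. inverse (sq p j p))"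
abbreviation "Dt p \<equiv> tor (\<lambda>j. q j p)"

definition H :: "'i \<Rightarrow> ('i, 'k) fa \<Rightarrow> ('i, 'k) fa \<Rightarrow> bool" where
  "H p x y \<longleftrightarrow> ld (sq p) p x = 0 \<and> rd q p y = 0 \<and> (\<forall>n. Te p ((Ds p ^^ n) x) = Ev ((Dt p ^^ n) y))"

lemma funpow_tor: "(tor a ^^ n) x = tor (\<lambda>j. a j ^ n) x"
  by (induction n) (simp_all add: tor_one tor_tor)

lemma H_linear: "H p 0 0" "H p x y \<Longrightarrow> H p x' y' \<Longrightarrow> H p (x + x') (y + y')" "H p x y \<Longrightarrow> H p (scl c x) (scl c y)"
  by (auto simp: H_def funpow_tor)

lemma H_D: "H p x y \<Longrightarrow> H p (Ds p x) (Dt p y)"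
proof -
  assume h: "H p x y"
  have "Te p ((Ds p ^^ n) (Ds p x)) = Ev ((Dt p ^^ n) (Dt p y))" for n
  proof -
    have "Te p ((Ds p ^^ Suc n) x) = Ev ((Dt p ^^ Suc n) y)" using h unfolding H_def by blast
    then show ?thesis by (simp only: funpow_Suc_right o_apply)
  qed
  moreover have "ld (sq p) p x = 0" "rd q p y = 0" using h unfolding H_def by blast+
  ultimately show ?thesis unfolding H_def by (simp only: ld_tor rd_tor) simp
qed

lemma sq_pp: "sq p p p = q p p" and sq_ip: "i \<noteq> p \<Longrightarrow> sq p i p = inverse (q i p * q p p ^ nn p \<chi> i)"
  by (simp_all add: qm_rp[OF bich])

lemma sq_nz: "sq p i j \<noteq> 0"
  by (rule qm_nonzero) (simp add: bich)

lemma H_one: "H p 1 1"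
  by (simp add: H_def funpow_tor)

lemma H_gen:
  assumes i: "i \<noteq> p" and h: "H p x y"
  shows "H p (gen i * x) (epl q p i (nn p \<chi> i) * y)"
proof -
  have "Te p ((Ds p ^^ n) (gen i * x)) = Ev ((Dt p ^^ n) (epl q p i (nn p \<chi> i) * y))" for n
  proof -
    have "Te p ((Ds p ^^ n) x) = Ev ((Dt p ^^ n) y)" using h by (simp add: H_def)
    then show ?thesis using i
      by (simp add: funpow_tor tor_gv sq_ip Ep_Ev power_mult_distrib mult_ac power_mult[symmetric] del: gv.simps)
  qed
  then show ?thesis using h i by (simp add: H_def rd_mult rd_p_epl)
qed

lemma H_ad:
  assumes h: "H p x y"
  shows "H p (gen p * x - Ds p x * gen p) (scl (q p p) (ld q p y))"
proof -
  have ldx: "ld (sq p) p x = 0" and rdy: "rd q p y = 0" using h by (auto simp: H_def)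
  have tt: "tor (\<lambda>j. sq p j p) (Ds p x) = x" by (simp add: tor_tor sq_nz tor_one)
  have 1: "ld (sq p) p (gen p * x - Ds p x * gen p) = 0"
    by (simp add: ld_mult ldx ld_tor tt)
  have 2: "rd q p (scl (q p p) (ld q p y)) = 0" by (simp add: ld_rd_commute[symmetric] rdy)
  have 3: "Te p ((Ds p ^^ n) (gen p * x - Ds p x * gen p)) = Ev ((Dt p ^^ n) (scl (q p p) (ld q p y)))" for n
  proof -
    let ?a = "(Ds p ^^ n) x" and ?b = "(Dt p ^^ n) y"
    have ab: "Te p ?a = Ev ?b" using h by (simp add: H_def)
    have Dab: "Te p (Ds p ?a) = Ev (Dt p ?b)"
      using h unfolding H_def by (metis funpow.simps(2) comp_apply)
    have rdb: "rd q p ?b = 0" by (simp add: funpow_tor rd_tor rdy)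
    have L'E: "L' p * Ev ?b = Ev (Dt p ?b) * L' p"
    proof -
      have "L p * Ev (Dt p ?b) = Ev ?b * L p" unfolding L_Ev by (simp add: tor_tor tor_one)
      then have "L' p * (L p * Ev (Dt p ?b)) * L' p = L' p * (Ev ?b * L p) * L' p" by simp
      moreover have "L' p * (L p * Ev (Dt p ?b)) * L' p = Ev (Dt p ?b) * L' p" by (simp add: mult.assoc[symmetric] L'L)
      moreover have "L' p * (Ev ?b * L p) * L' p = L' p * Ev ?b" by (simp add: mult.assoc LL')
      ultimately show ?thesis by simp
    qed
    have "(Ds p ^^ n) (gen p * x - Ds p x * gen p) = scl (inverse (q p p) ^ n) (gen p * ?a - Ds p ?a * gen p)"
      by (simp add: funpow_tor sq_pp tor_tor mult.commute)
    then have "Te p ((Ds p ^^ n) (gen p * x - Ds p x * gen p)) =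
        sc (inverse (q p p) ^ n) (F p * L' p * Ev ?b - Ev (Dt p ?b) * (F p * L' p))"
      by (simp add: ab Dab)
    also have "F p * L' p * Ev ?b - Ev (Dt p ?b) * (F p * L' p) = - ((Ev (Dt p ?b) * F p - F p * Ev (Dt p ?b)) * L' p)"
      by (simp add: mult.assoc L'E algebra_simps)
    also have "Ev (Dt p ?b) * F p - F p * Ev (Dt p ?b) = - (L p * Ev (ld q p (Dt p ?b)))"
      unfolding Ev_F by (simp add: rd_tor rdb)
    also have "ld q p (Dt p ?b) = scl (q p p) (Dt p (ld q p ?b))" by (rule ld_tor)
    also have "L p * Ev (scl (q p p) (Dt p (ld q p ?b))) = sc (q p p) (Ev (ld q p ?b) * L p)"
      by (simp add: L_Ev tor_tor tor_one)
    also have "- (- sc (q p p) (Ev (ld q p ?b) * L p) * L' p) = sc (q p p) (Ev (ld q p ?b))"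
      by (simp add: mult.assoc LL')
    also have "ld q p ?b = scl (q p p ^ n) ((Dt p ^^ n) (ld q p y))" by (simp add: funpow_tor ld_tor)
    also have "sc (inverse (q p p) ^ n) (sc (q p p) (Ev (scl (q p p ^ n) ((Dt p ^^ n) (ld q p y)))))
       = Ev (scl (q p p) ((Dt p ^^ n) (ld q p y)))"
    proof -
      have "inverse (q p p) ^ n * q p p ^ n = 1" by (simp flip: power_mult_distrib)
      then have e: "inverse (q p p) ^ n * (q p p * q p p ^ n) = q p p" by (metis mult.left_commute mult.right_neutral)
      show ?thesis by (simp add: e)
    qed
    finally show ?thesis by (simp add: funpow_tor)
  qed
  show ?thesis using 1 2 3 by (simp add: H_def)
qed

definition Dec :: "'i \<Rightarrow> nat \<Rightarrow> ('i, 'k) fa \<Rightarrow> (nat \<Rightarrow> ('i, 'k) fa) \<Rightarrow> (nat \<Rightarrow> ('i, 'k) fa) \<Rightarrow> bool" where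
  "Dec p n x xs ys \<longleftrightarrow> x = (\<Sum>k<n. xs k * gen p ^ k) \<and> (\<forall>k. H p (xs k) (ys k)) \<and> (\<forall>k\<ge>n. xs k = 0 \<and> ys k = 0)
     \<and> eps (ys 0) = eps x"

lemma Dec_mono: "Dec p n x xs ys \<Longrightarrow> n \<le> m \<Longrightarrow> Dec p m x xs ys"
proof -
  assume d: "Dec p n x xs ys" "n \<le> m"
  have "(\<Sum>k<n. xs k * gen p ^ k) = (\<Sum>k<m. xs k * gen p ^ k)"
    by (rule sum.mono_neutral_left) (use d in \<open>auto simp: Dec_def\<close>)
  then show ?thesis using d by (auto simp: Dec_def)
qed

lemma decomposition: "\<exists>n xs ys. Dec p n x xs ys"
proof (induction x rule: fa_word_induct)
  case 1
  show ?case
    by (rule exI[of _ 1], rule exI[of _ "\<lambda>k. if k = 0 then 1 else 0"], rule exI[of _ "\<lambda>k. if k = 0 then 1 else 0"])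
      (auto simp: Dec_def H_one H_linear)
next
  case (2 i x)
  then obtain n xs ys where d: "Dec p n x xs ys" by blast
  show ?case
  proof (cases "i = p")
    case False
    let ?e = "epl q p i (nn p \<chi> i)"
    have s: "gen i * x = (\<Sum>k<n. gen i * xs k * gen p ^ k)"
      using d by (simp add: Dec_def sum_distrib_left mult.assoc)
    have e: "eps (?e * ys 0) = eps (gen i * x)" by (simp add: eps_mult eps_gv False del: gv.simps)
    have z: "\<forall>k\<ge>n. gen i * xs k = 0 \<and> ?e * ys k = 0" using d by (simp add: Dec_def del: gv.simps)
    have "\<forall>k. H p (gen i * xs k) (?e * ys k)" using d H_gen[OF False] unfolding Dec_def by blast
    then have "Dec p n (gen i * x) (\<lambda>k. gen i * xs k) (\<lambda>k. ?e * ys k)"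
      unfolding Dec_def using s e z by blast
    then show ?thesis by blast
  next
    case True
    let ?xs = "\<lambda>k. (gen p * xs k - Ds p (xs k) * gen p) + (if k = 0 then 0 else Ds p (xs (k - 1)))"
    let ?ys = "\<lambda>k. scl (q p p) (ld q p (ys k)) + (if k = 0 then 0 else Dt p (ys (k - 1)))"
    have h: "H p (xs k) (ys k)" for k using d by (simp add: Dec_def)
    have z: "k \<ge> n \<Longrightarrow> xs k = 0" "k \<ge> n \<Longrightarrow> ys k = 0" for k using d by (simp_all add: Dec_def)
    have "gen p * x = (\<Sum>k<n. gen p * xs k * gen p ^ k)"
      using d by (simp add: Dec_def sum_distrib_left mult.assoc)
    also have "\<dots> = (\<Sum>k<n. (gen p * xs k - Ds p (xs k) * gen p) * gen p ^ k) + (\<Sum>k<n. Ds p (xs k) * gen p ^ Suc k)"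
      by (simp add: sum.distrib[symmetric] left_diff_distrib mult.assoc)
    also have "(\<Sum>k<n. (gen p * xs k - Ds p (xs k) * gen p) * gen p ^ k) = (\<Sum>k<Suc n. (gen p * xs k - Ds p (xs k) * gen p) * gen p ^ k)"
      by (simp add: z)
    also have "(\<Sum>k<n. Ds p (xs k) * gen p ^ Suc k) = (\<Sum>k<Suc n. (if k = 0 then 0 else Ds p (xs (k - 1))) * gen p ^ k)"
      by (subst sum.lessThan_Suc_shift) simp
    also have "(\<Sum>k<Suc n. (gen p * xs k - Ds p (xs k) * gen p) * gen p ^ k) + (\<Sum>k<Suc n. (if k = 0 then 0 else Ds p (xs (k - 1))) * gen p ^ k)
       = (\<Sum>k<Suc n. ?xs k * gen p ^ k)"
      unfolding sum.distrib[symmetric] distrib_right ..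
    finally have s: "gen p * x = (\<Sum>k<Suc n. ?xs k * gen p ^ k)" .
    have Hk: "H p (?xs k) (?ys k)" for k
      using H_linear(2)[OF H_ad[OF h[of k]] H_D[OF h[of "k - 1"]]] H_ad[OF h[of k]] by (cases "k = 0") simp_all
    have e: "eps (?ys 0) = eps (gen p * x)"
      using h[of 0] eps_rd[of q p "ys 0"] by (simp add: H_def)
    have z': "?xs k = 0 \<and> ?ys k = 0" if "k \<ge> Suc n" for k using that z[of k] z[of "k - 1"] by auto
    have "Dec p (Suc n) (gen p * x) ?xs ?ys" unfolding Dec_def using s Hk e z' by blast
    then show ?thesis using True by blast
  qed
next
  case (3 x y)
  then obtain n xs ys m xs' ys' where d: "Dec p n x xs ys" "Dec p m y xs' ys'" by blast
  have d': "Dec p (max n m) x xs ys" "Dec p (max n m) y xs' ys'" using d by (auto intro: Dec_mono)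
  have "Dec p (max n m) (x + y) (\<lambda>k. xs k + xs' k) (\<lambda>k. ys k + ys' k)"
    using d' unfolding Dec_def by (auto simp: sum.distrib distrib_right H_linear)
  then show ?case by blast
next
  case (4 c x)
  then obtain n xs ys where d: "Dec p n x xs ys" by blast
  have "Dec p n (scl c x) (\<lambda>k. scl c (xs k)) (\<lambda>k. scl c (ys k))"
  proof -
    have s: "scl c x = (\<Sum>k<n. scl c (xs k) * gen p ^ k)" using d by (simp add: Dec_def PM.sc_sum)
    have e: "eps (scl c (ys 0)) = eps (scl c x)" using d by (simp add: Dec_def)
    show ?thesis using s e d unfolding Dec_def by (auto simp: H_linear)
  qed
  then show ?case by blast
qed

lemma Te_Dec: "Dec p n x xs ys \<Longrightarrow> Te p x = (\<Sum>k<n. Ev (ys k) * (F p * L' p) ^ k)"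
proof -
  assume d: "Dec p n x xs ys"
  have "Te p (xs k) = Ev (ys k)" for k
  proof -
    have "Te p ((Ds p ^^ 0) (xs k)) = Ev ((Dt p ^^ 0) (ys k))" using d unfolding Dec_def H_def by blast
    then show ?thesis by simp
  qed
  then show ?thesis using d by (simp add: Dec_def Te_sum)
qed

lemma H_Te: "H p x y \<Longrightarrow> Te p x = Ev y"
proof -
  assume "H p x y"
  then have "Te p ((Ds p ^^ 0) x) = Ev ((Dt p ^^ 0) y)" unfolding H_def by blast
  then show ?thesis by simp
qed

end

lemma ld_power: "ld q p (gen p ^ m) = scl (qnum (q p p) m) (gen p ^ (m - 1))"
proof (induction m)
  case (Suc m)
  then show ?case by (cases m) (auto simp del: qnum_simps simp: qnum_Suc2[of _ m], simp_all add: qnum_Suc2 algebra_simps del: qnum_simps)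
qed simp

lemma gen_power: "gen p ^ k = mon (Word (replicate k p))"
  by (induction k) (simp_all add: single_Word_Nil single_Word_Cons)

lemma fw_power: "fw q v (gen p ^ k) = (if v = replicate k p then qfact (q p p) k else 0)"
proof (induction v arbitrary: k)
  case Nil
  show ?case by (cases k) (auto simp: qfact_def)
next
  case (Cons i v)
  show ?case
  proof (cases k)
    case 0 then show ?thesis by simp
  next
    case (Suc m)
    have o: "i \<noteq> p \<Longrightarrow> ld q i (gen p ^ m) = 0" for m by (induction m) auto
    show ?thesis
    proof (cases "i = p")
      case True
      have "fw q (i # v) (gen p ^ k) = qnum (q p p) k * fw q v (gen p ^ m)"
        by (simp add: True ld_power Suc del: power_Suc qnum_simps)
      then show ?thesis unfolding Cons.IH by (auto simp: Suc True qfact_Suc_prod simp del: qnum_simps)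
    qed (simp add: o Suc del: power_Suc)
  qed
qed

context bichar_loc
begin

lemma FL_power:
  "\<exists>c. c \<noteq> 0 \<and> app ((M.F p * M.L' p) ^ k) (mon (0, (a, b), 0)) =
     scl c (mon (0, (a, b - frag_cmul (int k) (al p)), Word (replicate k p)))"
proof (induction k)
  case 0 show ?case by (intro exI[of _ 1]) (simp add: zero_fmon_def)
next
  case (Suc k)
  then obtain c where c: "c \<noteq> 0" "app ((M.F p * M.L' p) ^ k) (mon (0, (a, b), 0)) =
     scl c (mon (0, (a, b - frag_cmul (int k) (al p)), Word (replicate k p)))" by blast
  let ?b = "b - frag_cmul (int k) (al p)"
  have w: "Word [p] + Word (replicate k p) = Word (replicate (Suc k) p)" by (simp add: plus_fmon_def)
  have b: "?b - al p = b - frag_cmul (int (Suc k)) (al p)" by (simp add: frag_cmul_distrib)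
  let ?d = "\<chi> a (al p) * inverse (\<chi> (al p) (?b - al p))"
  have "app (M.F p) (app (M.L' p) (mon (0, (a, ?b), Word (replicate k p))))
    = scl ?d (mon (0, (a, ?b - al p), Word [p] + Word (replicate k p)))"
    by (simp add: bichar_zero[OF bichar] zero_fmon_def wdeg_def)
  then have "app ((M.F p * M.L' p) ^ Suc k) (mon (0, (a, b), 0)) = scl (c * ?d) (mon (0, (a, b - frag_cmul (int (Suc k)) (al p)), Word (replicate (Suc k) p)))"
    unfolding power_Suc app_simps c(2) b w by (simp only: app_simps scl_laws(3))
  moreover have "c * ?d \<noteq> 0" using c(1) bichar_add(3)[OF bichar] by simp
  ultimately show ?case by blast
qed

lemma Phi_power: "Phi \<chi> u m v (J m' (Word (replicate k p)) x) =
   (if m' = m \<and> v = replicate k p then fw q u x * qfact (q p p) k else 0)"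
  unfolding Phi_J by (simp add: fw_power flip: gen_power) (simp add: gen_power fw_power[unfolded gen_power])

text \<open>Vanishing of an image in terms of its decomposition.\<close>

lemma Phi_Te:
  assumes d: "M.Dec p n x xs ys"
  shows "\<exists>c. c \<noteq> 0 \<and> Phi \<chi> u (a, b - frag_cmul (int k) (al p)) (replicate k p) (app (M.Te p x) (mon (0, (a, b), 0)))
      = c * (fw q u (ys k) * qfact (q p p) k)"
    "(\<And>k. fw q u (ys k) * qfact (q p p) k = 0) \<Longrightarrow> Phi \<chi> u m v (app (M.Te p x) (mon (0, (a, b), 0))) = 0"
    "a' \<noteq> a \<Longrightarrow> Phi \<chi> u (a', b') v (app (M.Te p x) (mon (0, (a, b), 0))) = 0"
proof -
  obtain c where c: "c k \<noteq> 0" "app ((M.F p * M.L' p) ^ k) (mon (0, (a, b), 0)) =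
     scl (c k) (mon (0, (a, b - frag_cmul (int k) (al p)), Word (replicate k p)))" for k
    using FL_power[of p _ a b] by metis
  let ?J = "\<lambda>k. J (a, b - frag_cmul (int k) (al p)) (Word (replicate k p)) (ys k)"
  have sum_app: "app (sum f {..<n}) z = (\<Sum>k<n. app (f k) z)" for f :: "nat \<Rightarrow> ('i pbw, 'k) lend" and z
    by (induction n) auto
  have t: "app (M.Te p x) (mon (0, (a, b), 0)) = (\<Sum>k<n. scl (c k) (?J k))"
    unfolding M.Te_Dec[OF d] sum_app app_simps c(2) J_def ..
  have Phi_sum: "Phi \<chi> u m v (sum f {..<n}) = (\<Sum>k<n. Phi \<chi> u m v (f k))" for u m v and f :: "nat \<Rightarrow> ('i pbw \<Rightarrow>\<^sub>0 'k)"
    by (induction n) auto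
  have P: "Phi \<chi> u m v (app (M.Te p x) (mon (0, (a, b), 0))) =
    (\<Sum>l<n. c l * (if (a, b - frag_cmul (int l) (al p)) = m \<and> v = replicate l p then fw q u (ys l) * qfact (q p p) l else 0))" for u m v
    unfolding t Phi_sum Phi_simps Phi_power ..
  show "\<exists>c. c \<noteq> 0 \<and> Phi \<chi> u (a, b - frag_cmul (int k) (al p)) (replicate k p) (app (M.Te p x) (mon (0, (a, b), 0)))
      = c * (fw q u (ys k) * qfact (q p p) k)"
  proof -
    have rep: "replicate k p = replicate l p \<longleftrightarrow> k = l" for l by (metis length_replicate)
    have "Phi \<chi> u (a, b - frag_cmul (int k) (al p)) (replicate k p) (app (M.Te p x) (mon (0, (a, b), 0)))
       = (\<Sum>l<n. if l = k then c k * (fw q u (ys k) * qfact (q p p) k) else 0)"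
      unfolding P rep by (rule sum.cong) auto
    also have "\<dots> = c k * (fw q u (ys k) * qfact (q p p) k)"
      using d by (auto simp: M.Dec_def)
    finally show ?thesis using c(1) by blast
  qed
  show "Phi \<chi> u m v (app (M.Te p x) (mon (0, (a, b), 0))) = 0" if "\<And>k. fw q u (ys k) * qfact (q p p) k = 0"
    unfolding P by (rule sum.neutral) (use that in auto)
  show "a' \<noteq> a \<Longrightarrow> Phi \<chi> u (a', b') v (app (M.Te p x) (mon (0, (a, b), 0))) = 0"
    unfolding P by (rule sum.neutral) auto
qed

end

section \<open>The Lusztig maps respect the radicals\<close>

text \<open>Data of a reflection: \<open>\<chi>\<close> is the source and \<open>\<psi>\<close> the target.\<close>

locale refl_loc =
  fixes \<chi> :: "('i, 'k::field) bichar" and p :: 'i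
  assumes b: "bicharacter \<chi>" and f: "p_finite p \<chi>"
begin

abbreviation "\<psi> \<equiv> rp p \<chi>"

lemma b': "bicharacter \<psi>" and f': "p_finite p \<psi>" and rr: "rp p \<psi> = \<chi>"
  using b f by (simp_all add: p_finite_rp rp_rp)

lemma nn': "nn p \<psi> = nn p \<chi>"
  using nn_rp[OF b f] by auto

end

sublocale refl_loc \<subseteq> S: bichar_loc \<chi>
  by (rule bichar_loc.intro) (rule b)

sublocale refl_loc \<subseteq> P: bichar_loc "rp p \<chi>"
  by (rule bichar_loc.intro) (rule b')

context refl_loc
begin

lemma rho_That_E: "rho \<psi> (That p \<chi> (embE x)) = P.M.Te p x"
  unfolding rho_hat(1) nn'[symmetric] embE_def LE.ev_ev P.M.Te_def by simp

lemma nf_That_E: "nf \<psi> (That p \<chi> (embE x)) = app (P.M.Te p x) (mon (0, (0, 0), 0))"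
  by (simp add: nf_def rho_That_E zero_prod_def)

lemma That_SF_iff:
  assumes d: "P.M.Dec p n x xs ys"
  shows "That p \<chi> (embE x) \<in> SF \<psi> \<longleftrightarrow> (\<forall>k u. fw (qm \<psi>) u (ys k) * qfact (qm \<psi> p p) k = 0)"
proof
  assume s: "That p \<chi> (embE x) \<in> SF \<psi>"
  show "\<forall>k u. fw (qm \<psi>) u (ys k) * qfact (qm \<psi> p p) k = 0"
  proof (intro allI)
    fix k u
    obtain c where c: "c \<noteq> 0" "Phi \<psi> u (0, 0 - frag_cmul (int k) (al p)) (replicate k p) (app (P.M.Te p x) (mon (0, (0, 0), 0)))
      = c * (fw (qm \<psi>) u (ys k) * qfact (qm \<psi> p p) k)" using P.Phi_Te(1)[OF d] by blast
    have "Phi \<psi> u m v (nf \<psi> (That p \<chi> (embE x))) = 0" for m v using s unfolding SF_def by blast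
    then show "fw (qm \<psi>) u (ys k) * qfact (qm \<psi> p p) k = 0" using c unfolding nf_That_E by simp
  qed
next
  assume "\<forall>k u. fw (qm \<psi>) u (ys k) * qfact (qm \<psi> p p) k = 0"
  then have "Phi \<psi> u m v (nf \<psi> (That p \<chi> (embE x))) = 0" for u m v
    unfolding nf_That_E by (intro P.Phi_Te(2)[OF d]) blast
  then show "That p \<chi> (embE x) \<in> SF \<psi>" unfolding SF_def by blast
qed

text \<open>The elements that are mapped to the radical form a subspace stable under the right derivations.\<close>

lemma That_E_SF_rd:
  assumes x: "That p \<chi> (embE x) \<in> SF \<psi>"
  shows "That p \<chi> (embE (rd (qm \<chi>) i x)) \<in> SF \<psi>"
proof -
  let ?\<sigma> = "reflection p \<psi> (al i)"
  let ?x' = "rd (qm \<chi>) i x" and ?x'' = "ld (qm \<chi>) i x"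
  let ?one = "mon (0, (0, 0), 0) :: 'i pbw \<Rightarrow>\<^sub>0 'k"
  note I = tideal_closed[OF SF_tideal[OF b']]
  let ?z = "embE x * gen (GF i) - gen (GF i) * embE x - (embE ?x' * gen (GK i) - gen (GL i) * embE ?x'')"
  have "rho \<chi> ?z = 0" using S.M.Ev_F[of x i] by (simp add: S.rho_embE del: opX.simps)
  then have "That p \<chi> ?z \<in> SF \<psi>" using That_R[OF b f] rho_zeroD[OF b] by blast
  moreover have "That p \<chi> (embE x * gen (GF i) - gen (GF i) * embE x) \<in> SF \<psi>"
    using x I by simp
  ultimately have "That p \<chi> (embE x * gen (GF i) - gen (GF i) * embE x) - That p \<chi> ?z \<in> SF \<psi>" using I(6) by blast
  then have "That p \<chi> (embE ?x' * gen (GK i) - gen (GL i) * embE ?x'') \<in> SF \<psi>" by simp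
  then have 0: "Phi \<psi> u m v (nf \<psi> (That p \<chi> (embE ?x' * gen (GK i)) - That p \<chi> (gen (GL i) * embE ?x''))) = 0" for u m v
    unfolding SF_def hat_simps by blast
  have gK: "rho \<psi> (That p \<chi> (gen (GK i))) = P.M.TX p (GK i)" and gL: "rho \<psi> (That p \<chi> (gen (GL i))) = P.M.TX p (GL i)"
    unfolding rho_hat(1) nn' by simp_all
  have powK: "app (P.M.K p ^ n) (mon (0, (a, c), 0)) = mon (0, (a + frag_cmul (int n) (al p), c), 0)" for n a c
    by (induction n) (simp_all add: bichar_zero[OF b'] frag_cmul_distrib add_ac)
  have TK: "app (P.M.TX p (GK i)) ?one = mon (0, (?\<sigma>, 0), 0)"
    by (simp add: refl_al bichar_zero[OF b'] powK add_ac del: opX.simps) (simp add: bichar_zero[OF b'] powK add_ac)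
  have sig: "?\<sigma> \<noteq> 0"
  proof
    assume "?\<sigma> = 0"
    then have "reflection p \<psi> ?\<sigma> = 0" by simp
    then show False by simp
  qed
  define Z where "Z t \<longleftrightarrow> (\<forall>u c v. Phi \<psi> u (?\<sigma>, c) v t = 0)" for t
  have ZL: "Z (app (opL \<psi> c) t)" if "Z t" for c t using that unfolding Z_def P.Phi_opL by simp
  have ZLn: "Z (app (opL \<psi> c ^ n) t)" if "Z t" for c t n using that by (induction n) (simp_all add: ZL)
  have "Z (app (P.M.Te p ?x'') ?one)"
  proof -
    obtain n xs ys where "P.M.Dec p n ?x'' xs ys" using P.M.decomposition by blast
    then show ?thesis unfolding Z_def using P.Phi_Te(3)[OF _ sig] by blast
  qed
  then have "Z (app (P.M.TX p (GL i)) (app (P.M.Te p ?x'') ?one))"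
    by (cases "i = p") (auto simp: ZL ZLn)
  then have L0: "Phi \<psi> u (?\<sigma>, c) v (nf \<psi> (That p \<chi> (gen (GL i) * embE ?x''))) = 0" for u c v
    by (simp only: nf_def hat_simps rho_simps app_simps gL rho_That_E zero_prod_def Z_def)
  obtain n xs ys where d: "P.M.Dec p n ?x' xs ys" using P.M.decomposition by blast
  have "fw (qm \<psi>) u (ys k) * qfact (qm \<psi> p p) k = 0" for k u
  proof -
    obtain c where c: "c \<noteq> 0" "Phi \<psi> u (?\<sigma>, 0 - frag_cmul (int k) (al p)) (replicate k p) (app (P.M.Te p ?x') (mon (0, (?\<sigma>, 0), 0)))
      = c * (fw (qm \<psi>) u (ys k) * qfact (qm \<psi> p p) k)" using P.Phi_Te(1)[OF d] by blast
    have "nf \<psi> (That p \<chi> (embE ?x' * gen (GK i))) = app (P.M.Te p ?x') (mon (0, (?\<sigma>, 0), 0))"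
      by (simp only: nf_def hat_simps rho_simps app_simps gK rho_That_E zero_prod_def TK)
    then show ?thesis
      using 0[of u "(?\<sigma>, 0 - frag_cmul (int k) (al p))" "replicate k p"] L0[of u _ "replicate k p"] c by simp
  qed
  then show ?thesis using That_SF_iff[OF d] by blast
qed

lemma That_E_SF_radical:
  assumes x: "That p \<chi> (embE x) \<in> SF \<psi>"
  shows "x \<in> radical (qm \<chi>)"
proof -
  have "{x. That p \<chi> (embE x) \<in> SF \<psi>} \<subseteq> radical (qm \<chi>)"
  proof (rule subset_radicalI_rd)
    show "rd (qm \<chi>) i x \<in> {x. That p \<chi> (embE x) \<in> SF \<psi>}" if "x \<in> {x. That p \<chi> (embE x) \<in> SF \<psi>}" for x i
      using That_E_SF_rd that by simp
    show "eps x = 0" if x: "x \<in> {x. That p \<chi> (embE x) \<in> SF \<psi>}" for x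
    proof -
      obtain n xs ys where d: "P.M.Dec p n x xs ys" using P.M.decomposition by blast
      have "fw (qm \<psi>) [] (ys 0) * qfact (qm \<psi> p p) 0 = 0" using x That_SF_iff[OF d] by blast
      then have "eps (ys 0) = 0" by (simp add: qfact_def)
      moreover have "eps (ys 0) = eps x" using d unfolding P.M.Dec_def by blast
      ultimately show ?thesis by simp
    qed
  qed
  then show ?thesis using x by blast
qed

lemma inv_op_refl_loc: "refl_loc (bichar_op (bichar_inv \<chi>)) p"
  by unfold_locales (simp_all add: b p_finite_op p_finite_inv f)

lemma rp_inv_op: "rp p (bichar_op (bichar_inv \<chi>)) = bichar_op (bichar_inv \<psi>)"
  by (simp add: rp_op rp_inv[OF b])

lemma Tmhat_E_SF_radical:
  assumes x: "Tmhat p \<chi> (embE x) \<in> SF \<psi>"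
  shows "x \<in> radical (qm \<chi>)"
proof -
  let ?c = "bichar_op (bichar_inv \<chi>)" and ?a = "conj_tor p \<chi>"
  have anz: "?a i \<noteq> 0" for i by (rule conj_tor_nonzero[OF b f])
  have "phth (That p ?c (phth (pha ?a (embE x)))) \<in> SF \<psi>"
    using P.eqm_SF[OF eqm_sym[OF R_tideal Tmhat_via_That[OF b f]] x] .
  then have "phth (phth (That p ?c (phth (pha ?a (embE x))))) \<in> SF (bichar_op (bichar_inv \<psi>))"
    by (rule phth_SF[OF b'])
  then have "That p ?c (embE (tor ?a x)) \<in> SF (rp p ?c)"
    by (simp add: pha_emb phth_emb rp_inv_op)
  then have "tor ?a x \<in> radical (inv_op (qm \<chi>))"
    using refl_loc.That_E_SF_radical[OF inv_op_refl_loc] unfolding qm_inv_op by blast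
  then have "tor (\<lambda>i. inverse (?a i)) (tor ?a x) \<in> radical (inv_op (qm \<chi>))" by simp
  then have "x \<in> radical (inv_op (qm \<chi>))" by (simp add: tor_tor anz tor_one)
  moreover have "radical (inv_op (qm \<chi>)) \<subseteq> radical (inv_op (inv_op (qm \<chi>)))"
    by (rule radical_inv_op) (simp add: inv_op_def)
  moreover have "inv_op (inv_op (qm \<chi>)) = qm \<chi>" by (simp add: inv_op_def fun_eq_iff)
  ultimately show ?thesis by auto
qed

lemma Tmhat_R_SF: "x \<in> \<U>_ideal \<chi> \<Longrightarrow> Tmhat p \<chi> x \<in> SF \<psi>"
proof -
  assume x: "x \<in> \<U>_ideal \<chi>"
  let ?c = "bichar_op (bichar_inv \<chi>)"
  have bc: "bicharacter ?c" using b by simp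
  have fc: "p_finite p ?c" by (intro p_finite_op p_finite_inv b f)
  have "That p ?c (phth (pha (conj_tor p \<chi>) x)) \<in> SF (rp p ?c)"
    by (rule That_R[OF bc fc]) (intro phth_R pha_R b x conj_tor_nonzero f)
  then have "phth (That p ?c (phth (pha (conj_tor p \<chi>) x))) \<in> SF \<psi>"
    using phth_SF[of "rp p ?c"] bc by (simp add: rp_inv_op bichar_inv_op b)
  then show ?thesis by (rule P.eqm_SF[OF Tmhat_via_That[OF b f]])
qed

end

text \<open>In a decomposition of an element of the radical every term lies in the radical.\<close>

lemma ld_iterate:
  assumes "\<And>k. ld q p (xs k) = 0"
  shows "ld q p (\<Sum>k<n. xs k * gen p ^ k) = (\<Sum>k<n. tor (\<lambda>j. q j p) (xs k) * scl (qnum (q p p) k) (gen p ^ (k - 1)))"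
proof (induction n)
  case (Suc n)
  have "ld q p (xs n * gen p ^ n) = tor (\<lambda>j. q j p) (xs n) * scl (qnum (q p p) n) (gen p ^ (n - 1))"
    by (simp only: ld_mult assms ld_power mult_zero_left add_0)
  then show ?case using Suc by (simp del: scl_mult_fa)
qed simp

lemma ld_power_term:
  assumes "ld q p x = 0"
  shows "k \<le> n \<Longrightarrow> \<exists>c d. (ld q p ^^ k) (x * gen p ^ n) = scl c (tor (\<lambda>j. q j p ^ k) x * gen p ^ (n - k)) \<and> c = (\<Prod>s<k. qnum (q p p) (n - s))"
proof (induction k)
  case (Suc k)
  then have IH: "(ld q p ^^ k) (x * gen p ^ n) = scl (\<Prod>s<k. qnum (q p p) (n - s)) (tor (\<lambda>j. q j p ^ k) x * gen p ^ (n - k))"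
    by auto
  have "ld q p (tor (\<lambda>j. q j p ^ k) x * gen p ^ (n - k)) = scl (qnum (q p p) (n - k)) (tor (\<lambda>j. q j p ^ Suc k) x * gen p ^ (n - Suc k))"
    by (simp add: ld_mult ld_tor assms ld_power tor_tor del: qnum_simps)
  then show ?case by (simp add: IH mult.commute del: qnum_simps)
qed (simp add: tor_one)

lemma ld_power_kill:
  assumes "ld q p x = 0" shows "n < k \<Longrightarrow> (ld q p ^^ k) (x * gen p ^ n) = 0"
proof -
  have "(ld q p ^^ Suc n) (x * gen p ^ n) = 0"
  proof -
    have "(ld q p ^^ n) (x * gen p ^ n) = scl (\<Prod>s<n. qnum (q p p) (n - s)) (tor (\<lambda>j. q j p ^ n) x)"
      using ld_power_term[OF assms, of n n] by auto
    then show ?thesis by (simp add: ld_tor assms)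
  qed
  moreover have z: "(ld q p ^^ m) 0 = 0" for m by (induction m) auto
  moreover assume "n < k"
  then obtain m where "k = m + Suc n" by (metis Suc_leI add.commute le_Suc_ex)
  ultimately show ?thesis by (simp only: funpow_add o_apply)
qed

lemma radical_split:
  assumes nz: "\<And>i. q i p \<noteq> 0" and k0: "\<And>k. ld q p (xs k) = 0" and r: "(\<Sum>k<n. xs k * gen p ^ k) \<in> radical q"
  shows "k < n \<Longrightarrow> xs k \<in> radical q \<or> qfact (q p p) k = 0"
  using r
proof (induction n)
  case (Suc n)
  have add: "(ld q p ^^ m) (x + y) = (ld q p ^^ m) x + (ld q p ^^ m) y" for m x y by (induction m) auto
  have rad: "x \<in> radical q \<Longrightarrow> (ld q p ^^ m) x \<in> radical q" for m x by (induction m) (auto intro: radical_ld)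
  have zero: "(ld q p ^^ n) (\<Sum>k<m. xs k * gen p ^ k) = 0" if "m \<le> n" for m
    using that
  proof (induction m)
    case 0 show ?case by (induction n) auto
  next
    case (Suc m) then show ?case by (simp add: add ld_power_kill[OF k0])
  qed
  let ?c = "\<Prod>s<n. qnum (q p p) (n - s)"
  have c: "?c = qfact (q p p) n"
  proof -
    have "?c = (\<Prod>s<n. qnum (q p p) (Suc (n - Suc s)))" by (rule prod.cong) (auto simp: Suc_diff_Suc)
    then show ?thesis unfolding qfact_Suc_prod by (simp only: prod.nat_diff_reindex[of "\<lambda>s. qnum (q p p) (Suc s)"])
  qed
  have "(ld q p ^^ n) (\<Sum>k<Suc n. xs k * gen p ^ k) = scl ?c (tor (\<lambda>j. q j p ^ n) (xs n))"
    using ld_power_term[OF k0, of n n n] by (simp add: add zero)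
  then have "scl (qfact (q p p) n) (tor (\<lambda>j. q j p ^ n) (xs n)) \<in> radical q"
    using rad[OF Suc.prems(2), of n] unfolding c by simp
  then have "tor (\<lambda>j. inverse (q j p ^ n)) (scl (qfact (q p p) n) (tor (\<lambda>j. q j p ^ n) (xs n))) \<in> radical q" by (rule radical_closed(5))
  then have top: "scl (qfact (q p p) n) (xs n) \<in> radical q" by (simp add: tor_tor nz tor_one)
  have dis: "xs n \<in> radical q \<or> qfact (q p p) n = 0"
  proof (cases "qfact (q p p) n = 0")
    case False
    then show ?thesis using radical_closed(4)[OF top, of "inverse (qfact (q p p) n)"] by simp
  qed simp
  have "xs n * gen p ^ n \<in> radical q"
    using dis
  proof
    assume "qfact (q p p) n = 0"
    then have "gen p ^ n \<in> radical q" by (simp add: radical_def fw_power)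
    then show ?thesis by (rule radical_left)
  qed (rule radical_right)
  then have "(\<Sum>k<n. xs k * gen p ^ k) \<in> radical q"
    using radical_closed(3)[OF Suc.prems(2)] by fastforce
  then show ?case using Suc.IH Suc.prems(1) dis by (cases "k = n") auto
qed simp

context refl_loc
begin

lemma That_E_radical:
  assumes x: "x \<in> radical (qm \<chi>)" shows "That p \<chi> (embE x) \<in> SF \<psi>"
proof -
  interpret T: refl_loc \<psi> p by unfold_locales (rule b', rule f')
  obtain n xs ys where d: "P.M.Dec p n x xs ys" using P.M.decomposition by blast
  have H: "P.M.H p (xs k) (ys k)" for k using d by (simp add: P.M.Dec_def)
  have ld0: "ld (qm \<chi>) p (xs k) = 0" for k using H[of k] unfolding P.M.H_def rr by blast
  have "fw (qm \<psi>) u (ys k) * qfact (qm \<psi> p p) k = 0" for k u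
  proof (cases "k < n")
    case True
    have "(\<Sum>k<n. xs k * gen p ^ k) \<in> radical (qm \<chi>)" using x d by (simp add: P.M.Dec_def)
    then consider "xs k \<in> radical (qm \<chi>)" | "qfact (qm \<chi> p p) k = 0"
      using radical_split[of "qm \<chi>" p xs n k, OF _ ld0 _ True] qm_nonzero[OF b] by blast
    then show ?thesis
    proof cases
      case 1
      have "eqm (\<U>_ideal \<psi>) (embE (ys k)) (That p \<chi> (embE (xs k)))"
        by (rule rho_eqmI[OF b']) (simp only: rho_That_E P.rho_embE P.M.H_Te[OF H])
      then have "Tmhat p \<psi> (embE (ys k) - That p \<chi> (embE (xs k))) \<in> SF \<chi>"
        using T.Tmhat_R_SF unfolding rr eqm_def by blast
      moreover have "Tmhat p \<psi> (That p \<chi> (embE (xs k))) \<in> SF \<chi>"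
        using S.eqm_SF[OF Tmhat_That[OF b f]] 1 embE_SF[OF b] by blast
      ultimately have "Tmhat p \<psi> (embE (ys k)) \<in> SF (rp p \<psi>)"
        using tideal_closed(2)[OF SF_tideal[OF b]] unfolding rr by fastforce
      then have "ys k \<in> radical (qm \<psi>)" by (rule T.Tmhat_E_SF_radical)
      then show ?thesis by (simp add: radical_def)
    qed (simp add: qm_rp(1)[OF b])
  qed (use d in \<open>simp add: P.M.Dec_def\<close>)
  then show ?thesis using That_SF_iff[OF d] by blast
qed

end

section \<open>The Lusztig maps and the symmetries\<close>

definition ph2 :: "('i ugen fmon \<Rightarrow>\<^sub>0 'k::field) \<Rightarrow> ('i ugen fmon \<Rightarrow>\<^sub>0 'k)" where
  "ph2 x = ph3 (phth x)"

lemma ph2_simps [simp]: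
  "ph2 (x + y) = ph2 x + ph2 y" "ph2 (x - y) = ph2 x - ph2 y" "ph2 (x * y) = ph2 x * ph2 y"
  "ph2 0 = 0" "ph2 1 = 1" "ph2 (scl c x) = scl c (ph2 x)" "ph2 (- x) = - ph2 x"
  "ph2 (gen (GK i)) = gen (GK i)" "ph2 (gen (GK' i)) = gen (GK' i)" "ph2 (gen (GL i)) = gen (GL i)"
  "ph2 (gen (GL' i)) = gen (GL' i)" "ph2 (gen (GE i)) = gen (GF i)" "ph2 (gen (GF i)) = - gen (GE i)"
  by (simp_all add: ph2_def)

lemma hat_power [simp]: "pha a (x ^ n) = pha a x ^ n" "ph2 (x ^ n) = ph2 x ^ n" "ph3 (x ^ n) = ph3 x ^ n"
  by (induction n) (simp_all only: power_0 power_Suc hat_simps ph2_simps)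

lemma rv_scl: "rv k k' (scl s x) (scl t y) m = scl (s ^ m * t) (rv k k' x y m)"
  for x :: "'g fmon \<Rightarrow>\<^sub>0 'k::field"
  by (induction m) (simp_all add: mult_ac)

lemma pha_rv: "pha a (rv k k' x y m) = rv (pha a k) (pha a k') (pha a x) (pha a y) m"
  by (induction m) (simp_all only: rv.simps hat_simps)

lemma ph2_rv: "ph2 (rv k k' x y m) = rv (ph2 k) (ph2 k') (ph2 x) (ph2 y) m"
  by (induction m) (simp_all only: rv.simps ph2_simps)

lemma That_gen: "That p \<chi> (gen g) = Tim scl gen p (nn p \<chi>) (\<lambda>i. inverse (lam p (rp p \<chi>) i)) g"
  by (simp add: That_def del: Tim.simps)

lemma Tmhat_gen: "Tmhat p \<chi> (gen g) = Tmim scl gen p (nn p \<chi>) (\<lambda>i. inverse (lam p (rp p (bichar_inv \<chi>)) i)) g"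
  by (simp add: Tmhat_def del: Tmim.simps)

lemma power_int_cartan:
  assumes "a \<noteq> (0 :: 'k::field)"
  shows "a powi (- cartan \<chi> p i) = (if i = p then inverse a ^ 2 else a ^ nn p \<chi> i)"
  using assms by (simp add: cartan_nn power_int_minus power_int_numeral power_inverse)

context
  fixes \<chi> :: "('i, 'k::field) bichar" and p :: 'i and a b :: "'i \<Rightarrow> 'k"
  assumes a: "\<And>i. a i \<noteq> 0" and ab: "\<And>i. b i = a i * a p powi (- cartan \<chi> p i)"
begin

lemma torus_reflected: "b p = inverse (a p)" "i \<noteq> p \<Longrightarrow> b i * b p ^ nn p \<chi> i = a i"
proof -
  show bp: "b p = inverse (a p)" using a[of p] unfolding ab power_int_cartan[OF a] by (simp add: power2_eq_square)
  show "i \<noteq> p \<Longrightarrow> b i * b p ^ nn p \<chi> i = a i"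
    using a[of p] unfolding bp by (simp add: ab power_int_cartan[OF a] power_inverse)
qed

lemma torus_reflected': "i \<noteq> p \<Longrightarrow> inverse (a i) = inverse (b i) * a p ^ nn p \<chi> i"
  using torus_reflected(2)[of i] a[of p] unfolding torus_reflected(1)
  by (metis inverse_inverse_eq inverse_mult_distrib power_inverse)

lemma That_pha: "That p \<chi> (pha a x) = pha b (That p \<chi> x)"
proof (induction x rule: fa_word_induct)
  case (2 g x)
  have "That p \<chi> (pha a (gen g)) = pha b (That p \<chi> (gen g))"
    using a torus_reflected torus_reflected'
    by (cases g) (auto simp: That_gen pha_rv rv_scl mult.commute nonzero_inverse_mult_distrib power_inverse simp del: rv.simps)
  then show ?case using 2 by simp
qed simp_all

lemma Tmhat_pha: "Tmhat p \<chi> (pha a x) = pha b (Tmhat p \<chi> x)"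
proof (induction x rule: fa_word_induct)
  case (2 g x)
  have "Tmhat p \<chi> (pha a (gen g)) = pha b (Tmhat p \<chi> (gen g))"
    using a torus_reflected torus_reflected'
    by (cases g) (auto simp: Tmhat_gen pha_rv rv_scl mult.commute nonzero_inverse_mult_distrib power_inverse simp del: rv.simps)
  then show ?case using 2 by simp
qed simp_all

end

lemma ph2_That:
  fixes \<chi> :: "('i, 'k::field) bichar"
  assumes b: "bicharacter \<chi>"
  shows "That p (bichar_inv \<chi>) (ph2 x) = ph2 (Tmhat p \<chi> (pha (\<lambda>i. if i = p then -1 else 1) x))"
proof (induction x rule: fa_word_induct)
  case (2 g x)
  let ?a = "\<lambda>i. if i = p then -1 else 1 :: 'k"
  have nn: "nn p (bichar_inv \<chi>) = nn p \<chi>" by (rule ext) (rule nn_inv[OF b])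
  have m: "scl ((- 1) ^ n) ((- 1) ^ Suc n * z) = - z" for n and z :: "'i ugen fmon \<Rightarrow>\<^sub>0 'k"
    unfolding minus_one_power_scl by (simp flip: power_add)
  have "That p (bichar_inv \<chi>) (ph2 (gen g)) = ph2 (Tmhat p \<chi> (pha ?a (gen g)))"
    by (cases g) (auto simp: That_gen Tmhat_gen ph2_rv nn rv_minus m simp del: rv.simps power_Suc power_add)
  then show ?case using 2 by simp
qed simp_all

text \<open>Congruences between homomorphisms can be checked on generators.\<close>

lemma hom_eqm:
  assumes b: "bicharacter \<psi>"
    and G: "G 1 = 1" "\<And>x y. G (x + y) = G x + G y" "\<And>x y. G (x * y) = G x * G y" "\<And>c x. G (scl c x) = scl c (G x)"
    and H: "H 1 = 1" "\<And>x y. H (x + y) = H x + H y" "\<And>x y. H (x * y) = H x * H y" "\<And>c x. H (scl c x) = scl c (H x)"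
    and gens: "\<And>g. rho \<psi> (G (gen g)) = rho \<psi> (H (gen g))"
  shows "eqm (\<U>_ideal \<psi>) (G x) (H x)"
proof (rule rho_eqmI[OF b])
  show "rho \<psi> (G x) = rho \<psi> (H x)"
    by (induction x rule: fa_word_induct) (simp_all add: G H gens)
qed

lemma rho_power: "rho \<psi> (x ^ n) = rho \<psi> x ^ n"
  by (induction n) simp_all

lemma rho_gen: "rho \<psi> (gen g) = opX \<psi> g"
  by (simp add: rho_def del: opX.simps)

lemma ph3_That:
  fixes \<chi> :: "('i, 'k::field) bichar"
  assumes b: "bicharacter \<chi>" and f: "p_finite p \<chi>"
  shows "eqm (\<U>_ideal (bichar_op (rp p \<chi>))) (That p (bichar_op \<chi>) (ph3 x))
    (ph3 (That p \<chi> (pha (\<lambda>i. if i = p then inverse (qm \<chi> p p) else inverse (lam p (rp p \<chi>) i)) x)))"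
    (is "eqm ?I (?G x) (?H x)")
proof (rule hom_eqm[of _ ?G ?H])
  show b': "bicharacter (bichar_op (rp p \<chi>))" using b by simp
  interpret bichar_loc "bichar_op (rp p \<chi>)" by (rule bichar_loc.intro[OF b'])
  have q: "q p p = qm \<chi> p p" by (simp add: qm_op_app qm_rp[OF b] del: qm_op)
  have nz: "qm \<chi> p p \<noteq> 0" "i \<noteq> p \<Longrightarrow> lam p (rp p \<chi>) i \<noteq> 0" for i
    using qm_nonzero[OF b] lam_nonzero[OF p_finite_rp[OF b f]] by auto
  have nn: "nn p (bichar_op \<chi>) = nn p \<chi>" by (rule ext) (rule nn_op)
  show "rho (bichar_op (rp p \<chi>)) (?G (gen g)) = rho (bichar_op (rp p \<chi>)) (?H (gen g))" for g
    by (cases g) (auto simp: That_gen ph3_rv nn nz rho_gen rp_op lam_op M.K'E M.L'F q simp del: rv.simps opX.simps qm_op)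
qed simp_all

lemma ph3_Tmhat:
  fixes \<chi> :: "('i, 'k::field) bichar"
  assumes b: "bicharacter \<chi>" and f: "p_finite p \<chi>"
  shows "eqm (\<U>_ideal (bichar_op (rp p \<chi>))) (Tmhat p (bichar_op \<chi>) (ph3 x))
    (ph3 (Tmhat p \<chi> (pha (\<lambda>i. if i = p then inverse (qm \<chi> p p)
        else (-1) powi cartan \<chi> p i * lam p (rp p (bichar_inv \<chi>)) i) x)))"
    (is "eqm ?I (?G x) (?H x)")
proof (rule hom_eqm[of _ ?G ?H])
  show b': "bicharacter (bichar_op (rp p \<chi>))" using b by simp
  interpret bichar_loc "bichar_op (rp p \<chi>)" by (rule bichar_loc.intro[OF b'])
  have q: "q p p = qm \<chi> p p" by (simp add: qm_op_app qm_rp[OF b] del: qm_op)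
  have nz: "qm \<chi> p p \<noteq> 0" "i \<noteq> p \<Longrightarrow> lam p (rp p (bichar_inv \<chi>)) i \<noteq> 0" for i
    using qm_nonzero[OF b] lam_inv_nonzero[OF b f] by auto
  have nn: "nn p (bichar_op \<chi>) = nn p \<chi>" by (rule ext) (rule nn_op)
  have pw: "i \<noteq> p \<Longrightarrow> (-1 :: 'k) powi cartan \<chi> p i = (-1) ^ nn p \<chi> i" for i
    by (simp add: cartan_nn power_int_minus power_inverse[symmetric])
  have sq: "(-1 :: 'k) ^ n * (-1) ^ n = 1" for n by (simp flip: power_mult_distrib)
  have sq': "(-1 :: 'k) ^ n * ((-1) ^ n * c) = c" for n c by (simp flip: mult.assoc power_mult_distrib)
  have canc: "i \<noteq> p \<Longrightarrow> lam p (rp p (bichar_inv \<chi>)) i * (c * inverse (lam p (rp p (bichar_inv \<chi>)) i)) = c" for i c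
    using nz(2) by simp
  have canc': "(-1) ^ n * (c * inverse ((-1) ^ n)) = (c :: 'k)" for n c by simp
  have rr: "rp p (bichar_inv (bichar_op \<chi>)) = bichar_op (rp p (bichar_inv \<chi>))" by (simp add: bichar_inv_op rp_op)
  show "rho (bichar_op (rp p \<chi>)) (?G (gen g)) = rho (bichar_op (rp p \<chi>)) (?H (gen g))" for g
    by (cases g) (auto simp: Tmhat_gen ph3_rv nn nz rho_gen rr lam_op M.L'E M.K'F q pw sq sq' power_inverse mult_ac
        nonzero_inverse_mult_distrib canc canc' simp del: rv.simps opX.simps qm_op)
qed simp_all

lemma frev_gv:
  assumes "s \<noteq> 0" "t \<noteq> 0"
  shows "frev (gv s t p i m) = scl (\<Prod>k<m. - (s ^ k * t)) (gv (inverse s) (inverse t) p i m)"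
proof (induction m)
  case (Suc m)
  let ?P = "\<Prod>k<m. - (s ^ k * t)" and ?g = "gv (inverse s) (inverse t) p i m" and ?c = "s ^ m * t"
  have c: "?c * (inverse (s ^ m) * inverse t) = 1" using assms by (simp add: field_simps)
  have "frev (gv s t p i (Suc m)) = scl ?P (?g * gen p) - scl (?c * ?P) (gen p * ?g)"
    by (simp add: Suc)
  also have "\<dots> = scl (?P * - ?c) (gen p * ?g - scl (inverse ?c) (?g * gen p))"
    using c by (simp add: mult.commute mult.left_commute)
  finally show ?case by (simp add: power_inverse nonzero_inverse_mult_distrib)
qed simp

context
  fixes \<psi> :: "('i, 'k::field) bichar" and p i :: 'i
  assumes b: "bicharacter \<psi>"
begin

lemma eqm_FpF: "eqm (\<U>_ideal \<psi>) (FpF p i m) (embF (gv (qm \<psi> p p) (qm \<psi> i p) p i m))"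
proof -
  have "eqm (\<U>_ideal (bichar_op \<psi>)) (EpF p i m) (embE (gv (qm \<psi> p p) (qm \<psi> i p) p i m))"
    using eqm_EpF[OF bichar_op[OF b], of p i m] by (simp add: transp_def)
  from ph3_R[OF bichar_op[OF b] this[unfolded eqm_def]] show ?thesis
    by (simp add: eqm_def ph3_rv ph3_emb del: rv.simps)
qed

lemma eqm_FmF: "eqm (\<U>_ideal \<psi>) (FmF p i m) (embF (gv (inverse (qm \<psi> p p)) (inverse (qm \<psi> p i)) p i m))"
proof -
  have "eqm (\<U>_ideal (bichar_op \<psi>)) (EmF p i m) (embE (gv (inverse (qm \<psi> p p)) (inverse (qm \<psi> p i)) p i m))"
    using eqm_EmF[OF bichar_op[OF b], of p i m] by (simp add: transp_def inv_op_def)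
  from ph3_R[OF bichar_op[OF b] this[unfolded eqm_def]] show ?thesis
    by (simp add: eqm_def ph3_rv ph3_emb del: rv.simps)
qed

lemma eqm_EmF': "eqm (\<U>_ideal \<psi>) (EmF p i m) (embE (gv (inverse (qm \<psi> p p)) (inverse (qm \<psi> i p)) p i m))"
  using eqm_EmF[OF b, of p i m] by (simp add: inv_op_def)

lemma ph4_eqm: "eqm (\<U>_ideal \<psi>) x y \<Longrightarrow> eqm (\<U>_ideal \<psi>) (ph4 x) (ph4 y)"
  using bichar_loc.ph4_R[OF bichar_loc.intro[OF b], of "x - y"] by (simp add: eqm_def)

lemma ph4_EmF:
  "rho \<psi> (ph4 (EmF p i m)) = lsc (\<Prod>k<m. - (inverse (qm \<psi> p p) ^ k * inverse (qm \<psi> i p))) (rho \<psi> (FpF p i m))"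
proof -
  have "rho \<psi> (ph4 (EmF p i m)) = rho \<psi> (ph4 (embE (gv (inverse (qm \<psi> p p)) (inverse (qm \<psi> i p)) p i m)))"
    by (rule eqm_rho[OF b ph4_eqm[OF eqm_EmF']])
  then show ?thesis
    by (simp add: ph4_embE frev_gv qm_nonzero[OF b] eqm_rho[OF b eqm_FpF] del: rv.simps gv.simps)
qed

lemma ph4_FmF:
  "rho \<psi> (ph4 (FmF p i m)) = lsc (\<Prod>k<m. - (inverse (qm \<psi> p p) ^ k * inverse (qm \<psi> p i))) (rho \<psi> (EpF p i m))"
proof -
  have "rho \<psi> (ph4 (FmF p i m)) = rho \<psi> (ph4 (embF (gv (inverse (qm \<psi> p p)) (inverse (qm \<psi> p i)) p i m)))"
    by (rule eqm_rho[OF b ph4_eqm[OF eqm_FmF]])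
  then show ?thesis
    by (simp add: ph4_embF frev_gv qm_nonzero[OF b] eqm_rho[OF b eqm_EpF[OF b]] del: rv.simps gv.simps)
qed

lemma lam_inverse:
  "lam p (bichar_inv \<psi>) i = lam p \<psi> i *
    (\<Prod>s<nn p \<psi> i. - (inverse (qm \<psi> p p) ^ s * inverse (qm \<psi> p i)) * (inverse (qm \<psi> p p) ^ s * inverse (qm \<psi> i p)))"
proof -
  let ?q = "qm \<psi> p p" and ?a = "qm \<psi> p i" and ?b = "qm \<psi> i p" and ?N = "nn p \<psi> i"
  note nz = qm_nonzero[OF b]
  have f: "qfact (inverse ?q) ?N = qfact ?q ?N * (\<Prod>s<?N. inverse ?q ^ s)"
  proof -
    have "(\<Prod>s<?N. inverse ?q ^ s) * (\<Prod>s<?N. ?q ^ s) = 1"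
      unfolding prod.distrib[symmetric] by (rule prod.neutral) (simp add: nz flip: power_mult_distrib)
    then have "qfact (inverse ?q) ?N = ((\<Prod>s<?N. inverse ?q ^ s) * (\<Prod>s<?N. ?q ^ s)) * qfact (inverse ?q) ?N" by simp
    also have "\<dots> = qfact ?q ?N * (\<Prod>s<?N. inverse ?q ^ s)"
      unfolding mult.assoc qfact_inverse[OF nz] by (rule mult.commute)
    finally show ?thesis .
  qed
  have e: "(\<Prod>s<?N. inverse ?q ^ s) * (\<Prod>s<?N. inverse ?q ^ s * inverse ?a * inverse ?b - 1) =
     (\<Prod>s<?N. ?q ^ s * ?a * ?b - 1) * (\<Prod>s<?N. - (inverse ?q ^ s * inverse ?a) * (inverse ?q ^ s * inverse ?b))"
    unfolding prod.distrib[symmetric] by (rule prod.cong) (simp_all add: nz field_simps)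
  have "lam p (bichar_inv \<psi>) i = qfact (inverse ?q) ?N * (\<Prod>s<?N. inverse ?q ^ s * inverse ?a * inverse ?b - 1)"
    by (simp add: lam_def cartan_inv[OF b] nn_def)
  also have "\<dots> = qfact ?q ?N * ((\<Prod>s<?N. inverse ?q ^ s) * (\<Prod>s<?N. inverse ?q ^ s * inverse ?a * inverse ?b - 1))"
    unfolding f by (simp only: mult.assoc)
  also have "\<dots> = lam p \<psi> i * (\<Prod>s<?N. - (inverse ?q ^ s * inverse ?a) * (inverse ?q ^ s * inverse ?b))"
    unfolding e by (simp add: lam_def nn_def mult.assoc)
  finally show ?thesis .
qed

end

definition phi4_tor :: "'i \<Rightarrow> ('i, 'k::field) bichar \<Rightarrow> 'i \<Rightarrow> 'k" where
  "phi4_tor p \<chi> i = (if i = p then inverse (qm \<chi> p p)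
     else \<Prod>k<nn p \<chi> i. inverse (qm (rp p \<chi>) p p) ^ k * inverse (qm (rp p \<chi>) p i))"

lemma phi4_tor_nonzero: "bicharacter \<chi> \<Longrightarrow> phi4_tor p \<chi> i \<noteq> 0"
  by (simp add: phi4_tor_def qm_nonzero)

lemma prod_minus: "(\<Prod>k<n. - f k) = (-1) ^ n * (\<Prod>k<n. f k)" for f :: "nat \<Rightarrow> 'k::field"
  by (induction n) auto

lemma ph4_That:
  fixes \<chi> :: "('i, 'k::field) bichar"
  assumes b: "bicharacter \<chi>" and f: "p_finite p \<chi>"
  shows "eqm (\<U>_ideal (rp p \<chi>)) (That p \<chi> (ph4 x)) (ph4 (Tmhat p \<chi> (pha (phi4_tor p \<chi>) x)))"
proof (rule rho_eqmI)
  let ?\<psi> = "rp p \<chi>" and ?a = "phi4_tor p \<chi>"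
  note b' = rp_bichar[OF b, of p] and f' = p_finite_rp[OF b f]
  show "bicharacter ?\<psi>" by (rule b')
  interpret bichar_loc ?\<psi> by (rule bichar_loc.intro[OF b'])
  have rr: "rp p (bichar_inv \<chi>) = bichar_inv ?\<psi>" by (rule rp_inv[OF b])
  have pow: "M.K p ^ n * M.K i = M.K i * M.K p ^ n" "M.L p ^ n * M.L i = M.L i * M.L p ^ n"
    "M.K' p ^ n * M.K' i = M.K' i * M.K' p ^ n" "M.L' p ^ n * M.L' i = M.L' i * M.L' p ^ n" for n i
    by (intro power_commuting_commutes M.cart_comm cg)+
  have ph4_pow: "ph4 (y ^ n) = ph4 y ^ n" for n and y :: "'i ugen fmon \<Rightarrow>\<^sub>0 'k"
    by (induction n) (simp_all add: power_commutes)
  have q: "q p p = qm \<chi> p p" by (simp add: qm_rp[OF b])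
  have nz: "qm \<chi> p p \<noteq> 0" by (rule qm_nonzero[OF b])
  have lE: "inverse (lam p ?\<psi> i) = ?a i * (inverse (lam p (bichar_inv ?\<psi>) i) *
      (\<Prod>k<nn p \<chi> i. - (inverse (q p p) ^ k * inverse (q i p))))" if i: "i \<noteq> p" for i
  proof -
    let ?A = "\<Prod>k<nn p \<chi> i. inverse (q p p) ^ k * inverse (q p i)"
    let ?B = "\<Prod>k<nn p \<chi> i. - (inverse (q p p) ^ k * inverse (q i p))"
    have "lam p (bichar_inv ?\<psi>) i = lam p ?\<psi> i * (?A * ?B)"
      unfolding lam_inverse[OF b'] nn_rp[OF b f] prod.distrib[symmetric] by simp
    moreover have "?A \<noteq> 0" "?B \<noteq> 0" by (simp_all add: qm_nonzero[OF b'])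
    moreover have "lam p ?\<psi> i \<noteq> 0" by (rule lam_nonzero[OF f' i])
    ultimately show ?thesis using i by (simp add: phi4_tor_def nonzero_inverse_mult_distrib)
  qed
  have lF: "inverse (?a i) * ((-1) ^ nn p \<chi> i * (\<Prod>k<nn p \<chi> i. - (inverse (q p p) ^ k * inverse (q p i)))) = 1" if i: "i \<noteq> p" for i
  proof -
    have "(-1) ^ nn p \<chi> i * (\<Prod>k<nn p \<chi> i. - (inverse (q p p) ^ k * inverse (q p i))) = ?a i"
      unfolding prod_minus using i by (simp add: phi4_tor_def flip: mult.assoc power_mult_distrib)
    then show ?thesis using phi4_tor_nonzero[OF b, of p i] by simp
  qed
  have gens: "rho ?\<psi> (That p \<chi> (ph4 (gen g))) = rho ?\<psi> (ph4 (Tmhat p \<chi> (pha ?a (gen g))))" for g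
  proof (cases g)
    case (GE i)
    show ?thesis
    proof (cases "i = p")
      case True
      then show ?thesis by (simp add: GE That_gen Tmhat_gen rho_gen M.K'E q phi4_tor_def nz del: opX.simps)
    next
      case False
      then show ?thesis
        by (simp add: GE That_gen Tmhat_gen rr ph4_EmF[OF b'] lE mult.assoc del: opX.simps rv.simps)
    qed
  next
    case (GF i)
    show ?thesis
    proof (cases "i = p")
      case True
      then show ?thesis by (simp add: GF That_gen Tmhat_gen rho_gen M.L'F q phi4_tor_def nz del: opX.simps)
    next
      case False
      then show ?thesis
        by (simp add: GF That_gen Tmhat_gen ph4_FmF[OF b'] lF mult.assoc del: opX.simps rv.simps)
    qed
  qed (auto simp: That_gen Tmhat_gen rho_gen ph4_pow pow rho_power simp del: opX.simps)
  show "rho ?\<psi> (That p \<chi> (ph4 x)) = rho ?\<psi> (ph4 (Tmhat p \<chi> (pha ?a x)))"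
    by (induction x rule: fa_word_induct) (simp_all add: gens[unfolded hat_simps ph4_simps])
qed

section \<open>The Lusztig maps induce bijections modulo the radicals\<close>

lemma That_E_SF: "bicharacter \<chi> \<Longrightarrow> p_finite p \<chi> \<Longrightarrow> x \<in> radical (qm \<chi>) \<Longrightarrow> That p \<chi> (embE x) \<in> SF (rp p \<chi>)"
  by (rule refl_loc.That_E_radical[OF refl_loc.intro])

lemma eqm_SF': "bicharacter \<chi> \<Longrightarrow> eqm (\<U>_ideal \<chi>) x y \<Longrightarrow> y \<in> SF \<chi> \<Longrightarrow> x \<in> SF \<chi>"
  using bichar_loc.eqm_SF[OF bichar_loc.intro] by blast

lemma That_F_SF:
  assumes b: "bicharacter \<chi>" and f: "p_finite p \<chi>" and x: "frev x \<in> radical (qm \<chi>)"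
  shows "That p \<chi> (embF x) \<in> SF (rp p \<chi>)"
proof -
  let ?o = "bichar_op \<chi>"
  let ?a = "\<lambda>i. if i = p then inverse (qm ?o p p) else inverse (lam p (rp p ?o) i)"
  have bo: "bicharacter ?o" and fo: "p_finite p ?o" using b f p_finite_op by auto
  have "x \<in> radical (qm ?o)" using radical_frev[OF x] by simp
  then have "tor ?a x \<in> radical (qm ?o)" by (rule radical_closed(5))
  from ph3_SF[OF rp_bichar[OF bo] That_E_SF[OF bo fo this]]
  have s: "ph3 (That p ?o (pha ?a (embE x))) \<in> SF (rp p \<chi>)"
    unfolding pha_emb rp_op bichar_op_op .
  from ph3_That[OF bo fo, of "embE x"]
  have "eqm (\<U>_ideal (rp p \<chi>)) (That p \<chi> (embF x)) (ph3 (That p ?o (pha ?a (embE x))))"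
    unfolding ph3_emb rp_op bichar_op_op .
  from eqm_SF'[OF rp_bichar[OF b] this s] show ?thesis .
qed

lemma That_SF:
  assumes b: "bicharacter \<chi>" and f: "p_finite p \<chi>" and x: "x \<in> SF \<chi>"
  shows "That p \<chi> x \<in> SF (rp p \<chi>)"
  by (rule SF_hom[OF b rp_bichar[OF b] _ _ _ _ _ x]) (simp_all add: That_R[OF b f] That_E_SF[OF b f] That_F_SF[OF b f])

text \<open>\<open>Tmhat\<close> is conjugate to a \<open>That\<close>, so it inherits what is known about the latter.\<close>

context
  fixes \<chi> :: "('i, 'k::field) bichar" and p :: 'i
  assumes b: "bicharacter \<chi>" and f: "p_finite p \<chi>"
begin

lemma Tmhat_SF_via:
  "Tmhat p \<chi> x \<in> SF (rp p \<chi>) \<longleftrightarrow>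
     That p (bichar_op (bichar_inv \<chi>)) (phth (pha (conj_tor p \<chi>) x)) \<in> SF (rp p (bichar_op (bichar_inv \<chi>)))"
proof -
  let ?c = "bichar_op (bichar_inv \<chi>)"
  have rc: "rp p ?c = bichar_op (bichar_inv (rp p \<chi>))" by (simp add: rp_op rp_inv[OF b])
  have inv: "bichar_op (bichar_inv (rp p ?c)) = rp p \<chi>" unfolding rc bichar_inv_op by simp
  note e = Tmhat_via_That[OF b f, of x]
  have bc: "bicharacter (rp p ?c)" using b by simp
  have "Tmhat p \<chi> x \<in> SF (rp p \<chi>) \<longleftrightarrow> phth (That p ?c (phth (pha (conj_tor p \<chi>) x))) \<in> SF (rp p \<chi>)"
    using eqm_SF'[OF rp_bichar[OF b] e] eqm_SF'[OF rp_bichar[OF b] eqm_sym[OF R_tideal e]] by blast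
  also have "\<dots> \<longleftrightarrow> That p ?c (phth (pha (conj_tor p \<chi>) x)) \<in> SF (rp p ?c)"
  proof
    assume "phth (That p ?c (phth (pha (conj_tor p \<chi>) x))) \<in> SF (rp p \<chi>)"
    from phth_SF[OF rp_bichar[OF b] this] show "That p ?c (phth (pha (conj_tor p \<chi>) x)) \<in> SF (rp p ?c)"
      unfolding rc phth_phth .
  next
    assume "That p ?c (phth (pha (conj_tor p \<chi>) x)) \<in> SF (rp p ?c)"
    from phth_SF[OF bc this] show "phth (That p ?c (phth (pha (conj_tor p \<chi>) x))) \<in> SF (rp p \<chi>)"
      unfolding inv .
  qed
  finally show ?thesis .
qed

lemma Tmhat_SF: assumes x: "x \<in> SF \<chi>" shows "Tmhat p \<chi> x \<in> SF (rp p \<chi>)"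
proof -
  have "phth (pha (conj_tor p \<chi>) x) \<in> SF (bichar_op (bichar_inv \<chi>))"
    by (rule phth_SF[OF b pha_SF[OF b _ x]]) (rule conj_tor_nonzero[OF b f])
  then show ?thesis unfolding Tmhat_SF_via
    by (rule That_SF[rotated 2]) (simp_all add: b p_finite_op p_finite_inv f)
qed

end

lemma SF_diff_scl: "bicharacter \<chi> \<Longrightarrow> x \<in> SF \<chi> \<Longrightarrow> x + y \<in> SF \<chi> \<Longrightarrow> y \<in> SF \<chi>"
  using tideal_closed(6)[OF SF_tideal, of \<chi> "x + y" x] by simp

lemma That_SF_D:
  assumes b: "bicharacter \<chi>" and f: "p_finite p \<chi>" and x: "That p \<chi> x \<in> SF (rp p \<chi>)"
  shows "x \<in> SF \<chi>"
proof -
  have "Tmhat p (rp p \<chi>) (That p \<chi> x) \<in> SF \<chi>"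
    using Tmhat_SF[OF rp_bichar[OF b] p_finite_rp[OF b f] x] unfolding rp_rp[OF b f] .
  from eqm_SF'[OF b eqm_sym[OF R_tideal Tmhat_That[OF b f]] this] show ?thesis .
qed

lemma pha_pha [simp]: "pha a (pha c x) = pha (\<lambda>i. a i * c i) x"
proof (induction x rule: fa_word_induct)
  case (2 g x)
  have "pha a (pha c (gen g)) = pha (\<lambda>i. a i * c i) (gen g)" by (cases g) (simp_all add: mult.commute)
  then show ?case using 2 by simp
qed simp_all

lemma pha_one: "pha (\<lambda>i. 1) x = x"
proof (induction x rule: fa_word_induct)
  case (2 g x)
  show ?case by (cases g) (simp_all add: 2)
qed simp_all

lemma Tmhat_SF_D:
  assumes b: "bicharacter \<chi>" and f: "p_finite p \<chi>" and x: "Tmhat p \<chi> x \<in> SF (rp p \<chi>)"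
  shows "x \<in> SF \<chi>"
proof -
  let ?c = "bichar_op (bichar_inv \<chi>)" and ?a = "conj_tor p \<chi>"
  have nz: "?a i \<noteq> 0" for i by (rule conj_tor_nonzero[OF b f])
  have bc: "bicharacter ?c" and fc: "p_finite p ?c" by (simp_all add: b p_finite_op p_finite_inv f)
  have "phth (pha ?a x) \<in> SF ?c" using x unfolding Tmhat_SF_via[OF b f] by (rule That_SF_D[OF bc fc])
  from phth_SF[OF bc this] have "pha ?a x \<in> SF \<chi>" unfolding phth_phth by (simp add: bichar_inv_op)
  from pha_SF[OF b _ this, of "\<lambda>i. inverse (?a i)"] show ?thesis by (simp add: nz pha_one)
qed

text \<open>As \<open>T\<^sub>p\<^sup>-\<close> is injective on \<open>U\<close>, its left inverse \<dots> is also a right inverse.\<close>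

lemma That_Tmhat:
  assumes b: "bicharacter \<chi>" and f: "p_finite p \<chi>"
  shows "That p (rp p \<chi>) (Tmhat p \<chi> x) - x \<in> SF \<chi>"
proof (rule Tmhat_SF_D[OF b f])
  note b' = rp_bichar[OF b, of p] and f' = p_finite_rp[OF b f]
  have "eqm (\<U>_ideal (rp p \<chi>)) (Tmhat p \<chi> (That p (rp p \<chi>) (Tmhat p \<chi> x))) (Tmhat p \<chi> x)"
    using Tmhat_That[OF b' f', of "Tmhat p \<chi> x"] unfolding rp_rp[OF b f] .
  then show "Tmhat p \<chi> (That p (rp p \<chi>) (Tmhat p \<chi> x) - x) \<in> SF (rp p \<chi>)"
    using R_SF[OF b'] unfolding eqm_def by auto
qed

section \<open>Algebras presented as quotients of a free algebra\<close>

lemma ring_cong: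
  assumes "ring R" "carrier S = carrier R" "mult S = mult R" "one S = one R" "zero S = zero R" "add S = add R"
  shows "ring S"
proof -
  interpret R: ring R by (rule assms(1))
  note e = assms(2-)
  show ?thesis
  proof (rule ringI)
    show "abelian_group S"
    proof (rule abelian_groupI)
      show "\<exists>y\<in>carrier S. y \<oplus>\<^bsub>S\<^esub> x = \<zero>\<^bsub>S\<^esub>" if "x \<in> carrier S" for x
        using that R.l_neg[of x] R.a_inv_closed[of x] unfolding e by blast
    qed (simp_all add: e R.a_ac)
    show "monoid S" by (rule monoidI) (simp_all add: e R.m_assoc)
  qed (simp_all add: e R.l_distr R.r_distr)
qed

locale presented =
  fixes A :: "('k::field, 'a) module" and f :: "('g fmon \<Rightarrow>\<^sub>0 'k) \<Rightarrow> 'a" and J :: "('g fmon \<Rightarrow>\<^sub>0 'k) set"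
  assumes is_ring: "ring A" and carrier: "carrier A = range f"
    and add: "f x \<oplus>\<^bsub>A\<^esub> f y = f (x + y)" and mult: "f x \<otimes>\<^bsub>A\<^esub> f y = f (x * y)"
    and one: "\<one>\<^bsub>A\<^esub> = f 1" and zero: "\<zero>\<^bsub>A\<^esub> = f 0" and smult: "c \<odot>\<^bsub>A\<^esub> f x = f (scl c x)"
    and eq: "f x = f y \<longleftrightarrow> x - y \<in> J"
begin

lemma in_carrier [simp]: "f x \<in> carrier A"
  by (simp add: carrier)

lemma neg: "\<ominus>\<^bsub>A\<^esub> f x = f (- x)"
proof -
  interpret ring A by (rule is_ring)
  show ?thesis by (rule minus_equality) (simp_all add: add zero)
qed

lemma diff: "f x \<ominus>\<^bsub>A\<^esub> f y = f (x - y)"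
  by (simp add: a_minus_def neg add)

lemma pow: "f x [^]\<^bsub>A\<^esub> (n::nat) = f (x ^ n)"
proof -
  interpret ring A by (rule is_ring)
  show ?thesis by (induction n) (simp_all add: one mult power_commutes)
qed

lemma tideal_preimage: "ideal I A \<Longrightarrow> tideal {x. f x \<in> I}"
proof -
  assume "ideal I A"
  then interpret ideal I A .
  show ?thesis
    unfolding tideal_def
    using zero_closed additive_subgroup.zero_closed[OF is_additive_subgroup] additive_subgroup.a_closed[OF is_additive_subgroup] I_l_closed I_r_closed
    by (auto simp: zero simp flip: add mult)
qed

lemma image_preimage: "ideal I A \<Longrightarrow> f ` {x. f x \<in> I} = I"
proof -
  assume "ideal I A"
  then interpret ideal I A .
  have "I \<subseteq> range f" using a_subset unfolding carrier .
  then show ?thesis by blast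
qed

lemma ideal_image: "tideal K \<Longrightarrow> ideal (f ` K) A"
proof -
  assume K: "tideal K"
  interpret ring A by (rule is_ring)
  show ?thesis
  proof (rule idealI[OF is_ring])
    show "subgroup (f ` K) (add_monoid A)"
    proof (rule group.subgroupI[OF a_group])
      show "inv\<^bsub>add_monoid A\<^esub> a \<in> f ` K" if "a \<in> f ` K" for a
        using that tideal_closed(5)[OF K] neg unfolding a_inv_def by auto
    qed (use tideal_closed[OF K] in \<open>auto simp: add\<close>)
  qed (use tideal_closed[OF K] in \<open>auto simp: mult carrier\<close>)
qed

lemma J_alt: "x \<in> J \<longleftrightarrow> f x = f 0"
  by (simp add: eq)

context
  fixes K assumes K: "tideal K" and JK: "J \<subseteq> K"
begin

lemma image_iff: "f x \<in> f ` K \<longleftrightarrow> x \<in> K"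
proof
  assume "f x \<in> f ` K"
  then obtain y where "f x = f y" "y \<in> K" by blast
  then show "x \<in> K" using JK tideal_closed(2)[OF K, of "x - y" y] by (auto simp: eq)
qed simp

lemma coset: "f ` K +>\<^bsub>A\<^esub> f x = f ` {y. y - x \<in> K}"
proof
  show "f ` K +>\<^bsub>A\<^esub> f x \<subseteq> f ` {y. y - x \<in> K}" by (auto simp: a_r_coset_def' add)
  show "f ` {y. y - x \<in> K} \<subseteq> f ` K +>\<^bsub>A\<^esub> f x"
  proof clarify
    fix y assume "y - x \<in> K"
    moreover have "f y = f (y - x) \<oplus>\<^bsub>A\<^esub> f x" by (simp add: add)
    ultimately show "f y \<in> f ` K +>\<^bsub>A\<^esub> f x" unfolding a_r_coset_def' by blast
  qed
qed

lemma coset_eq: "f ` K +>\<^bsub>A\<^esub> f x = f ` K +>\<^bsub>A\<^esub> f y \<longleftrightarrow> x - y \<in> K"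
proof
  assume "f ` K +>\<^bsub>A\<^esub> f x = f ` K +>\<^bsub>A\<^esub> f y"
  moreover have "f x \<in> f ` {y. y - x \<in> K}" using tideal_closed(1)[OF K] by simp
  ultimately obtain z where "f x = f z" "z - y \<in> K" unfolding coset by blast
  then show "x - y \<in> K" using JK tideal_closed(2)[OF K, of "x - z" "z - y"] by (auto simp: eq)
next
  assume xy: "x - y \<in> K"
  have "z - x \<in> K \<longleftrightarrow> z - y \<in> K" for z
    using tideal_closed(2)[OF K, of "z - x" "x - y"] tideal_closed(6)[OF K, of "z - y" "x - y"] xy by auto
  then show "f ` K +>\<^bsub>A\<^esub> f x = f ` K +>\<^bsub>A\<^esub> f y" unfolding coset by simp
qed

lemma presented_quotient: "presented (quot_alg A (f ` K)) (\<lambda>x. f ` K +>\<^bsub>A\<^esub> f x) K"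
proof -
  interpret ideal "f ` K" A by (rule ideal_image[OF K])
  show ?thesis
  proof (rule presented.intro)
    show "ring (quot_alg A (f ` K))"
      by (rule ring_cong[OF quotient_is_ring]) (simp_all add: quot_alg_def)
    show "carrier (quot_alg A (f ` K)) = range (\<lambda>x. f ` K +>\<^bsub>A\<^esub> f x)"
      unfolding quot_alg_def FactRing_def by (auto simp: A_RCOSETS_def' carrier)
    show "(f ` K +>\<^bsub>A\<^esub> f x) \<oplus>\<^bsub>quot_alg A (f ` K)\<^esub> (f ` K +>\<^bsub>A\<^esub> f y) = f ` K +>\<^bsub>A\<^esub> f (x + y)" for x y
      by (simp add: quot_alg_def FactRing_def a_rcos_sum flip: add)
    show "(f ` K +>\<^bsub>A\<^esub> f x) \<otimes>\<^bsub>quot_alg A (f ` K)\<^esub> (f ` K +>\<^bsub>A\<^esub> f y) = f ` K +>\<^bsub>A\<^esub> f (x * y)" for x y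
      by (simp add: quot_alg_def FactRing_def rcoset_mult_add flip: mult)
    show "\<one>\<^bsub>quot_alg A (f ` K)\<^esub> = f ` K +>\<^bsub>A\<^esub> f 1"
      by (simp add: quot_alg_def FactRing_def one)
    show "\<zero>\<^bsub>quot_alg A (f ` K)\<^esub> = f ` K +>\<^bsub>A\<^esub> f 0"
      by (simp add: quot_alg_def FactRing_def coset)
    show "c \<odot>\<^bsub>quot_alg A (f ` K)\<^esub> (f ` K +>\<^bsub>A\<^esub> f x) = f ` K +>\<^bsub>A\<^esub> f (scl c x)" for c x
    proof -
      have e: "f ` K +>\<^bsub>A\<^esub> (c \<odot>\<^bsub>A\<^esub> f y) = f ` K +>\<^bsub>A\<^esub> f (scl c x)" if "y - x \<in> K" for y
        unfolding smult coset_eq using tideal_scl[OF K that, of c] by simp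
      have "c \<odot>\<^bsub>quot_alg A (f ` K)\<^esub> (f ` K +>\<^bsub>A\<^esub> f x) = (\<Union>y\<in>{y. y - x \<in> K}. f ` K +>\<^bsub>A\<^esub> (c \<odot>\<^bsub>A\<^esub> f y))"
        unfolding quot_alg_def coset by simp
      also have "\<dots> = (\<Union>y\<in>{y. y - x \<in> K}. f ` K +>\<^bsub>A\<^esub> f (scl c x))" using e by simp
      also have "\<dots> = f ` K +>\<^bsub>A\<^esub> f (scl c x)"
        using tideal_closed(1)[OF K] by (subst UN_constant_eq[of x]) simp_all
      finally show ?thesis .
    qed
  qed (rule coset_eq)
qed

lemma induced_coset: "(\<And>y. y - x \<in> K \<Longrightarrow> h (f y) = v) \<Longrightarrow> induced h (f ` K +>\<^bsub>A\<^esub> f x) = v"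
proof -
  assume "\<And>y. y - x \<in> K \<Longrightarrow> h (f y) = v"
  then have "h ` f ` {y. y - x \<in> K} = {v}"
    using tideal_closed(1)[OF K] by (force intro!: image_eqI[of _ _ x])
  then show ?thesis unfolding induced_def coset by simp
qed

end

lemma alg_gen_subset: "X \<subseteq> carrier A \<Longrightarrow> alg_gen A X \<subseteq> carrier A"
proof -
  assume "X \<subseteq> carrier A"
  then have "alg_subspace A (carrier A) \<and> \<one>\<^bsub>A\<^esub> \<in> carrier A \<and> (\<forall>x\<in>carrier A. \<forall>y\<in>carrier A. x \<otimes>\<^bsub>A\<^esub> y \<in> carrier A) \<and> X \<subseteq> carrier A"
    by (auto simp: alg_subspace_def carrier zero one add mult smult)
  then show ?thesis unfolding alg_gen_def by blast
qed

lemma alg_hom_comp: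
  assumes "G 1 = 1" "\<And>x y. G (x + y) = G x + G y" "\<And>x y. G (x * y) = G x * G y" "\<And>c x. G (scl c x) = scl c (G x)"
  shows "(\<lambda>x. f (G x)) \<in> alg_hom free_alg A"
  by (simp add: alg_hom_def ring_hom_def assms one add mult smult)

lemma image_alg_gen:
  assumes H: "H 1 = 1" "\<And>x y. H (x + y) = H x + H y" "\<And>x y. H (x * y) = H x * H y" "\<And>c x. H (scl c x) = scl c (H x)"
  shows "f (H (x :: 'j fmon \<Rightarrow>\<^sub>0 'k)) \<in> alg_gen A (range (\<lambda>i. f (H (gen i))))"
  unfolding alg_gen_def
proof clarify
  fix B assume B: "alg_subspace A B" "\<one>\<^bsub>A\<^esub> \<in> B" "\<forall>x\<in>B. \<forall>y\<in>B. x \<otimes>\<^bsub>A\<^esub> y \<in> B" "range (\<lambda>i. f (H (gen i))) \<subseteq> B"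
  show "f (H x) \<in> B"
  proof (induction x rule: fa_word_induct)
    case 1 then show ?case using B(2) by (simp add: one H)
  next
    case (2 i x) then show ?case using B(3,4) by (auto simp: H simp flip: mult)
  next
    case (3 x y) then show ?case using B(1) by (auto simp: H alg_subspace_def simp flip: add)
  next
    case (4 c x) then show ?case using B(1) by (auto simp: H alg_subspace_def simp flip: smult)
  qed
qed

end

lemma presented_free: "presented free_alg id {0}"
  by (rule presented.intro) (simp_all add: ring_free_alg)

definition cl :: "('i, 'k::field) bichar \<Rightarrow> ('i ugen fmon \<Rightarrow>\<^sub>0 'k) \<Rightarrow> ('i, 'k) \<U>elem" where
  "cl \<chi> x = \<U>_ideal \<chi> +>\<^bsub>free_alg\<^esub> x"

lemma presented_U: "presented (\<U> \<chi>) (cl \<chi>) (\<U>_ideal \<chi>)"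
proof -
  have "presented (quot_alg free_alg (id ` \<U>_ideal \<chi>)) (\<lambda>x. id ` \<U>_ideal \<chi> +>\<^bsub>free_alg\<^esub> id x) (\<U>_ideal \<chi>)"
    by (rule presented.presented_quotient[OF presented_free R_tideal]) (simp add: tideal_closed(1)[OF R_tideal])
  then show ?thesis by (simp add: \<U>_def cl_def[abs_def])
qed

lemma U_gen_cl: "\<U>_gen \<chi> g = cl \<chi> (gen g)"
  by (simp add: \<U>_gen_def cl_def)

global_interpretation U: presented "\<U> \<chi>" "cl \<chi>" "\<U>_ideal \<chi>" for \<chi>
  by (rule presented_U)

text \<open>Maps defined on generators are computed by lifts to the free algebra.\<close>

lemma U_map_eq:
  fixes B :: "('k::field, 'b) module" and G :: "('i ugen fmon \<Rightarrow>\<^sub>0 'k) \<Rightarrow> 'b"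
  assumes b: "bicharacter \<chi>" and B: "ring B" and G: "G \<in> alg_hom free_alg B" and kill: "\<And>x. x \<in> \<U>_ideal \<chi> \<Longrightarrow> G x = \<zero>\<^bsub>B\<^esub>"
    and k: "\<And>i. k i = G (gen (GK i))" and l: "\<And>i. l i = G (gen (GL i))"
    and e: "\<And>i. e i = G (gen (GE i))" and f: "\<And>i. f i = G (gen (GF i))"
  shows "\<U>_map \<chi> B k l e f (cl \<chi> x) = G x"
proof -
  interpret B: ring B by (rule B)
  have Gc: "G x \<in> carrier B" for x using G by (auto simp: alg_hom_def ring_hom_def)
  have G_simps: "G (x + y) = G x \<oplus>\<^bsub>B\<^esub> G y" "G (x * y) = G x \<otimes>\<^bsub>B\<^esub> G y" "G 1 = \<one>\<^bsub>B\<^esub>" "G (scl c x) = c \<odot>\<^bsub>B\<^esub> G x" for x y c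
    using G by (auto simp: alg_hom_def ring_hom_def)
  have wd: "G x = G y" if "cl \<chi> x = cl \<chi> y" for x y
  proof -
    have "G x = G (x - y) \<oplus>\<^bsub>B\<^esub> G y" by (simp flip: G_simps)
    then show ?thesis using kill that Gc by (simp add: U.eq)
  qed
  define \<Psi> where "\<Psi> = restrict (\<lambda>X. G (SOME x. X = cl \<chi> x)) (carrier (\<U> \<chi>))"
  have \<Psi>: "\<Psi> (cl \<chi> x) = G x" for x
  proof -
    have "cl \<chi> x = cl \<chi> (SOME y. cl \<chi> x = cl \<chi> y)" by (rule someI[of _ x]) simp
    from wd[OF this] show ?thesis unfolding \<Psi>_def by (simp only: restrict_apply U.in_carrier if_True)
  qed
  let ?P = "\<lambda>\<Phi>. \<Phi> \<in> alg_hom (\<U> \<chi>) B \<and> \<Phi> \<in> extensional (carrier (\<U> \<chi>)) \<and>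
     (\<forall>i. \<Phi> (KK \<chi> i) = k i \<and> \<Phi> (LL \<chi> i) = l i \<and> \<Phi> (EE \<chi> i) = e i \<and> \<Phi> (FF \<chi> i) = f i)"
  have P: "?P \<Psi>"
  proof (intro conjI allI)
    have "\<Psi> X \<in> carrier B" if "X \<in> carrier (\<U> \<chi>)" for X using that Gc by (auto simp: U.carrier \<Psi>)
    moreover have "\<Psi> (X \<otimes>\<^bsub>\<U> \<chi>\<^esub> Y) = \<Psi> X \<otimes>\<^bsub>B\<^esub> \<Psi> Y" "\<Psi> (X \<oplus>\<^bsub>\<U> \<chi>\<^esub> Y) = \<Psi> X \<oplus>\<^bsub>B\<^esub> \<Psi> Y"
      if "X \<in> carrier (\<U> \<chi>)" "Y \<in> carrier (\<U> \<chi>)" for X Y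
      using that by (auto simp: U.carrier U.add U.mult \<Psi> G_simps)
    moreover have "\<Psi> (c \<odot>\<^bsub>\<U> \<chi>\<^esub> X) = c \<odot>\<^bsub>B\<^esub> \<Psi> X" if "X \<in> carrier (\<U> \<chi>)" for X c
      using that by (auto simp: U.carrier U.smult \<Psi> G_simps)
    moreover have "\<Psi> \<one>\<^bsub>\<U> \<chi>\<^esub> = \<one>\<^bsub>B\<^esub>" by (simp add: U.one \<Psi> G_simps)
    ultimately show "\<Psi> \<in> alg_hom (\<U> \<chi>) B" unfolding alg_hom_def ring_hom_def by blast
    show "\<Psi> \<in> extensional (carrier (\<U> \<chi>))" by (simp add: \<Psi>_def)
  qed (simp_all only: U_gen_cl k l e f \<Psi>)
  have uniq: "\<Phi> = \<Psi>" if P: "?P \<Phi>" for \<Phi>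
  proof -
    have h: "\<Phi> (cl \<chi> (x + y)) = \<Phi> (cl \<chi> x) \<oplus>\<^bsub>B\<^esub> \<Phi> (cl \<chi> y)" "\<Phi> (cl \<chi> (x * y)) = \<Phi> (cl \<chi> x) \<otimes>\<^bsub>B\<^esub> \<Phi> (cl \<chi> y)"
      "\<Phi> (cl \<chi> 1) = \<one>\<^bsub>B\<^esub>" "\<Phi> (cl \<chi> (scl c x)) = c \<odot>\<^bsub>B\<^esub> \<Phi> (cl \<chi> x)" "\<Phi> (cl \<chi> x) \<in> carrier B" for x y c
      using P by (auto simp: alg_hom_def ring_hom_def simp flip: U.add U.mult U.one U.smult)
    have inv: "\<Phi> (cl \<chi> (gen (ginv g))) = G (gen (ginv g))" if g: "g \<in> cartan_gens" and Pg: "\<Phi> (cl \<chi> (gen g)) = G (gen g)" for g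
    proof -
      interpret bl: bichar_loc \<chi> by (rule bichar_loc.intro[OF b])
      let ?i = "\<Phi> (cl \<chi> (gen (ginv g)))" and ?j = "G (gen (ginv g))"
      have 1: "cl \<chi> (gen g * gen (ginv g)) = cl \<chi> 1" "cl \<chi> (gen (ginv g) * gen g) = cl \<chi> 1"
        using bl.inverse_rels[of g] bl.inverse_rels[of "ginv g"] g by (simp_all add: U.eq eqm_def)
      have "?i \<otimes>\<^bsub>B\<^esub> G (gen g) = \<one>\<^bsub>B\<^esub>" unfolding Pg[symmetric] h(2)[symmetric] 1 by (rule h(3))
      moreover have "G (gen g) \<otimes>\<^bsub>B\<^esub> ?j = \<one>\<^bsub>B\<^esub>" using wd[OF 1(1)] by (simp add: G_simps)
      ultimately have "?i \<otimes>\<^bsub>B\<^esub> (G (gen g) \<otimes>\<^bsub>B\<^esub> ?j) = ?i" "(?i \<otimes>\<^bsub>B\<^esub> G (gen g)) \<otimes>\<^bsub>B\<^esub> ?j = ?j" using h(5) Gc by simp_all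
      then show ?thesis using B.m_assoc[OF h(5) Gc Gc] by simp
    qed
    have P': "\<Phi> (cl \<chi> (gen (GK i))) = G (gen (GK i))" "\<Phi> (cl \<chi> (gen (GL i))) = G (gen (GL i))"
       "\<Phi> (cl \<chi> (gen (GE i))) = G (gen (GE i))" "\<Phi> (cl \<chi> (gen (GF i))) = G (gen (GF i))" for i
      using P by (simp_all add: U_gen_cl k l e f)
    have gens: "\<Phi> (cl \<chi> (gen g)) = G (gen g)" for g
      using P' inv[of "GK _"] inv[of "GL _"] by (cases g) simp_all
    have "\<Phi> (cl \<chi> x) = G x" for x
      by (induction x rule: fa_word_induct) (simp_all only: h G_simps gens)
    then have "\<Phi> X = \<Psi> X" if "X \<in> carrier (\<U> \<chi>)" for X using that \<Psi> by (auto simp: U.carrier)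
    then show ?thesis using P by (intro extensionalityI[of _ "carrier (\<U> \<chi>)"]) (auto simp: \<Psi>_def)
  qed
  have "\<U>_map \<chi> B k l e f = \<Psi>" unfolding \<U>_map_def by (rule the_equality[of ?P, OF P uniq])
  then show ?thesis by (simp only: \<Psi>)
qed

section \<open>The symmetries on classes\<close>

lemma E_incl_cl: "E_incl \<chi> x = cl \<chi> (embE x)"
proof -
  have "E_incl \<chi> = (\<lambda>x. cl \<chi> (embE x))"
    unfolding E_incl_def
  proof (rule the_equality)
    show "(\<lambda>x. cl \<chi> (embE x)) \<in> alg_hom free_alg (\<U> \<chi>) \<and> (\<forall>i. cl \<chi> (embE (gen i)) = EE \<chi> i)"
      using U.alg_hom_comp[of embE \<chi>] by (simp add: U_gen_cl)
    fix \<iota> assume i: "\<iota> \<in> alg_hom free_alg (\<U> \<chi>) \<and> (\<forall>i. \<iota> (gen i) = EE \<chi> i)"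
    have h: "\<iota> (x + y) = \<iota> x \<oplus>\<^bsub>\<U> \<chi>\<^esub> \<iota> y" "\<iota> (x * y) = \<iota> x \<otimes>\<^bsub>\<U> \<chi>\<^esub> \<iota> y" "\<iota> 1 = \<one>\<^bsub>\<U> \<chi>\<^esub>"
      "\<iota> (scl c x) = c \<odot>\<^bsub>\<U> \<chi>\<^esub> \<iota> x" "\<iota> (gen i) = cl \<chi> (gen (GE i))" for x y c i
      using i by (auto simp: alg_hom_def ring_hom_def U_gen_cl)
    show "\<iota> = (\<lambda>x. cl \<chi> (embE x))"
    proof
      fix x show "\<iota> x = cl \<chi> (embE x)"
        by (induction x rule: fa_word_induct) (simp_all add: h U.one U.add U.mult U.smult)
    qed
  qed
  then show ?thesis by simp
qed

lemma cl_R: "x \<in> \<U>_ideal \<chi> \<Longrightarrow> cl \<chi> x = \<zero>\<^bsub>\<U> \<chi>\<^esub>"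
  by (simp add: U.J_alt U.zero)

lemma phi_cl:
  assumes b: "bicharacter \<chi>" and a: "\<And>i. a i \<noteq> 0"
  shows "phi \<chi> a (cl \<chi> x) = cl \<chi> (pha a x)"
  unfolding phi_def
  by (rule U_map_eq[OF b U.is_ring U.alg_hom_comp]) (simp_all add: cl_R pha_R[OF b a] U_gen_cl U.smult)

lemma phi2_cl:
  assumes b: "bicharacter \<chi>"
  shows "phi2 \<chi> (cl \<chi> x) = cl (bichar_inv \<chi>) (ph2 x)"
proof -
  have "ph2 x \<in> \<U>_ideal (bichar_inv \<chi>)" if "x \<in> \<U>_ideal \<chi>" for x
    using ph3_R[OF bichar_op[OF bichar_inv[OF b]] phth_R[OF b that]] by (simp add: ph2_def)
  then show ?thesis
    unfolding phi2_def Let_def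
    by (intro U_map_eq[OF b U.is_ring U.alg_hom_comp]) (simp_all add: cl_R U_gen_cl U.neg)
qed

lemma phi3_cl:
  assumes b: "bicharacter \<chi>"
  shows "phi3 \<chi> (cl \<chi> x) = cl (bichar_op \<chi>) (ph3 x)"
  unfolding phi3_def Let_def
  by (rule U_map_eq[OF b U.is_ring U.alg_hom_comp]) (simp_all add: cl_R ph3_R[OF b] U_gen_cl)

lemma ring_opp: "ring A \<Longrightarrow> ring (opp_alg A)"
proof -
  assume "ring A"
  then interpret ring A .
  show ?thesis
  proof (rule ringI)
    show "abelian_group (opp_alg A)"
    proof (rule abelian_groupI)
      show "\<exists>y\<in>carrier (opp_alg A). y \<oplus>\<^bsub>opp_alg A\<^esub> x = \<zero>\<^bsub>opp_alg A\<^esub>" if "x \<in> carrier (opp_alg A)" for x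
        using that l_neg[of x] a_inv_closed[of x] unfolding opp_alg_def by auto
    qed (simp_all add: opp_alg_def a_ac)
    show "monoid (opp_alg A)" by (rule monoidI) (simp_all add: opp_alg_def m_assoc)
  qed (simp_all add: opp_alg_def l_distr r_distr)
qed

lemma phi4_cl:
  assumes b: "bicharacter \<chi>"
  shows "phi4 \<chi> (cl \<chi> x) = cl \<chi> (ph4 x)"
  unfolding phi4_def
proof (rule U_map_eq[OF b ring_opp[OF U.is_ring]])
  show "(\<lambda>x. cl \<chi> (ph4 x)) \<in> alg_hom free_alg (opp_alg (\<U> \<chi>))"
    by (simp add: alg_hom_def ring_hom_def opp_alg_def U.one U.add U.mult U.smult)
  show "cl \<chi> (ph4 x) = \<zero>\<^bsub>opp_alg (\<U> \<chi>)\<^esub>" if "x \<in> \<U>_ideal \<chi>" for x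
    using bichar_loc.ph4_R[OF bichar_loc.intro[OF b] that] by (simp add: cl_R opp_alg_def)
qed (simp_all add: U_gen_cl)

section \<open>The ideal \<open>\<S>(\<chi>)\<close> and the algebra \<open>U(\<chi>)\<close>\<close>

lemma U_plus_mem: "cl \<chi> (embE x) \<in> \<U>_plus \<chi>"
  using U.image_alg_gen[of embE \<chi> x] by (simp add: \<U>_plus_def U_gen_cl[abs_def])

lemma U_minus_mem: "cl \<chi> (embF x) \<in> \<U>_minus \<chi>"
  using U.image_alg_gen[of embF \<chi> x] by (simp add: \<U>_minus_def U_gen_cl[abs_def])

lemma U_zero_mem: "set c \<subseteq> cartan_gens \<Longrightarrow> cl \<chi> (gw c) \<in> \<U>_zero \<chi>"
  unfolding \<U>_zero_def alg_gen_def
proof clarify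
  fix B assume c: "set c \<subseteq> cartan_gens" and B: "alg_subspace (\<U> \<chi>) B" "\<one>\<^bsub>\<U> \<chi>\<^esub> \<in> B" "\<forall>x\<in>B. \<forall>y\<in>B. x \<otimes>\<^bsub>\<U> \<chi>\<^esub> y \<in> B" "\<U>_gen \<chi> ` cartan_gens \<subseteq> B"
  show "cl \<chi> (gw c) \<in> B"
    using c
  proof (induction c)
    case Nil then show ?case using B(2) by (simp add: U.one)
  next
    case (Cons g c)
    then have "cl \<chi> (gen g) \<otimes>\<^bsub>\<U> \<chi>\<^esub> cl \<chi> (gw c) \<in> B" using B(3,4) by (auto simp: U_gen_cl)
    then show ?case by (simp add: U.mult)
  qed
qed

lemma U_parts_carrier: "\<U>_plus \<chi> \<subseteq> carrier (\<U> \<chi>)" "\<U>_minus \<chi> \<subseteq> carrier (\<U> \<chi>)" "\<U>_zero \<chi> \<subseteq> carrier (\<U> \<chi>)"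
  unfolding \<U>_plus_def \<U>_minus_def \<U>_zero_def by (intro U.alg_gen_subset; auto simp: U_gen_cl)+

lemma lin_span_closed:
  "X \<subseteq> lin_span A X" "\<zero>\<^bsub>A\<^esub> \<in> lin_span A X" "x \<in> lin_span A X \<Longrightarrow> y \<in> lin_span A X \<Longrightarrow> x \<oplus>\<^bsub>A\<^esub> y \<in> lin_span A X"
  "alg_subspace A V \<Longrightarrow> X \<subseteq> V \<Longrightarrow> lin_span A X \<subseteq> V"
  unfolding lin_span_def alg_subspace_def by blast+

lemma set_mult_mem: "s \<in> A \<Longrightarrow> t \<in> B \<Longrightarrow> u \<in> C \<Longrightarrow> (s \<otimes>\<^bsub>G\<^esub> t) \<otimes>\<^bsub>G\<^esub> u \<in> A <#>\<^bsub>G\<^esub> B <#>\<^bsub>G\<^esub> C"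
  unfolding set_mult_def by blast

lemma S_plus_eq: "bicharacter \<chi> \<Longrightarrow> \<S>_plus \<chi> = (\<lambda>x. cl \<chi> (embE x)) ` radical (qm \<chi>)"
  by (simp add: \<S>_plus_def nichols_space_eq E_incl_cl)

lemma S_minus_eq: "bicharacter \<chi> \<Longrightarrow> \<S>_minus \<chi> = (\<lambda>x. cl \<chi> (embF (frev x))) ` radical (qm \<chi>)"
  by (simp add: \<S>_minus_def S_plus_eq image_image phi4_cl ph4_embE)

lemma S_eq:
  assumes b: "bicharacter \<chi>" shows "\<S> \<chi> = cl \<chi> ` SF \<chi>"
proof
  note I = tideal_closed[OF SF_tideal[OF b]]
  interpret ideal "cl \<chi> ` SF \<chi>" "\<U> \<chi>" by (rule U.ideal_image[OF SF_tideal[OF b]])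
  show "\<S> \<chi> \<subseteq> cl \<chi> ` SF \<chi>"
    unfolding \<S>_def
  proof (rule lin_span_closed(4))
    show "alg_subspace (\<U> \<chi>) (cl \<chi> ` SF \<chi>)"
      using I tideal_scl[OF SF_tideal[OF b]] by (auto simp: alg_subspace_def U.zero U.add U.smult)
    define W where "W = cl \<chi> ` SF \<chi>"
    have p: "\<S>_plus \<chi> \<subseteq> W" by (auto simp: W_def S_plus_eq[OF b] embE_SF[OF b])
    have m: "\<S>_minus \<chi> \<subseteq> W" by (auto simp: W_def S_minus_eq[OF b] intro!: embF_SF[OF b])
    have r: "s \<in> W \<Longrightarrow> u \<in> carrier (\<U> \<chi>) \<Longrightarrow> s \<otimes>\<^bsub>\<U> \<chi>\<^esub> u \<in> W" for s u unfolding W_def by (rule I_r_closed)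
    have l: "s \<in> W \<Longrightarrow> u \<in> carrier (\<U> \<chi>) \<Longrightarrow> u \<otimes>\<^bsub>\<U> \<chi>\<^esub> s \<in> W" for s u unfolding W_def by (rule I_l_closed)
    note c = U_parts_carrier[THEN subsetD]
    have "(s \<otimes>\<^bsub>\<U> \<chi>\<^esub> t) \<otimes>\<^bsub>\<U> \<chi>\<^esub> u \<in> W" if "s \<in> \<S>_plus \<chi>" "t \<in> \<U>_zero \<chi>" "u \<in> \<U>_minus \<chi>" for s t u
      by (rule r[OF r[OF subsetD[OF p that(1)] c(3)[OF that(2)]] c(2)[OF that(3)]])
    moreover have "(s \<otimes>\<^bsub>\<U> \<chi>\<^esub> t) \<otimes>\<^bsub>\<U> \<chi>\<^esub> u \<in> W" if "s \<in> \<U>_plus \<chi>" "t \<in> \<U>_zero \<chi>" "u \<in> \<S>_minus \<chi>" for s t u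
      by (rule l[OF subsetD[OF m that(3)] m_closed[OF c(1)[OF that(1)] c(3)[OF that(2)]]])
    ultimately show "(\<S>_plus \<chi> <#>\<^bsub>\<U> \<chi>\<^esub> \<U>_zero \<chi> <#>\<^bsub>\<U> \<chi>\<^esub> \<U>_minus \<chi>) \<union>
      (\<U>_plus \<chi> <#>\<^bsub>\<U> \<chi>\<^esub> \<U>_zero \<chi> <#>\<^bsub>\<U> \<chi>\<^esub> \<S>_minus \<chi>) \<subseteq> cl \<chi> ` SF \<chi>"
      unfolding set_mult_def W_def[symmetric] by blast
  qed
  interpret bichar_loc \<chi> by (rule bichar_loc.intro[OF b])
  show "cl \<chi> ` SF \<chi> \<subseteq> \<S> \<chi>"
  proof clarify
    fix x assume "x \<in> SF \<chi>"
    then show "cl \<chi> x \<in> \<S> \<chi>"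
    proof (induction rule: SF_induct)
      case (R x)
      then show ?case unfolding cl_R[OF R] \<S>_def by (intro lin_span_closed(2))
    next
      case (add x y)
      then show ?case unfolding U.add[symmetric] \<S>_def by (intro lin_span_closed(3))
    next
      case (prod x c y)
      have e: "cl \<chi> (el x c y) = (cl \<chi> (embE x) \<otimes>\<^bsub>\<U> \<chi>\<^esub> cl \<chi> (gw c)) \<otimes>\<^bsub>\<U> \<chi>\<^esub> cl \<chi> (embF y)"
        by (simp add: el_def U.mult)
      have 1: "cl \<chi> (el x c y) \<in> \<S>_plus \<chi> <#>\<^bsub>\<U> \<chi>\<^esub> \<U>_zero \<chi> <#>\<^bsub>\<U> \<chi>\<^esub> \<U>_minus \<chi>" if "x \<in> radical q"
        unfolding e by (rule set_mult_mem[OF _ U_zero_mem[OF prod(1)] U_minus_mem]) (simp add: S_plus_eq[OF b] that)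
      have "cl \<chi> (embF y) \<in> \<S>_minus \<chi>" if "frev y \<in> radical q"
        unfolding S_minus_eq[OF b] by (rule image_eqI[OF _ that]) simp
      then have 2: "cl \<chi> (el x c y) \<in> \<U>_plus \<chi> <#>\<^bsub>\<U> \<chi>\<^esub> \<U>_zero \<chi> <#>\<^bsub>\<U> \<chi>\<^esub> \<S>_minus \<chi>" if "frev y \<in> radical q"
        unfolding e by (rule set_mult_mem[OF U_plus_mem U_zero_mem[OF prod(1)]]) (rule that)
      have "cl \<chi> (el x c y) \<in> (\<S>_plus \<chi> <#>\<^bsub>\<U> \<chi>\<^esub> \<U>_zero \<chi> <#>\<^bsub>\<U> \<chi>\<^esub> \<U>_minus \<chi>) \<union>
        (\<U>_plus \<chi> <#>\<^bsub>\<U> \<chi>\<^esub> \<U>_zero \<chi> <#>\<^bsub>\<U> \<chi>\<^esub> \<S>_minus \<chi>)"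
        using prod(2) 1 2 by (elim disjE) (simp_all only: Un_iff simp_thms)
      then show ?case unfolding \<S>_def by (rule subsetD[OF lin_span_closed(1)])
    qed
  qed
qed

lemma presented_Uq: "bicharacter \<chi> \<Longrightarrow> presented (Uq \<chi>) (\<lambda>x. Uq_class \<chi> (cl \<chi> x)) (SF \<chi>)"
  unfolding Uq_def Uq_class_def S_eq by (rule U.presented_quotient[OF SF_tideal R_SF])

section \<open>The ideal generated by the top root vectors\<close>

lemma top_root_vector_ideal:
  fixes q a b :: "'k::field"
  assumes J: "tideal J" and nz: "q \<noteq> 0" "a \<noteq> 0" "b \<noteq> 0"
    and top: "qnum q (Suc N) = 0 \<or> q ^ N * (a * b) = 1" and least: "\<And>m. m < N \<Longrightarrow> qnum q (Suc m) \<noteq> 0"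
    and P: "qnum q (Suc N) = 0 \<Longrightarrow> gen p ^ Suc N \<in> J" and G: "qnum q (Suc N) \<noteq> 0 \<Longrightarrow> gv q a p i (Suc N) \<in> J"
  shows "gv q a p i (Suc N) \<in> J" "gv (inverse q) (inverse b) p i (Suc N) \<in> J"
proof -
  have "gv q a p i (Suc N) \<in> J \<and> gv (inverse q) (inverse b) p i (Suc N) \<in> J"
  proof (cases "qnum q (Suc N) = 0")
    case True
    have least': "qnum q k \<noteq> 0" if "0 < k" "k < Suc N" for k
      using least[of "k - 1"] that by (cases k) (simp_all del: qnum_simps)
    have inv: "qnum (inverse q) k = 0 \<longleftrightarrow> qnum q k = 0" if "0 < k" for k
      using qnum_inverse_zero[OF nz(1), of "k - 1"] that by (simp del: qnum_simps)
    have gp: "gen p ^ Suc N * gen i \<in> J" "gen i * gen p ^ Suc N \<in> J" 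
      by (rule tideal_closed(4)[OF J P[OF True]] tideal_closed(3)[OF J P[OF True]])+
    have "gv q a p i (Suc N) = gen p ^ Suc N * gen i + scl (bc q a (Suc N) (Suc N)) (gen i * gen p ^ Suc N)"
      by (rule gv_height[OF True _ zero_less_Suc]) (rule least')
    then have "gv q a p i (Suc N) \<in> J"
      by (simp only:) (intro tideal_closed(2)[OF J] tideal_scl[OF J] gp)
    moreover have "gv (inverse q) (inverse b) p i (Suc N) =
        gen p ^ Suc N * gen i + scl (bc (inverse q) (inverse b) (Suc N) (Suc N)) (gen i * gen p ^ Suc N)"
      by (rule gv_height[OF _ _ zero_less_Suc]) (simp_all add: inv True least' del: qnum_simps)
    then have "gv (inverse q) (inverse b) p i (Suc N) \<in> J"
      by (simp only:) (intro tideal_closed(2)[OF J] tideal_scl[OF J] gp)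
    ultimately show ?thesis by blast
  next
    case False
    then have "q ^ N * a * b = 1" using top by (simp add: mult.assoc)
    then have "inverse b = q ^ N * a" using nz by (simp add: field_simps)
    then show ?thesis using G[OF False] by (simp only: gv_reverse[OF nz(1)])
  qed
  then show "gv q a p i (Suc N) \<in> J" "gv (inverse q) (inverse b) p i (Suc N) \<in> J" by blast+
qed

lemma height_enat:
  assumes "height \<chi> p = enat h"
  shows "qnum (qm \<chi> p p) h = 0" "0 < h" "\<And>k. 0 < k \<Longrightarrow> qnum (qm \<chi> p p) k = 0 \<Longrightarrow> h \<le> k"
proof -
  let ?P = "\<lambda>m. m > 0 \<and> qnum (qm \<chi> p p) m = 0"
  have ex: "\<exists>m. ?P m" and h: "h = (LEAST m. ?P m)" using assms by (auto simp: height_def split: if_splits)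
  show "qnum (qm \<chi> p p) h = 0" "0 < h" using LeastI_ex[OF ex] unfolding h by auto
  show "0 < k \<Longrightarrow> qnum (qm \<chi> p p) k = 0 \<Longrightarrow> h \<le> k" for k unfolding h by (intro Least_le conjI)
qed

lemma height_infinity: "height \<chi> p = \<infinity> \<Longrightarrow> 0 < k \<Longrightarrow> qnum (qm \<chi> p p) k \<noteq> 0"
  by (auto simp: height_def split: if_splits dest: spec[of _ k])

lemma (in ring) ideal_restrict:
  assumes B: "B \<subseteq> carrier R" "\<zero> \<in> B" "\<one> \<in> B" "\<And>x y. x \<in> B \<Longrightarrow> y \<in> B \<Longrightarrow> x \<oplus> y \<in> B"
    "\<And>x y. x \<in> B \<Longrightarrow> y \<in> B \<Longrightarrow> x \<otimes> y \<in> B" "\<And>x. x \<in> B \<Longrightarrow> \<ominus> x \<in> B"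
    and I: "ideal I R"
  shows "ideal (I \<inter> B) (R\<lparr>carrier := B\<rparr>)"
proof -
  let ?S = "R\<lparr>carrier := B\<rparr>"
  interpret I: ideal I R by (rule I)
  have c: "x \<in> B \<Longrightarrow> x \<in> carrier R" for x using B(1) by blast
  have S: "ring ?S"
  proof (rule ringI)
    show "abelian_group ?S"
    proof (rule abelian_groupI)
      show "\<exists>y\<in>carrier ?S. y \<oplus>\<^bsub>?S\<^esub> x = \<zero>\<^bsub>?S\<^esub>" if "x \<in> carrier ?S" for x
        using that B(6) l_neg[OF c] by auto
    qed (use B in \<open>auto simp: c a_ac\<close>)
    show "monoid ?S" by (rule monoidI) (use B in \<open>auto simp: c m_assoc\<close>)
  qed (auto simp: c l_distr r_distr)
  interpret S: ring ?S by (rule S)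
  have neg: "\<ominus>\<^bsub>?S\<^esub> x = \<ominus> x" if "x \<in> B" for x
    by (rule S.minus_equality) (use that B(6) l_neg[OF c] in auto)
  show ?thesis
  proof (rule idealI[OF S])
    show "subgroup (I \<inter> B) (add_monoid ?S)"
    proof (rule group.subgroupI[OF S.a_group])
      show "I \<inter> B \<noteq> {}" using B(2) additive_subgroup.zero_closed[OF I.is_additive_subgroup] by blast
      show "inv\<^bsub>add_monoid ?S\<^esub> x \<in> I \<inter> B" if "x \<in> I \<inter> B" for x
        using neg[of x] that B(6) I.a_inv_closed[of x] unfolding a_inv_def by auto
    qed (use B additive_subgroup.a_closed[OF I.is_additive_subgroup] in auto)
  qed (use B c I.I_l_closed I.I_r_closed in auto)
qed

lemma alg_gen_subring:
  fixes \<chi> :: "('i, 'k::field) bichar"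
  assumes X: "X \<subseteq> carrier (\<U> \<chi>)" and I: "ideal I (\<U> \<chi>)"
  shows "ideal (I \<inter> alg_gen (\<U> \<chi>) X) ((\<U> \<chi>)\<lparr>carrier := alg_gen (\<U> \<chi>) X\<rparr>)"
proof (rule ring.ideal_restrict[OF U.is_ring _ _ _ _ _ _ I])
  show c: "alg_gen (\<U> \<chi>) X \<subseteq> carrier (\<U> \<chi>)" by (rule U.alg_gen_subset[OF X])
  show "\<ominus>\<^bsub>\<U> \<chi>\<^esub> x \<in> alg_gen (\<U> \<chi>) X" if x: "x \<in> alg_gen (\<U> \<chi>) X" for x
  proof -
    have "\<ominus>\<^bsub>\<U> \<chi>\<^esub> x = (- 1) \<odot>\<^bsub>\<U> \<chi>\<^esub> x" using x c by (auto simp: U.carrier U.neg U.smult)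
    then show ?thesis using x unfolding alg_gen_def alg_subspace_def by auto
  qed
qed (auto simp: alg_gen_def alg_subspace_def)

lemma root_vec_cl: "root_vec (\<U> \<chi>) (cl \<chi> k) (cl \<chi> k') (cl \<chi> x) (cl \<chi> y) m = cl \<chi> (rv k k' x y m)"
  by (induction m) (simp_all add: U.mult U.diff)

lemma Eplus_cl: "Eplus \<chi> p i m = cl \<chi> (EpF p i m)" "Fplus \<chi> p i m = cl \<chi> (FpF p i m)"
  "Eminus \<chi> p i m = cl \<chi> (EmF p i m)" "Fminus \<chi> p i m = cl \<chi> (FmF p i m)"
  by (simp_all only: Eplus_def Eminus_def Fplus_def Fminus_def U_gen_cl root_vec_cl)

lemma gen_power_radical: "height \<chi> p = enat h \<Longrightarrow> gen p ^ h \<in> radical (qm \<chi>)"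
proof -
  assume h: "height \<chi> p = enat h"
  have "qfact (qm \<chi> p p) h = 0"
    unfolding qfact_def by (rule prod_zero) (use height_enat[OF h] in auto)
  then show ?thesis by (simp add: radical_def fw_power)
qed

lemma nat_cartan: "i \<noteq> p \<Longrightarrow> nat (1 - cartan \<chi> p i) = Suc (nn p \<chi> i)"
  by (simp add: cartan_nn)

lemma genideal_mem: "x \<in> S \<Longrightarrow> x \<in> Idl\<^bsub>R\<^esub> S"
  unfolding genideal_def by blast

lemma genideal_least: "ideal I R \<Longrightarrow> S \<subseteq> I \<Longrightarrow> Idl\<^bsub>R\<^esub> S \<subseteq> I"
  unfolding genideal_def by blast

lemma Ip_preimage:
  fixes \<chi> :: "('i, 'k::field) bichar"
  assumes b: "bicharacter \<chi>" and f: "p_finite p \<chi>"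
  obtains K where "tideal K" "\<U>_ideal \<chi> \<subseteq> K" "K \<subseteq> SF \<chi>" "Ip p \<chi> = cl \<chi> ` K"
    "\<And>i. i \<noteq> p \<Longrightarrow> EpF p i (Suc (nn p \<chi> i)) \<in> K" "\<And>i. i \<noteq> p \<Longrightarrow> FpF p i (Suc (nn p \<chi> i)) \<in> K"
    "\<And>i. i \<noteq> p \<Longrightarrow> EmF p i (Suc (nn p \<chi> i)) \<in> K" "\<And>i. i \<noteq> p \<Longrightarrow> FmF p i (Suc (nn p \<chi> i)) \<in> K"
proof -
  let ?S = "cl \<chi> ` SF \<chi>"
  have S: "ideal ?S (\<U> \<chi>)" by (rule U.ideal_image[OF SF_tideal[OF b]])
  have iE: "ideal (?S \<inter> \<U>_plus \<chi>) ((\<U> \<chi>)\<lparr>carrier := \<U>_plus \<chi>\<rparr>)"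
    unfolding \<U>_plus_def by (rule alg_gen_subring[OF _ S]) (auto simp: U_gen_cl)
  have iF: "ideal (?S \<inter> \<U>_minus \<chi>) ((\<U> \<chi>)\<lparr>carrier := \<U>_minus \<chi>\<rparr>)"
    unfolding \<U>_minus_def by (rule alg_gen_subring[OF _ S]) (auto simp: U_gen_cl)
  define GE' where "GE' = (case height \<chi> p of
       enat h \<Rightarrow> {EE \<chi> p [^]\<^bsub>\<U> \<chi>\<^esub> h} \<union> {Eplus \<chi> p i (nat (1 - cartan \<chi> p i)) | i. i \<noteq> p \<and> 1 - cartan \<chi> p i < int h}
     | \<infinity> \<Rightarrow> {Eplus \<chi> p i (nat (1 - cartan \<chi> p i)) | i. i \<noteq> p})"
  define GF' where "GF' = (case height \<chi> p of
       enat h \<Rightarrow> {FF \<chi> p [^]\<^bsub>\<U> \<chi>\<^esub> h} \<union> {Fplus \<chi> p i (nat (1 - cartan \<chi> p i)) | i. i \<noteq> p \<and> 1 - cartan \<chi> p i < int h}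
     | \<infinity> \<Rightarrow> {Fplus \<chi> p i (nat (1 - cartan \<chi> p i)) | i. i \<noteq> p})"
  have E1: "EE \<chi> p [^]\<^bsub>\<U> \<chi>\<^esub> h = cl \<chi> (embE (gen p ^ h))" and F1: "FF \<chi> p [^]\<^bsub>\<U> \<chi>\<^esub> h = cl \<chi> (embF (gen p ^ h))" for h :: nat
    by (simp_all add: U_gen_cl U.pow)
  have E2: "Eplus \<chi> p i m = cl \<chi> (embE (epl (qm \<chi>) p i m))" for i m
    using eqm_EpF[OF b, of p i m] by (simp add: Eplus_cl U.eq eqm_def del: rv.simps gv.simps)
  have F2: "Fplus \<chi> p i m = cl \<chi> (embF (gv (qm \<chi> p p) (qm \<chi> i p) p i m))" for i m
    using eqm_FpF[OF b, of p i m] by (simp add: Eplus_cl U.eq eqm_def del: rv.simps gv.simps)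
  have "GE' \<subseteq> ?S"
    using gen_power_radical[of \<chi> p] EpF_SF[OF b f]
    by (auto simp: GE'_def E1 Eplus_cl nat_cartan embE_SF[OF b] simp del: rv.simps emb_simps split: enat.splits)
  moreover have GE: "GE' \<subseteq> \<U>_plus \<chi>"
    using U_plus_mem by (auto simp: GE'_def E1 E2 simp del: emb_simps gv.simps split: enat.splits)
  ultimately have "Ip_plus p \<chi> \<subseteq> ?S \<inter> \<U>_plus \<chi>"
    unfolding Ip_plus_def GE'_def[symmetric] by (intro genideal_least[OF iE]) blast
  moreover have "GF' \<subseteq> ?S"
  proof -
    have "embF (gen p ^ h) \<in> SF \<chi>" if "height \<chi> p = enat h" for h
      by (rule embF_SF[OF b]) (use gen_power_radical[OF that] in \<open>simp add: gen_power\<close>)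
    then show ?thesis using FpF_SF[OF b f]
      by (auto simp: GF'_def F1 Eplus_cl nat_cartan simp del: rv.simps emb_simps split: enat.splits)
  qed
  moreover have GF: "GF' \<subseteq> \<U>_minus \<chi>"
    using U_minus_mem by (auto simp: GF'_def F1 F2 simp del: emb_simps gv.simps split: enat.splits)
  ultimately have sub: "Ip_plus p \<chi> \<union> Ip_minus p \<chi> \<subseteq> ?S"
    using genideal_least[OF iF, of GF'] unfolding Ip_minus_def GF'_def[symmetric] by (intro Un_least) blast+
  interpret UR: ring "\<U> \<chi>" by (rule U.is_ring)
  interpret SI: ideal ?S "\<U> \<chi>" by (rule S)
  have Ip: "ideal (Ip p \<chi>) (\<U> \<chi>)"
    unfolding Ip_def by (rule UR.genideal_ideal) (use sub SI.a_subset in blast)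
  have IpS: "Ip p \<chi> \<subseteq> ?S" unfolding Ip_def by (rule UR.genideal_minimal[OF S sub])
  have gens: "x \<in> Ip p \<chi>" if "x \<in> GE' \<or> x \<in> GF'" for x
    using that unfolding Ip_def Ip_plus_def Ip_minus_def GE'_def[symmetric] GF'_def[symmetric]
    by (intro genideal_mem) (auto intro: genideal_mem)
  define K where "K = {x. cl \<chi> x \<in> Ip p \<chi>}"
  have K: "tideal K" unfolding K_def by (rule U.tideal_preimage[OF Ip])
  have RK: "\<U>_ideal \<chi> \<subseteq> K"
    using additive_subgroup.zero_closed[OF ideal.axioms(1)[OF Ip]] by (auto simp: K_def cl_R)
  have KS: "K \<subseteq> SF \<chi>"
    using IpS U.image_iff[OF SF_tideal[OF b] R_SF[OF b]] by (auto simp: K_def)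
  have IK: "Ip p \<chi> = cl \<chi> ` K" unfolding K_def by (rule U.image_preimage[OF Ip, symmetric])
  have tE: "tideal {x. embE x \<in> K}" and tF: "tideal {x. embF x \<in> K}"
    using tideal_closed[OF K] by (auto simp: tideal_def)
  note nz = qm_nonzero[OF b]
  have top: "EpF p i (Suc (nn p \<chi> i)) \<in> K \<and> FpF p i (Suc (nn p \<chi> i)) \<in> K \<and> EmF p i (Suc (nn p \<chi> i)) \<in> K \<and> FmF p i (Suc (nn p \<chi> i)) \<in> K"
    if i: "i \<noteq> p" for i
  proof -
    let ?N = "nn p \<chi> i" and ?q = "qm \<chi> p p"
    have t: "qnum ?q (Suc ?N) = 0 \<or> ?q ^ ?N * (qm \<chi> p i * qm \<chi> i p) = 1"
      using cmin_nn(1)[OF f i] by (simp add: cmin_def)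
    have least: "m < ?N \<Longrightarrow> qnum ?q (Suc m) \<noteq> 0" for m
      using cmin_nn(2)[OF f i, of m] by (simp add: cmin_def)
    have least': "\<not> (0 < k \<and> k \<le> ?N \<and> qnum ?q k = 0)" for k
      using least[of "k - 1"] by (cases k) (auto simp del: qnum_simps)
    have hz: "height \<chi> p = enat (Suc ?N)" if "qnum ?q (Suc ?N) = 0"
    proof (cases "height \<chi> p")
      case (enat h)
      have "h \<le> Suc ?N" using height_enat(3)[OF enat _ that] by simp
      moreover have "\<not> h \<le> ?N" using least'[of h] height_enat(1,2)[OF enat] by auto
      ultimately show ?thesis using enat by (simp add: le_Suc_eq)
    qed (use height_infinity[of \<chi> p "Suc ?N"] that in simp)
    have hnz: "height \<chi> p = \<infinity> \<or> (\<exists>h. height \<chi> p = enat h \<and> Suc ?N < h)" if "qnum ?q (Suc ?N) \<noteq> 0"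
    proof (cases "height \<chi> p")
      case (enat h)
      have "\<not> h \<le> ?N" using least'[of h] height_enat(1,2)[OF enat] by auto
      moreover have "h \<noteq> Suc ?N" using height_enat(1)[OF enat] that by auto
      ultimately show ?thesis using enat by simp
    qed simp
    have PE: "embE (gen p ^ Suc ?N) \<in> K" "embF (gen p ^ Suc ?N) \<in> K" if "qnum ?q (Suc ?N) = 0"
    proof -
      have "EE \<chi> p [^]\<^bsub>\<U> \<chi>\<^esub> Suc ?N \<in> GE'" "FF \<chi> p [^]\<^bsub>\<U> \<chi>\<^esub> Suc ?N \<in> GF'"
        unfolding GE'_def GF'_def hz[OF that] by simp_all
      then show "embE (gen p ^ Suc ?N) \<in> K" "embF (gen p ^ Suc ?N) \<in> K"
        using gens unfolding K_def E1[symmetric] F1[symmetric] mem_Collect_eq by blast+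
    qed
    have GEF: "embE (epl (qm \<chi>) p i (Suc ?N)) \<in> K" "embF (gv ?q (qm \<chi> i p) p i (Suc ?N)) \<in> K" if "qnum ?q (Suc ?N) \<noteq> 0"
    proof -
      have "Eplus \<chi> p i (Suc ?N) \<in> GE'" "Fplus \<chi> p i (Suc ?N) \<in> GF'"
        using hnz[OF that] i nat_cartan[OF i, of \<chi>] cartan_nn[OF i, of \<chi>]
        unfolding GE'_def GF'_def by (auto intro!: exI[of _ i])
      then show "embE (epl (qm \<chi>) p i (Suc ?N)) \<in> K" "embF (gv ?q (qm \<chi> i p) p i (Suc ?N)) \<in> K"
        using gens unfolding K_def E2[symmetric] F2[symmetric] mem_Collect_eq by blast+
    qed
    have "embE (epl (qm \<chi>) p i (Suc ?N)) \<in> K" "embE (gv (inverse ?q) (inverse (qm \<chi> i p)) p i (Suc ?N)) \<in> K"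
      using top_root_vector_ideal[OF tE nz nz nz t least, of p i] PE GEF unfolding mem_Collect_eq by blast+
    moreover have "embF (gv ?q (qm \<chi> i p) p i (Suc ?N)) \<in> K" "embF (gv (inverse ?q) (inverse (qm \<chi> p i)) p i (Suc ?N)) \<in> K"
      using top_root_vector_ideal[OF tF nz nz nz t[unfolded mult.commute[of "qm \<chi> p i"]] least, of p i] PE GEF unfolding mem_Collect_eq by blast+
    ultimately show ?thesis
      using eqm_mem[OF K eqm_mono[OF RK eqm_EpF[OF b]]] eqm_mem[OF K eqm_mono[OF RK eqm_FpF[OF b]]]
        eqm_mem[OF K eqm_mono[OF RK eqm_EmF'[OF b]]] eqm_mem[OF K eqm_mono[OF RK eqm_FmF[OF b]]] by blast
  qed
  show ?thesis by (rule that[OF K RK KS IK]) (use top in blast)+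
qed

section \<open>The maps on \<open>U(\<chi>)\<close>\<close>

definition cq :: "('i, 'k::field) bichar \<Rightarrow> ('i ugen fmon \<Rightarrow>\<^sub>0 'k) \<Rightarrow> ('i, 'k) \<U>elem set" where
  "cq \<chi> x = Uq_class \<chi> (cl \<chi> x)"

lemma presented_cq: "bicharacter \<chi> \<Longrightarrow> presented (Uq \<chi>) (cq \<chi>) (SF \<chi>)"
  unfolding cq_def[abs_def] by (rule presented_Uq)

lemma cq_eq: "bicharacter \<chi> \<Longrightarrow> cq \<chi> x = cq \<chi> y \<longleftrightarrow> x - y \<in> SF \<chi>"
  by (rule presented.eq[OF presented_cq])

lemma cq_eqm: "bicharacter \<chi> \<Longrightarrow> eqm (\<U>_ideal \<chi>) x y \<Longrightarrow> cq \<chi> x = cq \<chi> y"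
  using R_SF by (auto simp: cq_eq eqm_def)

lemma induced_cq:
  assumes b: "bicharacter \<chi>" and h: "\<And>y. y - x \<in> SF \<chi> \<Longrightarrow> h (cl \<chi> y) = v"
  shows "induced h (cq \<chi> x) = v"
  unfolding cq_def Uq_class_def S_eq[OF b] using h by (rule U.induced_coset[OF SF_tideal[OF b] R_SF[OF b]])

lemma phi_U_cq:
  assumes b: "bicharacter \<chi>" and a: "\<And>i. a i \<noteq> 0"
  shows "phi_U \<chi> a (cq \<chi> x) = cq \<chi> (pha a x)"
  unfolding phi_U_def
proof (rule induced_cq[OF b])
  fix y assume "y - x \<in> SF \<chi>"
  from pha_SF[OF b a this] show "Uq_class \<chi> (phi \<chi> a (cl \<chi> y)) = cq \<chi> (pha a x)"
    by (simp add: phi_cl[OF b a] cq_eq[OF b] flip: cq_def)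
qed

lemma phi2_U_cq:
  assumes b: "bicharacter \<chi>"
  shows "phi2_U \<chi> (cq \<chi> x) = cq (bichar_inv \<chi>) (ph2 x)"
  unfolding phi2_U_def
proof (rule induced_cq[OF b])
  fix y assume "y - x \<in> SF \<chi>"
  from ph3_SF[OF bichar_op[OF bichar_inv[OF b]] phth_SF[OF b this]]
  have "ph2 (y - x) \<in> SF (bichar_inv \<chi>)" unfolding ph2_def[symmetric] bichar_op_op .
  then show "Uq_class (bichar_inv \<chi>) (phi2 \<chi> (cl \<chi> y)) = cq (bichar_inv \<chi>) (ph2 x)"
    by (simp add: phi2_cl[OF b] cq_eq[OF bichar_inv[OF b]] flip: cq_def)
qed

lemma phi3_U_cq:
  assumes b: "bicharacter \<chi>"
  shows "phi3_U \<chi> (cq \<chi> x) = cq (bichar_op \<chi>) (ph3 x)"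
  unfolding phi3_U_def
proof (rule induced_cq[OF b])
  fix y assume "y - x \<in> SF \<chi>"
  from ph3_SF[OF b this] show "Uq_class (bichar_op \<chi>) (phi3 \<chi> (cl \<chi> y)) = cq (bichar_op \<chi>) (ph3 x)"
    by (simp add: phi3_cl[OF b] cq_eq[OF bichar_op[OF b]] flip: cq_def)
qed

lemma phi4_U_cq:
  assumes b: "bicharacter \<chi>"
  shows "phi4_U \<chi> (cq \<chi> x) = cq \<chi> (ph4 x)"
  unfolding phi4_U_def
proof (rule induced_cq[OF b])
  fix y assume "y - x \<in> SF \<chi>"
  from bichar_loc.ph4_SF[OF bichar_loc.intro[OF b] this] show "Uq_class \<chi> (phi4 \<chi> (cl \<chi> y)) = cq \<chi> (ph4 x)"
    by (simp add: phi4_cl[OF b] cq_eq[OF b] flip: cq_def)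
qed

context
  fixes \<chi> :: "('i, 'k::field) bichar" and p :: 'i
  assumes b: "bicharacter \<chi>" and f: "p_finite p \<chi>"
begin

lemma LT_cl:
  shows "LT p \<chi> (cl \<chi> x) = Ip p (rp p \<chi>) +>\<^bsub>\<U> (rp p \<chi>)\<^esub> cl (rp p \<chi>) (That p \<chi> x)"
    "LTm p \<chi> (cl \<chi> x) = Ip p (rp p \<chi>) +>\<^bsub>\<U> (rp p \<chi>)\<^esub> cl (rp p \<chi>) (Tmhat p \<chi> x)"
    "Uq_canon (rp p \<chi>) (Ip p (rp p \<chi>) +>\<^bsub>\<U> (rp p \<chi>)\<^esub> cl (rp p \<chi>) y) = cq (rp p \<chi>) y"
proof -
  let ?\<psi> = "rp p \<chi>"
  note b' = rp_bichar[OF b, of p] and f' = p_finite_rp[OF b f]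
  obtain K where K: "tideal K" "\<U>_ideal ?\<psi> \<subseteq> K" "K \<subseteq> SF ?\<psi>" and Ip: "Ip p ?\<psi> = cl ?\<psi> ` K" and
    tops: "\<And>i. i \<noteq> p \<Longrightarrow> EpF p i (Suc (nn p ?\<psi> i)) \<in> K" "\<And>i. i \<noteq> p \<Longrightarrow> FpF p i (Suc (nn p ?\<psi> i)) \<in> K"
    "\<And>i. i \<noteq> p \<Longrightarrow> EmF p i (Suc (nn p ?\<psi> i)) \<in> K" "\<And>i. i \<noteq> p \<Longrightarrow> FmF p i (Suc (nn p ?\<psi> i)) \<in> K"
    using Ip_preimage[OF b' f'] by blast
  interpret Q: presented "quot_alg (\<U> ?\<psi>) (Ip p ?\<psi>)" "\<lambda>x. Ip p ?\<psi> +>\<^bsub>\<U> ?\<psi>\<^esub> cl ?\<psi> x" K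
    unfolding Ip by (rule U.presented_quotient[OF K(1,2)])
  note tops' = tops[unfolded nn_rp[OF b f]]
  have kill: "Ip p ?\<psi> +>\<^bsub>\<U> ?\<psi>\<^esub> cl ?\<psi> y = \<zero>\<^bsub>quot_alg (\<U> ?\<psi>) (Ip p ?\<psi>)\<^esub>" if "y \<in> K" for y
    using that Q.J_alt[of y] by (simp add: Q.zero)
  show "LT p \<chi> (cl \<chi> x) = Ip p ?\<psi> +>\<^bsub>\<U> ?\<psi>\<^esub> cl ?\<psi> (That p \<chi> x)"
    unfolding LT_def Let_def
  proof (rule U_map_eq[OF b Q.is_ring Q.alg_hom_comp])
    show "Ip p ?\<psi> +>\<^bsub>\<U> ?\<psi>\<^esub> cl ?\<psi> (That p \<chi> x) = \<zero>\<^bsub>quot_alg (\<U> ?\<psi>) (Ip p ?\<psi>)\<^esub>" if "x \<in> \<U>_ideal \<chi>" for x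
      by (rule kill[OF That_R_general[OF b f K(1,2) _ _ that]]) (use tops' in auto)
  qed (auto simp: That_gen U_gen_cl U.mult U.pow U.smult Eplus_cl nn_def simp del: rv.simps)
  show "LTm p \<chi> (cl \<chi> x) = Ip p ?\<psi> +>\<^bsub>\<U> ?\<psi>\<^esub> cl ?\<psi> (Tmhat p \<chi> x)"
    unfolding LTm_def Let_def
  proof (rule U_map_eq[OF b Q.is_ring Q.alg_hom_comp])
    show "Ip p ?\<psi> +>\<^bsub>\<U> ?\<psi>\<^esub> cl ?\<psi> (Tmhat p \<chi> x) = \<zero>\<^bsub>quot_alg (\<U> ?\<psi>) (Ip p ?\<psi>)\<^esub>" if "x \<in> \<U>_ideal \<chi>" for x
      by (rule kill[OF Tmhat_R_general[OF b f K(1,2) _ _ that]]) (use tops' in auto)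
    show "Ip p ?\<psi> +>\<^bsub>\<U> ?\<psi>\<^esub> (if i = p then EE ?\<psi> p \<otimes>\<^bsub>\<U> ?\<psi>\<^esub> LL' ?\<psi> p
        else ((-1) powi cartan \<chi> p i) \<odot>\<^bsub>\<U> ?\<psi>\<^esub> Fminus ?\<psi> p i (nat (- cartan \<chi> p i))) =
      Ip p ?\<psi> +>\<^bsub>\<U> ?\<psi>\<^esub> cl ?\<psi> (Tmhat p \<chi> (gen (GF i)))" for i
    proof (cases "i = p")
      case False
      have "(-1 :: 'k) powi cartan \<chi> p i = (-1) ^ nn p \<chi> i"
        using False by (simp add: cartan_nn power_int_minus power_inverse[symmetric])
      then show ?thesis using False by (simp add: Tmhat_gen U.smult Eplus_cl flip: nn_def del: rv.simps)
    qed (simp add: Tmhat_gen U_gen_cl U.mult)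
  qed (auto simp: Tmhat_gen U_gen_cl U.mult U.pow U.smult Eplus_cl nn_def simp del: rv.simps)
  show "Uq_canon ?\<psi> (Ip p ?\<psi> +>\<^bsub>\<U> ?\<psi>\<^esub> cl ?\<psi> y) = cq ?\<psi> y"
    unfolding Uq_canon_def Ip
  proof (rule U.induced_coset[OF K(1,2)])
    fix z assume "z - y \<in> K"
    then have "cq ?\<psi> z = cq ?\<psi> y" using K(3) by (auto simp: cq_eq[OF b'])
    then show "Uq_class ?\<psi> (cl ?\<psi> z) = cq ?\<psi> y" by (simp add: cq_def)
  qed
qed

lemma LT_U_cq: "LT_U p \<chi> (cq \<chi> x) = cq (rp p \<chi>) (That p \<chi> x)"
  unfolding LT_U_def
proof (rule induced_cq[OF b])
  fix y assume "y - x \<in> SF \<chi>"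
  from That_SF[OF b f this] show "Uq_canon (rp p \<chi>) (LT p \<chi> (cl \<chi> y)) = cq (rp p \<chi>) (That p \<chi> x)"
    unfolding LT_cl by (simp add: cq_eq[OF rp_bichar[OF b]])
qed

lemma LTm_U_cq: "LTm_U p \<chi> (cq \<chi> x) = cq (rp p \<chi>) (Tmhat p \<chi> x)"
  unfolding LTm_U_def
proof (rule induced_cq[OF b])
  fix y assume "y - x \<in> SF \<chi>"
  from Tmhat_SF[OF b f this] show "Uq_canon (rp p \<chi>) (LTm p \<chi> (cl \<chi> y)) = cq (rp p \<chi>) (Tmhat p \<chi> x)"
    unfolding LT_cl by (simp add: cq_eq[OF rp_bichar[OF b]])
qed

lemma LTm_LT_U: "LTm_U p (rp p \<chi>) (LT_U p \<chi> (cq \<chi> x)) = cq \<chi> x"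
  if "\<And>x. LTm_U p (rp p \<chi>) (cq (rp p \<chi>) x) = cq (rp p (rp p \<chi>)) (Tmhat p (rp p \<chi>) x)"
  unfolding LT_U_cq that rp_rp[OF b f] by (rule cq_eqm[OF b Tmhat_That[OF b f]])

lemma LT_LTm_U: "LT_U p (rp p \<chi>) (LTm_U p \<chi> (cq \<chi> x)) = cq \<chi> x"
  if "\<And>x. LT_U p (rp p \<chi>) (cq (rp p \<chi>) x) = cq (rp p (rp p \<chi>)) (That p (rp p \<chi>) x)"
  unfolding LTm_U_cq that rp_rp[OF b f] cq_eq[OF b] by (rule That_Tmhat[OF b f])

end

lemma alg_isoI:
  assumes A: "presented A f J" and B: "presented B g J'"
    and T: "\<And>x. T (f x) = g (H x)"
    and H: "H 1 = 1" "\<And>x y. H (x + y) = H x + H y" "\<And>x y. H (x * y) = H x * H y" "\<And>c x. H (scl c x) = scl c (H x)"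
    and S: "\<And>x. S (T (f x)) = f x" "\<And>y. T (S (g y)) = g y" "\<And>y. S (g y) \<in> carrier A"
  shows "T \<in> alg_iso A B"
proof -
  interpret A: presented A f J by (rule A)
  interpret B: presented B g J' by (rule B)
  have "T \<in> alg_hom A B"
    unfolding alg_hom_def ring_hom_def
    by (auto simp: A.carrier T A.add A.mult A.smult A.one B.one H simp flip: B.add B.mult B.smult)
  moreover have "bij_betw T (carrier A) (carrier B)"
    by (rule bij_betwI[of _ _ _ S]) (use S in \<open>auto simp: A.carrier B.carrier T\<close>)
  ultimately show ?thesis unfolding alg_iso_def by blast
qed

theorem theorem6p11:
  fixes \<chi> :: "('i::finite, 'k::field) bichar" and p :: 'i
  assumes "bicharacter \<chi>" and "p_finite p \<chi>"
  shows
    "(\<forall>x\<in>carrier (\<U> \<chi>). LT_U p \<chi> (Uq_class \<chi> x) = Uq_canon (rp p \<chi>) (LT p \<chi> x)) \<and>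
     (\<forall>x\<in>carrier (\<U> \<chi>). LTm_U p \<chi> (Uq_class \<chi> x) = Uq_canon (rp p \<chi>) (LTm p \<chi> x)) \<and>
     LT_U p \<chi> \<in> alg_iso (Uq \<chi>) (Uq (rp p \<chi>)) \<and>
     LTm_U p \<chi> \<in> alg_iso (Uq \<chi>) (Uq (rp p \<chi>)) \<and>
     (\<forall>x\<in>carrier (Uq \<chi>). LT_U p (rp p \<chi>) (LTm_U p \<chi> x) = x) \<and>
     (\<forall>x\<in>carrier (Uq \<chi>). LTm_U p (rp p \<chi>) (LT_U p \<chi> x) = x) \<and>
     (\<forall>a b. (\<forall>i. a i \<noteq> 0) \<longrightarrow> (\<forall>i. b i = a i * a p powi (- cartan \<chi> p i)) \<longrightarrow>
        (\<forall>x\<in>carrier (Uq \<chi>). LT_U p \<chi> (phi_U \<chi> a x) = phi_U (rp p \<chi>) b (LT_U p \<chi> x)) \<and>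
        (\<forall>x\<in>carrier (Uq \<chi>). LTm_U p \<chi> (phi_U \<chi> a x) = phi_U (rp p \<chi>) b (LTm_U p \<chi> x))) \<and>
     (\<forall>x\<in>carrier (Uq \<chi>). LT_U p (bichar_inv \<chi>) (phi2_U \<chi> x) =
        phi2_U (rp p \<chi>) (LTm_U p \<chi> (phi_U \<chi> (\<lambda>i. if i = p then -1 else 1) x))) \<and>
     (\<forall>x\<in>carrier (Uq \<chi>). LT_U p (bichar_op \<chi>) (phi3_U \<chi> x) =
        phi3_U (rp p \<chi>) (LT_U p \<chi> (phi_U \<chi>
          (\<lambda>i. if i = p then inverse (qm \<chi> p p) else inverse (lam p (rp p \<chi>) i)) x))) \<and>
     (\<forall>x\<in>carrier (Uq \<chi>). LTm_U p (bichar_op \<chi>) (phi3_U \<chi> x) =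
        phi3_U (rp p \<chi>) (LTm_U p \<chi> (phi_U \<chi>
          (\<lambda>i. if i = p then inverse (qm \<chi> p p)
                else (-1) powi cartan \<chi> p i * lam p (rp p (bichar_inv \<chi>)) i) x))) \<and>
     (\<exists>a. (\<forall>i. a i \<noteq> 0) \<and>
        (\<forall>x\<in>carrier (Uq \<chi>). LT_U p \<chi> (phi4_U \<chi> x) = phi4_U (rp p \<chi>) (LTm_U p \<chi> (phi_U \<chi> a x))))"
proof -
  let ?\<psi> = "rp p \<chi>"
  note b = assms(1) and f = assms(2)
  note b' = rp_bichar[OF b, of p] and f' = p_finite_rp[OF b f]
  note bo = bichar_op[OF b] and bi = bichar_inv[OF b] and fo = p_finite_op[OF f] and fi = p_finite_inv[OF b f]
  have carr: "carrier (Uq \<chi>) = range (cq \<chi>)" by (rule presented.carrier[OF presented_cq[OF b]])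
  note T = LT_U_cq[OF b f] and Tm = LTm_U_cq[OF b f]
  note T' = LT_U_cq[OF b' f'] and Tm' = LTm_U_cq[OF b' f']
  have inv1: "LTm_U p ?\<psi> (LT_U p \<chi> (cq \<chi> x)) = cq \<chi> x" for x by (rule LTm_LT_U[OF b f Tm'])
  have inv2: "LT_U p ?\<psi> (LTm_U p \<chi> (cq \<chi> x)) = cq \<chi> x" for x by (rule LT_LTm_U[OF b f T'])
  have inv3: "LTm_U p \<chi> (LT_U p ?\<psi> (cq ?\<psi> x)) = cq ?\<psi> x" for x
    using LTm_LT_U[OF b' f', of x] unfolding rp_rp[OF b f] by (simp add: Tm)
  have inv4: "LT_U p \<chi> (LTm_U p ?\<psi> (cq ?\<psi> x)) = cq ?\<psi> x" for x
    using LT_LTm_U[OF b' f', of x] unfolding rp_rp[OF b f] by (simp add: T)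
  have inC: "LTm_U p ?\<psi> (cq ?\<psi> y) \<in> carrier (Uq \<chi>)" "LT_U p ?\<psi> (cq ?\<psi> y) \<in> carrier (Uq \<chi>)" for y
    unfolding T' Tm' rp_rp[OF b f] carr by simp_all
  have iso: "LT_U p \<chi> \<in> alg_iso (Uq \<chi>) (Uq ?\<psi>)"
    by (rule alg_isoI[OF presented_cq[OF b] presented_cq[OF b'], where H = "That p \<chi>" and S = "LTm_U p ?\<psi>"])
       (rule T, simp_all add: inv1 inv4 inC)
  have isom: "LTm_U p \<chi> \<in> alg_iso (Uq \<chi>) (Uq ?\<psi>)"
    by (rule alg_isoI[OF presented_cq[OF b] presented_cq[OF b'], where H = "Tmhat p \<chi>" and S = "LT_U p ?\<psi>"])
       (rule Tm, simp_all add: inv2 inv3 inC)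
  have canon: "\<forall>x\<in>carrier (\<U> \<chi>). LT_U p \<chi> (Uq_class \<chi> x) = Uq_canon ?\<psi> (LT p \<chi> x)"
    "\<forall>x\<in>carrier (\<U> \<chi>). LTm_U p \<chi> (Uq_class \<chi> x) = Uq_canon ?\<psi> (LTm p \<chi> x)"
    unfolding U.carrier by (auto simp: T Tm LT_cl[OF b f] simp flip: cq_def)
  have tor: "LT_U p \<chi> (phi_U \<chi> a (cq \<chi> x)) = phi_U ?\<psi> c (LT_U p \<chi> (cq \<chi> x)) \<and>
      LTm_U p \<chi> (phi_U \<chi> a (cq \<chi> x)) = phi_U ?\<psi> c (LTm_U p \<chi> (cq \<chi> x))"
    if a: "\<forall>i. a i \<noteq> 0" and c: "\<forall>i. c i = a i * a p powi (- cartan \<chi> p i)" for a c x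
  proof -
    have c0: "c i \<noteq> 0" for i using a by (simp add: c)
    have "That p \<chi> (pha a x) = pha c (That p \<chi> x)" "Tmhat p \<chi> (pha a x) = pha c (Tmhat p \<chi> x)"
      by (rule That_pha Tmhat_pha; use a c in blast)+
    then show ?thesis using a by (simp only: phi_U_cq[OF b] phi_U_cq[OF b' c0] T Tm simp_thms)
  qed
  have phi2: "LT_U p (bichar_inv \<chi>) (phi2_U \<chi> (cq \<chi> x)) =
      phi2_U ?\<psi> (LTm_U p \<chi> (phi_U \<chi> (\<lambda>i. if i = p then -1 else 1) (cq \<chi> x)))" for x
    by (simp add: phi2_U_cq[OF b] phi2_U_cq[OF b'] phi_U_cq[OF b] LT_U_cq[OF bi fi] Tm ph2_That[OF b] rp_inv[OF b])
  have phi3: "LT_U p (bichar_op \<chi>) (phi3_U \<chi> (cq \<chi> x)) = phi3_U ?\<psi> (LT_U p \<chi> (phi_U \<chi>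
      (\<lambda>i. if i = p then inverse (qm \<chi> p p) else inverse (lam p ?\<psi> i)) (cq \<chi> x)))" (is "?l x = phi3_U _ (LT_U _ _ (phi_U _ ?a _))") for x
  proof -
    have nz: "?a i \<noteq> 0" for i using qm_nonzero[OF b] lam_nonzero[OF f'] by simp
    show ?thesis
      unfolding phi3_U_cq[OF b] phi_U_cq[OF b nz] T phi3_U_cq[OF b'] LT_U_cq[OF bo fo] rp_op
      by (rule cq_eqm[OF bichar_op[OF b'] ph3_That[OF b f]])
  qed
  have phi3m: "LTm_U p (bichar_op \<chi>) (phi3_U \<chi> (cq \<chi> x)) = phi3_U ?\<psi> (LTm_U p \<chi> (phi_U \<chi>
      (\<lambda>i. if i = p then inverse (qm \<chi> p p) else (-1) powi cartan \<chi> p i * lam p (rp p (bichar_inv \<chi>)) i) (cq \<chi> x)))"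
    (is "?l x = phi3_U _ (LTm_U _ _ (phi_U _ ?a _))") for x
  proof -
    have nz: "?a i \<noteq> 0" for i using qm_nonzero[OF b] lam_inv_nonzero[OF b f] by simp
    show ?thesis
      unfolding phi3_U_cq[OF b] phi_U_cq[OF b nz] Tm phi3_U_cq[OF b'] LTm_U_cq[OF bo fo] rp_op
      by (rule cq_eqm[OF bichar_op[OF b'] ph3_Tmhat[OF b f]])
  qed
  have phi4: "LT_U p \<chi> (phi4_U \<chi> (cq \<chi> x)) = phi4_U ?\<psi> (LTm_U p \<chi> (phi_U \<chi> (phi4_tor p \<chi>) (cq \<chi> x)))" for x
    unfolding phi4_U_cq[OF b] phi_U_cq[OF b phi4_tor_nonzero[OF b]] Tm phi4_U_cq[OF b'] T
    by (rule cq_eqm[OF b' ph4_That[OF b f]])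
  have all: "(\<forall>x\<in>carrier (Uq \<chi>). P x) \<longleftrightarrow> (\<forall>y. P (cq \<chi> y))" for P by (simp add: carr)
  show ?thesis
    unfolding all
    by (intro conjI allI impI exI[of _ "phi4_tor p \<chi>"] canon iso isom inv1 inv2 phi2 phi3 phi3m phi4 phi4_tor_nonzero[OF b];
        use tor in blast)
qed

end
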